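(* Assume that $$\sup_{x\ge0}\{g''(x)+\alpha g'(x)-\alpha\delta\}<0.$$ Let $\psi_1$ denote a positive and strictly increasing solution of the integro-differential equation $$g(x)\varphi'(x)-(\lambda+\delta)\varphi(x)+\lambda\int_0^x\varphi(x-y)\,\alpha e^{-\alpha y}\,\mathrm{d}y=0,\qquad x>0.$$ Then the following assertions are valid. (i) If in addition $\alpha\lambda g(0)+(g'(0)-\lambda-\delta)(\lambda+\delta)>0$, then there is a $b>0$, at which $\psi_1'$ attains its minimum on $[0,\infty)$, such that the barrier strategy with barrier level $b$ is an optimal unrestricted payment scheme and the value function is $$V(x)=\begin{cases}\dfrac{\psi_1(x)}{\psi_1'(b)}, & \text{if } 0\le x\le b,\\[2ex] x-b+\dfrac{\psi_1(b)}{\psi_1'(b)}, & \text{if } x>b.\end{cases}$$ (ii) Otherwise, if $\alpha\lambda g(0)+(g'(0)-\lambda-\delta)(\lambda+\delta)\le0$, then the optimal unrestricted payment scheme is the barrier strategy with barrier level $b=0$, and the value function is $$V(x)=x+\frac{g(0)}{\lambda+\delta},\qquad x\ge0.$$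
   Context: Model. Let $(\Omega,\mathcal F,\{\mathcal F_t\}_{t\ge0},\mathrm P)$ be a filtered probability space satisfying the usual conditions. $N=\{N(t),t\ge0\}$ is a Poisson process with rate $\lambda>0$, and $Y_1,Y_2,\dots$ are i.i.d. random variables, independent of $N$, with exponential distribution function $Q(y)=1-e^{-\alpha y}$, $y\ge0$, for some $\alpha>0$; $\sum_{i=1}^{N(t)}Y_i$ is a compound Poisson process relative to $\{\mathcal F_t\}$. The function $g\in C^2([0,\infty))$ takes values in $(0,\infty)$, is Lipschitz continuous and satisfies the linear growth condition. $\delta>0$ is a constant. Unrestricted dividend schemes. An admissible control is a càdlàg, nondecreasing, $\mathcal F_t$-adapted process $D=\{D(t),t\ge0\}$ with $D(0-)=0$ and $\Delta D(t):=D(t)-D(t-)\le X^D(t-)$ for all $t$ up to ruin; $\Pi$ is the set of all admissible controls. Here, for initial surplus $X^D(0-)=x\ge0$, the controlled surplus (considered up to ruin) is $$X^D(t)=x+\int_0^t g(X^D(s))\,\mathrm{d}s-\sum_{i=1}^{N(t)}Y_i-D(t),$$ the ruin time is $\tau=\inf\{t\ge0:X^D(t)<0\}$, and $$J(x,D)=\mathrm E_x\int_0^\tau e^{-\delta t}\,\mathrm{d}D(t),\qquad V(x)=\sup_{D\in\Pi}J(x,D),$$ where the integral is taken over $[0,\tau)$ (dividends up to ruin, including a lump payment $D(0)$ at time $0$). Standing assumption: $V(x)<\infty$ for all $x\ge0$. A control $D$ is optimal if $J(x,D)=V(x)$ for the initial surplus $x\ge 0$. Barrier strategy with barrier level $b\ge0$: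 the control $D^*$ with $D^*(0-)=0$, continuous part $\mathrm{d}D^*(t)=g(b)I_{\{X^*(t)=b\}}\,\mathrm{d}t$ and singular part $\Delta D^*(t)=X^*(t-)-b$ if $X^*(t-)>b$, where $X^*$ is the corresponding controlled surplus process with $X^*(0-)=x$ and $I_A$ is the indicator of $A$. Solutions of the integro-differential equation are real-valued continuously differentiable functions on $[0,\infty)$ satisfying the equation for $x>0$. A positive, strictly increasing solution $\psi_1$ always exists in this setting, and it is unique up to a multiplicative constant. *)

theory Defs
  imports "HOL-Probability.Probability"
begin

text \<open>Processes are indexed by \<^typ>\<open>real\<close>, as functions \<open>Z t \<omega>\<close>; unless stated otherwise only
  the times \<open>t \<ge> 0\<close> matter.  Path properties are required almost surely.\<close>

definition filtration_usual :: "'a measure \<Rightarrow> (real \<Rightarrow> 'a measure) \<Rightarrow> bool" where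
  "filtration_usual M F \<longleftrightarrow>
     (\<forall>t\<ge>0. subalgebra M (F t)) \<and>
     (\<forall>s t. 0 \<le> s \<longrightarrow> s \<le> t \<longrightarrow> sets (F s) \<subseteq> sets (F t)) \<and>
     complete_measure M \<and> null_sets M \<subseteq> sets (F 0) \<and>
     (\<forall>t\<ge>0. sets (F t) = (\<Inter>s\<in>{t<..}. sets (F s)))"

definition cadlag :: "(real \<Rightarrow> real) \<Rightarrow> bool" where
  "cadlag f \<longleftrightarrow> (\<forall>t\<ge>0. continuous (at_right t) f) \<and> (\<forall>t>0. \<exists>l. (f \<longlongrightarrow> l) (at_left t))"

definition poisson_process :: "'a measure \<Rightarrow> real \<Rightarrow> (real \<Rightarrow> 'a \<Rightarrow> nat) \<Rightarrow> bool" where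
  "poisson_process M lam N \<longleftrightarrow>
     (\<forall>t\<ge>0. N t \<in> measurable M (count_space UNIV)) \<and>
     (AE \<omega> in M. N 0 \<omega> = 0 \<and> mono_on {0..} (\<lambda>t. N t \<omega>) \<and> cadlag (\<lambda>t. real (N t \<omega>))) \<and>
     (\<forall>s t. 0 \<le> s \<longrightarrow> s < t \<longrightarrow>
        distr M (count_space UNIV) (\<lambda>\<omega>. N t \<omega> - N s \<omega>) = measure_pmf (poisson_pmf (lam * (t - s)))) \<and>
     (\<forall>t::nat \<Rightarrow> real. 0 \<le> t 0 \<longrightarrow> incseq t \<longrightarrow>
        prob_space.indep_vars M (\<lambda>_. count_space UNIV) (\<lambda>i \<omega>. N (t (Suc i)) \<omega> - N (t i) \<omega>) UNIV)"

text \<open>Claim sizes are numbered from \<open>0\<close>: \<open>Y i\<close> is the \<open>(i+1)\<close>-st claim.\<close>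

definition iid_exponential :: "'a measure \<Rightarrow> real \<Rightarrow> (nat \<Rightarrow> 'a \<Rightarrow> real) \<Rightarrow> bool" where
  "iid_exponential M \<alpha> Y \<longleftrightarrow>
     (\<forall>i. distributed M lborel (Y i) (exponential_density \<alpha>)) \<and>
     prob_space.indep_vars M (\<lambda>_. borel) Y UNIV"

definition indep_claims :: "'a measure \<Rightarrow> (real \<Rightarrow> 'a \<Rightarrow> nat) \<Rightarrow> (nat \<Rightarrow> 'a \<Rightarrow> real) \<Rightarrow> bool" where
  "indep_claims M N Y \<longleftrightarrow>
     prob_space.indep_set M
       (sets (vimage_algebra (space M) (\<lambda>\<omega>. restrict (\<lambda>t. N t \<omega>) {0..})
          (Pi\<^sub>M {0..} (\<lambda>_. count_space UNIV))))
       (sets (vimage_algebra (space M) (\<lambda>\<omega> i. Y i \<omega>) (Pi\<^sub>M UNIV (\<lambda>_. borel))))"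

definition aggregate_claims :: "(real \<Rightarrow> 'a \<Rightarrow> nat) \<Rightarrow> (nat \<Rightarrow> 'a \<Rightarrow> real) \<Rightarrow> real \<Rightarrow> 'a \<Rightarrow> real" where
  "aggregate_claims N Y t \<omega> = (\<Sum>i<N t \<omega>. Y i \<omega>)"

definition adapted :: "(real \<Rightarrow> 'a measure) \<Rightarrow> (real \<Rightarrow> 'a \<Rightarrow> real) \<Rightarrow> bool" where
  "adapted F Z \<longleftrightarrow> (\<forall>t\<ge>0. Z t \<in> borel_measurable (F t))"

text \<open>What "relative to the filtration" adds for a process with independent increments: it is
  adapted, and its increments after time \<open>s\<close> are independent of \<open>F s\<close>.\<close>

definition increments_relative_to ::
  "'a measure \<Rightarrow> (real \<Rightarrow> 'a measure) \<Rightarrow> (real \<Rightarrow> 'a \<Rightarrow> real) \<Rightarrow> bool" where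
  "increments_relative_to M F Z \<longleftrightarrow> adapted F Z \<and>
     (\<forall>s t. 0 \<le> s \<longrightarrow> s \<le> t \<longrightarrow>
        prob_space.indep_set M (sets (F s))
          (sets (vimage_algebra (space M) (\<lambda>\<omega>. Z t \<omega> - Z s \<omega>) borel)))"

text \<open>Controls and surplus processes are extended to \<open>t < 0\<close> by the values \<open>D(0-) = 0\<close> and
  \<open>X(0-) = x\<close>, so that left limits at time \<open>0\<close> need no special treatment.\<close>

definition left_lim :: "(real \<Rightarrow> real) \<Rightarrow> real \<Rightarrow> real" where
  "left_lim f t = Lim (at_left t) f"

definition jump :: "(real \<Rightarrow> real) \<Rightarrow> real \<Rightarrow> real" where
  "jump f t = f t - left_lim f t"

definition dividend_process ::
  "'a measure \<Rightarrow> (real \<Rightarrow> 'a measure) \<Rightarrow> (real \<Rightarrow> 'a \<Rightarrow> real) \<Rightarrow> bool" where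
  "dividend_process M F D \<longleftrightarrow> adapted F D \<and>
     (AE \<omega> in M. (\<forall>t<0. D t \<omega> = 0) \<and> mono (\<lambda>t. D t \<omega>) \<and> cadlag (\<lambda>t. D t \<omega>))"

text \<open>The premium rate \<open>g\<close> is given on \<open>[0,\<infinity>)\<close> only and the surplus matters up to ruin only.  To have
  the surplus, and hence the ruin time, determined by \<open>D\<close> also when \<open>D\<close> drives it continuously
  through \<open>0\<close>, the equation is imposed at all times with \<open>g\<close> continued by \<open>g 0\<close> below \<open>0\<close>.
  The path up to ruin does not depend on the choice of the continuation: as long as the path
  stays nonnegative, the continuation does not enter the equation.\<close>

definition controlled_surplus ::
  "'a measure \<Rightarrow> (real \<Rightarrow> real) \<Rightarrow> (real \<Rightarrow> 'a \<Rightarrow> real) \<Rightarrow> real \<Rightarrow>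
     (real \<Rightarrow> 'a \<Rightarrow> real) \<Rightarrow> (real \<Rightarrow> 'a \<Rightarrow> real) \<Rightarrow> bool" where
  "controlled_surplus M g S x D X \<longleftrightarrow>
     (AE \<omega> in M. (\<forall>t<0. X t \<omega> = x) \<and>
        (\<forall>t\<ge>0. (\<lambda>s. g (max 0 (X s \<omega>))) integrable_on {0..t} \<and>
           X t \<omega> = x + integral {0..t} (\<lambda>s. g (max 0 (X s \<omega>))) - S t \<omega> - D t \<omega>))"

definition ruin_time :: "(real \<Rightarrow> 'a \<Rightarrow> real) \<Rightarrow> 'a \<Rightarrow> ereal" where
  "ruin_time X \<omega> = Inf {ereal t |t. 0 \<le> t \<and> X t \<omega> < 0}"

text \<open>A control is carried along with its surplus process \<open>X\<close>, which it determines almost surely.\<close>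

definition admissible ::
  "'a measure \<Rightarrow> (real \<Rightarrow> 'a measure) \<Rightarrow> (real \<Rightarrow> real) \<Rightarrow> (real \<Rightarrow> 'a \<Rightarrow> real) \<Rightarrow> real \<Rightarrow>
     (real \<Rightarrow> 'a \<Rightarrow> real) \<Rightarrow> (real \<Rightarrow> 'a \<Rightarrow> real) \<Rightarrow> bool" where
  "admissible M F g S x D X \<longleftrightarrow>
     dividend_process M F D \<and> controlled_surplus M g S x D X \<and>
     (AE \<omega> in M. \<forall>t\<ge>0. ereal t \<le> ruin_time X \<omega> \<longrightarrow>
        jump (\<lambda>s. D s \<omega>) t \<le> left_lim (\<lambda>s. X s \<omega>) t)"

text \<open>As \<open>D t \<omega> = 0\<close> for \<open>t < 0\<close>, the Stieltjes measure of \<open>\<lambda>t. D t \<omega>\<close> has mass \<open>D 0 \<omega>\<close> at \<open>0\<close>.\<close>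

definition payoff ::
  "'a measure \<Rightarrow> real \<Rightarrow> (real \<Rightarrow> 'a \<Rightarrow> real) \<Rightarrow> (real \<Rightarrow> 'a \<Rightarrow> real) \<Rightarrow> ennreal" where
  "payoff M \<delta> D X =
     (\<integral>\<^sup>+\<omega>. (\<integral>\<^sup>+t. ennreal (exp (- \<delta> * t)) * indicator {t. 0 \<le> t \<and> ereal t < ruin_time X \<omega>} t
        \<partial>interval_measure (\<lambda>t. D t \<omega>)) \<partial>M)"

definition value_function ::
  "'a measure \<Rightarrow> (real \<Rightarrow> 'a measure) \<Rightarrow> (real \<Rightarrow> real) \<Rightarrow> (real \<Rightarrow> 'a \<Rightarrow> real) \<Rightarrow> real \<Rightarrow>
     real \<Rightarrow> ennreal" where
  "value_function M F g S \<delta> x = (SUP (D, X)\<in>{(D, X). admissible M F g S x D X}. payoff M \<delta> D X)"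

definition optimal ::
  "'a measure \<Rightarrow> (real \<Rightarrow> 'a measure) \<Rightarrow> (real \<Rightarrow> real) \<Rightarrow> (real \<Rightarrow> 'a \<Rightarrow> real) \<Rightarrow> real \<Rightarrow> real \<Rightarrow>
     (real \<Rightarrow> 'a \<Rightarrow> real) \<Rightarrow> (real \<Rightarrow> 'a \<Rightarrow> real) \<Rightarrow> bool" where
  "optimal M F g S \<delta> x D X \<longleftrightarrow>
     admissible M F g S x D X \<and> payoff M \<delta> D X = value_function M F g S \<delta> x"

text \<open>The continuous part of \<open>D\<close> is \<open>D\<close> minus the sum of its jumps.\<close>

definition barrier_strategy ::
  "'a measure \<Rightarrow> (real \<Rightarrow> 'a measure) \<Rightarrow> (real \<Rightarrow> real) \<Rightarrow> (real \<Rightarrow> 'a \<Rightarrow> real) \<Rightarrow> real \<Rightarrow> real \<Rightarrow>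
     (real \<Rightarrow> 'a \<Rightarrow> real) \<Rightarrow> (real \<Rightarrow> 'a \<Rightarrow> real) \<Rightarrow> bool" where
  "barrier_strategy M F g S b x D X \<longleftrightarrow>
     dividend_process M F D \<and> controlled_surplus M g S x D X \<and>
     (AE \<omega> in M. \<forall>t\<ge>0.
        D t \<omega> - (\<Sum>\<^sub>\<infinity>s\<in>{0..t}. jump (\<lambda>s. D s \<omega>) s) =
          integral {0..t} (\<lambda>s. g b * indicator {b} (X s \<omega>)) \<and>
        jump (\<lambda>s. D s \<omega>) t =
          (if left_lim (\<lambda>s. X s \<omega>) t > b then left_lim (\<lambda>s. X s \<omega>) t - b else 0))"

definition barrier_optimal ::
  "'a measure \<Rightarrow> (real \<Rightarrow> 'a measure) \<Rightarrow> (real \<Rightarrow> real) \<Rightarrow> (real \<Rightarrow> 'a \<Rightarrow> real) \<Rightarrow> real \<Rightarrow> real \<Rightarrow>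
     bool" where
  "barrier_optimal M F g S \<delta> b \<longleftrightarrow>
     (\<forall>x\<ge>0. (\<exists>D X. barrier_strategy M F g S b x D X) \<and>
            (\<forall>D X. barrier_strategy M F g S b x D X \<longrightarrow> optimal M F g S \<delta> x D X))"

text \<open>Continuous differentiability on \<open>[0,\<infinity>)\<close> with derivative \<open>f'\<close>, one-sided at \<open>0\<close>.\<close>

definition C1_halfline :: "(real \<Rightarrow> real) \<Rightarrow> (real \<Rightarrow> real) \<Rightarrow> bool" where
  "C1_halfline f f' \<longleftrightarrow>
     (\<forall>x\<ge>0. (f has_real_derivative f' x) (at x within {0..})) \<and> continuous_on {0..} f'"

definition ide_solution ::
  "(real \<Rightarrow> real) \<Rightarrow> real \<Rightarrow> real \<Rightarrow> real \<Rightarrow> (real \<Rightarrow> real) \<Rightarrow> (real \<Rightarrow> real) \<Rightarrow> bool" where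
  "ide_solution g lam \<alpha> \<delta> \<phi> \<phi>' \<longleftrightarrow> C1_halfline \<phi> \<phi>' \<and>
     (\<forall>x>0. g x * \<phi>' x - (lam + \<delta>) * \<phi> x
        + lam * integral {0..x} (\<lambda>y. \<phi> (x - y) * (\<alpha> * exp (- \<alpha> * y))) = 0)"

end

theory Submission
  imports Defs
begin

text \<open>Put \<open>p = g' + \<alpha> g - lam - \<delta>\<close>. Differentiating the equation gives \<open>g \<psi>'' = R\<close> with
  \<open>R = \<alpha> \<delta> \<psi> - p \<psi>'\<close>, and \<open>R' + (p / g) R = (\<alpha> \<delta> - g'' - \<alpha> g') \<psi>' \<ge> 0\<close>; so \<open>\<psi>''\<close> changes sign at most
  once, at \<open>b\<close> say, from negative to positive. The candidate \<open>W\<close> (\<open>\<psi> / \<psi>' b\<close> up to \<open>b\<close>, slope \<open>1\<close> beyond) is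
  \<open>C\<^sup>1\<close> with Lipschitz derivative \<open>W' \<ge> 1\<close> and satisfies \<open>g W' - (lam + \<delta>) W + lam E[W(x - Y); Y \<le> x] \<le> 0\<close>,
  with equality on \<open>[0, b]\<close>.

  Verification needs no stochastic integration. Cut \<open>[0, T]\<close> into \<open>m\<close> steps of length \<open>h\<close>. On almost every path
  the discounted dividends of a step plus the change of the discounted \<open>W(X)\<close> are bounded by an expression in
  the surplus at the beginning of the step and the claims during the step, up to errors whose sum tends to
  \<open>0\<close> pathwise: a step without claims costs \<open>O(h (h + \<Delta>D))\<close>, and in the boundedly many steps with a claim the
  dividends paid before the claim are small because \<open>D\<close> has left limits. As claim increments are independent of the
  past, the expectation of the bound is at most \<open>O(h\<^sup>2)\<close> per step, and Fatou's lemma concludes. For the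
  barrier strategy the same estimates hold in the opposite direction.\<close>

section \<open>The integro-differential equation\<close>

text \<open>Exponential claims enter through one identity: the derivative of E[f(x - Y); Y \<le> x]
  is \<alpha> times the difference of f and this mean, so the integral can be eliminated after
  differentiation. Three obstacles shape the rest. Ruin: premiums earned within a step may decide
  whether a claim ruins the path, and \<open>W\<close> continued by 0 jumps at 0; a Lipschitz
  majorant with a ramp of width \<epsilon> is used instead, whose excess is of order \<epsilon> in
  expectation since the claim density is bounded. Measurability: surplus and survival are not
  assumed adapted; they are recovered from \<open>D\<close> and the claims at countably many times,
  up to null sets that completeness absorbs. Existence: the net rate under the barrier strategy
  jumps at b, so Gronwall's inequality says nothing about its discretisation; in a coordinate of
  unit speed the stopped flow is a contraction. An integrable majorant for Fatou's lemma exists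
  because on [0, T] the surplus has one deterministic bound for all controls: a step contributes
  O(h), and a step with claims one further constant.\<close>

lemma C1_halflineD:
  assumes "C1_halfline f f'"
  shows "\<And>x. 0 \<le> x \<Longrightarrow> (f has_real_derivative f' x) (at x within {0..})" "continuous_on {0..} f'"
    "continuous_on {0..} f"
proof -
  show d: "\<And>x. 0 \<le> x \<Longrightarrow> (f has_real_derivative f' x) (at x within {0..})" "continuous_on {0..} f'"
    using assms by (auto simp: C1_halfline_def)
  show "continuous_on {0..} f"
    using d(1) by (intro DERIV_continuous_on[of _ f f']) auto
qed

lemma nonneg_deriv_halfline_mono:
  fixes f :: "real \<Rightarrow> real"
  assumes d: "\<And>x. a \<le> x \<Longrightarrow> x \<le> c \<Longrightarrow> (f has_real_derivative f' x) (at x within {0..})"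
    and pos: "\<And>x. a \<le> x \<Longrightarrow> x \<le> c \<Longrightarrow> 0 \<le> f' x" and "0 \<le> a" "a \<le> c"
  shows "f a \<le> f c"
proof -
  have "\<exists>x\<in>{a..c}. f c - f a = f' x * (c - a)"
  proof (rule mvt_very_simple)
    fix x assume "a \<le> x" "x \<le> c"
    then have "(f has_real_derivative f' x) (at x within {a..c})"
      using d \<open>0 \<le> a\<close> by (meson DERIV_subset atLeastAtMost_iff atLeast_iff order.trans subsetI)
    then show "(f has_derivative (\<lambda>y. f' x * y)) (at x within {a..c})"
      by (simp add: has_field_derivative_def)
  qed fact
  then show ?thesis using pos \<open>a \<le> c\<close> by (metis atLeastAtMost_iff diff_ge_0_iff_ge mult_nonneg_nonneg)
qed

lemma halfline_antiderivative:
  fixes f :: "real \<Rightarrow> real"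
  assumes "continuous_on {0..} f" "0 \<le> x"
  shows "((\<lambda>x. integral {0..x} f) has_real_derivative f x) (at x within {0..})"
proof -
  have "((\<lambda>x. integral {0..x} f) has_real_derivative f x) (at x within {0..x+1})"
    using assms by (intro integral_has_real_derivative continuous_on_subset[OF assms(1)]) auto
  moreover have "at x within {0..x+1} = at x within {0..}"
    by (rule at_within_nhd[of _ "{..<x+1}"]) auto
  ultimately show ?thesis by simp
qed

lemma FTC_halfline:
  fixes f :: "real \<Rightarrow> real"
  assumes d: "\<And>x. a \<le> x \<Longrightarrow> x \<le> c \<Longrightarrow> (f has_real_derivative f' x) (at x within {0..})" and "0 \<le> a" "a \<le> c"
  shows "(f' has_integral (f c - f a)) {a..c}"
proof (rule fundamental_theorem_of_calculus)
  fix x assume "x \<in> {a..c}"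
  then have "(f has_real_derivative f' x) (at x within {a..c})"
    using d \<open>0 \<le> a\<close> by (meson DERIV_subset atLeastAtMost_iff atLeast_iff order.trans subsetI)
  then show "(f has_vector_derivative f' x) (at x within {a..c})"
    by (simp add: has_real_derivative_iff_has_vector_derivative)
qed fact

text \<open>For Y exponential with rate \<alpha> this is E[f(x - Y); Y \<le> x].\<close>

definition claim_mean :: "real \<Rightarrow> (real \<Rightarrow> real) \<Rightarrow> real \<Rightarrow> real" where
  "claim_mean \<alpha> f x = integral {0..x} (\<lambda>y. f (x - y) * (\<alpha> * exp (- \<alpha> * y)))"

text \<open>The substitution z = x - y leaves x only in a prefactor and as an upper limit. In this
  form the mean of a merely continuous f can be differentiated.\<close>

lemma claim_mean_eq:
  assumes f: "continuous_on {0..} f" and x: "0 \<le> x"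
  shows "claim_mean \<alpha> f x = \<alpha> * exp (- \<alpha> * x) * integral {0..x} (\<lambda>z. f z * exp (\<alpha> * z))"
proof -
  let ?E = "\<lambda>x. integral {0..x} (\<lambda>z. f z * exp (\<alpha> * z))"
  have E: "(?E has_real_derivative f z * exp (\<alpha> * z)) (at z within {0..})" if "0 \<le> z" for z
    using that f by (intro halfline_antiderivative continuous_intros)
  have "((\<lambda>y. f (x - y) * (\<alpha> * exp (- \<alpha> * y))) has_integral
      (- \<alpha> * exp (- \<alpha> * x) * ?E (x - x)) - (- \<alpha> * exp (- \<alpha> * x) * ?E (x - 0))) {0..x}"
  proof (rule fundamental_theorem_of_calculus)
    fix y assume y: "y \<in> {0..x}"
    have "(?E has_real_derivative f (x-y) * exp (\<alpha> * (x-y))) (at (x - y) within (\<lambda>y. x - y) ` {0..x})"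
      by (rule DERIV_subset[OF E]) (use y in auto)
    then have "((?E \<circ> (\<lambda>y. x - y)) has_real_derivative f (x-y) * exp (\<alpha> * (x-y)) * (0 - 1)) (at y within {0..x})"
      by (rule DERIV_image_chain) (auto intro!: derivative_eq_intros)
    then have "((\<lambda>y. - \<alpha> * exp (- \<alpha> * x) * ?E (x - y)) has_real_derivative
         - \<alpha> * exp (- \<alpha> * x) * (f (x-y) * exp (\<alpha> * (x-y)) * (0 - 1))) (at y within {0..x})"
      unfolding o_def by (rule DERIV_cmult)
    also have "- \<alpha> * exp (- \<alpha> * x) * (f (x-y) * exp (\<alpha> * (x-y)) * (0 - 1)) = f (x - y) * (\<alpha> * exp (- \<alpha> * y))"
      by (simp add: exp_diff exp_minus field_simps)
    finally show "((\<lambda>y. - \<alpha> * exp (- \<alpha> * x) * ?E (x - y)) has_vector_derivative f (x - y) * (\<alpha> * exp (- \<alpha> * y))) (at y within {0..x})"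
      by (simp add: has_real_derivative_iff_has_vector_derivative)
  qed fact
  then show ?thesis by (simp add: claim_mean_def integral_unique)
qed

text \<open>Product rule on the factored form. The derivative contains the mean itself but no new
  integral, which is why the equation reduces to a differential equation of second order.\<close>

lemma claim_mean_deriv:
  assumes f: "continuous_on {0..} f" and x: "0 \<le> x"
  shows "(claim_mean \<alpha> f has_real_derivative \<alpha> * (f x - claim_mean \<alpha> f x)) (at x within {0..})"
proof -
  let ?E = "\<lambda>x. integral {0..x} (\<lambda>z. f z * exp (\<alpha> * z))"
  have E: "(?E has_real_derivative f x * exp (\<alpha> * x)) (at x within {0..})"
    using x f by (intro halfline_antiderivative continuous_intros)
  have "((\<lambda>x. \<alpha> * exp (- \<alpha> * x) * ?E x) has_real_derivative
     \<alpha> * (f x - \<alpha> * exp (- \<alpha> * x) * ?E x)) (at x within {0..})"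
    by (rule derivative_eq_intros E refl)+ (simp add: exp_minus field_simps)
  then have "(claim_mean \<alpha> f has_real_derivative \<alpha> * (f x - \<alpha> * exp (- \<alpha> * x) * ?E x)) (at x within {0..})"
    by (rule has_field_derivative_transform_within[OF _ zero_less_one]) (use x claim_mean_eq[OF f] in auto)
  then show ?thesis using claim_mean_eq[OF f x] by simp
qed

text \<open>\<open>R\<close> is g times the second derivative of \<psi>, and the expression
  separating the two cases is a negative multiple of \<open>R 0\<close>. If it is positive,
  \<open>R\<close> starts below 0 and b is a zero of \<open>R\<close>; otherwise \<open>R\<close> is
  nonnegative throughout and b = 0. \<open>R b \<ge> 0\<close> is kept for the inequality beyond
  b.\<close>

lemma ide_solution_inflection:
  fixes g g' g'' \<psi> \<psi>' :: "real \<Rightarrow> real"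
  assumes pos: "lam > 0" "\<alpha> > 0" "\<delta> > 0"
    and g: "C1_halfline g g'" "C1_halfline g' g''" "\<And>x. 0 \<le> x \<Longrightarrow> g x > 0"
    and eta: "\<eta> > 0" "\<And>x. 0 \<le> x \<Longrightarrow> g'' x + \<alpha> * g' x - \<alpha> * \<delta> \<le> - \<eta>"
    and sol: "ide_solution g lam \<alpha> \<delta> \<psi> \<psi>'"
    and psi: "\<And>x. 0 \<le> x \<Longrightarrow> \<psi> x > 0" "strict_mono_on {0..} \<psi>"
  defines "p \<equiv> \<lambda>x. g' x + \<alpha> * g x - lam - \<delta>"
  defines "R \<equiv> \<lambda>x. \<alpha> * \<delta> * \<psi> x - p x * \<psi>' x"
  obtains b where "0 \<le> b"
    "\<alpha> * lam * g 0 + (g' 0 - lam - \<delta>) * (lam + \<delta>) > 0 \<Longrightarrow> b > 0"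
    "\<alpha> * lam * g 0 + (g' 0 - lam - \<delta>) * (lam + \<delta>) \<le> 0 \<Longrightarrow> b = 0"
    "\<psi>' b > 0" "\<And>x. 0 \<le> x \<Longrightarrow> \<psi>' b \<le> \<psi>' x" "R b \<ge> 0"
    "\<And>x. 0 \<le> x \<Longrightarrow> (\<psi>' has_real_derivative R x / g x) (at x within {0..})"
    "\<And>x. 0 \<le> x \<Longrightarrow> g x * \<psi>' x - (lam + \<delta>) * \<psi> x + lam * claim_mean \<alpha> \<psi> x = 0"
    "continuous_on {0..} (\<lambda>x. R x / g x)"
proof -
  have C1psi: "C1_halfline \<psi> \<psi>'" using sol by (simp add: ide_solution_def)
  note gD = C1_halflineD[OF g(1)] and g'D = C1_halflineD[OF g(2)] and psiD = C1_halflineD[OF C1psi]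
  let ?m = "claim_mean \<alpha> \<psi>"
  have m_cont: "continuous_on {0..} ?m"
    using claim_mean_deriv[OF psiD(3)] by (intro DERIV_continuous_on) auto
  \<comment> \<open>The equation is given for x > 0 only; continuity of its terms extends it to
    0.\<close>
  have eq: "g x * \<psi>' x - (lam + \<delta>) * \<psi> x + lam * ?m x = 0" if "0 \<le> x" for x
  proof (cases "x = 0")
    case False
    then show ?thesis using sol that by (auto simp: ide_solution_def claim_mean_def)
  next
    case True
    let ?f = "\<lambda>x. g x * \<psi>' x - (lam + \<delta>) * \<psi> x + lam * ?m x"
    have "continuous_on {0..} ?f"
      using gD psiD m_cont by (intro continuous_intros) auto
    then have "(?f \<longlongrightarrow> ?f 0) (at 0 within {0..})" by (auto simp: continuous_on)
    then have "(?f \<longlongrightarrow> ?f 0) (at_right 0)" by (rule tendsto_within_subset) auto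
    moreover have "(?f \<longlongrightarrow> 0) (at_right 0)"
    proof (rule tendsto_eventually, rule eventually_at_rightI)
      fix x::real assume "x \<in> {0<..<1}"
      then show "?f x = 0" using sol by (auto simp: ide_solution_def claim_mean_def)
    qed simp
    ultimately have "?f 0 = 0" using tendsto_unique trivial_limit_at_right_real by blast
    then show ?thesis using True by simp
  qed
  have psi'_eq: "\<psi>' x = ((lam + \<delta>) * \<psi> x - lam * ?m x) / g x" if "0 \<le> x" for x
    using eq[OF that] g(3)[OF that] by (simp add: field_simps)
  \<comment> \<open>\<psi>' is only known to be continuous, but the equation expresses it as a
    quotient of differentiable functions.\<close>
  have psi2: "(\<psi>' has_real_derivative R x / g x) (at x within {0..})" if x: "0 \<le> x" for x
  proof -
    have gx: "g x > 0" using g(3) x by auto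
    let ?N = "(lam + \<delta>) * \<psi> x - lam * ?m x"
    have "((\<lambda>x. ((lam + \<delta>) * \<psi> x - lam * ?m x) / g x) has_real_derivative
       (((lam + \<delta>) * \<psi>' x - lam * (\<alpha> * (\<psi> x - ?m x))) * g x - ?N * g' x) / (g x * g x)) (at x within {0..})"
      by (intro DERIV_divide DERIV_diff DERIV_cmult psiD(1) gD(1) claim_mean_deriv x psiD(3)) (use gx in auto)
    also have "(((lam + \<delta>) * \<psi>' x - lam * (\<alpha> * (\<psi> x - ?m x))) * g x - ?N * g' x) / (g x * g x) = R x / g x"
    proof -
      have N: "?N = g x * \<psi>' x" using eq[OF x] by simp
      have m: "lam * ?m x = (lam + \<delta>) * \<psi> x - g x * \<psi>' x" using eq[OF x] by simp
      have e: "lam * (\<alpha> * (\<psi> x - ?m x)) = \<alpha> * (g x * \<psi>' x - \<delta> * \<psi> x)"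
      proof -
        have "lam * (\<alpha> * (\<psi> x - ?m x)) = \<alpha> * (lam * \<psi> x - lam * ?m x)" by (simp add: algebra_simps)
        also have "\<dots> = \<alpha> * (g x * \<psi>' x - \<delta> * \<psi> x)" unfolding m by (simp add: algebra_simps)
        finally show ?thesis .
      qed
      show ?thesis unfolding N e R_def p_def using gx by (simp add: field_simps)
    qed
    finally have "((\<lambda>x. ((lam + \<delta>) * \<psi> x - lam * ?m x) / g x) has_real_derivative R x / g x) (at x within {0..})" .
    then show ?thesis
      by (rule has_field_derivative_transform_within[OF _ zero_less_one]) (use x psi'_eq in auto)
  qed
  have p_cont: "continuous_on {0..} p" unfolding p_def using gD g'D by (intro continuous_intros) auto
  have R_cont: "continuous_on {0..} R" unfolding R_def using psiD p_cont by (intro continuous_intros) auto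
  have g0: "g x \<noteq> 0" if "x \<ge> 0" for x using g(3)[OF that] by simp
  have pg_cont: "continuous_on {0..} (\<lambda>x. p x / g x)" using p_cont gD(3) g0 by (intro continuous_intros) auto
  have p_deriv: "(p has_real_derivative g'' x + \<alpha> * g' x) (at x within {0..})" if "0 \<le> x" for x
    unfolding p_def by (rule derivative_eq_intros gD(1) g'D(1) that refl)+ simp
  have R_deriv: "(R has_real_derivative \<alpha> * \<delta> * \<psi>' x - ((g'' x + \<alpha> * g' x) * \<psi>' x + R x / g x * p x)) (at x within {0..})"
    if "0 \<le> x" for x
  proof -
    have "((\<lambda>x. \<alpha> * \<delta> * \<psi> x - p x * \<psi>' x) has_real_derivative
        \<alpha> * \<delta> * \<psi>' x - ((g'' x + \<alpha> * g' x) * \<psi>' x + R x / g x * p x)) (at x within {0..})"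
      by (intro DERIV_diff DERIV_cmult DERIV_mult psiD(1) p_deriv that psi2)
    then show ?thesis by (simp add: R_def)
  qed
  \<comment> \<open>Strict monotonicity yields no more than this; positivity of \<psi>' at b is
    obtained separately from \<open>R b = 0\<close>, or at 0 from the equation.\<close>
  have psi'_nonneg: "\<psi>' x \<ge> 0" if x: "0 \<le> x" for x
  proof -
    have "(\<psi> has_real_derivative \<psi>' x) (at x within {x<..})"
      by (rule DERIV_subset[OF psiD(1)]) (use x in auto)
    then have lim: "((\<lambda>y. (\<psi> y - \<psi> x) / (y - x)) \<longlongrightarrow> \<psi>' x) (at_right x)"
      by (simp add: has_field_derivative_iff)
    show ?thesis
    proof (rule tendsto_lowerbound[OF lim])
      show "eventually (\<lambda>y. 0 \<le> (\<psi> y - \<psi> x) / (y - x)) (at_right x)"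
        by (rule eventually_at_rightI[of _ "x+1"])
          (use psi(2) x in \<open>auto simp: strict_mono_on_def intro!: divide_nonneg_nonneg less_imp_le\<close>)
    qed simp
  qed
  \<comment> \<open>Integrating factor: \<open>E\<close> is nondecreasing and has the sign of
    \<open>R\<close>, so \<open>R\<close> cannot return from nonnegative to negative values.\<close>
  define E where "E = (\<lambda>x. R x * exp (integral {0..x} (\<lambda>x. p x / g x)))"
  have E_deriv: "(E has_real_derivative (\<alpha> * \<delta> - (g'' x + \<alpha> * g' x)) * \<psi>' x * exp (integral {0..x} (\<lambda>x. p x / g x))) (at x within {0..})"
    if x: "0 \<le> x" for x
    unfolding E_def
    by (rule derivative_eq_intros R_deriv halfline_antiderivative pg_cont x refl)+
      (use g0[OF x] in \<open>simp add: field_simps\<close>)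
  have E_mono: "E x \<le> E y" if "0 \<le> x" "x \<le> y" for x y
  proof (rule nonneg_deriv_halfline_mono[OF E_deriv])
    fix z assume "x \<le> z"
    then show "0 \<le> (\<alpha> * \<delta> - (g'' z + \<alpha> * g' z)) * \<psi>' z * exp (integral {0..z} (\<lambda>x. p x / g x))"
      using eta(1) eta(2)[of z] psi'_nonneg[of z] that by (intro mult_nonneg_nonneg) auto
  qed (use that in auto)
  have R_mono: "R x \<ge> 0 \<Longrightarrow> R y \<ge> 0" "R y \<le> 0 \<Longrightarrow> R x \<le> 0" if "0 \<le> x" "x \<le> y" for x y
    using E_mono[OF that] unfolding E_def
    by (smt (verit) exp_gt_zero mult_nonneg_nonneg mult_less_0_iff zero_less_mult_iff)+
  have m0: "?m 0 = 0" by (simp add: claim_mean_def)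
  have psi0: "g 0 * \<psi>' 0 = (lam + \<delta>) * \<psi> 0" using eq[of 0] m0 by simp
  have "g 0 * \<psi>' 0 > 0" unfolding psi0 using psi(1)[of 0] pos by (intro mult_pos_pos) auto
  then have psi'0: "\<psi>' 0 > 0" using g(3)[of 0] by (simp add: zero_less_mult_iff)
  have R0: "R 0 * (lam + \<delta>) = - \<psi>' 0 * (\<alpha> * lam * g 0 + (g' 0 - lam - \<delta>) * (lam + \<delta>))"
  proof -
    have "R 0 * (lam + \<delta>) = \<alpha> * \<delta> * ((lam + \<delta>) * \<psi> 0) - p 0 * \<psi>' 0 * (lam + \<delta>)"
      unfolding R_def by (simp add: algebra_simps)
    also have "\<dots> = - \<psi>' 0 * (\<alpha> * lam * g 0 + (g' 0 - lam - \<delta>) * (lam + \<delta>))"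
      unfolding psi0[symmetric] p_def by (simp add: algebra_simps)
    finally show ?thesis .
  qed
  have ld: "lam + \<delta> > 0" using pos by simp
  have decr: "\<psi>' y \<le> \<psi>' x" if "0 \<le> x" "x \<le> y" "R y \<le> 0" for x y
  proof -
    have "- \<psi>' x \<le> - \<psi>' y"
    proof (rule nonneg_deriv_halfline_mono[of x y "\<lambda>x. - \<psi>' x" "\<lambda>z. - (R z / g z)"])
      fix z assume z: "x \<le> z" "z \<le> y"
      then show "((\<lambda>x. - \<psi>' x) has_real_derivative - (R z / g z)) (at z within {0..})"
        using that by (intro DERIV_minus psi2) auto
      show "0 \<le> - (R z / g z)" using R_mono(2)[of z y] z that g(3)[of z]
        by (auto intro!: divide_nonpos_pos)
    qed (use that in auto)
    then show ?thesis by simp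
  qed
  have incr: "\<psi>' x \<le> \<psi>' y" if "0 \<le> x" "x \<le> y" "R x \<ge> 0" for x y
  proof (rule nonneg_deriv_halfline_mono[of x y "\<lambda>x. \<psi>' x" "\<lambda>z. (R z / g z)"])
    fix z assume z: "x \<le> z" "z \<le> y"
    then show "((\<lambda>x. \<psi>' x) has_real_derivative (R z / g z)) (at z within {0..})"
      using that by (intro psi2) auto
    show "0 \<le> (R z / g z)" using R_mono(1)[of x z] z that g(3)[of z]
      by (auto intro!: divide_nonneg_pos)
  qed (use that in auto)
  have g_cont': "continuous_on {0..} (\<lambda>x. R x / g x)" using R_cont gD(3) g0 by (intro continuous_intros) auto
  show ?thesis
  proof (cases "\<alpha> * lam * g 0 + (g' 0 - lam - \<delta>) * (lam + \<delta>) > 0")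
    case False
    then have "0 \<le> R 0 * (lam + \<delta>)" unfolding R0 using psi'0 by (simp add: mult_le_0_iff)
    then have "R 0 \<ge> 0" using ld by (simp add: zero_le_mult_iff)
    then show ?thesis using False psi'0 incr[of 0] psi2 eq g_cont' by (intro that[of 0]) auto
  next
    case True
    then have "R 0 * (lam + \<delta>) < 0" unfolding R0 using psi'0 by (simp add: mult_less_0_iff)
    then have R0neg: "R 0 < 0" using ld by (simp add: mult_less_0_iff)
    \<comment> \<open>If \<open>R\<close> stayed negative, \<psi>' would decrease, hence \<psi> x
      \<ge> \<psi> 0 + x \<psi>' x, and \<open>R x < 0\<close> would give \<alpha> \<delta> x < p x.
      But p x \<le> p 0 + (\<alpha> \<delta> - \<eta>) x, so \<eta> x < p 0 for every x, which is
      absurd. Here the supremum has to be strictly negative.\<close>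
    have "\<exists>x\<ge>0. R x \<ge> 0"
    proof (rule ccontr)
      assume "\<not> (\<exists>x\<ge>0. R x \<ge> 0)"
      then have neg: "R x < 0" if "0 \<le> x" for x using that by force
      have key: "\<eta> * x < p 0" if x: "0 \<le> x" for x
      proof -
        have d: "\<psi> 0 - \<psi>' x * 0 \<le> \<psi> x - \<psi>' x * x"
        proof (rule nonneg_deriv_halfline_mono[of 0 x _ "\<lambda>z. \<psi>' z - \<psi>' x * 1"])
          fix z assume z: "0 \<le> z" "z \<le> x"
          show "((\<lambda>a. \<psi> a - \<psi>' x * a) has_real_derivative \<psi>' z - \<psi>' x * 1) (at z within {0..})"
            by (intro DERIV_diff DERIV_cmult psiD(1) z DERIV_ident)
          show "0 \<le> \<psi>' z - \<psi>' x * 1" using decr[of z x] neg[of x] z by auto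
        qed (use x in auto)
        have pp: "p x \<le> p 0 + (\<alpha> * \<delta> - \<eta>) * x"
        proof -
          have "(\<alpha> * \<delta> - \<eta>) * 0 - p 0 \<le> (\<alpha> * \<delta> - \<eta>) * x - p x"
          proof (rule nonneg_deriv_halfline_mono[of 0 x _ "\<lambda>z. (\<alpha> * \<delta> - \<eta>) * 1 - (g'' z + \<alpha> * g' z)"])
            fix z assume z: "0 \<le> z" "z \<le> x"
            show "((\<lambda>a. (\<alpha> * \<delta> - \<eta>) * a - p a) has_real_derivative (\<alpha> * \<delta> - \<eta>) * 1 - (g'' z + \<alpha> * g' z)) (at z within {0..})"
              by (intro DERIV_diff DERIV_cmult p_deriv z DERIV_ident)
            show "0 \<le> (\<alpha> * \<delta> - \<eta>) * 1 - (g'' z + \<alpha> * g' z)" using eta(2)[of z] z by auto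
          qed (use x in auto)
          then show ?thesis by simp
        qed
        have Rx: "\<alpha> * \<delta> * \<psi> x < p x * \<psi>' x" using neg[OF x] by (simp add: R_def)
        have "0 < \<alpha> * \<delta> * \<psi> x" using pos psi(1)[OF x] by simp
        with Rx have "\<psi>' x \<noteq> 0" by auto
        then have px: "\<psi>' x > 0" using psi'_nonneg[OF x] by simp
        have "\<alpha> * \<delta> * x * \<psi>' x \<le> \<alpha> * \<delta> * \<psi> x"
          using d psi(1)[of 0] pos by (simp add: mult.assoc mult.commute[of x])
        with Rx have "\<alpha> * \<delta> * x * \<psi>' x < p x * \<psi>' x" by simp
        then have "\<alpha> * \<delta> * x < p x" using px by simp
        then show ?thesis using pp by (simp add: algebra_simps)
      qed
      have "\<eta> * ((\<bar>p 0\<bar> + 1) / \<eta>) < p 0" by (rule key) (use eta in auto)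
      then show False using eta(1) by simp
    qed
    then obtain x1 where x1: "0 \<le> x1" "R x1 \<ge> 0" by auto
    have "\<exists>b. 0 \<le> b \<and> b \<le> x1 \<and> R b = 0"
      by (rule IVT') (use R0neg x1 in \<open>auto intro: continuous_on_subset[OF R_cont]\<close>)
    then obtain b where b: "0 \<le> b" "R b = 0" by auto
    have "b \<noteq> 0" using b R0neg by auto
    moreover have "\<psi>' b \<noteq> 0"
    proof
      assume "\<psi>' b = 0"
      then have "R b > 0" using psi(1)[OF b(1)] pos by (simp add: R_def)
      then show False using b by simp
    qed
    moreover have "\<psi>' b \<le> \<psi>' x" if "0 \<le> x" for x
      using decr[of x b] incr[of b x] b that by (cases "x \<le> b") auto
    ultimately show ?thesis using b psi'_nonneg[of b] psi2 eq g_cont' True by (intro that[of b]) auto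
  qed
qed

text \<open>The interface between the differential equation and the verification. \<open>K\<close>
  is a Lipschitz constant of \<open>W'\<close>, in place of a bound on a second derivative;
  \<open>K1\<close> bounds \<open>W'\<close>; \<open>L\<close> is a Lipschitz constant of g.\<close>

locale dividend_hjb =
  fixes g :: "real \<Rightarrow> real" and lam \<alpha> \<delta> b L K K1 :: real and W W' :: "real \<Rightarrow> real"
  assumes lam: "lam > 0" and \<alpha>: "\<alpha> > 0" and \<delta>: "\<delta> > 0" and b: "b \<ge> 0"
    and g_pos: "\<And>x. 0 \<le> x \<Longrightarrow> g x > 0" and g_lip: "L-lipschitz_on {0..} g"
    and W_deriv: "\<And>x. 0 \<le> x \<Longrightarrow> (W has_real_derivative W' x) (at x within {0..})"
    and W'_lip: "\<And>x y. 0 \<le> x \<Longrightarrow> 0 \<le> y \<Longrightarrow> \<bar>W' x - W' y\<bar> \<le> K * \<bar>x - y\<bar>"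
    and W'_ge1: "\<And>x. 0 \<le> x \<Longrightarrow> 1 \<le> W' x" and W'_le: "\<And>x. 0 \<le> x \<Longrightarrow> W' x \<le> K1"
    and W'_eq1: "\<And>x. b \<le> x \<Longrightarrow> W' x = 1" and W0: "W 0 > 0"
    and hjb_le: "\<And>x. 0 \<le> x \<Longrightarrow> g x * W' x - (lam + \<delta>) * W x + lam * claim_mean \<alpha> W x \<le> 0"
    and hjb_eq: "\<And>x. 0 \<le> x \<Longrightarrow> x \<le> b \<Longrightarrow> g x * W' x - (lam + \<delta>) * W x + lam * claim_mean \<alpha> W x = 0"

text \<open>Up to b the equation for \<open>W\<close> is that for \<psi> divided by \<psi>' b.
  Beyond b, where \<open>W'\<close> is 1, the left-hand side f satisfies (exp(\<alpha> x) f)' =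
  exp(\<alpha> x) (p - \<alpha> \<delta> W). The last factor is nonincreasing there and equals -
  \<open>R b\<close> / \<psi>' b \<le> 0 at b, so f stays nonpositive.\<close>

lemma ide_solution_hjb:
  fixes g g' g'' \<psi> \<psi>' :: "real \<Rightarrow> real"
  assumes pos: "lam > 0" "\<alpha> > 0" "\<delta> > 0"
    and g: "C1_halfline g g'" "C1_halfline g' g''" "\<And>x. 0 \<le> x \<Longrightarrow> g x > 0" "L-lipschitz_on {0..} g"
    and eta: "\<eta> > 0" "\<And>x. 0 \<le> x \<Longrightarrow> g'' x + \<alpha> * g' x - \<alpha> * \<delta> \<le> - \<eta>"
    and sol: "ide_solution g lam \<alpha> \<delta> \<psi> \<psi>'"
    and psi: "\<And>x. 0 \<le> x \<Longrightarrow> \<psi> x > 0" "strict_mono_on {0..} \<psi>"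
  obtains b K K1 W W' where
    "dividend_hjb g lam \<alpha> \<delta> b L K K1 W W'"
    "\<alpha> * lam * g 0 + (g' 0 - lam - \<delta>) * (lam + \<delta>) > 0 \<Longrightarrow> b > 0"
    "\<alpha> * lam * g 0 + (g' 0 - lam - \<delta>) * (lam + \<delta>) \<le> 0 \<Longrightarrow> b = 0"
    "\<And>x. 0 \<le> x \<Longrightarrow> \<psi>' b \<le> \<psi>' x"
    "\<And>x. 0 \<le> x \<Longrightarrow> W x = (if x \<le> b then \<psi> x / \<psi>' b else x - b + \<psi> b / \<psi>' b)"
    "b = 0 \<Longrightarrow> W 0 = g 0 / (lam + \<delta>)"
proof -
  define p where "p = (\<lambda>x. g' x + \<alpha> * g x - lam - \<delta>)"
  define R where "R = (\<lambda>x. \<alpha> * \<delta> * \<psi> x - p x * \<psi>' x)"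
  obtain b where b: "0 \<le> b"
    "\<alpha> * lam * g 0 + (g' 0 - lam - \<delta>) * (lam + \<delta>) > 0 \<Longrightarrow> b > 0"
    "\<alpha> * lam * g 0 + (g' 0 - lam - \<delta>) * (lam + \<delta>) \<le> 0 \<Longrightarrow> b = 0"
    "\<psi>' b > 0" "\<And>x. 0 \<le> x \<Longrightarrow> \<psi>' b \<le> \<psi>' x" "R b \<ge> 0"
    and psi2: "\<And>x. 0 \<le> x \<Longrightarrow> (\<psi>' has_real_derivative R x / g x) (at x within {0..})"
    and eq: "\<And>x. 0 \<le> x \<Longrightarrow> g x * \<psi>' x - (lam + \<delta>) * \<psi> x + lam * claim_mean \<alpha> \<psi> x = 0"
    and psi2_cont: "continuous_on {0..} (\<lambda>x. R x / g x)"
    using ide_solution_inflection[OF pos g(1-3) eta sol psi] unfolding p_def R_def by blast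
  have C1psi: "C1_halfline \<psi> \<psi>'" using sol by (simp add: ide_solution_def)
  note gD = C1_halflineD[OF g(1)] and g'D = C1_halflineD[OF g(2)] and psiD = C1_halflineD[OF C1psi]
  define W' where "W' = (\<lambda>x. \<psi>' (min x b) / \<psi>' b)"
  define W where "W = (\<lambda>x. if x \<le> b then \<psi> x / \<psi>' b else x - b + \<psi> b / \<psi>' b)"
  have p_deriv: "(p has_real_derivative g'' x + \<alpha> * g' x) (at x within {0..})" if "0 \<le> x" for x
    unfolding p_def by (rule derivative_eq_intros gD(1) g'D(1) that refl)+ simp
  have W'_cont: "continuous_on {0..} W'" unfolding W'_def
    by (intro continuous_intros continuous_on_compose2[OF psiD(2)]) (use b in auto)
  \<comment> \<open>As an integral of the continuous \<open>W'\<close>, the function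
    \<open>W\<close> is differentiable also at the junction b.\<close>
  have W_eq: "W x = \<psi> 0 / \<psi>' b + integral {0..x} W'" if x: "0 \<le> x" for x
  proof -
    have le: "W x = \<psi> 0 / \<psi>' b + integral {0..x} W'" if x: "0 \<le> x" "x \<le> b" for x
    proof -
      have "((\<lambda>x. \<psi>' x / \<psi>' b) has_integral (\<psi> x / \<psi>' b - \<psi> 0 / \<psi>' b)) {0..x}"
        using x psiD(1) by (intro FTC_halfline DERIV_cdivide) auto
      then have "(W' has_integral (\<psi> x / \<psi>' b - \<psi> 0 / \<psi>' b)) {0..x}"
        by (rule has_integral_eq[rotated]) (use x in \<open>auto simp: W'_def min_def\<close>)
      then show ?thesis using x by (simp add: W_def integral_unique)
    qed
    show ?thesis
    proof (cases "x \<le> b")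
      case False
      have "((\<lambda>x. 1) has_integral (x - b)) {b..x}"
        using has_integral_const_real[of "1::real" b x] False by simp
      then have "(W' has_integral (x - b)) {b..x}"
        by (rule has_integral_eq[rotated]) (use b(4) in \<open>auto simp: W'_def min_def\<close>)
      then have 2: "integral {b..x} W' = x - b" by (rule integral_unique)
      have "integral {0..b} W' + integral {b..x} W' = integral {0..x} W'"
        using False b x by (intro Henstock_Kurzweil_Integration.integral_combine integrable_continuous_real
            continuous_on_subset[OF W'_cont]) auto
      then show ?thesis using 2 le[of b] b False by (simp add: W_def)
    qed (use le x in auto)
  qed
  have W_deriv: "(W has_real_derivative W' x) (at x within {0..})" if x: "0 \<le> x" for x
  proof -
    have "((\<lambda>x. \<psi> 0 / \<psi>' b + integral {0..x} W') has_real_derivative 0 + W' x) (at x within {0..})"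
      by (intro DERIV_add DERIV_const halfline_antiderivative W'_cont x)
    then have "((\<lambda>x. \<psi> 0 / \<psi>' b + integral {0..x} W') has_real_derivative W' x) (at x within {0..})" by simp
    then show ?thesis
      by (rule has_field_derivative_transform_within[OF _ zero_less_one]) (use x W_eq in auto)
  qed
  have W_cont: "continuous_on {0..} W" by (intro DERIV_continuous_on[of _ W W'] W_deriv) auto
  \<comment> \<open>\<open>B\<close> will bound the second derivative of \<psi> on [0, b]; divided
    by \<psi>' b it is the Lipschitz constant of \<open>W'\<close>, which is constant beyond
    b.\<close>
  have "compact ((\<lambda>x. R x / g x) ` {0..b})"
    by (intro compact_continuous_image continuous_on_subset[OF psi2_cont]) auto
  then have "bounded ((\<lambda>x. R x / g x) ` {0..b})" by (rule compact_imp_bounded)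
  then obtain B where "\<forall>y\<in>(\<lambda>x. R x / g x) ` {0..b}. norm y \<le> B"
    unfolding bounded_iff by blast
  then have B: "\<bar>R x / g x\<bar> \<le> B" if "0 \<le> x" "x \<le> b" for x using that by simp
  have B0: "B \<ge> 0" by (rule order_trans[OF abs_ge_zero B[of 0]]) (use b in auto)
  have psi'_lip: "\<bar>\<psi>' x - \<psi>' y\<bar> \<le> B * \<bar>x - y\<bar>" if xy: "x \<in> {0..b}" "y \<in> {0..b}" for x y
  proof -
    have "norm (\<psi>' x - \<psi>' y) \<le> B * norm (x - y)"
    proof (rule field_differentiable_bound[of "{0..b}" _ "\<lambda>x. R x / g x"])
      fix z assume "z \<in> {0..b}"
      then show "(\<psi>' has_field_derivative R z / g z) (at z within {0..b})"
        by (intro DERIV_subset[OF psi2]) auto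
    qed (use xy B in auto)
    then show ?thesis by simp
  qed
  have W'_lip: "\<bar>W' x - W' y\<bar> \<le> B / \<psi>' b * \<bar>x - y\<bar>" if xy: "0 \<le> x" "0 \<le> y" for x y
  proof -
    have "\<bar>W' x - W' y\<bar> = \<bar>\<psi>' (min x b) - \<psi>' (min y b)\<bar> / \<psi>' b"
      using b(4) by (simp add: W'_def diff_divide_distrib[symmetric])
    also have "\<dots> \<le> B * \<bar>min x b - min y b\<bar> / \<psi>' b"
      using psi'_lip[of "min x b" "min y b"] xy b by (intro divide_right_mono) auto
    also have "\<dots> \<le> B * \<bar>x - y\<bar> / \<psi>' b"
      using B0 b(4) by (intro divide_right_mono mult_left_mono) auto
    finally show ?thesis by simp
  qed
  have W'_le: "W' x \<le> 1 + B / \<psi>' b * b" if x: "0 \<le> x" for x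
  proof -
    have "\<bar>W' (min x b) - W' b\<bar> \<le> B / \<psi>' b * \<bar>min x b - b\<bar>" using x b by (intro W'_lip) auto
    also have "\<dots> \<le> B / \<psi>' b * b" using x b B0 by (intro mult_left_mono) auto
    finally show ?thesis using b(4) by (auto simp: W'_def)
  qed
  have W_le: "W z = \<psi> z / \<psi>' b" if "z \<le> b" for z using that by (simp add: W_def)
  have hjb_eq: "g x * W' x - (lam + \<delta>) * W x + lam * claim_mean \<alpha> W x = 0" if x: "0 \<le> x" "x \<le> b" for x
  proof -
    have "claim_mean \<alpha> W x = integral {0..x} (\<lambda>y. \<psi> (x - y) * (\<alpha> * exp (- \<alpha> * y)) / \<psi>' b)"
      unfolding claim_mean_def by (rule integral_cong) (use x W_le in auto)
    also have "\<dots> = claim_mean \<alpha> \<psi> x / \<psi>' b" unfolding claim_mean_def by (rule integral_divide)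
    finally have m: "claim_mean \<alpha> W x = claim_mean \<alpha> \<psi> x / \<psi>' b" .
    have "g x * W' x - (lam + \<delta>) * W x + lam * claim_mean \<alpha> W x =
       (g x * \<psi>' x - (lam + \<delta>) * \<psi> x + lam * claim_mean \<alpha> \<psi> x) / \<psi>' b"
      unfolding m using x by (simp add: W_le W'_def min_def diff_divide_distrib add_divide_distrib)
    then show ?thesis using eq[OF x(1)] by simp
  qed
  have W'1: "W' x = 1" if "b \<le> x" for x using that b(4) by (simp add: W'_def min_def)
  have hjb_le: "g x * W' x - (lam + \<delta>) * W x + lam * claim_mean \<alpha> W x \<le> 0" if x: "0 \<le> x" for x
  proof (cases "x \<le> b")
    case False
    have neg: "p z - \<alpha> * \<delta> * W z \<le> 0" if z: "b \<le> z" for z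
    proof -
      have "\<alpha> * \<delta> * W b - p b \<le> \<alpha> * \<delta> * W z - p z"
      proof (rule nonneg_deriv_halfline_mono[of b z _ "\<lambda>z. \<alpha> * \<delta> * W' z - (g'' z + \<alpha> * g' z)"])
        fix y assume y: "b \<le> y" "y \<le> z"
        show "((\<lambda>a. \<alpha> * \<delta> * W a - p a) has_real_derivative \<alpha> * \<delta> * W' y - (g'' y + \<alpha> * g' y)) (at y within {0..})"
          using y b by (intro DERIV_diff DERIV_cmult p_deriv W_deriv) auto
        show "0 \<le> \<alpha> * \<delta> * W' y - (g'' y + \<alpha> * g' y)" using eta(1) eta(2)[of y] y b W'1[of y] by auto
      qed (use b z in auto)
      moreover have "\<alpha> * \<delta> * W b - p b = R b / \<psi>' b" using b(4) by (simp add: W_def R_def diff_divide_distrib)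
      moreover have "R b / \<psi>' b \<ge> 0" using b by simp
      ultimately show ?thesis by simp
    qed
    let ?f = "\<lambda>x. g x - (lam + \<delta>) * W x + lam * claim_mean \<alpha> W x"
    have "- (exp (\<alpha> * b) * ?f b) \<le> - (exp (\<alpha> * x) * ?f x)"
    proof (rule nonneg_deriv_halfline_mono[of b x _ "\<lambda>z. - (exp (\<alpha> * z) * (p z - \<alpha> * \<delta> * W z))"])
      fix z assume z: "b \<le> z" "z \<le> x"
      have z0: "0 \<le> z" using z b by auto
      show "((\<lambda>x. - (exp (\<alpha> * x) * ?f x)) has_real_derivative - (exp (\<alpha> * z) * (p z - \<alpha> * \<delta> * W z))) (at z within {0..})"
        by (rule derivative_eq_intros gD(1) W_deriv claim_mean_deriv W_cont z0 refl)+
          (use W'1[OF z(1)] in \<open>simp add: p_def algebra_simps\<close>)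
      show "0 \<le> - (exp (\<alpha> * z) * (p z - \<alpha> * \<delta> * W z))" using neg[OF z(1)] by (simp add: mult_nonneg_nonpos)
    qed (use b False in auto)
    moreover have "?f b = 0" using hjb_eq[of b] b W'1[of b] by simp
    ultimately have "exp (\<alpha> * x) * ?f x \<le> 0" by simp
    then have "?f x \<le> 0" by (simp add: mult_le_0_iff)
    then show ?thesis using W'1[of x] False by simp
  qed (use hjb_eq x in auto)
  have W0: "W 0 = g 0 / (lam + \<delta>)" if "b = 0"
    using hjb_eq[of 0] W'1[of 0] that pos by (simp add: claim_mean_def field_simps)
  show ?thesis
  proof (rule that)
    show "dividend_hjb g lam \<alpha> \<delta> b L (B / \<psi>' b) (1 + B / \<psi>' b * b) W W'"
    proof
      fix x::real assume "0 \<le> x" then show "1 \<le> W' x" using b by (simp add: W'_def)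
    next
      show "0 < W 0" using psi(1)[of 0] b by (simp add: W_def)
    qed (fact | use W'1 W'_lip W'_le W_deriv hjb_le hjb_eq pos b g in auto)+
  qed (use b W0 in \<open>auto simp: W_def\<close>)
qed

section \<open>Paths of the controlled surplus\<close>

text \<open>On either side of a point p both functions oscillate by less than \<eta> nearby. A
  Lebesgue number of these neighbourhoods makes the scale uniform on [0, T], and u is p if p lies
  between s and t, else s. One u has to serve both functions: with claim numbers and dividends, it
  bounds what is paid before a claim.\<close>

lemma cadlag_modulus2:
  fixes f1 f2 :: "real \<Rightarrow> real"
  assumes c: "cadlag f1" "cadlag f2" and \<eta>: "0 < \<eta>"
  obtains \<rho> where "0 < \<rho>" "\<And>s t. 0 \<le> s \<Longrightarrow> s \<le> t \<Longrightarrow> t \<le> T \<Longrightarrow> t - s < \<rho> \<Longrightarrow>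
     \<exists>u\<in>{s..t}. (\<forall>r\<in>{s..<u}. \<bar>f1 r - f1 s\<bar> < \<eta> \<and> \<bar>f2 r - f2 s\<bar> < \<eta>) \<and>
        (\<forall>r\<in>{u..t}. \<bar>f1 r - f1 t\<bar> < \<eta> \<and> \<bar>f2 r - f2 t\<bar> < \<eta>)"
proof -
  have lft: "\<exists>\<rho>>0. \<forall>r r'. 0 \<le> r \<longrightarrow> 0 \<le> r' \<longrightarrow> p - \<rho> < r \<longrightarrow> r < p \<longrightarrow> p - \<rho> < r' \<longrightarrow> r' < p \<longrightarrow> \<bar>f r - f r'\<bar> < \<eta>"
    if "cadlag f" "0 \<le> p" for f :: "real \<Rightarrow> real" and p
  proof (cases "p = 0")
    case True then show ?thesis by (intro exI[of _ 1]) auto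
  next
    case False
    then have "0 < p" using that by simp
    then have "\<exists>l. (f \<longlongrightarrow> l) (at_left p)" using that(1) unfolding cadlag_def by blast
    then obtain l where "(f \<longlongrightarrow> l) (at_left p)" by blast
    then have "eventually (\<lambda>r. \<bar>f r - l\<bar> < \<eta> / 2) (at_left p)"
      using \<eta> by (simp add: tendsto_iff dist_real_def del: less_divide_eq_numeral1)
    then obtain a where a: "a < p" "\<And>r. a < r \<Longrightarrow> r < p \<Longrightarrow> \<bar>f r - l\<bar> < \<eta> / 2"
      unfolding eventually_at_left_field by auto
    show ?thesis
    proof (intro exI[of _ "p - a"] conjI allI impI)
      fix r r' assume "p - (p - a) < r" "r < p" "p - (p - a) < r'" "r' < p"
      then have "\<bar>f r - l\<bar> < \<eta> / 2" "\<bar>f r' - l\<bar> < \<eta> / 2" using a by auto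
      then show "\<bar>f r - f r'\<bar> < \<eta>" by linarith
    qed (use a in auto)
  qed
  have rgt: "\<exists>\<rho>>0. \<forall>r r'. p \<le> r \<longrightarrow> r < p + \<rho> \<longrightarrow> p \<le> r' \<longrightarrow> r' < p + \<rho> \<longrightarrow> \<bar>f r - f r'\<bar> < \<eta>"
    if "cadlag f" "0 \<le> p" for f :: "real \<Rightarrow> real" and p
  proof -
    have "(f \<longlongrightarrow> f p) (at_right p)" using that by (auto simp: cadlag_def continuous_within)
    then have "eventually (\<lambda>r. \<bar>f r - f p\<bar> < \<eta> / 2) (at_right p)"
      using \<eta> by (simp add: tendsto_iff dist_real_def del: less_divide_eq_numeral1)
    then obtain a where a: "a > p" "\<And>r. p < r \<Longrightarrow> r < a \<Longrightarrow> \<bar>f r - f p\<bar> < \<eta> / 2"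
      unfolding eventually_at_right_field by auto
    have a': "\<bar>f r - f p\<bar> < \<eta> / 2" if "p \<le> r" "r < a" for r
      using a(2)[of r] that \<eta> by (cases "r = p") auto
    show ?thesis
    proof (intro exI[of _ "a - p"] conjI allI impI)
      fix r r' assume "p \<le> r" "r < p + (a - p)" "p \<le> r'" "r' < p + (a - p)"
      then have "\<bar>f r - f p\<bar> < \<eta> / 2" "\<bar>f r' - f p\<bar> < \<eta> / 2" using a' by auto
      then show "\<bar>f r - f r'\<bar> < \<eta>" by linarith
    qed (use a in auto)
  qed
  define near where "near p \<rho> \<longleftrightarrow> 0 < \<rho> \<and>
      (\<forall>r r'. 0 \<le> r \<longrightarrow> 0 \<le> r' \<longrightarrow> p - \<rho> < r \<longrightarrow> r < p \<longrightarrow> p - \<rho> < r' \<longrightarrow> r' < p \<longrightarrow> \<bar>f1 r - f1 r'\<bar> < \<eta> \<and> \<bar>f2 r - f2 r'\<bar> < \<eta>) \<and>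
      (\<forall>r r'. p \<le> r \<longrightarrow> r < p + \<rho> \<longrightarrow> p \<le> r' \<longrightarrow> r' < p + \<rho> \<longrightarrow> \<bar>f1 r - f1 r'\<bar> < \<eta> \<and> \<bar>f2 r - f2 r'\<bar> < \<eta>)"
    for p \<rho>
  have "\<exists>\<rho>. 0 \<le> p \<longrightarrow> near p \<rho>" for p
  proof (cases "0 \<le> p")
    case p: True
    obtain a1 a2 b1 b2 where
      a1: "a1 > 0" "\<forall>r r'. 0 \<le> r \<longrightarrow> 0 \<le> r' \<longrightarrow> p - a1 < r \<longrightarrow> r < p \<longrightarrow> p - a1 < r' \<longrightarrow> r' < p \<longrightarrow> \<bar>f1 r - f1 r'\<bar> < \<eta>"
      and a2: "a2 > 0" "\<forall>r r'. 0 \<le> r \<longrightarrow> 0 \<le> r' \<longrightarrow> p - a2 < r \<longrightarrow> r < p \<longrightarrow> p - a2 < r' \<longrightarrow> r' < p \<longrightarrow> \<bar>f2 r - f2 r'\<bar> < \<eta>"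
      and b1: "b1 > 0" "\<forall>r r'. p \<le> r \<longrightarrow> r < p + b1 \<longrightarrow> p \<le> r' \<longrightarrow> r' < p + b1 \<longrightarrow> \<bar>f1 r - f1 r'\<bar> < \<eta>"
      and b2: "b2 > 0" "\<forall>r r'. p \<le> r \<longrightarrow> r < p + b2 \<longrightarrow> p \<le> r' \<longrightarrow> r' < p + b2 \<longrightarrow> \<bar>f2 r - f2 r'\<bar> < \<eta>"
      using lft[OF c(1) p] lft[OF c(2) p] rgt[OF c(1) p] rgt[OF c(2) p] by auto
    define m where "m = min (min a1 a2) (min b1 b2)"
    have m: "0 < m" "m \<le> a1" "m \<le> a2" "m \<le> b1" "m \<le> b2" using a1(1) a2(1) b1(1) b2(1) by (auto simp: m_def)
    have "near p m"
      unfolding near_def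
    proof (intro conjI allI impI)
      fix r r' assume r: "0 \<le> r" "0 \<le> r'" "p - m < r" "r < p" "p - m < r'" "r' < p"
      have l: "p - a1 < r" "p - a1 < r'" "p - a2 < r" "p - a2 < r'" using r m by linarith+
      show "\<bar>f1 r - f1 r'\<bar> < \<eta>" using a1(2) r l by blast
      show "\<bar>f2 r - f2 r'\<bar> < \<eta>" using a2(2) r l by blast
    next
      fix r r' assume r: "p \<le> r" "r < p + m" "p \<le> r'" "r' < p + m"
      have l: "r < p + b1" "r' < p + b1" "r < p + b2" "r' < p + b2" using r m by linarith+
      show "\<bar>f1 r - f1 r'\<bar> < \<eta>" using b1(2) r l by blast
      show "\<bar>f2 r - f2 r'\<bar> < \<eta>" using b2(2) r l by blast
    qed fact
    then show ?thesis by blast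
  qed blast
  then have "\<exists>\<rho>. \<forall>p. 0 \<le> p \<longrightarrow> near p (\<rho> p)" by (intro choice) blast
  then obtain \<rho> where near: "\<And>p. 0 \<le> p \<Longrightarrow> near p (\<rho> p)" by blast
  have \<rho>: "0 < \<rho> p"
    "\<And>r r'. 0 \<le> r \<Longrightarrow> 0 \<le> r' \<Longrightarrow> p - \<rho> p < r \<Longrightarrow> r < p \<Longrightarrow> p - \<rho> p < r' \<Longrightarrow> r' < p \<Longrightarrow> \<bar>f1 r - f1 r'\<bar> < \<eta> \<and> \<bar>f2 r - f2 r'\<bar> < \<eta>"
    "\<And>r r'. p \<le> r \<Longrightarrow> r < p + \<rho> p \<Longrightarrow> p \<le> r' \<Longrightarrow> r' < p + \<rho> p \<Longrightarrow> \<bar>f1 r - f1 r'\<bar> < \<eta> \<and> \<bar>f2 r - f2 r'\<bar> < \<eta>"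
    if "0 \<le> p" for p
    using near[OF that] unfolding near_def by blast+
  show ?thesis
  proof (rule Lebesgue_number_lemma[of "{0..max 0 T}" "(\<lambda>p. ball p (\<rho> p)) ` {0..max 0 T}"])
    show "{0..max 0 T} \<subseteq> \<Union> ((\<lambda>p. ball p (\<rho> p)) ` {0..max 0 T})" using \<rho>(1) by force
  next
    fix \<epsilon> assume \<epsilon>: "0 < \<epsilon>" and leb: "\<And>U. U \<subseteq> {0..max 0 T} \<Longrightarrow> diameter U < \<epsilon> \<Longrightarrow> \<exists>B\<in>(\<lambda>p. ball p (\<rho> p)) ` {0..max 0 T}. U \<subseteq> B"
    show ?thesis
    proof (rule that[OF \<epsilon>])
      fix s t :: real assume st: "0 \<le> s" "s \<le> t" "t \<le> T" "t - s < \<epsilon>"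
      have "diameter {s..t} \<le> t - s" by (rule diameter_le) (use st in auto)
      then have "\<exists>B\<in>(\<lambda>p. ball p (\<rho> p)) ` {0..max 0 T}. {s..t} \<subseteq> B" using st by (intro leb) auto
      then obtain p where p: "0 \<le> p" "{s..t} \<subseteq> ball p (\<rho> p)" by auto
      have s: "p - \<rho> p < s" "s < p + \<rho> p" and t: "p - \<rho> p < t" "t < p + \<rho> p"
        using p(2) st by (auto simp: subset_iff dist_real_def)+
      show "\<exists>u\<in>{s..t}. (\<forall>r\<in>{s..<u}. \<bar>f1 r - f1 s\<bar> < \<eta> \<and> \<bar>f2 r - f2 s\<bar> < \<eta>) \<and>
        (\<forall>r\<in>{u..t}. \<bar>f1 r - f1 t\<bar> < \<eta> \<and> \<bar>f2 r - f2 t\<bar> < \<eta>)"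
      proof (cases "s < p \<and> p \<le> t")
        case True
        then show ?thesis using st s t p(1) by (intro bexI[of _ p] conjI ballI \<rho>(2)[OF p(1)] \<rho>(3)[OF p(1)]) auto
      next
        case False
        then consider "p \<le> s" | "t < p" by linarith
        then show ?thesis
        proof cases
          case 1 then show ?thesis using st s t p(1) by (intro bexI[of _ s] conjI ballI \<rho>(3)[of p]) auto
        next
          case 2 then show ?thesis using st s t p(1) by (intro bexI[of _ s] conjI ballI \<rho>(2)[of p]) auto
        qed
      qed
    qed
  qed auto
qed

text \<open>The Stieltjes measure asks for right continuity on the whole line; before time 0 it
  comes from the constant value 0.\<close>

lemma cadlag_right_cont:
  assumes "cadlag D" "\<And>t. t < 0 \<Longrightarrow> D t = (0::real)"
  shows "continuous (at_right a) D"
proof (cases "a < 0")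
  case True
  have "((\<lambda>_. 0) \<longlongrightarrow> (0::real)) (at_right a)" by simp
  then have "(D \<longlongrightarrow> 0) (at_right a)"
    by (rule Lim_transform_eventually) (use True assms(2) in \<open>auto intro!: eventually_at_rightI[of a 0]\<close>)
  then show ?thesis using True assms(2) by (simp add: continuous_within)
qed (use assms in \<open>auto simp: cadlag_def\<close>)

text \<open>The times satisfying \<open>A\<close> form an initial segment that may lack its right
  end. In that case half-open intervals ending at times in the segment exhaust it, so a jump of
  \<open>D\<close> at the missing end is not counted and a bound on payments within the segment is
  enough.\<close>

lemma interval_measure_alive_le:
  assumes D: "mono D" "\<And>a. continuous (at_right a) D"
    and s: "s \<le> t" "0 \<le> c" and down: "\<And>r r'. A r' \<Longrightarrow> r \<le> r' \<Longrightarrow> A r" and As: "A s"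
    and le: "\<And>r. s \<le> r \<Longrightarrow> r \<le> t \<Longrightarrow> A r \<Longrightarrow> D r - D s \<le> c"
  shows "emeasure (interval_measure D) ({s<..t} \<inter> {r. A r}) \<le> ennreal c"
proof -
  have Ioc: "emeasure (interval_measure D) {s<..r} \<le> ennreal c" if "s \<le> r" "r \<le> t" "A r" for r
  proof -
    have "emeasure (interval_measure D) {s<..r} = D r - D s"
      using that D by (intro emeasure_interval_measure_Ioc) (auto simp: mono_def)
    then show ?thesis using le[OF that] by (simp add: ennreal_leI)
  qed
  let ?R = "{r\<in>{s..t}. A r}"
  define \<rho> where "\<rho> = Sup ?R"
  have ne: "?R \<noteq> {}" using As s by auto
  have bdd: "bdd_above ?R" by (rule bdd_aboveI[of _ t]) auto
  have s\<rho>: "s \<le> \<rho>" "\<rho> \<le> t" unfolding \<rho>_def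
    by (rule cSup_upper[OF _ bdd]; use As s in auto) (rule cSup_least[OF ne]; auto)
  have up: "r \<le> \<rho>" if "s < r" "r \<le> t" "A r" for r
    unfolding \<rho>_def by (rule cSup_upper[OF _ bdd]) (use that in auto)
  show ?thesis
  proof (cases "A \<rho>")
    case True
    have "emeasure (interval_measure D) ({s<..t} \<inter> {r. A r}) \<le> emeasure (interval_measure D) {s<..\<rho>}"
      by (rule emeasure_mono) (use up in auto)
    also have "\<dots> \<le> c" by (rule Ioc) (use True s\<rho> in auto)
    finally show ?thesis .
  next
    case False
    then have s\<rho>': "s < \<rho>" using As s\<rho> by (cases "s = \<rho>") auto
    define r where "r = (\<lambda>n::nat. \<rho> - (\<rho> - s) / (real n + 1))"
    have r_bd: "s \<le> r n" "r n < \<rho>" for n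
    proof -
      have "(\<rho> - s) / (real n + 1) \<le> \<rho> - s" using s\<rho>' by (simp add: divide_le_eq mult_le_cancel_left1)
      moreover have "(\<rho> - s) / (real n + 1) > 0" using s\<rho>' by simp
      ultimately show "s \<le> r n" "r n < \<rho>" by (auto simp: r_def)
    qed
    have Ar: "A (r n)" for n
    proof -
      obtain v where "v \<in> ?R" "r n < v" using less_cSupE[OF _ ne, of "r n"] r_bd[of n] unfolding \<rho>_def by blast
      then show ?thesis using down[of v "r n"] by auto
    qed
    have inc: "incseq (\<lambda>n. {s<..r n})"
    proof (rule incseq_SucI)
      fix n
      have "(\<rho> - s) / (real (Suc n) + 1) \<le> (\<rho> - s) / (real n + 1)" using s\<rho>' by (intro divide_left_mono) auto
      then show "{s<..r n} \<subseteq> {s<..r (Suc n)}" by (auto simp: r_def)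
    qed
    have lim: "r \<longlonglongrightarrow> \<rho>"
    proof -
      have "(\<lambda>n. \<rho> - (\<rho> - s) * inverse (real (Suc n))) \<longlonglongrightarrow> \<rho> - (\<rho> - s) * 0"
        by (intro tendsto_intros LIMSEQ_inverse_real_of_nat)
      then show ?thesis by (simp add: r_def[abs_def] divide_inverse add.commute)
    qed
    have "{s<..t} \<inter> {r. A r} \<subseteq> (\<Union>n. {s<..r n})"
    proof
      fix v assume v: "v \<in> {s<..t} \<inter> {r. A r}"
      then have "v \<noteq> \<rho>" using False by auto
      then have "v < \<rho>" using up[of v] v by auto
      then have "eventually (\<lambda>n. v < r n) sequentially" by (rule order_tendstoD[OF lim])
      then obtain n where "v < r n" by (auto simp: eventually_sequentially)
      then show "v \<in> (\<Union>n. {s<..r n})" using v by (auto intro!: exI[of _ n])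
    qed
    then have "emeasure (interval_measure D) ({s<..t} \<inter> {r. A r}) \<le> emeasure (interval_measure D) (\<Union>n. {s<..r n})"
      by (intro emeasure_mono) auto
    also have "\<dots> = (SUP n. emeasure (interval_measure D) {s<..r n})"
      by (rule SUP_emeasure_incseq[symmetric]) (use inc in auto)
    also have "\<dots> \<le> c"
      by (rule SUP_least, rule Ioc) (use r_bd Ar order_trans[OF less_imp_le[OF r_bd(2)] s\<rho>(2)] in auto)
    finally show ?thesis .
  qed
qed

section \<open>Increments of the candidate \<open>W\<close>\<close>

context dividend_hjb
begin

lemma K_nonneg: "0 \<le> K"
  using W'_lip[of 0 1] abs_ge_zero[of "W' 0 - W' 1"] by (simp del: abs_ge_zero)

lemma L_nonneg: "0 \<le> L" using g_lip by (rule lipschitz_on_nonneg)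

lemma g_diff: "0 \<le> x \<Longrightarrow> 0 \<le> y \<Longrightarrow> \<bar>g x - g y\<bar> \<le> L * \<bar>x - y\<bar>"
  using lipschitz_onD[OF g_lip, of x y] by (simp add: dist_real_def)

lemma K1_ge1: "1 \<le> K1" using W'_ge1[of 0] W'_le[of 0] by simp

lemma W_mvt:
  assumes "0 \<le> x" "x \<le> y"
  obtains z where "x \<le> z" "z \<le> y" "W y - W x = W' z * (y - x)"
proof -
  have "\<exists>z\<in>{x..y}. W y - W x = W' z * (y - x)"
  proof (rule mvt_very_simple)
    fix z assume "x \<le> z" "z \<le> y"
    then have "(W has_real_derivative W' z) (at z within {x..y})"
      using assms by (intro DERIV_subset[OF W_deriv]) auto
    then show "(W has_derivative (\<lambda>v. W' z * v)) (at z within {x..y})" by (simp add: has_field_derivative_def)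
  qed fact
  then show ?thesis using that by auto
qed

text \<open>\<open>W' \<ge> 1\<close> in integrated form: a payment lowers \<open>W\<close> by at
  least the amount paid. The upper estimates compare payments of every kind with \<open>W\<close>
  through this inequality.\<close>

lemma W_diff_ge: "0 \<le> x \<Longrightarrow> x \<le> y \<Longrightarrow> y - x \<le> W y - W x"
proof -
  assume xy: "0 \<le> x" "x \<le> y"
  obtain z where z: "x \<le> z" "W y - W x = W' z * (y - x)" using W_mvt[OF xy] by auto
  note a = xy z
  have "1 * (y - x) \<le> W' z * (y - x)" using a W'_ge1[of z] by (intro mult_right_mono) auto
  then show ?thesis using a by simp
qed

lemma W_diff_le: "0 \<le> x \<Longrightarrow> x \<le> y \<Longrightarrow> W y - W x \<le> K1 * (y - x)"
proof -
  assume xy: "0 \<le> x" "x \<le> y"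
  obtain z where z: "x \<le> z" "W y - W x = W' z * (y - x)" using W_mvt[OF xy] by auto
  note a = xy z
  then show ?thesis using W'_le[of z] by (auto intro!: mult_right_mono)
qed

text \<open>The Lipschitz property of \<open>W'\<close> gives a quadratic remainder; this takes the
  place of a change-of-variables formula along the path.\<close>

lemma W_taylor: "0 \<le> x \<Longrightarrow> 0 \<le> i \<Longrightarrow> \<bar>W (x + i) - W x - W' x * i\<bar> \<le> K * i\<^sup>2"
proof -
  assume a: "0 \<le> x" "0 \<le> i"
  have "x \<le> x + i" using a by simp
  from W_mvt[OF a(1) this] obtain z where z: "x \<le> z" "z \<le> x + i" "W (x + i) - W x = W' z * i" by auto
  have "W (x + i) - W x - W' x * i = (W' z - W' x) * i" unfolding z(3) by (simp add: algebra_simps)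
  then have "\<bar>W (x + i) - W x - W' x * i\<bar> = \<bar>W' z - W' x\<bar> * i" using a by (simp add: abs_mult)
  also have "\<dots> \<le> (K * \<bar>z - x\<bar>) * i" using W'_lip[of z x] a z by (intro mult_right_mono) auto
  also have "\<dots> \<le> (K * i) * i" using a z K_nonneg by (intro mult_right_mono mult_left_mono) auto
  finally show ?thesis by (simp add: power2_eq_square)
qed

lemma W_mono: "0 \<le> x \<Longrightarrow> x \<le> y \<Longrightarrow> W x \<le> W y" using W_diff_ge[of x y] by simp

lemma W_ge0: "0 \<le> x \<Longrightarrow> W 0 + x \<le> W x" using W_diff_ge[of 0 x] by simp

lemma W_pos: "0 \<le> x \<Longrightarrow> 0 < W x" using W_ge0[of x] W0 by simp

text \<open>The drift of the discounted \<open>W\<close> between claims while nothing is paid; the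
  effect of claims is treated separately.\<close>

definition q :: "real \<Rightarrow> real" where "q x = g x * W' x - \<delta> * W x"

text \<open>\<open>W\<close> extended by \<open>0\<close> to the negative reals jumps at \<open>0\<close>, where discretised surpluses need not converge;
  \<open>Weps \<epsilon>\<close> is a Lipschitz majorant of that extension.\<close>

definition Weps :: "real \<Rightarrow> real \<Rightarrow> real" where
  "Weps \<epsilon> z = W (max 0 z) - W 0 + W 0 * max 0 (min 1 (1 + z / \<epsilon>))"

lemma Weps_nonneg_arg: "0 < \<epsilon> \<Longrightarrow> 0 \<le> z \<Longrightarrow> Weps \<epsilon> z = W z" by (simp add: Weps_def)

lemma Weps_nonneg: "0 < \<epsilon> \<Longrightarrow> 0 \<le> Weps \<epsilon> z"
  unfolding Weps_def using W_mono[of 0 "max 0 z"] W0 by (intro add_nonneg_nonneg) auto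

text \<open>\<open>K1\<close> comes from \<open>W\<close> and \<open>W 0 / \<epsilon>\<close> from
  the ramp on [-\<epsilon>, 0]. The constant is large for small \<epsilon>, but \<epsilon> stays
  fixed while the mesh tends to 0.\<close>

lemma Weps_mono_lip:
  assumes "0 < \<epsilon>" "z \<le> z'"
  shows "Weps \<epsilon> z' - Weps \<epsilon> z \<le> (K1 + W 0 / \<epsilon>) * (z' - z)"
proof -
  have 1: "W (max 0 z') - W (max 0 z) \<le> K1 * (z' - z)"
  proof -
    have "W (max 0 z') - W (max 0 z) \<le> K1 * (max 0 z' - max 0 z)" using assms by (intro W_diff_le) auto
    also have "\<dots> \<le> K1 * (z' - z)" using assms K1_ge1 by (intro mult_left_mono) auto
    finally show ?thesis .
  qed
  have "z / \<epsilon> \<le> z' / \<epsilon>" using assms by (intro divide_right_mono) auto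
  then have "max 0 (min 1 (1 + z' / \<epsilon>)) - max 0 (min 1 (1 + z / \<epsilon>)) \<le> z' / \<epsilon> - z / \<epsilon>" by linarith
  then have "W 0 * (max 0 (min 1 (1 + z' / \<epsilon>)) - max 0 (min 1 (1 + z / \<epsilon>))) \<le> W 0 * (z' / \<epsilon> - z / \<epsilon>)"
    using W0 by (intro mult_left_mono) auto
  with 1 show ?thesis unfolding Weps_def by (simp add: algebra_simps diff_divide_distrib)
qed

lemma Weps_le: "0 < \<epsilon> \<Longrightarrow> z \<le> y \<Longrightarrow> 0 \<le> y \<Longrightarrow> Weps \<epsilon> z \<le> W y"
proof -
  assume a: "0 < \<epsilon>" "z \<le> y" "0 \<le> y"
  have "W 0 * max 0 (min 1 (1 + z / \<epsilon>)) \<le> W 0 * 1" using W0 by (intro mult_left_mono) auto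
  then show ?thesis unfolding Weps_def using W_mono[of "max 0 z" y] a by simp
qed

end

section \<open>A single path of the surplus equation\<close>

locale surplus_path =
  fixes g :: "real \<Rightarrow> real" and L x :: real and n :: "real \<Rightarrow> nat" and y :: "nat \<Rightarrow> real"
    and D X :: "real \<Rightarrow> real"
  assumes rate_pos: "\<And>z. 0 \<le> z \<Longrightarrow> g z > 0" and rate_lip: "L-lipschitz_on {0..} g"
    and x: "0 \<le> x"
    and n0: "n 0 = 0" and n_mono: "mono_on {0..} n" and n_cadlag: "cadlag (\<lambda>t. real (n t))"
    and y_pos: "\<And>i. 0 < y i"
    and D_neg: "\<And>t. t < 0 \<Longrightarrow> D t = 0" and D_mono: "mono D" and D_cadlag: "cadlag D"
    and X_int: "\<And>t. 0 \<le> t \<Longrightarrow> (\<lambda>s. g (max 0 (X s))) integrable_on {0..t}"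
    and X_eq: "\<And>t. 0 \<le> t \<Longrightarrow> X t = x + integral {0..t} (\<lambda>s. g (max 0 (X s))) - (\<Sum>i<n t. y i) - D t"
begin

definition S :: "real \<Rightarrow> real" where "S t = (\<Sum>i<n t. y i)"

text \<open>Times before ruin are alive; the ruin time itself is alive too if the path is still
  nonnegative there. Unlike being before ruin, this is decided by the path on [0, t].\<close>

definition alive :: "real \<Rightarrow> bool" where "alive t \<longleftrightarrow> (\<forall>r. 0 \<le> r \<longrightarrow> r \<le> t \<longrightarrow> 0 \<le> X r)"

abbreviation G :: "real \<Rightarrow> real" where "G z \<equiv> g (max 0 z)"

lemma alive_down: "alive t \<Longrightarrow> s \<le> t \<Longrightarrow> alive s" by (auto simp: alive_def)

lemma aliveD: "alive t \<Longrightarrow> 0 \<le> t \<Longrightarrow> 0 \<le> X t" by (auto simp: alive_def)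

lemma n_le: "0 \<le> s \<Longrightarrow> s \<le> t \<Longrightarrow> n s \<le> n t" using n_mono by (auto simp: mono_on_def)

lemma D_le: "s \<le> t \<Longrightarrow> D s \<le> D t" using D_mono by (auto simp: mono_def)

lemma D_nonneg: "0 \<le> D t" using D_le[of "-\<bar>t\<bar> - 1" t] D_neg[of "-\<bar>t\<bar> - 1"] by auto

lemma S_le: "0 \<le> s \<Longrightarrow> s \<le> t \<Longrightarrow> S s \<le> S t"
  unfolding S_def using n_le[of s t] y_pos by (intro sum_mono2) (auto intro: less_imp_le)

text \<open>As claim sizes are positive, the occurrence of a claim can be read off from the
  aggregate claims, whose increments are the ones known to be independent of the past.\<close>

lemma S_less: "0 \<le> s \<Longrightarrow> s \<le> t \<Longrightarrow> S s < S t \<longleftrightarrow> n s < n t"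
proof -
  assume a: "0 \<le> s" "s \<le> t"
  show ?thesis
  proof
    assume "n s < n t"
    then have "0 < (\<Sum>i\<in>{n s..<n t}. y i)" by (intro sum_pos) (use y_pos in auto)
    moreover have "{..<n t} = {..<n s} \<union> {n s..<n t}" using \<open>n s < n t\<close> by auto
    then have "S t = S s + (\<Sum>i\<in>{n s..<n t}. y i)"
      unfolding S_def by (simp add: sum.union_disjoint ivl_disj_int)
    ultimately show "S s < S t" by simp
  next
    assume "S s < S t"
    then have "n s \<noteq> n t" by (auto simp: S_def)
    then show "n s < n t" using n_le[OF a] by simp
  qed
qed

lemma S_nonneg: "0 \<le> S t" unfolding S_def using y_pos by (intro sum_nonneg) (auto intro: less_imp_le)

lemma L_nonneg': "0 \<le> L" using rate_lip by (rule lipschitz_on_nonneg)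

lemma G_lip: "\<bar>G a - G b\<bar> \<le> L * \<bar>a - b\<bar>"
proof -
  have "\<bar>G a - G b\<bar> \<le> L * \<bar>max 0 a - max 0 b\<bar>"
    using lipschitz_onD[OF rate_lip, of "max 0 a" "max 0 b"] by (simp add: dist_real_def)
  also have "\<dots> \<le> L * \<bar>a - b\<bar>" using L_nonneg' by (intro mult_left_mono) auto
  finally show ?thesis .
qed

lemma G_pos: "0 < G a" by (rule rate_pos) simp

lemma G_int: "0 \<le> s \<Longrightarrow> (\<lambda>u. G (X u)) integrable_on {s..t}"
proof (cases "s \<le> t")
  case True
  assume "0 \<le> s"
  then show ?thesis using X_int[of t] True by (auto intro!: integrable_subinterval_real[OF X_int[of t]])
qed auto

lemma X_diff: "0 \<le> s \<Longrightarrow> s \<le> t \<Longrightarrow>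
    X t = X s + integral {s..t} (\<lambda>u. G (X u)) - (S t - S s) - (D t - D s)"
  using X_eq[of t] X_eq[of s] Henstock_Kurzweil_Integration.integral_combine[of 0 s t "\<lambda>u. G (X u)"] X_int[of t]
  by (simp add: S_def)

lemma int_nonneg: "0 \<le> s \<Longrightarrow> 0 \<le> integral {s..t} (\<lambda>u. G (X u))"
  by (intro integral_nonneg G_int) (auto intro: less_imp_le[OF G_pos])

lemma int_le:
  assumes "0 \<le> s" "s \<le> t" "\<And>u. s \<le> u \<Longrightarrow> u \<le> t \<Longrightarrow> G (X u) \<le> c"
  shows "integral {s..t} (\<lambda>u. G (X u)) \<le> c * (t - s)"
proof -
  have "integral {s..t} (\<lambda>u. G (X u)) \<le> integral {s..t} (\<lambda>u. c)"
    by (intro integral_le G_int) (use assms in auto)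
  then show ?thesis using assms by (simp add: mult.commute)
qed

lemma int_ge:
  assumes "0 \<le> s" "s \<le> t" "\<And>u. s \<le> u \<Longrightarrow> u \<le> t \<Longrightarrow> c \<le> G (X u)"
  shows "c * (t - s) \<le> integral {s..t} (\<lambda>u. G (X u))"
proof -
  have "integral {s..t} (\<lambda>u. c) \<le> integral {s..t} (\<lambda>u. G (X u))"
    by (intro integral_le G_int) (use assms in auto)
  then show ?thesis using assms by (simp add: mult.commute)
qed

text \<open>Gronwall's inequality for the initial capital plus accumulated premiums, which dominates
  the surplus. The bound does not depend on path or control and later serves to truncate functions
  of the surplus.\<close>

lemma X_le_exp:
  assumes t: "0 \<le> t"
  shows "X t \<le> (1 + x) * exp ((g 0 + L) * t)"
proof -
  define k where "k = g 0 + L"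
  define v where "v = (\<lambda>t. x + integral {0..t} (\<lambda>u. G (X u)))"
  have k: "k > 0" using rate_pos[of 0] L_nonneg' by (simp add: k_def)
  have v0: "0 \<le> v s" for s unfolding v_def using x int_nonneg[of 0 s] by simp
  have Xv: "X s \<le> v s" if "0 \<le> s" for s
    using X_eq[OF that] S_nonneg[of s] D_nonneg[of s] by (simp add: v_def S_def)
  have Gv: "G (X s) \<le> k * (1 + v s)" if "0 \<le> s" for s
  proof -
    have "G (X s) \<le> g 0 + L * max 0 (X s)"
      using lipschitz_onD[OF rate_lip, of "max 0 (X s)" 0] by (simp add: dist_real_def abs_le_iff)
    also have "\<dots> \<le> g 0 + L * v s" using Xv[OF that] v0[of s] L_nonneg' by (intro add_left_mono mult_left_mono) auto
    also have "\<dots> \<le> k * (1 + v s)" using v0[of s] rate_pos[of 0] L_nonneg' by (simp add: k_def algebra_simps)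
    finally show ?thesis .
  qed
  have v_cont: "continuous_on {0..} v"
  proof (unfold continuous_on_eq_continuous_within, intro ballI)
    fix s :: real assume s: "s \<in> {0..}"
    have "continuous_on {0..s+1} v" unfolding v_def
      by (intro continuous_intros indefinite_integral_continuous_1 X_int) (use s in auto)
    then have "continuous (at s within {0..s+1}) v" using s by (auto simp: continuous_on_eq_continuous_within)
    moreover have "at s within {0..s+1} = at s within {0..}"
      by (rule at_within_nhd[of _ "{..<s+1}"]) (use s in auto)
    ultimately show "continuous (at s within {0..}) v" by simp
  qed
  \<comment> \<open>\<open>v\<close> is continuous but perhaps not differentiable, \<open>J\<close>
    is: from J' = k (1 + v) \<le> k (1 + J) it follows that (1 + J) exp(- k t) does not
    increase.\<close>
  define J where "J = (\<lambda>t. x + integral {0..t} (\<lambda>s. k * (1 + v s)))"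
  have vJ: "v s \<le> J s" if "0 \<le> s" for s
  proof -
    have "integral {0..s} (\<lambda>u. G (X u)) \<le> integral {0..s} (\<lambda>s. k * (1 + v s))"
      by (intro integral_le X_int that integrable_continuous_real continuous_intros
        continuous_on_subset[OF v_cont]) (use Gv in auto)
    moreover have "v s = x + integral {0..s} (\<lambda>u. G (X u))" by (simp add: v_def)
    ultimately show ?thesis by (simp add: J_def)
  qed
  have J_deriv: "(J has_real_derivative 0 + k * (1 + v s)) (at s within {0..})" if "0 \<le> s" for s
    unfolding J_def by (intro DERIV_add DERIV_const halfline_antiderivative that continuous_intros v_cont)
  have "- ((1 + J 0) * exp (- k * 0)) \<le> - ((1 + J t) * exp (- k * t))"
  proof (rule nonneg_deriv_halfline_mono[of 0 t _ "\<lambda>s. (J s - v s) * k * exp (- k * s)"])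
    fix s :: real assume s: "0 \<le> s"
    show "((\<lambda>s. - ((1 + J s) * exp (- k * s))) has_real_derivative (J s - v s) * k * exp (- k * s)) (at s within {0..})"
      by (rule derivative_eq_intros J_deriv s refl)+ (simp add: algebra_simps)
    show "0 \<le> (J s - v s) * k * exp (- k * s)" using vJ[OF s] k by simp
  qed (use t in auto)
  then have "(1 + J t) * exp (- k * t) \<le> 1 + x" by (simp add: J_def)
  then have "1 + J t \<le> (1 + x) * exp (k * t)" by (simp add: exp_minus field_simps)
  then show ?thesis using Xv[OF t] vJ[OF t] by (simp add: k_def)
qed

lemma path_bounds:
  obtains B \<Gamma> where "0 \<le> B" "0 \<le> \<Gamma>" "\<And>t. 0 \<le> t \<Longrightarrow> t \<le> T \<Longrightarrow> X t \<le> B" "\<And>t. 0 \<le> t \<Longrightarrow> t \<le> T \<Longrightarrow> G (X t) \<le> \<Gamma>"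
proof -
  define B where "B = (1 + x) * exp ((g 0 + L) * \<bar>T\<bar>)"
  have k: "g 0 + L > 0" using rate_pos[of 0] L_nonneg' by simp
  have B: "X t \<le> B" if "0 \<le> t" "t \<le> T" for t
  proof -
    have "X t \<le> (1 + x) * exp ((g 0 + L) * t)" by (rule X_le_exp) fact
    also have "\<dots> \<le> B" unfolding B_def using x that k by (intro mult_left_mono) (auto intro!: mult_left_mono)
    finally show ?thesis .
  qed
  have B0: "0 \<le> B" using x by (simp add: B_def)
  have "G (X t) \<le> g 0 + L * B" if "0 \<le> t" "t \<le> T" for t
  proof -
    have "G (X t) \<le> g 0 + L * max 0 (X t)"
      using lipschitz_onD[OF rate_lip, of "max 0 (X t)" 0] by (simp add: dist_real_def abs_le_iff)
    also have "\<dots> \<le> g 0 + L * B" using B[OF that] B0 L_nonneg' by (intro add_left_mono mult_left_mono) auto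
    finally show ?thesis .
  qed
  moreover have "0 \<le> g 0 + L * B" using rate_pos[of 0] L_nonneg' B0 by simp
  ultimately show ?thesis using that B B0 by blast
qed

lemma D_right_cont: "continuous (at_right a) D"
  using D_cadlag D_neg by (rule cadlag_right_cont)

lemma alive_measurable: "{t. alive t} \<in> sets borel"
proof -
  have "mono (\<lambda>t. if alive t then 0 else 1::real)" by (auto simp: mono_def dest: alive_down)
  then have "(\<lambda>t. if alive t then 0 else 1::real) \<in> borel_measurable borel" by (rule borel_measurable_mono)
  then have "(\<lambda>t. if alive t then 0 else 1::real) -` {0} \<inter> space borel \<in> sets borel" by (rule measurable_sets) simp
  also have "(\<lambda>t. if alive t then 0 else 1::real) -` {0} \<inter> space borel = {t. alive t}" by (auto split: if_splits)
  finally show ?thesis .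
qed

end

text \<open>From 1 + z \<le> exp z and (1 - z + z^2) (1 + z) = 1 + z^3 \<ge> 1.\<close>

lemma exp_neg_le_quadratic: "0 \<le> (z::real) \<Longrightarrow> exp (- z) \<le> 1 - z + z\<^sup>2"
proof -
  assume z: "0 \<le> z"
  have "1 + z \<le> exp z" by (rule exp_ge_add_one_self)
  have "(1 - z + z\<^sup>2) * (1 + z) = 1 + z ^ 3" by (simp add: power2_eq_square power3_eq_cube algebra_simps)
  then have "1 \<le> (1 - z + z\<^sup>2) * (1 + z)" using z by simp
  also have "\<dots> \<le> (1 - z + z\<^sup>2) * exp z"
  proof (rule mult_left_mono)
    have "1 - z + z\<^sup>2 = (z - 1/2)\<^sup>2 + 3/4" by (simp add: power2_eq_square algebra_simps)
    then show "0 \<le> 1 - z + z\<^sup>2" by simp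
  qed fact
  finally show ?thesis by (simp add: exp_minus field_simps)
qed

section \<open>One step of the grid under an arbitrary control\<close>

locale hjb_path = dividend_hjb g lam \<alpha> \<delta> b L K K1 W W' + surplus_path g L x n y D X
  for g lam \<alpha> \<delta> b L K K1 W W' x n y D X
begin

text \<open>The change of discounted \<open>W\<close> credited to a step: its drift plus the effect
  of its claims, both evaluated at the surplus at the beginning. Only survival up to s,
  \<open>X s\<close> and an increment of \<open>S\<close> occur, so independence will apply.
  \<open>\<Phi>\<close> continues \<open>W\<close> below 0, as \<open>Weps\<close> for upper and as
  \<open>Wdead\<close> for lower estimates.\<close>

definition gain :: "(real \<Rightarrow> real) \<Rightarrow> real \<Rightarrow> real \<Rightarrow> real" where
  "gain \<Phi> s t = (if alive s then (t - s) * q (X s) +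
     (if 0 < S t - S s then \<Phi> (X s - (S t - S s)) - W (X s) else 0) else 0)"

definition U :: "real \<Rightarrow> real" where "U t = (if alive t then W (X t) else 0)"

text \<open>Let I be the premiums, d the payments and h the length of the step. Since
  \<open>W' \<ge> 1\<close>, d + W(X r) \<le> W(X s + I), and the right-hand side is expanded at
  \<open>X s\<close>. The summands of \<open>C\<close> stem in turn from the variation of g along
  the path, the Taylor remainder, the variation of \<open>W\<close> in the discounted term, and the
  quadratic remainder of exp. The errors h (h + d) add up to O(h) on a path, as the payments d add
  up to at most \<open>D T\<close>.\<close>

lemma no_claim_upper:
  assumes st: "0 \<le> s" "s \<le> r" "r \<le> T" "n s = n r" "alive r"
    and \<Gamma>: "0 \<le> \<Gamma>" "\<And>t. 0 \<le> t \<Longrightarrow> t \<le> T \<Longrightarrow> G (X t) \<le> \<Gamma>"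
    and B: "0 \<le> B" "\<And>t. 0 \<le> t \<Longrightarrow> t \<le> T \<Longrightarrow> X t \<le> B"
  defines "C \<equiv> K1 * L * (\<Gamma> + 1) + K * \<Gamma>\<^sup>2 + \<delta> * K1 * (\<Gamma> + 1) + \<delta>\<^sup>2 * W B"
  shows "D r - D s + exp (- \<delta> * (r - s)) * W (X r) \<le> W (X s) + (r - s) * q (X s) + C * (r - s) * ((r - s) + (D r - D s))"
proof -
  define h where "h = r - s"
  define d where "d = D r - D s"
  define I where "I = integral {s..r} (\<lambda>u. G (X u))"
  define H where "H = \<Gamma> * h + d"
  have h: "0 \<le> h" using st by (simp add: h_def)
  have d: "0 \<le> d" using D_le st by (simp add: d_def)
  have H0: "0 \<le> H" using h d \<Gamma> by (simp add: H_def)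
  have Xs: "0 \<le> X s" and Xr: "0 \<le> X r" using st alive_down aliveD by auto
  have Seq: "S u = S s" if "s \<le> u" "u \<le> r" for u
    using n_le[of s u] n_le[of u r] st that by (simp add: S_def)
  have eq: "X r = X s + I - d" using X_diff[of s r] Seq[of r] st by (simp add: I_def d_def)
  have I0: "0 \<le> I" unfolding I_def using st by (intro int_nonneg) auto
  have I1: "I \<le> \<Gamma> * h" unfolding I_def h_def by (rule int_le) (use st \<Gamma> in auto)
  have inc: "\<bar>X u - X s\<bar> \<le> H" if "s \<le> u" "u \<le> r" for u
  proof -
    have e: "X u = X s + integral {s..u} (\<lambda>u. G (X u)) - (D u - D s)" using X_diff[of s u] Seq[of u] st that by simp
    have "integral {s..u} (\<lambda>u. G (X u)) \<le> \<Gamma> * (u - s)" by (rule int_le) (use st \<Gamma> that in auto)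
    also have "\<dots> \<le> \<Gamma> * h" using \<Gamma> that by (intro mult_left_mono) (auto simp: h_def)
    finally have 1: "integral {s..u} (\<lambda>u. G (X u)) \<le> \<Gamma> * h" .
    have 2: "0 \<le> integral {s..u} (\<lambda>u. G (X u))" using st by (intro int_nonneg)
    have "D s \<le> D u" "D u \<le> D r" using that D_le by auto
    then show ?thesis using 1 2 e \<Gamma>(1) h d by (simp add: H_def d_def abs_le_iff)
  qed
  have I2: "I \<le> (g (X s) + L * H) * h" unfolding I_def h_def
  proof (rule int_le)
    fix u assume u: "s \<le> u" "u \<le> r"
    have "\<bar>G (X u) - G (X s)\<bar> \<le> L * \<bar>X u - X s\<bar>" by (rule G_lip)
    also have "\<dots> \<le> L * H" using inc[OF u] L_nonneg by (intro mult_left_mono)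
    finally show "G (X u) \<le> g (X s) + L * H" using Xs by (simp add: max_def)
  qed (use st in auto)
  have a1: "W (X r) + d \<le> W (X s + I)" using W_diff_ge[of "X r" "X r + d"] Xr d eq by simp
  have a2: "W (X s + I) \<le> W (X s) + W' (X s) * I + K * I\<^sup>2" using W_taylor[OF Xs I0] by simp
  have a3: "W' (X s) * I \<le> W' (X s) * (g (X s) * h) + K1 * (L * H * h)"
  proof -
    have "W' (X s) * I \<le> W' (X s) * (g (X s) * h + L * H * h)"
      using I2 W'_ge1[OF Xs] by (intro mult_left_mono) (auto simp: algebra_simps)
    also have "\<dots> = W' (X s) * (g (X s) * h) + W' (X s) * (L * H * h)" by (simp add: algebra_simps)
    also have "\<dots> \<le> W' (X s) * (g (X s) * h) + K1 * (L * H * h)"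
      using W'_le[OF Xs] L_nonneg H0 h by (intro add_left_mono mult_right_mono) auto
    finally show ?thesis .
  qed
  have a4: "K * I\<^sup>2 \<le> K * (\<Gamma> * h)\<^sup>2" using K_nonneg I0 I1 by (intro mult_left_mono power_mono)
  have WsH: "W (X s) - K1 * H \<le> W (X r)"
  proof (cases "X s \<le> X r")
    case True then show ?thesis using W_mono[OF Xs True] K1_ge1 H0 by (smt (verit) mult_nonneg_nonneg)
  next
    case False
    then have "W (X s) - W (X r) \<le> K1 * (X s - X r)" using Xr by (intro W_diff_le) auto
    also have "\<dots> \<le> K1 * H" using inc[of r] st K1_ge1 by (intro mult_left_mono) auto
    finally show ?thesis by simp
  qed
  have a5: "exp (- \<delta> * h) * W (X r) \<le> W (X r) - \<delta> * h * W (X s) + \<delta> * h * (K1 * H) + (\<delta> * h)\<^sup>2 * W B"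
  proof -
    have "exp (- (\<delta> * h)) * W (X r) \<le> (1 - \<delta> * h + (\<delta> * h)\<^sup>2) * W (X r)"
      using \<delta> h W_pos[OF Xr] by (intro mult_right_mono exp_neg_le_quadratic) auto
    also have "\<dots> = W (X r) - \<delta> * h * W (X r) + (\<delta> * h)\<^sup>2 * W (X r)" by (simp add: algebra_simps)
    also have "\<dots> \<le> W (X r) - \<delta> * h * (W (X s) - K1 * H) + (\<delta> * h)\<^sup>2 * W B"
      using WsH \<delta> h W_mono[OF Xr B(2)[of r]] st by (intro add_mono diff_mono mult_left_mono) auto
    finally show ?thesis by (simp add: algebra_simps)
  qed
  have HH: "H \<le> (\<Gamma> + 1) * (h + d)" unfolding H_def using h d \<Gamma> by (simp add: algebra_simps)
  have hh: "h * h \<le> h * (h + d)" using h d by (intro mult_left_mono) auto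
  have b1: "K1 * (L * H * h) \<le> K1 * L * (\<Gamma> + 1) * (h * (h + d))"
  proof -
    have "K1 * (L * H * h) = (K1 * L * h) * H" by simp
    also have "\<dots> \<le> (K1 * L * h) * ((\<Gamma> + 1) * (h + d))" using HH K1_ge1 L_nonneg h by (intro mult_left_mono) auto
    finally show ?thesis by (simp add: algebra_simps)
  qed
  have b2: "\<delta> * h * (K1 * H) \<le> \<delta> * K1 * (\<Gamma> + 1) * (h * (h + d))"
  proof -
    have "\<delta> * h * (K1 * H) = (\<delta> * K1 * h) * H" by simp
    also have "\<dots> \<le> (\<delta> * K1 * h) * ((\<Gamma> + 1) * (h + d))" using HH K1_ge1 \<delta> h by (intro mult_left_mono) auto
    finally show ?thesis by (simp add: algebra_simps)
  qed
  have b3: "K * (\<Gamma> * h)\<^sup>2 \<le> K * \<Gamma>\<^sup>2 * (h * (h + d))"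
  proof -
    have "K * (\<Gamma> * h)\<^sup>2 = K * \<Gamma>\<^sup>2 * (h * h)" by (simp add: power2_eq_square)
    also have "\<dots> \<le> K * \<Gamma>\<^sup>2 * (h * (h + d))" by (rule mult_left_mono[OF hh]) (use K_nonneg in auto)
    finally show ?thesis .
  qed
  have b4: "(\<delta> * h)\<^sup>2 * W B \<le> \<delta>\<^sup>2 * W B * (h * (h + d))"
  proof -
    have "(\<delta> * h)\<^sup>2 * W B = \<delta>\<^sup>2 * W B * (h * h)" by (simp add: power2_eq_square)
    also have "\<dots> \<le> \<delta>\<^sup>2 * W B * (h * (h + d))" by (rule mult_left_mono[OF hh]) (use W_pos[OF B(1)] in auto)
    finally show ?thesis .
  qed
  have "d + exp (- \<delta> * h) * W (X r) \<le> W (X s) + h * (g (X s) * W' (X s) - \<delta> * W (X s)) + C * (h * (h + d))"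
    using a1 a2 a3 a4 a5 b1 b2 b3 b4 unfolding C_def by (simp add: algebra_simps)
  then show ?thesis by (simp add: d_def h_def q_def mult.assoc)
qed


text \<open>No claim comes after r, so X r plus the payments equals X s - (S t - S s) plus the
  premiums, in whatever order payments and claims occurred. The left-hand side is nonnegative, while
  X s - (S t - S s) may be slightly negative if premiums save the path; the Lipschitz property of
  \<open>Weps\<close> bridges this.\<close>

lemma claim_upper:
  assumes st: "0 \<le> s" "s \<le> r" "r \<le> t" "t \<le> T" "n r = n t" "alive r"
    and \<Gamma>: "0 \<le> \<Gamma>" "\<And>t. 0 \<le> t \<Longrightarrow> t \<le> T \<Longrightarrow> G (X t) \<le> \<Gamma>" and \<epsilon>: "0 < \<epsilon>"
  shows "D r - D s + W (X r) \<le> Weps \<epsilon> (X s - (S t - S s)) + (K1 + W 0 / \<epsilon>) * \<Gamma> * (t - s)"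
proof -
  define d where "d = D r - D s"
  define I where "I = integral {s..r} (\<lambda>u. G (X u))"
  have d: "0 \<le> d" using D_le st by (simp add: d_def)
  have Xr: "0 \<le> X r" using st aliveD by auto
  have I0: "0 \<le> I" unfolding I_def using st by (intro int_nonneg) auto
  have "I \<le> \<Gamma> * (r - s)" unfolding I_def by (rule int_le) (use st \<Gamma> in auto)
  also have "\<dots> \<le> \<Gamma> * (t - s)" using st \<Gamma> by (intro mult_left_mono) auto
  finally have I1: "I \<le> \<Gamma> * (t - s)" .
  have eq: "X r + d = X s - (S t - S s) + I" using X_diff[of s r] st by (simp add: I_def d_def S_def)
  have "d + W (X r) \<le> W (X r + d)" using W_diff_ge[of "X r" "X r + d"] Xr d by simp
  also have "\<dots> = Weps \<epsilon> (X s - (S t - S s) + I)" using Xr d eq \<epsilon> by (simp add: Weps_nonneg_arg flip: eq)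
  also have "\<dots> \<le> Weps \<epsilon> (X s - (S t - S s)) + (K1 + W 0 / \<epsilon>) * I"
    using Weps_mono_lip[OF \<epsilon>, of "X s - (S t - S s)" "X s - (S t - S s) + I"] I0 by simp
  also have "(K1 + W 0 / \<epsilon>) * I \<le> (K1 + W 0 / \<epsilon>) * (\<Gamma> * (t - s))"
    using I1 K1_ge1 W0 \<epsilon> by (intro mult_left_mono) auto
  finally show ?thesis by (simp add: d_def mult.assoc)
qed

lemma q_bound:
  assumes "0 \<le> X v" "X v \<le> B" "G (X v) \<le> \<Gamma>"
  shows "\<bar>q (X v)\<bar> \<le> \<Gamma> * K1 + \<delta> * W B"
proof -
  have g: "0 < g (X v)" "g (X v) \<le> \<Gamma>" using assms g_pos[of "X v"] by (auto simp: max_def)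
  have "0 \<le> g (X v) * W' (X v)" using g W'_ge1[of "X v"] assms by simp
  moreover have "g (X v) * W' (X v) \<le> \<Gamma> * K1"
    using g W'_le[of "X v"] W'_ge1[of "X v"] assms by (intro mult_mono) auto
  moreover have "0 \<le> \<delta> * W (X v)" using \<delta> W_pos[of "X v"] assms by simp
  moreover have "\<delta> * W (X v) \<le> \<delta> * W B" using \<delta> assms W_mono[of "X v" B] by simp
  ultimately show ?thesis unfolding q_def by linarith
qed

text \<open>r is an arbitrary surviving time of the step, because payments count only up to ruin.
  The differences in the error terms telescope and charge the exceptional steps: the step in which
  survival ends costs O(h), a step with claims O(h) plus \<eta>, where \<eta> bounds the payments
  before u.\<close>

lemma step_upper:
  assumes st: "0 \<le> s" "s \<le> t" "t \<le> T" and r: "s \<le> r" "r \<le> t" "alive r"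
    and \<Gamma>: "0 \<le> \<Gamma>" "\<And>t. 0 \<le> t \<Longrightarrow> t \<le> T \<Longrightarrow> G (X t) \<le> \<Gamma>"
    and B: "0 \<le> B" "\<And>t. 0 \<le> t \<Longrightarrow> t \<le> T \<Longrightarrow> X t \<le> B"
    and \<epsilon>: "0 < \<epsilon>" and \<eta>: "0 \<le> \<eta>"
    and u: "u \<in> {s..t}" "\<And>v. s \<le> v \<Longrightarrow> v < u \<Longrightarrow> D v - D s \<le> \<eta>" "\<And>v. u \<le> v \<Longrightarrow> v \<le> t \<Longrightarrow> n v = n t"
    and C: "K1 * L * (\<Gamma> + 1) + K * \<Gamma>\<^sup>2 + \<delta> * K1 * (\<Gamma> + 1) + \<delta>\<^sup>2 * W B \<le> C"
      "(\<Gamma> * K1 + \<delta> * W B) + (K1 + W 0 / \<epsilon>) * \<Gamma> \<le> C"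
  shows "D r - D s + exp (- \<delta> * (t - s)) * U t \<le> U s + gain (Weps \<epsilon>) s t
    + C * (t - s) * ((t - s) + (D t - D s) + of_bool (alive s) - of_bool (alive t) + (real (n t) - real (n s)))
    + \<eta> * (real (n t) - real (n s))"
proof -
  define C0 where "C0 = K1 * L * (\<Gamma> + 1) + K * \<Gamma>\<^sup>2 + \<delta> * K1 * (\<Gamma> + 1) + \<delta>\<^sup>2 * W B"
  define QB where "QB = \<Gamma> * K1 + \<delta> * W B"
  define h where "h = t - s"
  define d where "d = D t - D s"
  define R where "R = (K1 + W 0 / \<epsilon>) * \<Gamma>"
  have WB: "0 < W B" using W_pos B by auto
  have C0: "0 \<le> C0" "C0 \<le> C" unfolding C0_def using K1_ge1 L_nonneg \<Gamma>(1) K_nonneg \<delta> WB C by (auto intro!: add_nonneg_nonneg mult_nonneg_nonneg)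
  have QB0: "0 \<le> QB" unfolding QB_def using K1_ge1 \<Gamma>(1) \<delta> WB by auto
  have R0: "0 \<le> R" unfolding R_def using K1_ge1 \<Gamma>(1) W0 \<epsilon> by auto
  have QR: "QB + R \<le> C" using C by (simp add: QB_def R_def)
  have h: "0 \<le> h" and d: "0 \<le> d" using st D_le[OF st(2)] by (auto simp: h_def d_def)
  have as: "alive s" using alive_down r by blast
  have Xs: "0 \<le> X s" using aliveD as st by auto
  have Us: "U s = W (X s)" using as by (simp add: U_def)
  have qb: "\<bar>q (X s)\<bar> \<le> QB" unfolding QB_def by (rule q_bound) (use Xs B(2) \<Gamma>(2)[of s] st in auto)
  have hq: "- (h * q (X s)) \<le> h * QB" "h * q (X s) \<le> h * QB"
    using mult_left_mono[of "- q (X s)" QB h] mult_left_mono[of "q (X s)" QB h] qb h by auto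
  have Dr: "D r - D s \<le> d" using r D_le by (simp add: d_def)
  have Dr0: "0 \<le> D r - D s" using r D_le by simp
  have exp1: "exp (- \<delta> * h) \<le> 1" using \<delta> h by simp
  have main: "D r - D s + exp (- \<delta> * h) * U t \<le> U s + gain (Weps \<epsilon>) s t
    + C * h * (h + d + of_bool (alive s) - of_bool (alive t) + (real (n t) - real (n s)))
    + \<eta> * (real (n t) - real (n s))"
  proof (cases "n s = n t")
    case True
    have nr: "n s = n r" using True n_le[of s r] n_le[of r t] st r by simp
    have gain: "gain (Weps \<epsilon>) s t = h * q (X s)" using as True by (simp add: gain_def S_def h_def)
    show ?thesis
    proof (cases "alive t")
      case at: True
      have "d + exp (- \<delta> * h) * W (X t) \<le> W (X s) + h * q (X s) + C0 * h * (h + d)"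
        using no_claim_upper[OF st(1,2,3) True at \<Gamma> B] by (simp add: h_def d_def C0_def)
      also have "C0 * h * (h + d) \<le> C * h * (h + d)" using C0 h d by (intro mult_right_mono) auto
      finally show ?thesis using Dr at as True gain Us by (simp add: U_def)
    next
      \<comment> \<open>Ruin without a claim is caused by payments. The estimate is applied up to r;
        the drift missing on [r, t] is at most h times the bound on \<open>q\<close> and is charged
        to the loss of survival.\<close>
      case at: False
      have rT: "r \<le> T" using r st by simp
      have "D r - D s + exp (- \<delta> * (r - s)) * W (X r) \<le> W (X s) + (r - s) * q (X s) + C0 * (r - s) * ((r - s) + (D r - D s))"
        using no_claim_upper[OF st(1) r(1) rT nr r(3) \<Gamma> B] by (simp add: C0_def)
      moreover have "0 \<le> exp (- \<delta> * (r - s)) * W (X r)" using W_pos[of "X r"] aliveD[OF r(3)] r st by simp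
      moreover have "(r - s) * q (X s) \<le> h * q (X s) + h * QB"
      proof -
        have "(r - s) * q (X s) - h * q (X s) = (t - r) * (- q (X s))" by (simp add: h_def algebra_simps)
        also have "\<dots> \<le> (t - r) * QB" using qb r by (intro mult_left_mono) auto
        also have "\<dots> \<le> h * QB" using r QB0 by (intro mult_right_mono) (auto simp: h_def)
        finally show ?thesis by simp
      qed
      moreover have "C0 * (r - s) * ((r - s) + (D r - D s)) \<le> C * h * (h + d)"
        using C0 h d r Dr Dr0 by (intro mult_mono add_mono) (auto simp: h_def)
      moreover have "h * QB \<le> C * h" using QR R0 h mult_left_mono[of QB C h] by (simp add: mult.commute)
      ultimately have "D r - D s \<le> W (X s) + h * q (X s) + (C * h + C * h * (h + d))" by linarith
      then show ?thesis using at as True gain Us by (simp add: U_def algebra_simps)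
    qed
  next
    case False
    then have nlt: "n s < n t" using n_le[of s t] st by simp
    then have S: "S s < S t" using S_less[of s t] st by simp
    have gain: "gain (Weps \<epsilon>) s t = h * q (X s) + (Weps \<epsilon> (X s - (S t - S s)) - W (X s))"
      using as S by (simp add: gain_def h_def)
    define Z where "Z = Weps \<epsilon> (X s - (S t - S s)) + R * h + \<eta>"
    have Wp: "0 \<le> Weps \<epsilon> (X s - (S t - S s))" using \<epsilon> by (rule Weps_nonneg)
    have late: "D v - D s + W (X v) \<le> Z" if "u \<le> v" "v \<le> t" "alive v" for v
    proof -
      have sv: "s \<le> v" using that u(1) by simp
      show ?thesis
        using claim_upper[OF st(1) sv that(2) st(3) u(3)[OF that(1,2)] that(3) \<Gamma> \<epsilon>] \<eta>
        unfolding Z_def R_def h_def by linarith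
    qed
    have "D r - D s + exp (- \<delta> * h) * U t \<le> Z"
    proof (cases "alive t")
      case True
      have "0 \<le> W (X t)" using W_pos[of "X t"] aliveD[OF True] st by simp
      then have "exp (- \<delta> * h) * W (X t) \<le> W (X t)" using exp1 by (simp add: mult_left_le_one_le)
      then show ?thesis using late[of t] u True Dr by (simp add: U_def d_def)
    next
      case at: False
      show ?thesis
      \<comment> \<open>If the path does not survive the step, payments made before u need not be
        covered by the value after the claim; only their smallness \<eta> controls them.\<close>
      proof (cases "r < u")
        case True
        then have "D r - D s \<le> \<eta>" using u(2)[of r] r by simp
        then show ?thesis using at Wp mult_nonneg_nonneg[OF R0 h] by (simp add: U_def Z_def)
      next
        case False
        then have "D r - D s + W (X r) \<le> Z" using late r by simp
        moreover have "0 \<le> W (X r)" using W_pos[of "X r"] aliveD[OF r(3)] r st by simp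
        ultimately show ?thesis using at by (simp add: U_def)
      qed
    qed
    moreover have "Z \<le> U s + gain (Weps \<epsilon>) s t + C * h * 1 + \<eta> * 1"
    proof -
      have "h * QB + R * h \<le> C * h" using mult_right_mono[OF QR h] by (simp add: algebra_simps)
      then show ?thesis unfolding gain Us Z_def using hq by simp
    qed
    moreover have "C * h * 1 \<le> C * h * (h + d + of_bool (alive s) - of_bool (alive t) + (real (n t) - real (n s)))"
      using C0 h d as nlt by (intro mult_left_mono) auto
    moreover have "\<eta> * 1 \<le> \<eta> * (real (n t) - real (n s))" using nlt \<eta> by (intro mult_left_mono) auto
    ultimately show ?thesis by linarith
  qed
  then show ?thesis by (simp add: h_def d_def)
qed

end

section \<open>Summing the steps: upper bound on a path\<close>

context hjb_path
begin

lemma U_nonneg: "0 \<le> t \<Longrightarrow> 0 \<le> U t"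
  unfolding U_def using W_pos[of "X t"] aliveD[of t] by auto

text \<open>The atom at 0 is measured through (-1, 0], at whose left end \<open>D\<close> is
  0.\<close>

lemma dividend_mass_0:
  "(\<integral>\<^sup>+t. ennreal (exp (- \<delta> * t)) * indicator {t. 0 \<le> t \<and> t \<le> 0 \<and> alive t} t \<partial>interval_measure D)
     \<le> ennreal (if alive 0 then D 0 else 0)"
proof (cases "alive 0")
  case True
  have "(\<integral>\<^sup>+t. ennreal (exp (- \<delta> * t)) * indicator {t. 0 \<le> t \<and> t \<le> 0 \<and> alive t} t \<partial>interval_measure D)
      \<le> (\<integral>\<^sup>+t. indicator {-1<..0} t \<partial>interval_measure D)"
    by (rule nn_integral_mono) (auto split: split_indicator)
  also have "\<dots> = emeasure (interval_measure D) {-1<..0}" by simp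
  also have "\<dots> = D 0 - D (-1)"
    using D_right_cont by (intro emeasure_interval_measure_Ioc) (auto intro: D_le)
  finally show ?thesis using True D_neg[of "-1"] by simp
next
  case False
  have "(\<integral>\<^sup>+t. ennreal (exp (- \<delta> * t)) * indicator {t. 0 \<le> t \<and> t \<le> 0 \<and> alive t} t \<partial>interval_measure D)
      = (\<integral>\<^sup>+t. 0 \<partial>interval_measure D)"
    by (rule nn_integral_cong) (use False in \<open>auto split: split_indicator\<close>)
  then show ?thesis by simp
qed

text \<open>For an upper bound the payments of a step are discounted as if made at its
  beginning.\<close>

lemma dividend_mass_step:
  assumes "0 \<le> s" "s \<le> t" "0 \<le> c" "\<And>r. s \<le> r \<Longrightarrow> r \<le> t \<Longrightarrow> alive r \<Longrightarrow> D r - D s \<le> c"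
  shows "(\<integral>\<^sup>+u. ennreal (exp (- \<delta> * u)) * indicator {u. 0 \<le> u \<and> u \<le> t \<and> alive u} u \<partial>interval_measure D)
     \<le> (\<integral>\<^sup>+u. ennreal (exp (- \<delta> * u)) * indicator {u. 0 \<le> u \<and> u \<le> s \<and> alive u} u \<partial>interval_measure D)
       + ennreal (exp (- \<delta> * s) * c)"
proof -
  have am: "{u. alive u} \<in> sets (interval_measure D)" using alive_measurable by simp
  have eq: "{u. 0 \<le> u \<and> u \<le> v \<and> alive u} = {0..v} \<inter> {u. alive u}" for v by auto
  have mass: "emeasure (interval_measure D) ({s<..t} \<inter> {u. alive u}) \<le> ennreal c"
  proof (cases "alive s")
    case True
    show ?thesis
      by (rule interval_measure_alive_le[OF D_mono D_right_cont])
        (use assms True in \<open>auto dest: alive_down\<close>)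
  next
    case False
    then have "{s<..t} \<inter> {u. alive u} = {}" using alive_down by fastforce
    then show ?thesis by simp
  qed
  have "(\<integral>\<^sup>+u. ennreal (exp (- \<delta> * u)) * indicator {u. 0 \<le> u \<and> u \<le> t \<and> alive u} u \<partial>interval_measure D)
     \<le> (\<integral>\<^sup>+u. (ennreal (exp (- \<delta> * u)) * indicator {u. 0 \<le> u \<and> u \<le> s \<and> alive u} u
       + ennreal (exp (- \<delta> * s)) * indicator ({s<..t} \<inter> {u. alive u}) u) \<partial>interval_measure D)"
  proof (rule nn_integral_mono)
    fix u
    have "s \<le> u \<Longrightarrow> exp (- \<delta> * u) \<le> exp (- \<delta> * s)" using \<delta> by simp
    then show "ennreal (exp (- \<delta> * u)) * indicator {u. 0 \<le> u \<and> u \<le> t \<and> alive u} u \<le>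
      ennreal (exp (- \<delta> * u)) * indicator {u. 0 \<le> u \<and> u \<le> s \<and> alive u} u
       + ennreal (exp (- \<delta> * s)) * indicator ({s<..t} \<inter> {u. alive u}) u"
      by (auto split: split_indicator intro: ennreal_leI)
  qed
  also have "\<dots> = (\<integral>\<^sup>+u. ennreal (exp (- \<delta> * u)) * indicator {u. 0 \<le> u \<and> u \<le> s \<and> alive u} u \<partial>interval_measure D)
      + (\<integral>\<^sup>+u. ennreal (exp (- \<delta> * s)) * indicator ({s<..t} \<inter> {u. alive u}) u \<partial>interval_measure D)"
    unfolding eq using alive_measurable by (intro nn_integral_add) simp_all
  also have "(\<integral>\<^sup>+u. ennreal (exp (- \<delta> * s)) * indicator ({s<..t} \<inter> {u. alive u}) u \<partial>interval_measure D)
      = ennreal (exp (- \<delta> * s)) * emeasure (interval_measure D) ({s<..t} \<inter> {u. alive u})"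
    using am by (intro nn_integral_cmult_indicator) simp
  also have "\<dots> \<le> ennreal (exp (- \<delta> * s)) * ennreal c" using mass by (intro mult_left_mono) auto
  also have "\<dots> = ennreal (exp (- \<delta> * s) * c)" by (simp add: ennreal_mult' assms)
  finally show ?thesis by (simp add: add_left_mono)
qed

text \<open>The discounted step bounds telescope in \<open>U\<close> up to gains and errors, and the
  errors sum to at most C h (T + D T + 1 + n T) + \<eta> n T. The path determines \<eta>, then the
  mesh. Nonnegativity belongs to the claim because \<open>ennreal\<close> sends negative numbers to
  0.\<close>

lemma discounted_dividends_le:
  fixes T \<epsilon> e :: real
  assumes T: "0 < T" and \<epsilon>: "0 < \<epsilon>" and e: "0 < e"
  shows "\<forall>\<^sub>F m in sequentially.
    0 \<le> W x + (\<Sum>k<m. exp (- \<delta> * (T * k / m)) * gain (Weps \<epsilon>) (T * k / m) (T * Suc k / m)) + e \<and>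
    (\<integral>\<^sup>+u. ennreal (exp (- \<delta> * u)) * indicator {u. 0 \<le> u \<and> u \<le> T \<and> alive u} u \<partial>interval_measure D)
      \<le> ennreal (W x + (\<Sum>k<m. exp (- \<delta> * (T * k / m)) * gain (Weps \<epsilon>) (T * k / m) (T * Suc k / m)) + e)"
proof -
  obtain B \<Gamma> where bd: "0 \<le> B" "0 \<le> \<Gamma>" "\<And>t. 0 \<le> t \<Longrightarrow> t \<le> T \<Longrightarrow> X t \<le> B"
    "\<And>t. 0 \<le> t \<Longrightarrow> t \<le> T \<Longrightarrow> G (X t) \<le> \<Gamma>"
    by (rule path_bounds[of T]) (rule that)
  note B = bd(1,3) and \<Gamma> = bd(2,4)
  define C where "C = max (K1 * L * (\<Gamma> + 1) + K * \<Gamma>\<^sup>2 + \<delta> * K1 * (\<Gamma> + 1) + \<delta>\<^sup>2 * W B)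
      ((\<Gamma> * K1 + \<delta> * W B) + (K1 + W 0 / \<epsilon>) * \<Gamma>)"
  have C: "K1 * L * (\<Gamma> + 1) + K * \<Gamma>\<^sup>2 + \<delta> * K1 * (\<Gamma> + 1) + \<delta>\<^sup>2 * W B \<le> C"
      "(\<Gamma> * K1 + \<delta> * W B) + (K1 + W 0 / \<epsilon>) * \<Gamma> \<le> C" by (simp_all add: C_def)
  have C0: "0 \<le> C"
    by (rule order_trans[OF _ C(2)]) (use \<Gamma>(1) K1_ge1 \<delta> W_pos[OF B(1)] W0 \<epsilon> in auto)
  \<comment> \<open>The first bound limits the payments before claims to e / 2 in total; \<eta> < 1
    forces claim numbers at distance less than \<eta> to coincide.\<close>
  define \<eta> where "\<eta> = min (e / (2 * (real (n T) + 1))) (1/2)"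
  have \<eta>: "0 < \<eta>" "\<eta> < 1" "\<eta> * real (n T) \<le> e / 2"
  proof -
    show "0 < \<eta>" "\<eta> < 1" using e by (auto simp: \<eta>_def)
    have "\<eta> * real (n T) \<le> (e / (2 * (real (n T) + 1))) * (real (n T) + 1)"
      using e by (intro mult_mono) (auto simp: \<eta>_def)
    also have "\<dots> = e / 2" by (simp add: field_simps)
    finally show "\<eta> * real (n T) \<le> e / 2" .
  qed
  obtain \<rho> where \<rho>: "0 < \<rho>" "\<And>s t. 0 \<le> s \<Longrightarrow> s \<le> t \<Longrightarrow> t \<le> T \<Longrightarrow> t - s < \<rho> \<Longrightarrow>
     \<exists>u\<in>{s..t}. (\<forall>r\<in>{s..<u}. \<bar>real (n r) - real (n s)\<bar> < \<eta> \<and> \<bar>D r - D s\<bar> < \<eta>) \<and>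
        (\<forall>r\<in>{u..t}. \<bar>real (n r) - real (n t)\<bar> < \<eta> \<and> \<bar>D r - D t\<bar> < \<eta>)"
    using cadlag_modulus2[OF n_cadlag D_cadlag \<eta>(1), of T] by blast
  have lim0: "(\<lambda>m. c * inverse (real m)) \<longlonglongrightarrow> 0" for c
    using tendsto_mult[OF tendsto_const[of c] lim_inverse_n] by simp
  have "\<forall>\<^sub>F m in sequentially. T * inverse (real m) < \<rho>"
    by (rule order_tendstoD(2)[OF lim0 \<rho>(1)])
  moreover have "\<forall>\<^sub>F m in sequentially. (C * T * (T + D T + 1 + real (n T))) * inverse (real m) < e / 2"
    by (rule order_tendstoD(2)[OF lim0]) (use e in simp)
  ultimately have "\<forall>\<^sub>F m in sequentially. 0 < m \<and> T * inverse (real m) < \<rho> \<and> (C * T * (T + D T + 1 + real (n T))) * inverse (real m) < e / 2"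
    using eventually_gt_at_top[of 0] by eventually_elim auto
  then show ?thesis
  proof (rule eventually_mono, elim conjE)
    fix m :: nat assume m: "0 < m" and m1: "T * inverse (real m) < \<rho>"
      and m2: "(C * T * (T + D T + 1 + real (n T))) * inverse (real m) < e / 2"
    define t where "t k = T * real k / real m" for k :: nat
    define h where "h = T / real m"
    have h: "0 < h" "h < \<rho>" using T m m1 by (auto simp: h_def divide_inverse)
    have tS: "t (Suc k) = t k + h" for k using m by (simp add: t_def h_def field_simps)
    have t0: "t 0 = 0" "t m = T" using m by (auto simp: t_def)
    have tk0: "0 \<le> t k" for k using T by (simp add: t_def)
    have tkT: "t k \<le> T" if "k \<le> m" for k
      using that T m by (simp add: t_def divide_le_eq mult_left_mono)
    define err where "err k = C * h * (h + (D (t (Suc k)) - D (t k)) + of_bool (alive (t k)) - of_bool (alive (t (Suc k))) + (real (n (t (Suc k))) - real (n (t k))))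
      + \<eta> * (real (n (t (Suc k))) - real (n (t k)))" for k
    \<comment> \<open>The allowance for the payments of step k. It is nonnegative also after ruin,
      where only the error remains.\<close>
    define c where "c k = U (t k) + gain (Weps \<epsilon>) (t k) (t (Suc k)) + err k - exp (- \<delta> * h) * U (t (Suc k))" for k
    have err0: "0 \<le> err k" for k
    proof -
      have "real (n (t k)) \<le> real (n (t (Suc k)))" using n_le[of "t k" "t (Suc k)"] tS[of k] h tk0 by simp
      moreover have "D (t k) \<le> D (t (Suc k))" using tS[of k] h by (intro D_le) auto
      moreover have "alive (t (Suc k)) \<Longrightarrow> alive (t k)" using tS[of k] h by (auto elim: alive_down)
      then have "0 \<le> of_bool (alive (t k)) - (of_bool (alive (t (Suc k))) :: real)" by auto
      ultimately show ?thesis unfolding err_def using C0 h \<eta>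
        by (intro add_nonneg_nonneg mult_nonneg_nonneg) auto
    qed
    have bound: "D r - D (t k) \<le> c k" if k: "k < m" and r: "t k \<le> r" "r \<le> t (Suc k)" "alive r" for k r
    proof -
      have s: "0 \<le> t k" "t k \<le> t (Suc k)" "t (Suc k) \<le> T" using tk0 tS[of k] h tkT[of "Suc k"] k by auto
      obtain u where u: "u \<in> {t k..t (Suc k)}" "\<forall>r\<in>{t k..<u}. \<bar>real (n r) - real (n (t k))\<bar> < \<eta> \<and> \<bar>D r - D (t k)\<bar> < \<eta>"
        "\<forall>r\<in>{u..t (Suc k)}. \<bar>real (n r) - real (n (t (Suc k)))\<bar> < \<eta> \<and> \<bar>D r - D (t (Suc k))\<bar> < \<eta>"
        using \<rho>(2)[OF s] tS[of k] h by auto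
      have u2: "D v - D (t k) \<le> \<eta>" if "t k \<le> v" "v < u" for v using u(2) that by (auto simp: abs_less_iff intro: less_imp_le)
      have u3: "n v = n (t (Suc k))" if "u \<le> v" "v \<le> t (Suc k)" for v
      proof -
        have "\<bar>real (n v) - real (n (t (Suc k)))\<bar> < \<eta>" using u(3) that by simp
        then have "\<bar>real (n v) - real (n (t (Suc k)))\<bar> < 1" using \<eta>(2) by linarith
        then show ?thesis by linarith
      qed
      show ?thesis
        using step_upper[OF s r \<Gamma> B \<epsilon> less_imp_le[OF \<eta>(1)] u(1) u2 u3 C] tS[of k]
        by (simp add: c_def err_def)
    qed
    have c0: "0 \<le> c k" if k: "k < m" for k
    proof (cases "alive (t k)")
      case True
      then show ?thesis using bound[OF k, of "t k"] tS[of k] h by simp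
    next
      case False
      then have "\<not> alive (t (Suc k))" using tS[of k] h alive_down by force
      then show ?thesis using False err0[of k] by (simp add: c_def gain_def U_def)
    qed
    let ?F = "\<lambda>v. \<integral>\<^sup>+u. ennreal (exp (- \<delta> * u)) * indicator {u. 0 \<le> u \<and> u \<le> v \<and> alive u} u \<partial>interval_measure D"
    let ?c0 = "if alive 0 then D 0 else 0"
    have ind: "?F (t k) \<le> ennreal (?c0 + (\<Sum>j<k. exp (- \<delta> * t j) * c j))" if "k \<le> m" for k
      using that
    proof (induction k)
      case 0
      then show ?case using dividend_mass_0 by (simp add: t0)
    next
      case (Suc k)
      have k: "k < m" using Suc by simp
      have "?F (t (Suc k)) \<le> ?F (t k) + ennreal (exp (- \<delta> * t k) * c k)"
        by (rule dividend_mass_step) (use tk0 tS[of k] h c0[OF k] bound[OF k] in auto)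
      also have "\<dots> \<le> ennreal (?c0 + (\<Sum>j<k. exp (- \<delta> * t j) * c j)) + ennreal (exp (- \<delta> * t k) * c k)"
        using Suc by (intro add_right_mono) auto
      also have "\<dots> = ennreal (?c0 + (\<Sum>j<Suc k. exp (- \<delta> * t j) * c j))"
      proof -
        have "0 \<le> (\<Sum>j<k. exp (- \<delta> * t j) * c j)" using k c0 by (intro sum_nonneg mult_nonneg_nonneg) auto
        then show ?thesis using c0[OF k] D_nonneg[of 0] by (subst ennreal_plus[symmetric]) (auto simp: add.assoc)
      qed
      finally show ?case .
    qed
    define a where "a k = exp (- \<delta> * t k) * U (t k)" for k
    have "(\<Sum>j<m. exp (- \<delta> * t j) * c j) =
       (\<Sum>j<m. (a j - a (Suc j)) + exp (- \<delta> * t j) * gain (Weps \<epsilon>) (t j) (t (Suc j)) + exp (- \<delta> * t j) * err j)"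
    proof (rule sum.cong[OF refl])
      fix j
      have ee: "exp (- \<delta> * t (Suc j)) = exp (- \<delta> * t j) * exp (- \<delta> * h)"
        by (simp add: tS mult_exp_exp algebra_simps)
      have e2: "exp (- \<delta> * t j) * (exp (- \<delta> * h) * U (t (Suc j))) = a (Suc j)"
        unfolding a_def ee by (simp only: mult.assoc)
      have e1: "exp (- \<delta> * t j) * U (t j) = a j" by (simp add: a_def)
      have "exp (- \<delta> * t j) * c j = exp (- \<delta> * t j) * U (t j) + exp (- \<delta> * t j) * gain (Weps \<epsilon>) (t j) (t (Suc j))
          + exp (- \<delta> * t j) * err j - exp (- \<delta> * t j) * (exp (- \<delta> * h) * U (t (Suc j)))"
        unfolding c_def by (simp only: distrib_left right_diff_distrib)
      then show "exp (- \<delta> * t j) * c j = (a j - a (Suc j)) + exp (- \<delta> * t j) * gain (Weps \<epsilon>) (t j) (t (Suc j)) + exp (- \<delta> * t j) * err j"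
        unfolding e1 e2 by linarith
    qed
    also have "\<dots> = (\<Sum>j<m. a j - a (Suc j)) + (\<Sum>j<m. exp (- \<delta> * t j) * gain (Weps \<epsilon>) (t j) (t (Suc j))) + (\<Sum>j<m. exp (- \<delta> * t j) * err j)"
      by (simp add: sum.distrib)
    also have "(\<Sum>j<m. a j - a (Suc j)) = a 0 - a m" by (rule sum_lessThan_telescope')
    also have "(\<Sum>j<m. exp (- \<delta> * t j) * err j) \<le> (\<Sum>j<m. err j)"
      using err0 tk0 \<delta> by (intro sum_mono mult_left_le_one_le) auto
    also have "(\<Sum>j<m. err j) \<le> e"
    proof -
      have "(\<Sum>j<m. err j) = C * h * (\<Sum>j<m. (h + (D (t (Suc j)) - D (t j)) + (of_bool (alive (t j)) - of_bool (alive (t (Suc j)))) + (real (n (t (Suc j))) - real (n (t j)))))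
         + \<eta> * (\<Sum>j<m. real (n (t (Suc j))) - real (n (t j)))"
        unfolding err_def by (simp add: sum.distrib sum_distrib_left[symmetric] add_diff_eq)
      also have "\<dots> = C * h * (T + (D T - D 0) + (of_bool (alive 0) - of_bool (alive T)) + (real (n T) - real (n 0))) + \<eta> * (real (n T) - real (n 0))"
      proof -
        have "real m * h = T" using m by (simp add: h_def)
        then show ?thesis
          using sum_lessThan_telescope[of "\<lambda>j. D (t j)" m] sum_lessThan_telescope[of "\<lambda>j. real (n (t j))" m]
            sum_lessThan_telescope'[of "\<lambda>j. of_bool (alive (t j)) :: real" m]
          by (simp add: sum.distrib t0)
      qed
      also have "\<dots> \<le> C * h * (T + D T + 1 + real (n T)) + \<eta> * real (n T)"
        using C0 h D_nonneg[of 0] \<eta>(1) by (intro add_mono mult_left_mono) (auto simp: n0)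
      also have "C * h * (T + D T + 1 + real (n T)) = C * T * (T + D T + 1 + real (n T)) * inverse (real m)"
        by (simp add: h_def divide_inverse)
      also have "\<dots> \<le> e / 2" using m2 by (rule less_imp_le)
      finally show ?thesis using \<eta>(3) by simp
    qed
    finally have sum: "(\<Sum>j<m. exp (- \<delta> * t j) * c j) \<le> a 0 - a m + (\<Sum>j<m. exp (- \<delta> * t j) * gain (Weps \<epsilon>) (t j) (t (Suc j))) + e"
      by simp
    have am: "0 \<le> a m" unfolding a_def using U_nonneg[OF tk0] by simp
    \<comment> \<open>A lump payment at time 0 is covered by the drop of \<open>W\<close> from x to
      \<open>X 0\<close>.\<close>
    have a0: "?c0 + a 0 \<le> W x"
    proof (cases "alive 0")
      case True
      then have "0 \<le> X 0" by (auto simp: alive_def)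
      moreover have "X 0 = x - D 0" using X_eq[of 0] n0 by simp
      ultimately show ?thesis using True W_diff_ge[of "X 0" x] D_nonneg[of 0] by (simp add: a_def U_def t0)
    next
      case False
      then show ?thesis using W_pos[OF x] by (simp add: a_def U_def t0)
    qed
    have "?F T \<le> ennreal (?c0 + (\<Sum>j<m. exp (- \<delta> * t j) * c j))" using ind[of m] by (simp add: t0)
    also have "\<dots> \<le> ennreal (W x + (\<Sum>j<m. exp (- \<delta> * t j) * gain (Weps \<epsilon>) (t j) (t (Suc j))) + e)"
      using sum am a0 by (intro ennreal_leI) simp
    finally have "?F T \<le> ennreal (W x + (\<Sum>j<m. exp (- \<delta> * t j) * gain (Weps \<epsilon>) (t j) (t (Suc j))) + e)" .
    moreover have "0 \<le> (\<Sum>j<m. exp (- \<delta> * t j) * c j)" using c0 by (intro sum_nonneg mult_nonneg_nonneg) auto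
    then have "0 \<le> W x + (\<Sum>j<m. exp (- \<delta> * t j) * gain (Weps \<epsilon>) (t j) (t (Suc j))) + e"
      using sum am a0 D_nonneg[of 0] by (simp split: if_splits)
    ultimately show "0 \<le> W x + (\<Sum>k<m. exp (- \<delta> * (T * k / m)) * gain (Weps \<epsilon>) (T * k / m) (T * Suc k / m)) + e \<and>
      ?F T \<le> ennreal (W x + (\<Sum>k<m. exp (- \<delta> * (T * k / m)) * gain (Weps \<epsilon>) (T * k / m) (T * Suc k / m)) + e)"
      by (simp add: t_def)
  qed
qed

end

section \<open>Paths under the barrier strategy\<close>

context dividend_hjb
begin

text \<open>The discontinuous continuation of \<open>W\<close> by 0 is good enough for lower bounds:
  under the barrier strategy premiums within a step can only raise the surplus above its initial
  value less the claims.\<close>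

definition Wdead :: "real \<Rightarrow> real" where "Wdead z = (if 0 \<le> z then W z else 0)"

end

text \<open>Pathwise content of the barrier strategy: after an initial lump sum, payments are
  absolutely continuous and occur at level b only.\<close>

locale barrier_path = hjb_path +
  assumes X_le: "\<And>t. 0 \<le> t \<Longrightarrow> X t \<le> b"
    and D_0: "D 0 = max 0 (x - b)"
    and D_int: "\<And>t. 0 \<le> t \<Longrightarrow> (\<lambda>u. g b * indicator {b} (X u)) integrable_on {0..t}"
    and D_eq: "\<And>t. 0 \<le> t \<Longrightarrow> D t = D 0 + integral {0..t} (\<lambda>u. g b * indicator {b} (X u))"
begin

lemma D_diff: "0 \<le> s \<Longrightarrow> s \<le> t \<Longrightarrow> D t - D s = integral {s..t} (\<lambda>u. g b * indicator {b} (X u))"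
  using D_eq[of t] D_eq[of s] Henstock_Kurzweil_Integration.integral_combine[of 0 s t "\<lambda>u. g b * indicator {b} (X u)"] D_int[of t]
  by simp

lemma D_int': "0 \<le> s \<Longrightarrow> (\<lambda>u. g b * indicator {b} (X u)) integrable_on {s..t}"
  using D_int[of t] by (cases "s \<le> t") (auto intro!: integrable_subinterval_real[OF D_int[of t]])

text \<open>Payments are made at level b alone and there at the premium rate. They never exceed the
  premiums, so the surplus decreases through claims only.\<close>

lemma D_diff_le: "0 \<le> s \<Longrightarrow> s \<le> t \<Longrightarrow> D t - D s \<le> integral {s..t} (\<lambda>u. G (X u))"
  unfolding D_diff using b
  by (intro integral_le D_int' G_int) (auto simp: indicator_def intro: less_imp_le[OF G_pos])

lemma X_ge: "0 \<le> s \<Longrightarrow> s \<le> t \<Longrightarrow> X s - (S t - S s) \<le> X t"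
  using X_diff[of s t] D_diff_le[of s t] by simp

lemma alive_no_claim:
  assumes "0 \<le> s" "s \<le> t" "alive s" "S t - S s \<le> X s"
  shows "alive t"
  unfolding alive_def
proof (intro allI impI)
  fix r assume r: "0 \<le> r" "r \<le> t"
  show "0 \<le> X r"
  proof (cases "r \<le> s")
    case True then show ?thesis using assms(3) r by (auto simp: alive_def)
  next
    case False
    then have "X s - (S r - S s) \<le> X r" using assms by (intro X_ge) auto
    moreover have "S r \<le> S t" using r by (intro S_le)
    ultimately show ?thesis using assms(4) by simp
  qed
qed

lemma X_0: "X 0 = min x b" using X_eq[of 0] n0 D_0 by (simp add: max_def min_def)

lemma alive_0: "alive 0" using X_0 x b by (auto simp: alive_def)

text \<open>Right continuity of the claim number leaves a claim-free interval after t, on which the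
  surplus cannot decrease. Hence, under the barrier strategy, alive times lie strictly before
  ruin.\<close>

lemma alive_extend:
  assumes "0 \<le> t" "alive t"
  shows "\<exists>t'>t. alive t'"
proof -
  have "((\<lambda>t. real (n t)) \<longlongrightarrow> real (n t)) (at_right t)"
    using n_cadlag assms by (auto simp: cadlag_def continuous_within)
  then have "eventually (\<lambda>s. dist (real (n s)) (real (n t)) < 1) (at_right t)" by (rule tendstoD) simp
  then obtain t' where t': "t' > t" "\<And>s. t < s \<Longrightarrow> s < t' \<Longrightarrow> dist (real (n s)) (real (n t)) < 1"
    unfolding eventually_at_right_field by auto
  define r where "r = (t + t') / 2"
  have r: "t < r" "r < t'" using t' by (auto simp: r_def)
  have "n r = n t" using t'(2)[OF r] by (simp add: dist_real_def)
  then have "S r = S t" by (simp add: S_def)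
  then have "alive r"
    using alive_no_claim[OF assms(1) less_imp_le[OF r(1)] assms(2)] aliveD[OF assms(2,1)] by simp
  then show ?thesis using r by auto
qed

text \<open>If anything is paid in a step without claims, the path meets b; the step then ends
  within \<Gamma> h of b, where \<open>W'\<close> exceeds 1 by at most K \<Gamma> h, so
  \<open>W\<close> drops by the payment up to O(h^2). In a step with claims the payments are simply
  dropped, and the drift and discounting cost O(h).\<close>

lemma step_lower:
  assumes st: "0 \<le> s" "s \<le> t" "t \<le> T"
    and \<Gamma>: "0 \<le> \<Gamma>" "\<And>t. 0 \<le> t \<Longrightarrow> t \<le> T \<Longrightarrow> G (X t) \<le> \<Gamma>"
  defines "C \<equiv> 2 * K * \<Gamma>\<^sup>2 + K1 * L * \<Gamma> + \<delta> * K1 * \<Gamma> + (\<Gamma> * K1 + \<delta> * W b) + \<delta> * W b"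
  shows "U s + gain Wdead s t - C * (t - s) * ((t - s) + (real (n t) - real (n s)))
    \<le> exp (- \<delta> * (t - s)) * ((if alive t then D t - D s else 0) + U t)"
proof -
  define h where "h = t - s"
  define d where "d = D t - D s"
  define C1 where "C1 = 2 * K * \<Gamma>\<^sup>2 + K1 * L * \<Gamma> + \<delta> * K1 * \<Gamma>"
  define QB where "QB = \<Gamma> * K1 + \<delta> * W b"
  have h: "0 \<le> h" using st by (simp add: h_def)
  have Wb: "0 < W b" using W_pos b by auto
  have C1: "0 \<le> C1" unfolding C1_def using K_nonneg \<Gamma>(1) K1_ge1 L_nonneg \<delta> by auto
  have QB: "0 \<le> QB" unfolding QB_def using K1_ge1 \<Gamma>(1) \<delta> Wb by auto
  have C: "C = C1 + QB + \<delta> * W b" by (simp add: C_def C1_def QB_def)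
  have CC: "0 \<le> C" "C1 \<le> C" using C1 QB \<delta> Wb by (auto simp: C)
  have nn: "real (n s) \<le> real (n t)" using n_le[of s t] st by simp
  have exp1: "1 - \<delta> * h \<le> exp (- \<delta> * h)" using exp_ge_add_one_self[of "- \<delta> * h"] by simp
  have exp0: "0 < exp (- \<delta> * h)" by simp
  have main: "U s + gain Wdead s t - C * h * (h + (real (n t) - real (n s)))
    \<le> exp (- \<delta> * h) * ((if alive t then d else 0) + U t)"
  proof (cases "alive s")
    case False
    then have "\<not> alive t" using alive_down st by blast
    then show ?thesis using False CC h nn by (simp add: U_def gain_def mult_nonneg_nonneg)
  next
    case as: True
    have Xs: "0 \<le> X s" "X s \<le> b" using aliveD[OF as] X_le st by auto
    have Us: "U s = W (X s)" using as by (simp add: U_def)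
    have qb: "\<bar>q (X s)\<bar> \<le> QB" unfolding QB_def by (rule q_bound) (use Xs \<Gamma>(2)[of s] st in auto)
    have hq: "h * q (X s) \<le> h * QB" using qb h by (intro mult_left_mono) auto
    have d0: "0 \<le> d" using D_le[OF st(2)] by (simp add: d_def)
    show ?thesis
    proof (cases "n s = n t")
      case True
      have Seq: "S u = S s" if "s \<le> u" "u \<le> t" for u
        using n_le[of s u] n_le[of u t] st that True by (simp add: S_def)
      have at: "alive t" using alive_no_claim[OF st(1,2) as] Seq[of t] st(2) Xs(1) by simp
      have Xt: "0 \<le> X t" using aliveD[OF at] st by simp
      define I where "I = integral {s..t} (\<lambda>u. G (X u))"
      have I0: "0 \<le> I" unfolding I_def using st by (intro int_nonneg) auto
      have I1: "I \<le> \<Gamma> * h" unfolding I_def h_def by (rule int_le) (use st \<Gamma> in auto)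
      have dI: "d \<le> I" using D_diff_le st by (simp add: d_def I_def)
      have eq: "X t = X s + I - d" using X_diff[of s t] Seq[of t] st by (simp add: I_def d_def)
      have inc: "X s \<le> X u \<and> X u \<le> X s + \<Gamma> * h" if "s \<le> u" "u \<le> t" for u
      proof -
        have "X u = X s + integral {s..u} (\<lambda>u. G (X u)) - (D u - D s)" using X_diff[of s u] Seq[of u] st that by simp
        moreover have "integral {s..u} (\<lambda>u. G (X u)) \<le> \<Gamma> * (u - s)" by (rule int_le) (use st \<Gamma> that in auto)
        moreover have "\<Gamma> * (u - s) \<le> \<Gamma> * h" using \<Gamma> that by (intro mult_left_mono) (auto simp: h_def)
        moreover have "D s \<le> D u" using that D_le by auto
        ultimately show ?thesis using D_diff_le[of s u] st that by simp
      qed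
      have I2: "(g (X s) - L * (\<Gamma> * h)) * h \<le> I" unfolding I_def h_def
      proof (rule int_ge)
        fix u assume u: "s \<le> u" "u \<le> t"
        have "\<bar>G (X u) - G (X s)\<bar> \<le> L * \<bar>X u - X s\<bar>" by (rule G_lip)
        also have "\<dots> \<le> L * (\<Gamma> * h)" using inc[OF u] L_nonneg by (intro mult_left_mono) auto
        finally show "g (X s) - L * (\<Gamma> * (t - s)) \<le> G (X u)" using Xs by (simp add: max_def h_def)
      qed (use st in auto)
      have a1: "W (X s + I) - W (X t) \<le> d + K * (\<Gamma> * h)\<^sup>2"
      proof (cases "d = 0")
        case True then show ?thesis using eq K_nonneg by simp
      next
        case False
        have "\<exists>u\<in>{s..t}. X u = b"
        proof (rule ccontr)
          assume a: "\<not> (\<exists>u\<in>{s..t}. X u = b)"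
          have "integral {s..t} (\<lambda>u. g b * indicator {b} (X u)) = integral {s..t} (\<lambda>u. 0)"
            by (rule integral_cong) (use a in auto)
          then show False using False D_diff st by (simp add: d_def)
        qed
        then obtain u where u: "s \<le> u" "u \<le> t" "X u = b" by auto
        then have Xb: "b - \<Gamma> * h \<le> X t" using inc[of u] inc[of t] st by simp
        have "X t \<le> X s + I" using eq d0 by simp
        from W_mvt[OF Xt this] obtain z where z: "X t \<le> z" "W (X s + I) - W (X t) = W' z * (X s + I - X t)" by metis
        have "W' z \<le> 1 + K * (\<Gamma> * h)"
        proof (cases "b \<le> z")
          case True then show ?thesis using W'_eq1[of z] K_nonneg \<Gamma> h by simp
        next
          case False
          have "\<bar>W' z - W' b\<bar> \<le> K * \<bar>z - b\<bar>" using z Xt b by (intro W'_lip) auto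
          also have "\<dots> \<le> K * (\<Gamma> * h)" using z Xb False K_nonneg by (intro mult_left_mono) auto
          finally show ?thesis using W'_eq1[of b] by simp
        qed
        then have "W' z * d \<le> (1 + K * (\<Gamma> * h)) * d" using d0 by (intro mult_right_mono)
        also have "\<dots> = d + K * (\<Gamma> * h) * d" by (simp add: algebra_simps)
        also have "K * (\<Gamma> * h) * d \<le> K * (\<Gamma> * h) * (\<Gamma> * h)" using dI I1 K_nonneg \<Gamma> h by (intro mult_left_mono) auto
        finally show ?thesis using z eq by (simp add: power2_eq_square mult.assoc)
      qed
      have a2: "W (X s) + W' (X s) * I - K * I\<^sup>2 \<le> W (X s + I)" using W_taylor[OF Xs(1) I0] by (simp add: abs_le_iff)
      have a3: "W' (X s) * (g (X s) * h) - K1 * (L * (\<Gamma> * h) * h) \<le> W' (X s) * I"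
      proof -
        have "W' (X s) * (g (X s) * h) - W' (X s) * (L * (\<Gamma> * h) * h) = W' (X s) * ((g (X s) - L * (\<Gamma> * h)) * h)"
          by (simp add: algebra_simps)
        also have "\<dots> \<le> W' (X s) * I" using I2 W'_ge1[OF Xs(1)] by (intro mult_left_mono) auto
        finally have "W' (X s) * (g (X s) * h) - W' (X s) * (L * (\<Gamma> * h) * h) \<le> W' (X s) * I" .
        moreover have "W' (X s) * (L * (\<Gamma> * h) * h) \<le> K1 * (L * (\<Gamma> * h) * h)"
          using W'_le[OF Xs(1)] L_nonneg \<Gamma> h by (intro mult_right_mono) auto
        ultimately show ?thesis by simp
      qed
      have a4: "K * I\<^sup>2 \<le> K * (\<Gamma> * h)\<^sup>2" using K_nonneg I0 I1 by (intro mult_left_mono power_mono)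
      have up: "d + W (X t) \<le> W (X s) + K1 * (\<Gamma> * h)"
      proof -
        have "d + W (X t) \<le> W (X s + I)" using W_diff_ge[of "X t" "X s + I"] Xt d0 eq by simp
        also have "\<dots> \<le> W (X s) + K1 * I" using W_diff_le[of "X s" "X s + I"] Xs I0 by simp
        also have "\<dots> \<le> W (X s) + K1 * (\<Gamma> * h)" using I1 K1_ge1 by simp
        finally show ?thesis .
      qed
      have pos: "0 \<le> d + W (X t)" using d0 W_pos[OF Xt] by simp
      have "(1 - \<delta> * h) * (d + W (X t)) \<le> exp (- \<delta> * h) * (d + W (X t))"
        using exp1 pos by (intro mult_right_mono)
      then have a5: "d + W (X t) - \<delta> * h * (d + W (X t)) \<le> exp (- \<delta> * h) * (d + W (X t))"
        by (simp add: algebra_simps)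
      have a6: "\<delta> * h * (d + W (X t)) \<le> \<delta> * h * (W (X s) + K1 * (\<Gamma> * h))"
        using up \<delta> h by (intro mult_left_mono) auto
      have gain: "gain Wdead s t = h * q (X s)" using as True by (simp add: gain_def S_def h_def)
      have "W (X s) + h * q (X s) - C1 * (h * h) \<le> exp (- \<delta> * h) * (d + W (X t))"
        using a1 a2 a3 a4 a5 a6 unfolding C1_def q_def by (simp add: algebra_simps power2_eq_square)
      moreover have "C1 * (h * h) \<le> C * (h * h)" using CC h by (intro mult_right_mono) auto
      ultimately show ?thesis using gain Us at True by (simp add: U_def mult.assoc)
    next
      case False
      then have nlt: "n s < n t" using nn by simp
      then have S: "S s < S t" using S_less[of s t] st by simp
      define z where "z = X s - (S t - S s)"
      have gain: "gain Wdead s t = h * q (X s) + (Wdead z - W (X s))"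
        using as S by (simp add: gain_def h_def z_def)
      have "C * h * 1 \<le> C * h * (h + (real (n t) - real (n s)))"
        using CC h nlt by (intro mult_left_mono) auto
      moreover have "C * h = C1 * h + h * QB + \<delta> * W b * h" by (simp add: C algebra_simps)
      moreover have "0 \<le> C1 * h" using C1 h by simp
      moreover have "Wdead z - \<delta> * W b * h \<le> exp (- \<delta> * h) * ((if alive t then d else 0) + U t)"
      proof (cases "0 \<le> z")
        case True
        then have at: "alive t" using alive_no_claim[OF st(1,2) as] by (simp add: z_def)
        have zt: "z \<le> X t" using X_ge[OF st(1,2)] by (simp add: z_def)
        have "W z \<le> W b" using True S Xs by (intro W_mono) (auto simp: z_def)
        then have "\<delta> * h * W z \<le> \<delta> * h * W b" using \<delta> h by (intro mult_left_mono) auto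
        moreover have "(1 - \<delta> * h) * W z \<le> exp (- \<delta> * h) * W z"
          using exp1 W_pos[OF True] by (intro mult_right_mono) auto
        moreover have "exp (- \<delta> * h) * W z \<le> exp (- \<delta> * h) * (d + W (X t))"
          using W_mono[OF True zt] d0 exp0 by (intro mult_left_mono) auto
        ultimately show ?thesis using at True by (simp add: Wdead_def U_def algebra_simps)
      next
        case False
        have "0 \<le> (if alive t then d else 0) + U t" using d0 U_nonneg[of t] st by simp
        then have "0 \<le> exp (- \<delta> * h) * ((if alive t then d else 0) + U t)" by simp
        moreover have "0 \<le> \<delta> * W b * h" using \<delta> h Wb by simp
        ultimately show ?thesis using False by (simp add: Wdead_def)
      qed
      ultimately show ?thesis unfolding gain Us using hq by linarith
    qed
  qed
  then show ?thesis unfolding h_def d_def .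
qed

text \<open>The interval (-1, 0) carries no mass, since \<open>D\<close> vanishes there; it is a
  union of half-open intervals, whose measure is known.\<close>

lemma interval_measure_singleton_0: "ennreal (D 0) \<le> emeasure (interval_measure D) {0}"
proof -
  have null: "{-1<..-1 / real (Suc k)} \<in> null_sets (interval_measure D)" for k
  proof -
    have "emeasure (interval_measure D) {-1<..-1 / real (Suc k)} = D (-1 / real (Suc k)) - D (-1)"
      using D_right_cont by (intro emeasure_interval_measure_Ioc) (auto intro: D_le simp: field_simps)
    also have "\<dots> = 0" using D_neg[of "-1 / real (Suc k)"] D_neg[of "-1"] by (simp add: field_simps)
    finally show ?thesis by (intro null_setsI) auto
  qed
  let ?N = "\<Union>k. {-1<..-1 / real (Suc k)}"
  have N: "?N \<in> null_sets (interval_measure D)" using null by (rule null_sets_UN)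
  have "ennreal (D 0) = D 0 - D (-1)" using D_neg[of "-1"] by simp
  also have "\<dots> = emeasure (interval_measure D) {-1<..0}"
    using D_right_cont by (intro emeasure_interval_measure_Ioc[symmetric]) (auto intro: D_le)
  also have "\<dots> \<le> emeasure (interval_measure D) ({0} \<union> ?N)"
  proof (rule emeasure_mono)
    show "{-1<..0} \<subseteq> {0} \<union> ?N"
    proof
      fix v :: real assume v: "v \<in> {-1<..0}"
      show "v \<in> {0} \<union> ?N"
      proof (cases "v = 0")
        case False
        then have "0 < - v" using v by simp
        then obtain k where "inverse (real (Suc k)) < - v" using reals_Archimedean by blast
        then have "v \<le> -1 / real (Suc k)" by (simp add: divide_inverse)
        then show ?thesis using v by auto
      qed simp
    qed
  qed auto
  also have "\<dots> = emeasure (interval_measure D) {0}" by (rule emeasure_Un_null_set) (use N in auto)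
  finally show ?thesis .
qed

text \<open>For a lower bound the payments are discounted as if made at the end of the step, and
  counted only if the step is survived.\<close>

lemma dividend_mass_step_ge:
  assumes "0 \<le> s" "s \<le> t"
  shows "(\<integral>\<^sup>+u. ennreal (exp (- \<delta> * u)) * indicator {u. 0 \<le> u \<and> u \<le> s \<and> alive u} u \<partial>interval_measure D)
       + ennreal (exp (- \<delta> * t) * (if alive t then D t - D s else 0))
     \<le> (\<integral>\<^sup>+u. ennreal (exp (- \<delta> * u)) * indicator {u. 0 \<le> u \<and> u \<le> t \<and> alive u} u \<partial>interval_measure D)"
proof (cases "alive t")
  case True
  have eq: "{u. 0 \<le> u \<and> u \<le> v \<and> alive u} = {0..v} \<inter> {u. alive u}" for v by auto
  have "ennreal (exp (- \<delta> * t) * (D t - D s)) = ennreal (exp (- \<delta> * t)) * emeasure (interval_measure D) {s<..t}"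
    using assms D_right_cont by (subst emeasure_interval_measure_Ioc) (auto intro: D_le simp: ennreal_mult')
  also have "\<dots> = (\<integral>\<^sup>+u. ennreal (exp (- \<delta> * t)) * indicator {s<..t} u \<partial>interval_measure D)"
    by (intro nn_integral_cmult_indicator[symmetric]) simp
  finally have "(\<integral>\<^sup>+u. ennreal (exp (- \<delta> * u)) * indicator {u. 0 \<le> u \<and> u \<le> s \<and> alive u} u \<partial>interval_measure D)
       + ennreal (exp (- \<delta> * t) * (D t - D s))
     = (\<integral>\<^sup>+u. (ennreal (exp (- \<delta> * u)) * indicator {u. 0 \<le> u \<and> u \<le> s \<and> alive u} u
       + ennreal (exp (- \<delta> * t)) * indicator {s<..t} u) \<partial>interval_measure D)"
    unfolding eq using alive_measurable by (subst nn_integral_add) simp_all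
  also have "\<dots> \<le> (\<integral>\<^sup>+u. ennreal (exp (- \<delta> * u)) * indicator {u. 0 \<le> u \<and> u \<le> t \<and> alive u} u \<partial>interval_measure D)"
  proof (rule nn_integral_mono)
    fix u
    have "u \<le> t \<Longrightarrow> exp (- \<delta> * t) \<le> exp (- \<delta> * u)" using \<delta> by simp
    moreover have "u \<le> t \<Longrightarrow> alive u" using True alive_down by blast
    ultimately show "ennreal (exp (- \<delta> * u)) * indicator {u. 0 \<le> u \<and> u \<le> s \<and> alive u} u
       + ennreal (exp (- \<delta> * t)) * indicator {s<..t} u
      \<le> ennreal (exp (- \<delta> * u)) * indicator {u. 0 \<le> u \<and> u \<le> t \<and> alive u} u"
      using assms by (auto split: split_indicator intro: ennreal_leI)
  qed
  finally show ?thesis using True by simp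
next
  case False
  have "(\<integral>\<^sup>+u. ennreal (exp (- \<delta> * u)) * indicator {u. 0 \<le> u \<and> u \<le> s \<and> alive u} u \<partial>interval_measure D)
     \<le> (\<integral>\<^sup>+u. ennreal (exp (- \<delta> * u)) * indicator {u. 0 \<le> u \<and> u \<le> t \<and> alive u} u \<partial>interval_measure D)"
    using assms by (intro nn_integral_mono) (auto split: split_indicator)
  then show ?thesis using False by simp
qed

text \<open>\<open>exp (- \<delta> * T) * W b\<close> bounds the discounted value of the surplus
  left at time T. The errors sum to C h (T + n T), so the required mesh depends on the path only
  through the premium bound and the number of claims.\<close>

lemma discounted_dividends_ge:
  fixes T e :: real
  assumes T: "0 < T" and e: "0 < e"
  shows "\<forall>\<^sub>F m in sequentially.
    ennreal (W x + (\<Sum>k<m. exp (- \<delta> * (T * k / m)) * gain Wdead (T * k / m) (T * Suc k / m)) - e - exp (- \<delta> * T) * W b)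
    \<le> (\<integral>\<^sup>+u. ennreal (exp (- \<delta> * u)) * indicator {u. 0 \<le> u \<and> u \<le> T \<and> alive u} u \<partial>interval_measure D)"
proof -
  obtain B \<Gamma> where bd: "0 \<le> B" "0 \<le> \<Gamma>" "\<And>t. 0 \<le> t \<Longrightarrow> t \<le> T \<Longrightarrow> X t \<le> B"
    "\<And>t. 0 \<le> t \<Longrightarrow> t \<le> T \<Longrightarrow> G (X t) \<le> \<Gamma>"
    by (rule path_bounds[of T]) (rule that)
  note \<Gamma> = bd(2,4)
  define C where "C = 2 * K * \<Gamma>\<^sup>2 + K1 * L * \<Gamma> + \<delta> * K1 * \<Gamma> + (\<Gamma> * K1 + \<delta> * W b) + \<delta> * W b"
  have C0: "0 \<le> C" using K_nonneg \<Gamma>(1) K1_ge1 L_nonneg \<delta> W_pos[OF b] by (auto simp: C_def)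
  have lim0: "(\<lambda>m. c * inverse (real m)) \<longlonglongrightarrow> 0" for c
    using tendsto_mult[OF tendsto_const[of c] lim_inverse_n] by simp
  have "\<forall>\<^sub>F m in sequentially. (C * T * (T + real (n T))) * inverse (real m) < e"
    by (rule order_tendstoD(2)[OF lim0]) (use e in simp)
  then have "\<forall>\<^sub>F m in sequentially. 0 < m \<and> (C * T * (T + real (n T))) * inverse (real m) < e"
    using eventually_gt_at_top[of 0] by eventually_elim auto
  then show ?thesis
  proof (rule eventually_mono, elim conjE)
    fix m :: nat assume m: "0 < m" and m2: "(C * T * (T + real (n T))) * inverse (real m) < e"
    define t where "t k = T * real k / real m" for k :: nat
    define h where "h = T / real m"
    have h: "0 < h" using T m by (auto simp: h_def)
    have tS: "t (Suc k) = t k + h" for k using m by (simp add: t_def h_def field_simps)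
    have t0: "t 0 = 0" "t m = T" using m by (auto simp: t_def)
    have tk0: "0 \<le> t k" for k using T by (simp add: t_def)
    have tkT: "t k \<le> T" if "k \<le> m" for k
      using that T m by (simp add: t_def divide_le_eq mult_left_mono)
    define err where "err k = C * h * (h + (real (n (t (Suc k))) - real (n (t k))))" for k
    define dl where "dl k = (if alive (t (Suc k)) then D (t (Suc k)) - D (t k) else 0)" for k
    have err0: "0 \<le> err k" for k
    proof -
      have "real (n (t k)) \<le> real (n (t (Suc k)))" using n_le[of "t k" "t (Suc k)"] tS[of k] h tk0 by simp
      then show ?thesis unfolding err_def using C0 h by (intro mult_nonneg_nonneg) auto
    qed
    have dl0: "0 \<le> dl k" for k using D_le[of "t k" "t (Suc k)"] tS[of k] h by (simp add: dl_def)
    have bound: "U (t k) + gain Wdead (t k) (t (Suc k)) - err k \<le> exp (- \<delta> * h) * (dl k + U (t (Suc k)))" if k: "k < m" for k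
    proof -
      have s: "0 \<le> t k" "t k \<le> t (Suc k)" "t (Suc k) \<le> T" using tk0 tS[of k] h tkT[of "Suc k"] k by auto
      show ?thesis using step_lower[OF s \<Gamma>] tS[of k] by (simp add: dl_def err_def C_def)
    qed
    let ?F = "\<lambda>v. \<integral>\<^sup>+u. ennreal (exp (- \<delta> * u)) * indicator {u. 0 \<le> u \<and> u \<le> v \<and> alive u} u \<partial>interval_measure D"
    have ind: "ennreal (D 0 + (\<Sum>j<k. exp (- \<delta> * t (Suc j)) * dl j)) \<le> ?F (t k)" for k
    proof (induction k)
      case 0
      have "ennreal (D 0) \<le> emeasure (interval_measure D) {0}" by (rule interval_measure_singleton_0)
      also have "\<dots> = (\<integral>\<^sup>+u. indicator {0} u \<partial>interval_measure D)" by simp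
      also have "\<dots> \<le> ?F (t 0)"
        by (rule nn_integral_mono) (use alive_0 t0 in \<open>auto split: split_indicator\<close>)
      finally show ?case by simp
    next
      case (Suc k)
      have "0 \<le> (\<Sum>j<k. exp (- \<delta> * t (Suc j)) * dl j)" using dl0 by (intro sum_nonneg mult_nonneg_nonneg) auto
      then have "ennreal (D 0 + (\<Sum>j<Suc k. exp (- \<delta> * t (Suc j)) * dl j))
         = ennreal (D 0 + (\<Sum>j<k. exp (- \<delta> * t (Suc j)) * dl j)) + ennreal (exp (- \<delta> * t (Suc k)) * dl k)"
        using dl0[of k] D_nonneg[of 0] by (subst ennreal_plus[symmetric]) (auto simp: add.assoc)
      also have "\<dots> \<le> ?F (t k) + ennreal (exp (- \<delta> * t (Suc k)) * dl k)" using Suc by (intro add_right_mono)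
      also have "\<dots> \<le> ?F (t (Suc k))"
        unfolding dl_def by (rule dividend_mass_step_ge) (use tk0 tS[of k] h in auto)
      finally show ?case .
    qed
    define a where "a k = exp (- \<delta> * t k) * U (t k)" for k
    have "a j - a (Suc j) + exp (- \<delta> * t j) * gain Wdead (t j) (t (Suc j)) - err j \<le> exp (- \<delta> * t (Suc j)) * dl j" if "j < m" for j
    proof -
      have ee: "exp (- \<delta> * t (Suc j)) = exp (- \<delta> * t j) * exp (- \<delta> * h)"
        by (simp add: tS mult_exp_exp algebra_simps)
      have "exp (- \<delta> * t j) * (U (t j) + gain Wdead (t j) (t (Suc j)) - err j)
          \<le> exp (- \<delta> * t j) * (exp (- \<delta> * h) * (dl j + U (t (Suc j))))"
        using bound[OF that] by (intro mult_left_mono) auto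
      also have "\<dots> = exp (- \<delta> * t (Suc j)) * dl j + a (Suc j)"
        unfolding a_def ee by (simp add: algebra_simps)
      finally have "a j + exp (- \<delta> * t j) * gain Wdead (t j) (t (Suc j)) - exp (- \<delta> * t j) * err j
          \<le> exp (- \<delta> * t (Suc j)) * dl j + a (Suc j)" by (simp add: a_def algebra_simps)
      moreover have "exp (- \<delta> * t j) * err j \<le> err j"
        using err0 tk0 \<delta> by (intro mult_left_le_one_le) auto
      ultimately show ?thesis by linarith
    qed
    then have "(\<Sum>j<m. a j - a (Suc j) + exp (- \<delta> * t j) * gain Wdead (t j) (t (Suc j)) - err j)
       \<le> (\<Sum>j<m. exp (- \<delta> * t (Suc j)) * dl j)"
      by (intro sum_mono) auto
    also have "(\<Sum>j<m. a j - a (Suc j) + exp (- \<delta> * t j) * gain Wdead (t j) (t (Suc j)) - err j)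
      = (\<Sum>j<m. a j - a (Suc j)) + (\<Sum>j<m. exp (- \<delta> * t j) * gain Wdead (t j) (t (Suc j))) - (\<Sum>j<m. err j)"
      by (simp add: sum.distrib sum_subtractf)
    also have "(\<Sum>j<m. a j - a (Suc j)) = a 0 - a m" by (rule sum_lessThan_telescope')
    finally have sum: "a 0 - a m + (\<Sum>j<m. exp (- \<delta> * t j) * gain Wdead (t j) (t (Suc j))) - (\<Sum>j<m. err j)
       \<le> (\<Sum>j<m. exp (- \<delta> * t (Suc j)) * dl j)" .
    have err: "(\<Sum>j<m. err j) \<le> e"
    proof -
      have "(\<Sum>j<m. err j) = C * h * (\<Sum>j<m. (h + (real (n (t (Suc j))) - real (n (t j)))))"
        unfolding err_def by (simp add: sum_distrib_left[symmetric])
      also have "\<dots> = C * h * (T + real (n T))"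
      proof -
        have "real m * h = T" using m by (simp add: h_def)
        then show ?thesis
          using sum_lessThan_telescope[of "\<lambda>j. real (n (t j))" m] by (simp add: sum.distrib t0 n0)
      qed
      also have "\<dots> = C * T * (T + real (n T)) * inverse (real m)" by (simp add: h_def divide_inverse)
      also have "\<dots> \<le> e" using m2 by (rule less_imp_le)
      finally show ?thesis .
    qed
    have am: "a m \<le> exp (- \<delta> * T) * W b"
    proof -
      have "U T \<le> W b" using W_mono[of "X T" b] aliveD[of T] X_le[of T] T W_pos[OF b] by (auto simp: U_def)
      then show ?thesis by (simp add: a_def t0)
    qed
    \<comment> \<open>Above b the slope of \<open>W\<close> is exactly 1, so nothing is lost by the
      initial lump payment.\<close>
    have a0: "D 0 + a 0 = W x"
    proof -
      have "D 0 + a 0 = D 0 + W (min x b)" using alive_0 X_0 by (simp add: a_def U_def t0)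
      also have "\<dots> = W x"
      proof (cases "x \<le> b")
        case True then show ?thesis using D_0 by simp
      next
        case False
        then have "b \<le> x" by simp
        from W_mvt[OF b this] obtain z where "b \<le> z" "W x - W b = W' z * (x - b)" by metis
        then show ?thesis using W'_eq1[of z] D_0 False by simp
      qed
      finally show ?thesis .
    qed
    have "ennreal (W x + (\<Sum>j<m. exp (- \<delta> * t j) * gain Wdead (t j) (t (Suc j))) - e - exp (- \<delta> * T) * W b)
       \<le> ennreal (D 0 + (\<Sum>j<m. exp (- \<delta> * t (Suc j)) * dl j))"
      using sum err am a0 by (intro ennreal_leI) simp
    also have "\<dots> \<le> ?F T" using ind[of m] by (simp add: t0)
    finally show "ennreal (W x + (\<Sum>k<m. exp (- \<delta> * (T * k / m)) * gain Wdead (T * k / m) (T * Suc k / m)) - e - exp (- \<delta> * T) * W b)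
      \<le> ?F T"
      by (simp add: t_def)
  qed
qed

end

section \<open>Law of the claim increments\<close>

text \<open>Subtraction of claim numbers is truncated, but a difference of 1, or of at least 2,
  still determines the event. With z = lam (t - s) the second bound is 1 - (1 + z) exp(- z) \<le> 1
  - (1 + z) (1 - z) = z^2.\<close>

lemma poisson_increment_probs:
  assumes M: "prob_space M" and N: "poisson_process M lam N" and lam: "0 < lam" and st: "0 \<le> s" "s < t"
  shows "measure M {\<omega>\<in>space M. N t \<omega> = Suc (N s \<omega>)} = lam * (t - s) * exp (- (lam * (t - s)))"
    and "measure M {\<omega>\<in>space M. N s \<omega> + 2 \<le> N t \<omega>} \<le> (lam * (t - s))\<^sup>2"
proof -
  interpret prob_space M by fact
  have [measurable]: "N t \<in> measurable M (count_space UNIV)" "N s \<in> measurable M (count_space UNIV)"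
    using N st by (auto simp: poisson_process_def)
  define z where "z = lam * (t - s)"
  have z: "0 < z" using lam st by (simp add: z_def)
  have distr: "distr M (count_space UNIV) (\<lambda>\<omega>. N t \<omega> - N s \<omega>) = measure_pmf (poisson_pmf z)"
    using N st by (auto simp: poisson_process_def z_def)
  have m: "measure M {\<omega>\<in>space M. N t \<omega> - N s \<omega> \<in> A} = measure (measure_pmf (poisson_pmf z)) A" for A
    unfolding distr[symmetric] by (subst measure_distr) (auto intro!: arg_cong[of _ _ "measure M"])
  have "{\<omega>\<in>space M. N t \<omega> = Suc (N s \<omega>)} = {\<omega>\<in>space M. N t \<omega> - N s \<omega> \<in> {1}}" by auto
  then have "measure M {\<omega>\<in>space M. N t \<omega> = Suc (N s \<omega>)} = pmf (poisson_pmf z) 1"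
    using m[of "{1}"] by (simp add: pmf.rep_eq)
  then show "measure M {\<omega>\<in>space M. N t \<omega> = Suc (N s \<omega>)} = lam * (t - s) * exp (- (lam * (t - s)))"
    using z by (simp add: z_def)
  have "{\<omega>\<in>space M. N s \<omega> + 2 \<le> N t \<omega>} = {\<omega>\<in>space M. N t \<omega> - N s \<omega> \<in> - {0, 1}}" by auto
  then have "measure M {\<omega>\<in>space M. N s \<omega> + 2 \<le> N t \<omega>} = measure (measure_pmf (poisson_pmf z)) (- {0, 1})"
    using m[of "- {0, 1}"] by simp
  also have "\<dots> = 1 - measure (measure_pmf (poisson_pmf z)) {0, 1}"
    using measure_pmf.prob_compl[of "{0, 1}" "poisson_pmf z"] by (simp add: Compl_eq_Diff_UNIV)
  also have "measure (measure_pmf (poisson_pmf z)) {0, 1} = exp (- z) + z * exp (- z)"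
    using z by (simp add: measure_measure_pmf_finite)
  also have "1 - (exp (- z) + z * exp (- z)) \<le> z\<^sup>2"
  proof -
    have "(1 + z) * (1 - z) \<le> (1 + z) * exp (- z)"
      using exp_ge_add_one_self[of "- z"] z by (intro mult_left_mono) auto
    then show ?thesis by (simp add: algebra_simps power2_eq_square)
  qed
  finally show "measure M {\<omega>\<in>space M. N s \<omega> + 2 \<le> N t \<omega>} \<le> (lam * (t - s))\<^sup>2" by (simp add: z_def)
qed

lemma integrable_poisson:
  assumes "0 < r"
  shows "integrable (measure_pmf (poisson_pmf r)) real"
proof -
  have "summable (\<lambda>n. r * (r ^ n / fact n * exp (- r)))"
    using summable_exp[of r] by (intro summable_mult) (simp add: summable_mult2 divide_inverse mult.commute)
  moreover have "real (Suc n) * (r ^ Suc n / fact (Suc n) * exp (- r)) = r * (r ^ n / fact n * exp (- r))" for n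
    by (simp add: field_simps del: of_nat_Suc)
  ultimately have "summable (\<lambda>n. real (Suc n) * (r ^ Suc n / fact (Suc n) * exp (- r)))"
    by (simp only:)
  then have "summable (\<lambda>n. real n * (r ^ n / fact n * exp (- r)))"
    by (subst (asm) summable_Suc_iff)
  then have "summable (\<lambda>n. norm (pmf (poisson_pmf r) n *\<^sub>R real n))"
    using assms by (simp add: abs_mult mult_ac)
  then have "integrable (count_space UNIV) (\<lambda>n. pmf (poisson_pmf r) n *\<^sub>R real n)"
    by (simp add: integrable_count_space_nat_iff)
  then show ?thesis
    unfolding measure_pmf_eq_density by (subst integrable_density) auto
qed

text \<open>Integrability of the number of claims provides the majorant of the discretised
  sums.\<close>

lemma poisson_process_integrable:
  assumes M: "prob_space M" and N: "poisson_process M lam N" and lam: "0 < lam" and t: "0 < t"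
  shows "integrable M (\<lambda>\<omega>. real (N t \<omega>))"
proof -
  interpret prob_space M by fact
  have [measurable]: "N t \<in> measurable M (count_space UNIV)" "N 0 \<in> measurable M (count_space UNIV)"
    using N t by (auto simp: poisson_process_def)
  have distr: "distr M (count_space UNIV) (\<lambda>\<omega>. N t \<omega> - N 0 \<omega>) = measure_pmf (poisson_pmf (lam * (t - 0)))"
    using N t by (auto simp: poisson_process_def)
  have "integrable (distr M (count_space UNIV) (\<lambda>\<omega>. N t \<omega> - N 0 \<omega>)) real"
    unfolding distr by (rule integrable_poisson) (use lam t in simp)
  then have "integrable M (\<lambda>\<omega>. real (N t \<omega> - N 0 \<omega>))"
    by (subst (asm) integrable_distr_eq) auto
  moreover have "AE \<omega> in M. real (N t \<omega> - N 0 \<omega>) = real (N t \<omega>)"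
  proof -
    have "AE \<omega> in M. N 0 \<omega> = 0" using N unfolding poisson_process_def by (auto elim: AE_mp)
    then show ?thesis by eventually_elim simp
  qed
  ultimately show ?thesis by (subst integrable_cong_AE[symmetric]) auto
qed

lemma exponential_claims_pos:
  assumes M: "prob_space M" and Y: "iid_exponential M \<alpha> Y" and \<alpha>: "0 < \<alpha>"
  shows "AE \<omega> in M. \<forall>i. 0 < Y i \<omega>"
proof (subst AE_all_countable, intro allI)
  fix i
  interpret prob_space M by fact
  have d: "distributed M lborel (Y i) (exponential_density \<alpha>)" using Y by (simp add: iid_exponential_def)
  have "AE y in lborel. (0::ennreal) < ennreal (exponential_density \<alpha> y) \<longrightarrow> 0 < (y::real)"
    using AE_lborel_singleton[of "0::real"] by eventually_elim (auto simp: exponential_density_def split: if_splits)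
  then show "AE \<omega> in M. 0 < Y i \<omega>"
    by (subst distributed_AE2[OF d]) auto
qed

text \<open>The event is split by the claim number j at time s. With claims numbered from 0 the
  increment of the aggregate claims on \<open>E j\<close> is \<open>Y j\<close>, which is
  independent of \<open>E j\<close>, an event of \<open>N\<close>; all \<open>Y j\<close> have the
  same law.\<close>

lemma one_claim_law:
  assumes M: "prob_space M" and N: "poisson_process M lam N" and Y: "iid_exponential M \<alpha> Y"
    and ind: "indep_claims M N Y" and lam: "0 < lam" and st: "0 \<le> s" "s < t" and A: "A \<in> sets borel"
  shows "emeasure M {\<omega>\<in>space M. N t \<omega> = Suc (N s \<omega>) \<and> aggregate_claims N Y t \<omega> - aggregate_claims N Y s \<omega> \<in> A}
    = ennreal (lam * (t - s) * exp (- (lam * (t - s)))) * emeasure (density lborel (exponential_density \<alpha>)) A"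
proof -
  interpret prob_space M by fact
  have [measurable]: "N t \<in> measurable M (count_space UNIV)" "N s \<in> measurable M (count_space UNIV)"
    using N st by (auto simp: poisson_process_def)
  have dY: "distributed M lborel (Y i) (exponential_density \<alpha>)" for i using Y by (simp add: iid_exponential_def)
  have [measurable]: "Y i \<in> borel_measurable M" for i using distributed_measurable[OF dY] by simp
  define E where "E j = {\<omega>\<in>space M. N s \<omega> = j \<and> N t \<omega> = Suc j}" for j
  define H where "H j = {\<omega>\<in>space M. Y j \<omega> \<in> A}" for j
  have [measurable]: "E j \<in> sets M" "H j \<in> sets M" for j using A unfolding E_def H_def by measurable
  have EH: "prob (E j \<inter> H j) = prob (E j) * prob (H j)" for j
  proof (rule indep_setD)
    show "indep_set (sets (vimage_algebra (space M) (\<lambda>\<omega>. restrict (\<lambda>t. N t \<omega>) {0..}) (Pi\<^sub>M {0..} (\<lambda>_. count_space UNIV))))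
       (sets (vimage_algebra (space M) (\<lambda>\<omega> i. Y i \<omega>) (Pi\<^sub>M UNIV (\<lambda>_. borel))))"
      using ind by (simp add: indep_claims_def)
    let ?P = "Pi\<^sub>M {0::real..} (\<lambda>_. count_space (UNIV :: nat set))"
    have [measurable]: "(\<lambda>f. f s) \<in> measurable ?P (count_space UNIV)" "(\<lambda>f. f t) \<in> measurable ?P (count_space UNIV)"
      using st by (auto intro!: measurable_component_singleton)
    have "{f\<in>space ?P. f s = j \<and> f t = Suc j} \<in> sets ?P" by measurable
    from in_vimage_algebra[OF this, of "\<lambda>\<omega>. restrict (\<lambda>t. N t \<omega>) {0..}" "space M"]
    show "E j \<in> sets (vimage_algebra (space M) (\<lambda>\<omega>. restrict (\<lambda>t. N t \<omega>) {0..}) ?P)"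
      by (rule back_subst[of "\<lambda>S. S \<in> _"]) (use st in \<open>auto simp: E_def space_PiM\<close>)
    let ?Q = "Pi\<^sub>M UNIV (\<lambda>_::nat. borel :: real measure)"
    have "{f\<in>space ?Q. f j \<in> A} \<in> sets ?Q" using A by measurable
    from in_vimage_algebra[OF this, of "\<lambda>\<omega> i. Y i \<omega>" "space M"]
    show "H j \<in> sets (vimage_algebra (space M) (\<lambda>\<omega> i. Y i \<omega>) ?Q)"
      by (rule back_subst[of "\<lambda>S. S \<in> _"]) (auto simp: H_def space_PiM)
  qed
  have H: "emeasure M (H j) = emeasure (density lborel (exponential_density \<alpha>)) A" for j
  proof -
    have "emeasure M (H j) = emeasure (distr M lborel (Y j)) A"
      using A by (subst emeasure_distr) (auto simp: H_def intro!: arg_cong[of _ _ "emeasure M"])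
    then show ?thesis using distributed_distr_eq_density[OF dY[of j]] by simp
  qed
  have "{\<omega>\<in>space M. N t \<omega> = Suc (N s \<omega>) \<and> aggregate_claims N Y t \<omega> - aggregate_claims N Y s \<omega> \<in> A} = (\<Union>j. E j \<inter> H j)"
    by (auto simp: E_def H_def aggregate_claims_def)
  then have "emeasure M {\<omega>\<in>space M. N t \<omega> = Suc (N s \<omega>) \<and> aggregate_claims N Y t \<omega> - aggregate_claims N Y s \<omega> \<in> A}
     = (\<Sum>j. emeasure M (E j \<inter> H j))"
    by (simp, intro suminf_emeasure[symmetric]) (auto simp: disjoint_family_on_def E_def)
  also have "\<dots> = (\<Sum>j. emeasure M (E j) * emeasure (density lborel (exponential_density \<alpha>)) A)"
  proof (rule suminf_cong)
    fix j
    have "emeasure M (E j \<inter> H j) = emeasure M (E j) * emeasure M (H j)"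
      by (simp add: emeasure_eq_measure EH ennreal_mult)
    then show "emeasure M (E j \<inter> H j) = emeasure M (E j) * emeasure (density lborel (exponential_density \<alpha>)) A"
      by (simp only: H)
  qed
  also have "\<dots> = (\<Sum>j. emeasure M (E j)) * emeasure (density lborel (exponential_density \<alpha>)) A"
    by (rule ennreal_suminf_multc)
  also have "(\<Sum>j. emeasure M (E j)) = emeasure M (\<Union>j. E j)"
    by (intro suminf_emeasure) (auto simp: disjoint_family_on_def E_def)
  also have "(\<Union>j. E j) = {\<omega>\<in>space M. N t \<omega> = Suc (N s \<omega>)}" by (auto simp: E_def)
  also have "emeasure M \<dots> = ennreal (lam * (t - s) * exp (- (lam * (t - s))))"
    using poisson_increment_probs(1)[OF M N lam st] by (simp add: emeasure_eq_measure)
  finally show ?thesis .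
qed

text \<open>The image of the measure restricted to the event is a multiple of the exponential law.
  Equality of measures transfers to integrals of f without a separate discussion of
  integrability.\<close>

lemma one_claim_expectation:
  assumes M: "prob_space M" and N: "poisson_process M lam N" and Y: "iid_exponential M \<alpha> Y"
    and ind: "indep_claims M N Y" and lam: "0 < lam" and \<alpha>: "0 < \<alpha>" and st: "0 \<le> s" "s < t"
    and S: "(\<lambda>\<omega>. aggregate_claims N Y t \<omega> - aggregate_claims N Y s \<omega>) \<in> borel_measurable M"
    and f: "f \<in> borel_measurable borel"
  shows "(\<integral>\<omega>. indicator {\<omega>\<in>space M. N t \<omega> = Suc (N s \<omega>)} \<omega> * f (aggregate_claims N Y t \<omega> - aggregate_claims N Y s \<omega>) \<partial>M)
    = lam * (t - s) * exp (- (lam * (t - s))) * (\<integral>y. exponential_density \<alpha> y * f y \<partial>lborel)"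
proof -
  interpret prob_space M by fact
  have [measurable]: "N t \<in> measurable M (count_space UNIV)" "N s \<in> measurable M (count_space UNIV)"
    using N st by (auto simp: poisson_process_def)
  let ?S = "\<lambda>\<omega>. aggregate_claims N Y t \<omega> - aggregate_claims N Y s \<omega>"
  let ?E = "{\<omega>\<in>space M. N t \<omega> = Suc (N s \<omega>)}"
  let ?p = "lam * (t - s) * exp (- (lam * (t - s)))"
  note S[measurable] f[measurable]
  have "?E = (\<Union>j. {\<omega>\<in>space M. N s \<omega> = j \<and> N t \<omega> = Suc j})" by auto
  also have "\<dots> \<in> sets M" by measurable
  finally have E[measurable]: "?E \<in> sets M" .
  have p: "0 \<le> ?p" using lam st by simp
  have eq: "distr (density M (\<lambda>\<omega>. ennreal (indicator ?E \<omega>))) borel ?S = density (density lborel (exponential_density \<alpha>)) (\<lambda>_. ennreal ?p)"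
  proof (rule measure_eqI)
    fix A assume "A \<in> sets (distr (density M (\<lambda>\<omega>. ennreal (indicator ?E \<omega>))) borel ?S)"
    then have A[measurable]: "A \<in> sets borel" by simp
    have "emeasure (distr (density M (\<lambda>\<omega>. ennreal (indicator ?E \<omega>))) borel ?S) A
       = emeasure (density M (\<lambda>\<omega>. ennreal (indicator ?E \<omega>))) (?S -` A \<inter> space M)"
      by (subst emeasure_distr) auto
    also have "\<dots> = (\<integral>\<^sup>+\<omega>. ennreal (indicator ?E \<omega>) * indicator (?S -` A \<inter> space M) \<omega> \<partial>M)"
      by (rule emeasure_density) auto
    also have "\<dots> = (\<integral>\<^sup>+\<omega>. indicator {\<omega>\<in>space M. N t \<omega> = Suc (N s \<omega>) \<and> ?S \<omega> \<in> A} \<omega> \<partial>M)"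
      by (rule nn_integral_cong) (auto split: split_indicator)
    also have "\<dots> = emeasure M {\<omega>\<in>space M. N t \<omega> = Suc (N s \<omega>) \<and> ?S \<omega> \<in> A}"
    proof (rule nn_integral_indicator)
      have "{\<omega>\<in>space M. N t \<omega> = Suc (N s \<omega>) \<and> ?S \<omega> \<in> A} = ?E \<inter> {\<omega>\<in>space M. ?S \<omega> \<in> A}" by auto
      also have "\<dots> \<in> sets M" by measurable
      finally show "{\<omega>\<in>space M. N t \<omega> = Suc (N s \<omega>) \<and> ?S \<omega> \<in> A} \<in> sets M" .
    qed
    also have "\<dots> = ennreal ?p * emeasure (density lborel (exponential_density \<alpha>)) A"
      by (rule one_claim_law[OF M N Y ind lam st A])
    also have "\<dots> = emeasure (density (density lborel (exponential_density \<alpha>)) (\<lambda>_. ennreal ?p)) A"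
      by (subst emeasure_density_const) auto
    finally show "emeasure (distr (density M (\<lambda>\<omega>. ennreal (indicator ?E \<omega>))) borel ?S) A
      = emeasure (density (density lborel (exponential_density \<alpha>)) (\<lambda>_. ennreal ?p)) A" .
  qed simp
  have "(\<integral>\<omega>. indicator ?E \<omega> * f (?S \<omega>) \<partial>M) = (\<integral>\<omega>. f (?S \<omega>) \<partial>density M (\<lambda>\<omega>. ennreal (indicator ?E \<omega>)))"
    by (subst integral_density) auto
  also have "\<dots> = (\<integral>y. f y \<partial>distr (density M (\<lambda>\<omega>. ennreal (indicator ?E \<omega>))) borel ?S)"
    by (subst integral_distr) auto
  also have "\<dots> = (\<integral>y. f y \<partial>density (density lborel (exponential_density \<alpha>)) (\<lambda>_. ennreal ?p))"
    by (simp only: eq)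
  also have "\<dots> = ?p * (\<integral>y. f y \<partial>density lborel (exponential_density \<alpha>))"
    using p by (subst integral_density) auto
  also have "(\<integral>y. f y \<partial>density lborel (exponential_density \<alpha>)) = (\<integral>y. exponential_density \<alpha> y * f y \<partial>lborel)"
    using \<alpha> by (subst integral_density) (auto simp: exponential_density_nonneg)
  finally show ?thesis .
qed

text \<open>A function that is not integrable has integral 0 by convention, so the bound covers it
  as well.\<close>

lemma (in prob_space) integral_abs_le_const:
  fixes f :: "'a \<Rightarrow> real"
  assumes "AE x in M. \<bar>f x\<bar> \<le> c" "0 \<le> c"
  shows "\<bar>\<integral>x. f x \<partial>M\<bar> \<le> c"
proof (cases "integrable M f")
  case True
  have "\<bar>\<integral>x. f x \<partial>M\<bar> \<le> (\<integral>x. \<bar>f x\<bar> \<partial>M)" by (rule integral_abs_bound)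
  also have "\<dots> \<le> (\<integral>x. c \<partial>M)" using True assms by (intro integral_mono_AE) auto
  finally show ?thesis by (simp add: prob_space)
qed (use assms in \<open>simp add: not_integrable_integral_eq\<close>)

section \<open>Claims relative to the filtration\<close>

locale risk_model = prob_space M for M :: "'a measure" +
  fixes F :: "real \<Rightarrow> 'a measure" and N :: "real \<Rightarrow> 'a \<Rightarrow> nat" and Y :: "nat \<Rightarrow> 'a \<Rightarrow> real"
    and lam \<alpha> :: real
  assumes usual: "filtration_usual M F" and lam_pos: "0 < lam" and \<alpha>_pos: "0 < \<alpha>"
    and poisson: "poisson_process M lam N" and claims: "iid_exponential M \<alpha> Y"
    and indep: "indep_claims M N Y" and incr: "increments_relative_to M F (aggregate_claims N Y)"
begin

abbreviation S :: "real \<Rightarrow> 'a \<Rightarrow> real" where "S \<equiv> aggregate_claims N Y"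

lemma usualD:
  shows "\<forall>t\<ge>0. subalgebra M (F t)" "\<forall>s t. 0 \<le> s \<longrightarrow> s \<le> t \<longrightarrow> sets (F s) \<subseteq> sets (F t)"
    "complete_measure M" "null_sets M \<subseteq> sets (F 0)"
proof -
  note u = usual[unfolded filtration_usual_def]
  show "\<forall>t\<ge>0. subalgebra M (F t)" by (rule u[THEN conjunct1])
  show "\<forall>s t. 0 \<le> s \<longrightarrow> s \<le> t \<longrightarrow> sets (F s) \<subseteq> sets (F t)" by (rule u[THEN conjunct2, THEN conjunct1])
  show "complete_measure M" by (rule u[THEN conjunct2, THEN conjunct2, THEN conjunct1])
  show "null_sets M \<subseteq> sets (F 0)" by (rule u[THEN conjunct2, THEN conjunct2, THEN conjunct2, THEN conjunct1])
qed

lemma F_subalgebra: "0 \<le> t \<Longrightarrow> subalgebra M (F t)"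
  using usualD(1) by blast

lemma space_F: "0 \<le> t \<Longrightarrow> space (F t) = space M"
  using F_subalgebra by (simp add: subalgebra_def)

lemma sets_F_mono: "0 \<le> s \<Longrightarrow> s \<le> t \<Longrightarrow> sets (F s) \<subseteq> sets (F t)"
  using usualD(2) by blast

lemma measurable_F_mono: "f \<in> measurable (F s) A \<Longrightarrow> 0 \<le> s \<Longrightarrow> s \<le> t \<Longrightarrow> f \<in> measurable (F t) A"
  using sets_F_mono[of s t] by (auto simp: measurable_def space_F)

lemma measurable_F_M: "f \<in> measurable (F t) A \<Longrightarrow> 0 \<le> t \<Longrightarrow> f \<in> measurable M A"
  using F_subalgebra by (rule measurable_from_subalg)

lemma S_F: "0 \<le> t \<Longrightarrow> S t \<in> borel_measurable (F t)"
  using incr by (auto simp: increments_relative_to_def adapted_def)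

lemma S_M[measurable]: "0 \<le> t \<Longrightarrow> S t \<in> borel_measurable M"
  using S_F measurable_F_M by blast

lemma AE_claims: "AE \<omega> in M. N 0 \<omega> = 0 \<and> mono_on {0..} (\<lambda>t. N t \<omega>) \<and> cadlag (\<lambda>t. real (N t \<omega>)) \<and> (\<forall>i. 0 < Y i \<omega>)"
  using poisson exponential_claims_pos[OF prob_space_axioms claims \<alpha>_pos] unfolding poisson_process_def by auto

text \<open>By completeness every subset of the exceptional null set belongs to \<open>F 0\<close>.
  In this way objects determined only almost surely become adapted.\<close>

lemma measurable_F_AE:
  fixes f h :: "'a \<Rightarrow> real"
  assumes t: "0 \<le> t" and f: "f \<in> borel_measurable (F t)" and ae: "AE \<omega> in M. f \<omega> = h \<omega>"
  shows "h \<in> borel_measurable (F t)"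
proof (rule measurableI)
  fix A :: "real set" assume A: "A \<in> sets borel"
  have null: "null_sets M \<subseteq> sets (F t)" using usualD(4) sets_F_mono[of 0 t] t by auto
  note compl = usualD(3)
  interpret complete_measure M by fact
  from ae obtain Z where Z: "Z \<in> null_sets M" "{\<omega>\<in>space M. f \<omega> \<noteq> h \<omega>} \<subseteq> Z" by (rule AE_E) auto
  have "h -` A \<inter> Z \<inter> space M \<in> null_sets M" using Z(1) by (rule complete2[rotated]) auto
  then have 1: "h -` A \<inter> Z \<inter> space M \<in> sets (F t)" using null by auto
  have 2: "f -` A \<inter> space M - Z \<in> sets (F t)"
    using measurable_sets[OF f A] space_F[OF t] Z(1) null by auto
  have "h -` A \<inter> space (F t) = (f -` A \<inter> space M - Z) \<union> (h -` A \<inter> Z \<inter> space M)"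
    using Z(2) space_F[OF t] by auto
  with 1 2 show "h -` A \<inter> space (F t) \<in> sets (F t)" by auto
qed simp

lemma increment_indep_var:
  assumes st: "0 \<le> s" "s \<le> t" and z: "z \<in> borel_measurable (F s)"
  shows "indep_var borel z borel (\<lambda>\<omega>. S t \<omega> - S s \<omega>)"
proof -
  have ind: "indep_set (sets (F s)) (sets (vimage_algebra (space M) (\<lambda>\<omega>. S t \<omega> - S s \<omega>) borel))"
    using incr st by (auto simp: increments_relative_to_def)
  have 1: "sigma_sets (space M) {z -` A \<inter> space M |A. A \<in> sets borel} \<subseteq> sets (F s)"
  proof -
    have "sigma_sets (space (F s)) {z -` A \<inter> space M |A. A \<in> sets borel} \<subseteq> sets (F s)"
      by (rule sets.sigma_sets_subset) (use measurable_sets[OF z] space_F[OF st(1)] in auto)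
    then show ?thesis using space_F[OF st(1)] by simp
  qed
  have 2: "sigma_sets (space M) {(\<lambda>\<omega>. S t \<omega> - S s \<omega>) -` A \<inter> space M |A. A \<in> sets borel}
     \<subseteq> sets (vimage_algebra (space M) (\<lambda>\<omega>. S t \<omega> - S s \<omega>) borel)"
    by (simp add: sets_vimage_algebra)
  have "indep_set (sigma_sets (space M) {z -` A \<inter> space M |A. A \<in> sets borel})
      (sigma_sets (space M) {(\<lambda>\<omega>. S t \<omega> - S s \<omega>) -` A \<inter> space M |A. A \<in> sets borel})"
    using ind unfolding indep_set_def
    by (rule indep_sets_mono_sets) (use 1 2 in \<open>auto split: bool.split\<close>)
  then show ?thesis using measurable_F_M[OF z] st by (simp add: indep_var_eq)
qed

text \<open>Let z = lam (t - s). Without a claim the integrand is 0; a single claim has an exact law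
  of weight z exp(- z); two or more claims have probability at most z^2. Replacing exp(- z) by 1
  costs another c z^2, whence the factor 2.\<close>

lemma claim_increment_expectation:
  assumes st: "0 \<le> s" "s < t" and f[measurable]: "f \<in> borel_measurable borel" and c: "\<And>y. \<bar>f y\<bar> \<le> c"
  shows "\<bar>(\<integral>\<omega>. (if 0 < S t \<omega> - S s \<omega> then f (S t \<omega> - S s \<omega>) else 0) \<partial>M)
      - lam * (t - s) * (\<integral>y. exponential_density \<alpha> y * f y \<partial>lborel)\<bar> \<le> 2 * c * (lam * (t - s))\<^sup>2"
proof -
  define z where "z = lam * (t - s)"
  have z: "0 < z" using lam_pos st by (simp add: z_def)
  have c0: "0 \<le> c" using c[of 0] by linarith
  have [measurable]: "N t \<in> measurable M (count_space UNIV)" "N s \<in> measurable M (count_space UNIV)"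
    using poisson st by (auto simp: poisson_process_def)
  have [measurable]: "S t \<in> borel_measurable M" "S s \<in> borel_measurable M" using st by auto
  let ?D = "\<lambda>\<omega>. S t \<omega> - S s \<omega>"
  let ?X = "\<lambda>\<omega>. if 0 < ?D \<omega> then f (?D \<omega>) else 0"
  let ?E = "{\<omega>\<in>space M. N t \<omega> = Suc (N s \<omega>)}"
  define E2 where "E2 = {\<omega>\<in>space M. N s \<omega> + 2 \<le> N t \<omega>}"
  have "?E = (\<Union>j. {\<omega>\<in>space M. N s \<omega> = j \<and> N t \<omega> = Suc j})" by auto
  also have "\<dots> \<in> sets M" by measurable
  finally have E[measurable]: "?E \<in> sets M" .
  have "E2 = (\<Union>j. {\<omega>\<in>space M. N s \<omega> = j \<and> j + 2 \<le> N t \<omega>})" by (auto simp: E2_def)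
  also have "\<dots> \<in> sets M" by measurable
  finally have E2m[measurable]: "E2 \<in> sets M" .
  let ?I = "\<integral>y. exponential_density \<alpha> y * f y \<partial>lborel"
  have ae: "AE \<omega> in M. ?X \<omega> = indicator ?E \<omega> * f (?D \<omega>) + indicator E2 \<omega> * ?X \<omega>"
    using AE_claims AE_space
  proof eventually_elim
    case (elim \<omega>)
    then have le: "N s \<omega> \<le> N t \<omega>" using st by (auto simp: mono_on_def)
    consider "N t \<omega> = N s \<omega>" | "N t \<omega> = Suc (N s \<omega>)" | "N s \<omega> + 2 \<le> N t \<omega>" using le by linarith
    then show ?case
    proof cases
      case 2
      then have "?D \<omega> = Y (N s \<omega>) \<omega>" by (simp add: aggregate_claims_def)
      then show ?thesis using 2 elim by (simp add: E2_def)
    qed (use elim in \<open>auto simp: aggregate_claims_def E2_def\<close>)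
  qed
  have m0: "?X \<in> borel_measurable M" by measurable
  have m1: "(\<lambda>\<omega>. indicator ?E \<omega> * f (?D \<omega>)) \<in> borel_measurable M" by measurable
  have m2: "(\<lambda>\<omega>. indicator E2 \<omega> * ?X \<omega>) \<in> borel_measurable M"
    using E2m m0 by (intro borel_measurable_times borel_measurable_indicator)
  have i1: "integrable M (\<lambda>\<omega>. indicator ?E \<omega> * f (?D \<omega>))"
    by (rule integrable_const_bound[OF _ m1, of c]) (use c c0 in \<open>auto split: split_indicator\<close>)
  have i2: "integrable M (\<lambda>\<omega>. indicator E2 \<omega> * ?X \<omega>)"
    by (rule integrable_const_bound[OF _ m2, of c]) (use c c0 in \<open>auto split: split_indicator\<close>)
  have "(\<integral>\<omega>. ?X \<omega> \<partial>M) = (\<integral>\<omega>. indicator ?E \<omega> * f (?D \<omega>) + indicator E2 \<omega> * ?X \<omega> \<partial>M)"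
    by (rule integral_cong_AE[OF m0 borel_measurable_add[OF m1 m2] ae])
  also have "\<dots> = (\<integral>\<omega>. indicator ?E \<omega> * f (?D \<omega>) \<partial>M) + (\<integral>\<omega>. indicator E2 \<omega> * ?X \<omega> \<partial>M)"
    using i1 i2 by (rule Bochner_Integration.integral_add)
  also have "(\<integral>\<omega>. indicator ?E \<omega> * f (?D \<omega>) \<partial>M) = z * exp (- z) * ?I"
    using one_claim_expectation[OF prob_space_axioms poisson claims indep lam_pos \<alpha>_pos st, of f] by (simp add: z_def)
  finally have eq: "(\<integral>\<omega>. ?X \<omega> \<partial>M) = z * exp (- z) * ?I + (\<integral>\<omega>. indicator E2 \<omega> * ?X \<omega> \<partial>M)" .
  have b2: "\<bar>\<integral>\<omega>. indicator E2 \<omega> * ?X \<omega> \<partial>M\<bar> \<le> c * z\<^sup>2"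
  proof -
    have iE2: "integrable M (indicator E2 :: 'a \<Rightarrow> real)"
      by (rule integrable_const_bound[of _ 1]) (auto split: split_indicator)
    have "\<bar>\<integral>\<omega>. indicator E2 \<omega> * ?X \<omega> \<partial>M\<bar> \<le> (\<integral>\<omega>. \<bar>indicator E2 \<omega> * ?X \<omega>\<bar> \<partial>M)" by (rule integral_abs_bound)
    also have "\<dots> \<le> (\<integral>\<omega>. c * indicator E2 \<omega> \<partial>M)"
      by (intro integral_mono integrable_abs i2 integrable_mult_right iE2) (use c c0 in \<open>auto split: split_indicator\<close>)
    also have "\<dots> = c * prob E2" by simp
    also have "\<dots> \<le> c * z\<^sup>2"
      using poisson_increment_probs(2)[OF prob_space_axioms poisson lam_pos st] c0 by (intro mult_left_mono) (auto simp: z_def E2_def)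
    finally show ?thesis .
  qed
  have I: "\<bar>?I\<bar> \<le> c"
  proof -
    interpret e: prob_space "density lborel (exponential_density \<alpha>)" by (rule prob_space_exponential_density[OF \<alpha>_pos])
    have "?I = (\<integral>y. f y \<partial>density lborel (exponential_density \<alpha>))"
      using \<alpha>_pos by (subst integral_density) (auto simp: exponential_density_nonneg)
    then show ?thesis using e.integral_abs_le_const[of f c] c c0 by simp
  qed
  have "\<bar>z * exp (- z) * ?I - z * ?I\<bar> \<le> c * z\<^sup>2"
  proof -
    have "z * exp (- z) * ?I - z * ?I = - (z * (1 - exp (- z)) * ?I)" by (simp add: algebra_simps)
    then have "\<bar>z * exp (- z) * ?I - z * ?I\<bar> = z * (1 - exp (- z)) * \<bar>?I\<bar>" using z by (simp add: abs_mult)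
    also have "\<dots> \<le> z * z * c"
      using z I exp_ge_add_one_self[of "- z"] by (intro mult_mono) auto
    finally show ?thesis by (simp add: power2_eq_square mult_ac)
  qed
  then have "\<bar>(\<integral>\<omega>. ?X \<omega> \<partial>M) - z * ?I\<bar> \<le> 2 * c * z\<^sup>2" unfolding eq using b2 by linarith
  then show ?thesis by (simp add: z_def)
qed

text \<open>Only the increments of the aggregate claims are assumed to be independent of \<open>F s\<close>, those of \<open>N\<close> are not;
  hence the number of claims may be used only after integrating out \<open>z\<close>.\<close>

lemma claim_increment_expectation_F:
  fixes k :: "real \<Rightarrow> real \<Rightarrow> real"
  assumes st: "0 \<le> s" "s < t" and z: "z \<in> borel_measurable (F s)"
    and k[measurable]: "(\<lambda>(u, y). k u y) \<in> borel_measurable (borel \<Otimes>\<^sub>M borel)" and c: "\<And>u y. \<bar>k u y\<bar> \<le> c"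
  shows "\<bar>(\<integral>\<omega>. (if 0 < S t \<omega> - S s \<omega> then k (z \<omega>) (S t \<omega> - S s \<omega>) else 0) \<partial>M)
      - lam * (t - s) * (\<integral>\<omega>. (\<integral>y. exponential_density \<alpha> y * k (z \<omega>) y \<partial>lborel) \<partial>M)\<bar> \<le> 2 * c * (lam * (t - s))\<^sup>2"
proof -
  let ?D = "\<lambda>\<omega>. S t \<omega> - S s \<omega>"
  have [measurable]: "z \<in> borel_measurable M" using measurable_F_M[OF z] st by simp
  have [measurable]: "S t \<in> borel_measurable M" "S s \<in> borel_measurable M" using st by auto
  have D[measurable]: "?D \<in> borel_measurable M" by measurable
  have c0: "0 \<le> c" using c[of 0 0] by linarith
  let ?k = "\<lambda>(u, d). if 0 < d then k u d else 0"
  have km[measurable]: "?k \<in> borel_measurable (borel \<Otimes>\<^sub>M borel)" using k by (auto simp: split_beta')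
  have ksec[measurable]: "k u \<in> borel_measurable borel" for u
    using measurable_compose[OF _ k, of "\<lambda>y. (u, y)" borel] by simp
  interpret P: prob_space "distr M borel z" by (rule prob_space_distr) simp
  interpret Q: prob_space "distr M borel ?D" by (rule prob_space_distr) simp
  interpret PQ: pair_prob_space "distr M borel z" "distr M borel ?D" ..
  have joint: "distr M borel z \<Otimes>\<^sub>M distr M borel ?D = distr M (borel \<Otimes>\<^sub>M borel) (\<lambda>\<omega>. (z \<omega>, ?D \<omega>))"
    using increment_indep_var[OF st(1) less_imp_le[OF st(2)] z] by (subst (asm) indep_var_distribution_eq) auto
  let ?inner = "\<lambda>u. \<integral>\<omega>. (if 0 < ?D \<omega> then k u (?D \<omega>) else 0) \<partial>M"
  let ?kap = "\<lambda>u. \<integral>y. exponential_density \<alpha> y * k u y \<partial>lborel"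
  have intk: "integrable (distr M borel z \<Otimes>\<^sub>M distr M borel ?D) ?k"
  proof (rule PQ.integrable_const_bound[of _ c])
    have "sets (distr M borel z \<Otimes>\<^sub>M distr M borel ?D) = sets (borel \<Otimes>\<^sub>M borel)"
      by (intro sets_pair_measure_cong) simp_all
    from measurable_cong_sets[OF this refl]
    show "?k \<in> borel_measurable (distr M borel z \<Otimes>\<^sub>M distr M borel ?D)" using km by blast
    show "AE v in distr M borel z \<Otimes>\<^sub>M distr M borel ?D. norm (?k v) \<le> c"
      using c c0 by (intro AE_I2) (simp add: split_beta)
  qed
  have "(\<integral>\<omega>. (if 0 < ?D \<omega> then k (z \<omega>) (?D \<omega>) else 0) \<partial>M) = (\<integral>v. ?k v \<partial>distr M (borel \<Otimes>\<^sub>M borel) (\<lambda>\<omega>. (z \<omega>, ?D \<omega>)))"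
  proof -
    have "(\<lambda>\<omega>. (z \<omega>, ?D \<omega>)) \<in> measurable M (borel \<Otimes>\<^sub>M borel)" by measurable
    from integral_distr[OF this km] show ?thesis by (simp only: split)
  qed
  also have "\<dots> = (\<integral>u. (\<integral>d. ?k (u, d) \<partial>distr M borel ?D) \<partial>distr M borel z)"
    unfolding joint[symmetric] using intk by (rule PQ.integral_fst'[symmetric])
  also have "(\<lambda>u. \<integral>d. ?k (u, d) \<partial>distr M borel ?D) = ?inner"
    by (rule ext, subst integral_distr) auto
  finally have e1: "(\<integral>\<omega>. (if 0 < ?D \<omega> then k (z \<omega>) (?D \<omega>) else 0) \<partial>M) = (\<integral>u. ?inner u \<partial>distr M borel z)" .
  have kapm[measurable]: "?kap \<in> borel_measurable borel"
    by (intro lborel.borel_measurable_lebesgue_integral) (simp add: split_beta')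
  have inm[measurable]: "?inner \<in> borel_measurable borel"
    by (intro borel_measurable_lebesgue_integral) (simp add: split_beta')
  have e2: "(\<integral>\<omega>. ?kap (z \<omega>) \<partial>M) = (\<integral>u. ?kap u \<partial>distr M borel z)"
    by (subst integral_distr) auto
  have kapb: "\<bar>?kap u\<bar> \<le> c" for u
  proof -
    interpret e: prob_space "density lborel (exponential_density \<alpha>)" by (rule prob_space_exponential_density[OF \<alpha>_pos])
    have "?kap u = (\<integral>y. k u y \<partial>density lborel (exponential_density \<alpha>))"
      using \<alpha>_pos by (subst integral_density) (auto simp: exponential_density_nonneg)
    then show ?thesis using e.integral_abs_le_const[of "k u" c] c c0 by simp
  qed
  have inb: "\<bar>?inner u\<bar> \<le> c" for u by (rule integral_abs_le_const) (use c c0 in auto)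
  have i1: "integrable (distr M borel z) ?inner" by (rule P.integrable_const_bound[of _ c]) (use inb in auto)
  have i2: "integrable (distr M borel z) (\<lambda>u. lam * (t - s) * ?kap u)"
    by (intro integrable_mult_right P.integrable_const_bound[of _ c]) (use kapb in auto)
  have "(\<integral>u. ?inner u \<partial>distr M borel z) - lam * (t - s) * (\<integral>u. ?kap u \<partial>distr M borel z)
     = (\<integral>u. ?inner u - lam * (t - s) * ?kap u \<partial>distr M borel z)"
    by (subst Bochner_Integration.integral_diff[OF i1 i2]) simp
  also have "\<bar>\<dots>\<bar> \<le> 2 * c * (lam * (t - s))\<^sup>2"
    by (rule P.integral_abs_le_const) (use claim_increment_expectation[OF st ksec c] c0 in auto)
  finally show ?thesis unfolding e1 e2 .
qed

end

section \<open>Discretised expectations\<close>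

text \<open>Fatou's lemma for the nonnegative functions f m + w. As \<phi> may fail to be
  measurable, the conclusion is stated for a measurable majorant, namely liminf (f m + w) -
  w.\<close>

lemma nn_integral_dominated_upper:
  fixes f :: "nat \<Rightarrow> 'a \<Rightarrow> real" and w :: "'a \<Rightarrow> real" and \<phi> :: "'a \<Rightarrow> ennreal"
  assumes f[measurable]: "\<And>m. f m \<in> borel_measurable M" and w: "integrable M w"
    and dom: "\<And>m. AE \<omega> in M. \<bar>f m \<omega>\<bar> \<le> w \<omega>" and c: "0 \<le> c"
    and le: "\<And>e. 0 < e \<Longrightarrow> AE \<omega> in M. \<forall>\<^sub>F m in sequentially. 0 \<le> f m \<omega> + e \<and> \<phi> \<omega> \<le> ennreal (f m \<omega> + e)"
    and E: "\<And>e. 0 < e \<Longrightarrow> \<forall>\<^sub>F m in sequentially. (\<integral>\<omega>. f m \<omega> \<partial>M) \<le> c + e"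
  obtains H where "H \<in> borel_measurable M" "AE \<omega> in M. \<phi> \<omega> \<le> H \<omega>" "(\<integral>\<^sup>+\<omega>. H \<omega> \<partial>M) \<le> ennreal c"
proof -
  have [measurable]: "w \<in> borel_measurable M" using w by auto
  define H' where "H' \<omega> = liminf (\<lambda>m. ennreal (f m \<omega> + w \<omega>))" for \<omega>
  have H'm[measurable]: "H' \<in> borel_measurable M" unfolding H'_def by measurable
  have dom': "AE \<omega> in M. \<forall>m. \<bar>f m \<omega>\<bar> \<le> w \<omega>" using dom by (simp add: AE_all_countable)
  have w0: "AE \<omega> in M. 0 \<le> w \<omega>" using dom' by eventually_elim (metis abs_ge_zero order_trans)
  have fi: "integrable M (f m)" for m
    by (rule Bochner_Integration.integrable_bound[OF w]) (use dom[of m] in auto)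
  \<comment> \<open>Only the countably many values e = 1 / (j + 1) are used, so that a single null
    set suffices.\<close>
  have le': "AE \<omega> in M. \<forall>j::nat. \<forall>\<^sub>F m in sequentially. 0 \<le> f m \<omega> + 1 / real (Suc j) \<and> \<phi> \<omega> \<le> ennreal (f m \<omega> + 1 / real (Suc j))"
    by (subst AE_all_countable, intro allI le) simp
  have key: "AE \<omega> in M. \<phi> \<omega> + ennreal (w \<omega>) \<le> H' \<omega>"
    using le' dom' w0
  proof eventually_elim
    case (elim \<omega>)
    have step: "\<phi> \<omega> + ennreal (w \<omega>) \<le> H' \<omega> + ennreal (1 / real (Suc j))" for j
    proof -
      have "\<forall>\<^sub>F m in sequentially. (\<phi> \<omega> + ennreal (w \<omega>)) - ennreal (1 / real (Suc j)) \<le> ennreal (f m \<omega> + w \<omega>)"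
        using elim(1)[rule_format, of j]
      proof eventually_elim
        case (elim m)
        have fw: "0 \<le> f m \<omega> + w \<omega>" using \<open>\<forall>m. \<bar>f m \<omega>\<bar> \<le> w \<omega>\<close>[rule_format, of m] by linarith
        have "\<phi> \<omega> + ennreal (w \<omega>) \<le> ennreal (f m \<omega> + 1 / real (Suc j)) + ennreal (w \<omega>)"
          using elim by (intro add_right_mono) auto
        also have "\<dots> = ennreal (f m \<omega> + w \<omega>) + ennreal (1 / real (Suc j))"
          using elim fw \<open>0 \<le> w \<omega>\<close> by (subst (1 2) ennreal_plus[symmetric]) (auto simp: algebra_simps)
        finally show ?case by (simp add: ennreal_minus_le_iff add.commute)
      qed
      then have "(\<phi> \<omega> + ennreal (w \<omega>)) - ennreal (1 / real (Suc j)) \<le> H' \<omega>"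
        unfolding H'_def by (rule Liminf_bounded)
      then show ?thesis by (simp add: ennreal_minus_le_iff add.commute)
    qed
    show ?case
    proof (rule ennreal_le_epsilon)
      fix e :: real assume "0 < e"
      then obtain j where "inverse (real (Suc j)) < e" using reals_Archimedean by blast
      then have "ennreal (1 / real (Suc j)) \<le> ennreal e" by (intro ennreal_leI) (simp add: divide_inverse)
      then show "\<phi> \<omega> + ennreal (w \<omega>) \<le> H' \<omega> + ennreal e"
        using step[of j] by (meson add_left_mono order_trans)
    qed
  qed
  have intw: "(\<integral>\<^sup>+\<omega>. ennreal (w \<omega>) \<partial>M) = ennreal (\<integral>\<omega>. w \<omega> \<partial>M)"
    by (rule nn_integral_eq_integral[OF w w0])
  have iw0: "0 \<le> (\<integral>\<omega>. w \<omega> \<partial>M)" by (rule integral_nonneg_AE[OF w0])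
  have H'int: "(\<integral>\<^sup>+\<omega>. H' \<omega> \<partial>M) \<le> ennreal (c + (\<integral>\<omega>. w \<omega> \<partial>M))"
  proof (rule ennreal_le_epsilon)
    fix e :: real assume e: "0 < e"
    have "(\<integral>\<^sup>+\<omega>. H' \<omega> \<partial>M) \<le> liminf (\<lambda>m. \<integral>\<^sup>+\<omega>. ennreal (f m \<omega> + w \<omega>) \<partial>M)"
      unfolding H'_def by (rule nn_integral_liminf) measurable
    also have "\<dots> \<le> limsup (\<lambda>m. \<integral>\<^sup>+\<omega>. ennreal (f m \<omega> + w \<omega>) \<partial>M)" by (rule Liminf_le_Limsup) simp
    also have "\<dots> \<le> ennreal (c + (\<integral>\<omega>. w \<omega> \<partial>M)) + ennreal e"
    proof (rule Limsup_bounded)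
      show "\<forall>\<^sub>F m in sequentially. (\<integral>\<^sup>+\<omega>. ennreal (f m \<omega> + w \<omega>) \<partial>M) \<le> ennreal (c + (\<integral>\<omega>. w \<omega> \<partial>M)) + ennreal e"
        using E[OF e]
      proof eventually_elim
        case (elim m)
        have "AE \<omega> in M. 0 \<le> f m \<omega> + w \<omega>" using dom[of m] by eventually_elim linarith
        then have "(\<integral>\<^sup>+\<omega>. ennreal (f m \<omega> + w \<omega>) \<partial>M) = ennreal (\<integral>\<omega>. f m \<omega> + w \<omega> \<partial>M)"
          using fi w by (intro nn_integral_eq_integral) auto
        also have "(\<integral>\<omega>. f m \<omega> + w \<omega> \<partial>M) = (\<integral>\<omega>. f m \<omega> \<partial>M) + (\<integral>\<omega>. w \<omega> \<partial>M)"
          using fi w by (intro Bochner_Integration.integral_add)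
        also have "ennreal \<dots> \<le> ennreal (c + (\<integral>\<omega>. w \<omega> \<partial>M) + e)" using elim by (intro ennreal_leI) simp
        also have "\<dots> = ennreal (c + (\<integral>\<omega>. w \<omega> \<partial>M)) + ennreal e" using c iw0 e by (intro ennreal_plus) auto
        finally show ?case .
      qed
    qed
    finally show "(\<integral>\<^sup>+\<omega>. H' \<omega> \<partial>M) \<le> ennreal (c + (\<integral>\<omega>. w \<omega> \<partial>M)) + ennreal e" .
  qed
  show ?thesis
  proof (rule that)
    show "(\<lambda>\<omega>. H' \<omega> - ennreal (w \<omega>)) \<in> borel_measurable M" by measurable
    show "AE \<omega> in M. \<phi> \<omega> \<le> H' \<omega> - ennreal (w \<omega>)" using key
    proof eventually_elim
      case (elim \<omega>)
      then have "(\<phi> \<omega> + ennreal (w \<omega>)) - ennreal (w \<omega>) \<le> H' \<omega> - ennreal (w \<omega>)" by (intro ennreal_minus_mono) auto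
      then show ?case by simp
    qed
    have "AE \<omega> in M. ennreal (w \<omega>) \<le> H' \<omega>" using key by eventually_elim (meson add_increasing order_trans order_refl zero_le)
    then have "(\<integral>\<^sup>+\<omega>. H' \<omega> - ennreal (w \<omega>) \<partial>M) = (\<integral>\<^sup>+\<omega>. H' \<omega> \<partial>M) - (\<integral>\<^sup>+\<omega>. ennreal (w \<omega>) \<partial>M)"
      by (intro nn_integral_diff) (auto simp: intw)
    also have "\<dots> \<le> ennreal (c + (\<integral>\<omega>. w \<omega> \<partial>M)) - ennreal (\<integral>\<omega>. w \<omega> \<partial>M)"
      unfolding intw using H'int by (intro ennreal_minus_mono) auto
    also have "\<dots> = ennreal c" using c iw0 by (simp add: ennreal_minus)
    finally show "(\<integral>\<^sup>+\<omega>. H' \<omega> - ennreal (w \<omega>) \<partial>M) \<le> ennreal c" .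
  qed
qed

text \<open>Reverse Fatou lemma with majorant w: the limsup of the positive parts of f m lies almost
  surely below \<phi>, and the integral is monotone.\<close>

lemma nn_integral_dominated_lower:
  fixes f :: "nat \<Rightarrow> 'a \<Rightarrow> real" and w :: "'a \<Rightarrow> real" and \<phi> :: "'a \<Rightarrow> ennreal"
  assumes f[measurable]: "\<And>m. f m \<in> borel_measurable M" and w: "integrable M w"
    and dom: "\<And>m. AE \<omega> in M. \<bar>f m \<omega>\<bar> \<le> w \<omega>"
    and le: "\<And>e. 0 < e \<Longrightarrow> AE \<omega> in M. \<forall>\<^sub>F m in sequentially. ennreal (f m \<omega> - e) \<le> \<phi> \<omega>"
    and E: "\<And>e. 0 < e \<Longrightarrow> \<forall>\<^sub>F m in sequentially. c - e \<le> (\<integral>\<omega>. f m \<omega> \<partial>M)"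
  shows "ennreal c \<le> (\<integral>\<^sup>+\<omega>. \<phi> \<omega> \<partial>M)"
proof -
  have [measurable]: "w \<in> borel_measurable M" using w by auto
  have fi: "integrable M (f m)" for m
    by (rule Bochner_Integration.integrable_bound[OF w]) (use dom[of m] in auto)
  have w0: "AE \<omega> in M. 0 \<le> w \<omega>" using dom[of 0] by eventually_elim linarith
  have le': "AE \<omega> in M. \<forall>j::nat. \<forall>\<^sub>F m in sequentially. ennreal (f m \<omega> - 1 / real (Suc j)) \<le> \<phi> \<omega>"
    by (subst AE_all_countable, intro allI le) simp
  have key: "AE \<omega> in M. limsup (\<lambda>m. ennreal (f m \<omega>)) \<le> \<phi> \<omega>"
    using le'
  proof eventually_elim
    case (elim \<omega>)
    show ?case
    proof (rule ennreal_le_epsilon)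
      fix e :: real assume e: "0 < e"
      then obtain j where j: "inverse (real (Suc j)) < e" using reals_Archimedean by blast
      show "limsup (\<lambda>m. ennreal (f m \<omega>)) \<le> \<phi> \<omega> + ennreal e"
      proof (rule Limsup_bounded)
        show "\<forall>\<^sub>F m in sequentially. ennreal (f m \<omega>) \<le> \<phi> \<omega> + ennreal e"
          using elim[rule_format, of j]
        proof eventually_elim
          case (elim m)
          have "ennreal (f m \<omega>) \<le> ennreal (max 0 (f m \<omega> - 1 / real (Suc j)) + e)"
            using j by (intro ennreal_leI) (auto simp: divide_inverse)
          also have "\<dots> = ennreal (f m \<omega> - 1 / real (Suc j)) + ennreal e"
            using e by (subst ennreal_plus) auto
          finally show ?case using elim by (meson add_right_mono order_trans)
        qed
      qed
    qed
  qed
  have "limsup (\<lambda>m. \<integral>\<^sup>+\<omega>. ennreal (f m \<omega>) \<partial>M) \<le> (\<integral>\<^sup>+\<omega>. limsup (\<lambda>m. ennreal (f m \<omega>)) \<partial>M)"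
  proof (rule nn_integral_limsup)
    show "AE \<omega> in M. ennreal (f m \<omega>) \<le> ennreal (w \<omega>)" for m
      using dom[of m] by eventually_elim (intro ennreal_leI, linarith)
    show "(\<integral>\<^sup>+\<omega>. ennreal (w \<omega>) \<partial>M) < \<infinity>" by (subst nn_integral_eq_integral[OF w w0]) simp
  qed measurable
  also have "\<dots> \<le> (\<integral>\<^sup>+\<omega>. \<phi> \<omega> \<partial>M)" using key by (rule nn_integral_mono_AE)
  finally have upper: "limsup (\<lambda>m. \<integral>\<^sup>+\<omega>. ennreal (f m \<omega>) \<partial>M) \<le> (\<integral>\<^sup>+\<omega>. \<phi> \<omega> \<partial>M)" .
  show ?thesis
  proof (rule ennreal_le_epsilon)
    fix e :: real assume e: "0 < e"
    have "ennreal (c - e) \<le> liminf (\<lambda>m. \<integral>\<^sup>+\<omega>. ennreal (f m \<omega>) \<partial>M)"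
    proof (rule Liminf_bounded)
      show "\<forall>\<^sub>F m in sequentially. ennreal (c - e) \<le> (\<integral>\<^sup>+\<omega>. ennreal (f m \<omega>) \<partial>M)"
        using E[OF e]
      proof eventually_elim
        case (elim m)
        have "ennreal (c - e) \<le> ennreal (\<integral>\<omega>. f m \<omega> \<partial>M)" using elim by (rule ennreal_leI)
        also have "\<dots> \<le> ennreal (\<integral>\<omega>. max 0 (f m \<omega>) \<partial>M)"
          using fi[of m] by (intro ennreal_leI integral_mono) auto
        also have "\<dots> = (\<integral>\<^sup>+\<omega>. ennreal (max 0 (f m \<omega>)) \<partial>M)"
          using fi[of m] by (intro nn_integral_eq_integral[symmetric]) auto
        finally show ?case by simp
      qed
    qed
    also have "\<dots> \<le> limsup (\<lambda>m. \<integral>\<^sup>+\<omega>. ennreal (f m \<omega>) \<partial>M)" by (rule Liminf_le_Limsup) simp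
    finally have "ennreal (c - e) \<le> (\<integral>\<^sup>+\<omega>. \<phi> \<omega> \<partial>M)" using upper by simp
    moreover have "ennreal c \<le> ennreal (max 0 (c - e) + e)" by (intro ennreal_leI) auto
    moreover have "ennreal (max 0 (c - e) + e) = ennreal (c - e) + ennreal e" using e by (subst ennreal_plus) auto
    ultimately show "ennreal c \<le> (\<integral>\<^sup>+\<omega>. \<phi> \<omega> \<partial>M) + ennreal e"
      by (metis add_right_mono order_trans)
  qed
qed

text \<open>Explicit Euler scheme for the surplus with total outflow \<xi> on the grid t k / m. It
  uses finitely many values of \<xi> up to time t and inherits their measurability.\<close>

primrec euler :: "(real \<Rightarrow> real) \<Rightarrow> real \<Rightarrow> (real \<Rightarrow> real) \<Rightarrow> real \<Rightarrow> nat \<Rightarrow> nat \<Rightarrow> real" where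
  "euler g x \<xi> t m 0 = x - \<xi> 0"
| "euler g x \<xi> t m (Suc k) = euler g x \<xi> t m k + t / real m * g (max 0 (euler g x \<xi> t m k))
     - (\<xi> (t * real (Suc k) / real m) - \<xi> (t * real k / real m))"

section \<open>Recovering the surplus from the outflow\<close>

context surplus_path
begin

text \<open>Within the interval the surplus moves by at most the premiums plus the outflow.
  Lipschitz continuity of g turns this into an error linear in the outflow, which can be summed over
  a grid.\<close>

lemma premium_integral_approx:
  assumes st: "0 \<le> s" "s \<le> r" and \<Gamma>: "0 \<le> \<Gamma>" "\<And>u. s \<le> u \<Longrightarrow> u \<le> r \<Longrightarrow> G (X u) \<le> \<Gamma>"
  shows "\<bar>integral {s..r} (\<lambda>u. G (X u)) - (r - s) * G (X s)\<bar>
    \<le> L * (r - s) * (\<Gamma> * (r - s) + ((S r + D r) - (S s + D s)))"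
proof -
  define \<xi> where "\<xi> u = S u + D u" for u
  have \<xi>_le: "\<xi> v \<le> \<xi> u" if "0 \<le> v" "v \<le> u" for v u
    unfolding \<xi>_def using S_le[OF that] D_le[OF that(2)] by (rule add_mono)
  define H where "H = \<Gamma> * (r - s) + (\<xi> r - \<xi> s)"
  define I where "I = integral {s..r} (\<lambda>u. G (X u))"
  have GX: "\<bar>G (X u) - G (X s)\<bar> \<le> L * H" if u: "s \<le> u" "u \<le> r" for u
  proof -
    have e: "X u = X s + integral {s..u} (\<lambda>u. G (X u)) - (\<xi> u - \<xi> s)"
      using X_diff[of s u] st u by (simp add: \<xi>_def)
    have "integral {s..u} (\<lambda>u. G (X u)) \<le> \<Gamma> * (u - s)" by (rule int_le) (use st u \<Gamma> in auto)
    also have "\<dots> \<le> \<Gamma> * (r - s)" using \<Gamma> u by (intro mult_left_mono) auto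
    finally have 1: "integral {s..u} (\<lambda>u. G (X u)) \<le> \<Gamma> * (r - s)" .
    have 2: "0 \<le> integral {s..u} (\<lambda>u. G (X u))" using st by (intro int_nonneg) auto
    have 3: "\<xi> s \<le> \<xi> u" "\<xi> u \<le> \<xi> r" using st u by (auto intro!: \<xi>_le)
    have "0 \<le> \<Gamma> * (r - s)" using \<Gamma> st by simp
    with 1 2 3 e have "\<bar>X u - X s\<bar> \<le> H" by (simp add: H_def abs_le_iff)
    then show ?thesis using G_lip[of "X u" "X s"] L_nonneg' by (meson mult_left_mono order_trans)
  qed
  have I_up: "I \<le> (G (X s) + L * H) * (r - s)" unfolding I_def
  proof (rule int_le)
    fix u assume "s \<le> u" "u \<le> r"
    from GX[OF this] show "G (X u) \<le> G (X s) + L * H" by (simp only: abs_le_iff) linarith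
  qed (use st in auto)
  have I_lo: "(G (X s) - L * H) * (r - s) \<le> I" unfolding I_def
  proof (rule int_ge)
    fix u assume "s \<le> u" "u \<le> r"
    from GX[OF this] show "G (X s) - L * H \<le> G (X u)" by (simp only: abs_le_iff) linarith
  qed (use st in auto)
  have "\<bar>I - (r - s) * G (X s)\<bar> \<le> L * (r - s) * H"
    using I_up I_lo by (simp add: abs_le_iff algebra_simps)
  then show ?thesis by (simp add: I_def H_def \<xi>_def)
qed

text \<open>The errors sum to at most L h times \<Gamma> t plus the total outflow. The limit makes a
  dividend process adapted that is expressed through the premium integral.\<close>

lemma premium_integral_riemann:
  assumes t: "0 \<le> t"
  shows "(\<lambda>m. \<Sum>k<m. t / real m * G (X (t * real k / real m))) \<longlonglongrightarrow> integral {0..t} (\<lambda>u. G (X u))"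
proof -
  obtain B \<Gamma> where bd: "0 \<le> B" "0 \<le> \<Gamma>" "\<And>u. 0 \<le> u \<Longrightarrow> u \<le> t \<Longrightarrow> X u \<le> B"
    "\<And>u. 0 \<le> u \<Longrightarrow> u \<le> t \<Longrightarrow> G (X u) \<le> \<Gamma>"
    by (rule path_bounds[of t]) (rule that)
  define \<xi> where "\<xi> u = S u + D u" for u
  define C where "C = L * t * (\<Gamma> * t + (\<xi> t - \<xi> 0))"
  have bound: "\<bar>(\<Sum>k<m. t / real m * G (X (t * real k / real m))) - integral {0..t} (\<lambda>u. G (X u))\<bar> \<le> C * inverse (real m)" if m: "0 < m" for m
  proof -
    define s where "s k = t * real k / real m" for k
    define h where "h = t / real m"
    have h: "0 \<le> h" using t by (simp add: h_def)
    have sS: "s (Suc k) = s k + h" for k using m by (simp add: s_def h_def field_simps)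
    have s0: "s 0 = 0" "s m = t" using m by (auto simp: s_def)
    have sk0: "0 \<le> s k" for k using t by (simp add: s_def)
    have skt: "s k \<le> t" if "k \<le> m" for k
      using that t m by (simp add: s_def divide_le_eq mult_left_mono)
    let ?I = "\<lambda>k. integral {s k..s (Suc k)} (\<lambda>u. G (X u))"
    have split: "integral {0..s k} (\<lambda>u. G (X u)) = (\<Sum>j<k. ?I j)" for k
    proof (induction k)
      case (Suc k)
      have "integral {0..s k} (\<lambda>u. G (X u)) + ?I k = integral {0..s (Suc k)} (\<lambda>u. G (X u))"
        using sk0 sS[of k] h by (intro Henstock_Kurzweil_Integration.integral_combine X_int) auto
      then show ?case using Suc by simp
    qed (simp add: s0)
    have "(\<Sum>k<m. h * G (X (s k))) - integral {0..t} (\<lambda>u. G (X u)) = (\<Sum>k<m. h * G (X (s k)) - ?I k)"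
      using split[of m] by (simp add: s0 sum_subtractf)
    then have "\<bar>(\<Sum>k<m. h * G (X (s k))) - integral {0..t} (\<lambda>u. G (X u))\<bar> \<le> (\<Sum>k<m. \<bar>h * G (X (s k)) - ?I k\<bar>)"
      by (simp add: sum_abs)
    also have "\<dots> \<le> (\<Sum>k<m. L * h * (\<Gamma> * h + (\<xi> (s (Suc k)) - \<xi> (s k))))"
    proof (rule sum_mono)
      fix k assume "k \<in> {..<m}"
      then have ss: "0 \<le> s k" "s k \<le> s (Suc k)" "s (Suc k) \<le> t" using sk0 sS[of k] h skt[of "Suc k"] by auto
      have hs: "s (Suc k) - s k = h" using sS[of k] by simp
      have "\<bar>?I k - h * G (X (s k))\<bar> \<le> L * h * (\<Gamma> * h + (\<xi> (s (Suc k)) - \<xi> (s k)))"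
        unfolding \<xi>_def by (rule premium_integral_approx[OF ss(1,2), of \<Gamma>, unfolded hs]) (use bd ss in auto)
      then show "\<bar>h * G (X (s k)) - ?I k\<bar> \<le> L * h * (\<Gamma> * h + (\<xi> (s (Suc k)) - \<xi> (s k)))"
        by (subst abs_minus_commute)
    qed
    also have "\<dots> = L * h * (\<Sum>k<m. \<Gamma> * h + (\<xi> (s (Suc k)) - \<xi> (s k)))" by (simp only: sum_distrib_left)
    also have "(\<Sum>k<m. \<Gamma> * h + (\<xi> (s (Suc k)) - \<xi> (s k))) = \<Gamma> * t + (\<xi> t - \<xi> 0)"
      using sum_lessThan_telescope[of "\<lambda>k. \<xi> (s k)" m] m by (simp add: sum.distrib s0 h_def)
    also have "L * h * (\<Gamma> * t + (\<xi> t - \<xi> 0)) = C * inverse (real m)" by (simp add: C_def h_def divide_inverse)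
    finally show ?thesis by (simp add: s_def h_def)
  qed
  have "(\<lambda>m. (\<Sum>k<m. t / real m * G (X (t * real k / real m))) - integral {0..t} (\<lambda>u. G (X u))) \<longlonglongrightarrow> 0"
  proof (rule Lim_null_comparison)
    show "\<forall>\<^sub>F m in sequentially. norm ((\<Sum>k<m. t / real m * G (X (t * real k / real m))) - integral {0..t} (\<lambda>u. G (X u))) \<le> C * inverse (real m)"
      using eventually_gt_at_top[of 0] by eventually_elim (use bound in simp)
    show "(\<lambda>m. C * inverse (real m)) \<longlonglongrightarrow> 0"
      using tendsto_mult[OF tendsto_const[of C] lim_inverse_n] by simp
  qed
  then show ?thesis by (rule LIM_zero_cancel)
qed

text \<open>Discrete Gronwall inequality: the error grows by the factor 1 + L h per step and
  receives L h times an amount whose sum over the steps stays bounded, although the outflow has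
  jumps.\<close>

lemma euler_tendsto:
  assumes t: "0 \<le> t"
  shows "(\<lambda>m. euler g x (\<lambda>u. S u + D u) t m m) \<longlonglongrightarrow> X t"
proof -
  obtain B \<Gamma> where bd: "0 \<le> B" "0 \<le> \<Gamma>" "\<And>u. 0 \<le> u \<Longrightarrow> u \<le> t \<Longrightarrow> X u \<le> B"
    "\<And>u. 0 \<le> u \<Longrightarrow> u \<le> t \<Longrightarrow> G (X u) \<le> \<Gamma>"
    by (rule path_bounds[of t]) (rule that)
  define \<xi> where "\<xi> u = S u + D u" for u
  have \<xi>_le: "\<xi> s \<le> \<xi> r" if "0 \<le> s" "s \<le> r" for s r
    unfolding \<xi>_def using S_le[OF that] D_le[OF that(2)] by (rule add_mono)
  define C where "C = exp (L * t) * L * t * (\<Gamma> * t + (\<xi> t - \<xi> 0))"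
  have bound: "\<bar>euler g x \<xi> t m m - X t\<bar> \<le> C * inverse (real m)" if m: "0 < m" for m
  proof -
    define s where "s k = t * real k / real m" for k
    define h where "h = t / real m"
    have h: "0 \<le> h" using t by (simp add: h_def)
    have sS: "s (Suc k) = s k + h" for k using m by (simp add: s_def h_def field_simps)
    have s0: "s 0 = 0" "s m = t" using m by (auto simp: s_def)
    have sk0: "0 \<le> s k" for k using t by (simp add: s_def)
    have skt: "s k \<le> t" if "k \<le> m" for k
      using that t m by (simp add: s_def divide_le_eq mult_left_mono)
    define e where "e k = \<bar>euler g x \<xi> t m k - X (s k)\<bar>" for k
    have step: "e (Suc k) \<le> (1 + L * h) * e k + L * h * (\<Gamma> * h + (\<xi> (s (Suc k)) - \<xi> (s k)))" if k: "k < m" for k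
    proof -
      have ss: "0 \<le> s k" "s k \<le> s (Suc k)" "s (Suc k) \<le> t" using sk0 sS[of k] h skt[of "Suc k"] k by auto
      define H where "H = \<Gamma> * h + (\<xi> (s (Suc k)) - \<xi> (s k))"
      define I where "I = integral {s k..s (Suc k)} (\<lambda>u. G (X u))"
      have hs: "s (Suc k) - s k = h" using sS[of k] by simp
      have I: "\<bar>I - h * G (X (s k))\<bar> \<le> L * h * H"
        unfolding I_def H_def \<xi>_def by (rule premium_integral_approx[OF ss(1,2), of \<Gamma>, unfolded hs]) (use bd ss in auto)
      have Xs: "X (s (Suc k)) = X (s k) + I - (\<xi> (s (Suc k)) - \<xi> (s k))"
        using X_diff[OF ss(1,2)] by (simp add: \<xi>_def I_def)
      have Es: "euler g x \<xi> t m (Suc k) = euler g x \<xi> t m k + h * G (euler g x \<xi> t m k) - (\<xi> (s (Suc k)) - \<xi> (s k))"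
        by (simp add: s_def h_def)
      have "h * \<bar>G (euler g x \<xi> t m k) - G (X (s k))\<bar> \<le> h * (L * e k)"
        unfolding e_def using G_lip h by (intro mult_left_mono)
      then have "\<bar>h * G (euler g x \<xi> t m k) - h * G (X (s k))\<bar> \<le> L * h * e k"
        using h by (simp add: right_diff_distrib[symmetric] abs_mult mult_ac)
      moreover have "e k = \<bar>euler g x \<xi> t m k - X (s k)\<bar>" by (rule e_def)
      moreover have "e (Suc k) = \<bar>euler g x \<xi> t m k - X (s k) + (h * G (euler g x \<xi> t m k) - h * G (X (s k))) + (h * G (X (s k)) - I)\<bar>"
        unfolding e_def Es Xs by (simp add: algebra_simps)
      ultimately have "e (Suc k) \<le> e k + L * h * e k + L * h * H" using I by linarith
      then show ?thesis by (simp add: H_def algebra_simps)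
    qed
    have "e k \<le> exp (L * h * real k) * (L * h * (\<Gamma> * h * real k + (\<xi> (s k) - \<xi> 0)))" if "k \<le> m" for k
      using that
    proof (induction k)
      case 0
      have "X 0 = x - \<xi> 0" using X_eq[of 0] by (simp add: \<xi>_def S_def)
      then show ?case by (simp add: e_def s0)
    next
      case (Suc k)
      define A where "A = L * h * (\<Gamma> * h * real k + (\<xi> (s k) - \<xi> 0))"
      define a where "a = L * h * (\<Gamma> * h + (\<xi> (s (Suc k)) - \<xi> (s k)))"
      have Lh: "0 \<le> L * h" using L_nonneg' h by simp
      have A0: "0 \<le> A" using Lh bd h \<xi>_le[of 0 "s k"] sk0 by (simp add: A_def)
      have a0: "0 \<le> a" using Lh bd h \<xi>_le[of "s k" "s (Suc k)"] sk0 sS[of k] by (simp add: a_def)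
      have "e (Suc k) \<le> (1 + L * h) * e k + a" using step[of k] Suc by (simp add: a_def)
      also have "\<dots> \<le> (1 + L * h) * (exp (L * h * real k) * A) + a"
        using Suc Lh by (intro add_right_mono mult_left_mono) (auto simp: A_def)
      also have "\<dots> \<le> exp (L * h) * (exp (L * h * real k) * A) + exp (L * h * real (Suc k)) * a"
      proof (rule add_mono)
        show "(1 + L * h) * (exp (L * h * real k) * A) \<le> exp (L * h) * (exp (L * h * real k) * A)"
          using A0 exp_ge_add_one_self[of "L * h"] by (intro mult_right_mono) auto
        have "1 \<le> exp (L * h * real (Suc k))" using Lh by simp
        then show "a \<le> exp (L * h * real (Suc k)) * a" using a0 by (simp add: mult_le_cancel_right1)
      qed
      also have "\<dots> = exp (L * h * real (Suc k)) * (A + a)"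
        by (simp add: distrib_left exp_add algebra_simps)
      also have "A + a = L * h * (\<Gamma> * h * real (Suc k) + (\<xi> (s (Suc k)) - \<xi> 0))"
        by (simp add: A_def a_def algebra_simps)
      finally show ?case .
    qed
    from this[of m] have "e m \<le> exp (L * h * real m) * (L * h * (\<Gamma> * h * real m + (\<xi> t - \<xi> 0)))" by (simp add: s0)
    moreover have "L * h * real m = L * t" "\<Gamma> * h * real m = \<Gamma> * t" using m by (simp_all add: h_def)
    moreover have "exp (L * t) * (L * h * (\<Gamma> * t + (\<xi> t - \<xi> 0))) = C * inverse (real m)"
      by (simp add: C_def h_def divide_inverse)
    ultimately show ?thesis by (simp only: e_def s0)
  qed
  have "(\<lambda>m. euler g x \<xi> t m m - X t) \<longlonglongrightarrow> 0"
  proof (rule Lim_null_comparison)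
    show "\<forall>\<^sub>F m in sequentially. norm (euler g x \<xi> t m m - X t) \<le> C * inverse (real m)"
      using eventually_gt_at_top[of 0] by eventually_elim (use bound in simp)
    show "(\<lambda>m. C * inverse (real m)) \<longlonglongrightarrow> 0"
      using tendsto_mult[OF tendsto_const[of C] lim_inverse_n] by simp
  qed
  then show ?thesis unfolding \<xi>_def[abs_def] by (rule LIM_zero_cancel)
qed

text \<open>The surplus has no upward jumps and rises at rate at most \<Gamma>, so a negative value
  persists for a while and is seen at a rational fraction of t. The fraction 1 takes care of t
  itself.\<close>

lemma alive_iff_rat:
  assumes t: "0 \<le> t"
  shows "alive t \<longleftrightarrow> (\<forall>q::rat. 0 \<le> q \<and> q \<le> 1 \<longrightarrow> 0 \<le> X (of_rat q * t))"
proof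
  assume a: "alive t"
  show "\<forall>q::rat. 0 \<le> q \<and> q \<le> 1 \<longrightarrow> 0 \<le> X (of_rat q * t)"
  proof (intro allI impI)
    fix q :: rat assume q: "0 \<le> q \<and> q \<le> 1"
    then have "(0::real) \<le> of_rat q" "(of_rat q :: real) \<le> 1" by (auto simp: zero_le_of_rat_iff of_rat_le_1_iff)
    then have "0 \<le> of_rat q * t" "of_rat q * t \<le> t" using t by (auto intro!: mult_left_le_one_le)
    then show "0 \<le> X (of_rat q * t)" using a by (auto simp: alive_def)
  qed
next
  assume a: "\<forall>q::rat. 0 \<le> q \<and> q \<le> 1 \<longrightarrow> 0 \<le> X (of_rat q * t)"
  obtain B \<Gamma> where bd: "0 \<le> B" "0 \<le> \<Gamma>" "\<And>u. 0 \<le> u \<Longrightarrow> u \<le> t \<Longrightarrow> X u \<le> B"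
    "\<And>u. 0 \<le> u \<Longrightarrow> u \<le> t \<Longrightarrow> G (X u) \<le> \<Gamma>"
    by (rule path_bounds[of t]) (rule that)
  show "alive t" unfolding alive_def
  proof (intro allI impI, rule ccontr)
    fix r assume r: "0 \<le> r" "r \<le> t" and neg: "\<not> 0 \<le> X r"
    have "r \<noteq> t" using a[rule_format, of 1] neg by auto
    then have rt: "r < t" using r by simp
    \<comment> \<open>Up to this time the premiums make up at most half of the deficit at r.\<close>
    define \<rho> where "\<rho> = min t (r + - X r / (2 * (\<Gamma> + 1)))"
    have "0 < - X r / (2 * (\<Gamma> + 1))" by (rule divide_pos_pos) (use neg bd in auto)
    then have \<rho>: "r < \<rho>" "\<rho> \<le> t" using rt by (auto simp: \<rho>_def)
    then have "r / t < \<rho> / t" using rt r by (simp add: divide_strict_right_mono)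
    then obtain q where q: "r / t < of_rat q" "of_rat q < \<rho> / t" using of_rat_dense by blast
    define v where "v = of_rat q * t"
    have v: "r < v" "v < \<rho>" using q rt r by (auto simp: v_def field_simps)
    have "(0::real) \<le> r / t" "\<rho> / t \<le> 1" using r rt \<rho> by auto
    then have "0 \<le> (of_rat q :: real)" "(of_rat q :: real) \<le> 1" using q by linarith+
    then have "0 \<le> q" "q \<le> 1" by (auto simp: zero_le_of_rat_iff of_rat_le_1_iff)
    then have "0 \<le> X v" using a by (simp add: v_def)
    have "X v \<le> X r + integral {r..v} (\<lambda>u. G (X u))"
      using X_diff[of r v] S_le[of r v] D_le[of r v] r v by simp
    also have "integral {r..v} (\<lambda>u. G (X u)) \<le> \<Gamma> * (v - r)" by (rule int_le) (use r v \<rho> bd in auto)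
    also have "\<Gamma> * (v - r) \<le> (\<Gamma> + 1) * (- X r / (2 * (\<Gamma> + 1)))"
      using v bd neg by (intro mult_mono) (auto simp: \<rho>_def)
    also have "\<dots> = - X r / 2" using bd by (simp add: field_simps)
    finally show False using \<open>0 \<le> X v\<close> neg by simp
  qed
qed

end

locale controlled_model = risk_model M F N Y lam \<alpha>
  for M :: "'a measure" and F N Y lam \<alpha> +
  fixes g :: "real \<Rightarrow> real" and L x :: real and D X :: "real \<Rightarrow> 'a \<Rightarrow> real"
  assumes premium_pos: "\<And>z. 0 \<le> z \<Longrightarrow> g z > 0" and premium_lip: "L-lipschitz_on {0..} g" and x_nonneg: "0 \<le> x"
    and dividends: "dividend_process M F D" and surplus: "controlled_surplus M g S x D X"
begin

lemma AE_surplus_path: "AE \<omega> in M. surplus_path g L x (\<lambda>t. N t \<omega>) (\<lambda>i. Y i \<omega>) (\<lambda>t. D t \<omega>) (\<lambda>t. X t \<omega>)"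
proof -
  have "AE \<omega> in M. (\<forall>t<0. D t \<omega> = 0) \<and> mono (\<lambda>t. D t \<omega>) \<and> cadlag (\<lambda>t. D t \<omega>)"
    using dividends by (simp add: dividend_process_def)
  moreover have "AE \<omega> in M. (\<forall>t<0. X t \<omega> = x) \<and>
        (\<forall>t\<ge>0. (\<lambda>s. g (max 0 (X s \<omega>))) integrable_on {0..t} \<and>
           X t \<omega> = x + integral {0..t} (\<lambda>s. g (max 0 (X s \<omega>))) - S t \<omega> - D t \<omega>)"
    using surplus unfolding controlled_surplus_def .
  ultimately show ?thesis using AE_claims
  proof eventually_elim
    case (elim \<omega>)
    note d = elim(1) and c = elim(3) and s = elim(2)[THEN conjunct2, rule_format]
    show ?case
    proof unfold_locales
      fix t :: real assume t: "0 \<le> t"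
      show "(\<lambda>s. g (max 0 (X s \<omega>))) integrable_on {0..t}" using s[OF t] by (rule conjunct1)
      show "X t \<omega> = x + integral {0..t} (\<lambda>s. g (max 0 (X s \<omega>))) - (\<Sum>i<N t \<omega>. Y i \<omega>) - D t \<omega>"
        unfolding aggregate_claims_def[symmetric] using s[OF t] by (rule conjunct2)
    next
      show "N 0 \<omega> = 0" "mono_on {0..} (\<lambda>t. N t \<omega>)" "cadlag (\<lambda>t. real (N t \<omega>))" using c by auto
      show "0 < Y i \<omega>" for i using c by auto
      show "mono (\<lambda>t. D t \<omega>)" "cadlag (\<lambda>t. D t \<omega>)" using d by auto
      show "D t \<omega> = 0" if "t < 0" for t using d that by auto
    qed (use premium_pos premium_lip x_nonneg in auto)
  qed
qed

lemma D_F: "0 \<le> t \<Longrightarrow> D t \<in> borel_measurable (F t)"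
  using dividends by (simp add: dividend_process_def adapted_def)

text \<open>The surplus is given only as a solution of its equation; it is adapted as an almost sure
  limit of Euler schemes in \<open>S\<close> and \<open>D\<close>.\<close>

lemma X_F:
  assumes t: "0 \<le> t"
  shows "X t \<in> borel_measurable (F t)"
proof -
  have g_cont: "continuous_on UNIV (\<lambda>z. g (max 0 z))"
    using lipschitz_on_continuous_on[OF premium_lip]
    by (rule continuous_on_compose2) (auto intro!: continuous_intros)
  then have gm: "(\<lambda>z. g (max 0 z)) \<in> borel_measurable borel" by (rule borel_measurable_continuous_onI)
  have euler_m: "(\<lambda>\<omega>. euler g x (\<lambda>u. S u \<omega> + D u \<omega>) t m k) \<in> borel_measurable (F t)" if m: "0 < m" and "k \<le> m" for m k
    using that(2)
  proof (induction k)
    case 0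
    have "S 0 \<in> borel_measurable (F t)" "D 0 \<in> borel_measurable (F t)"
      using measurable_F_mono[OF S_F[of 0] _ t] measurable_F_mono[OF D_F[of 0] _ t] by auto
    then show ?case by simp
  next
    case (Suc k)
    have tt: "0 \<le> t * real j / real m \<and> t * real j / real m \<le> t" if "j \<le> m" for j
      using that t m by (simp add: divide_le_eq mult_left_mono)
    have SD: "S (t * real j / real m) \<in> borel_measurable (F t)" "D (t * real j / real m) \<in> borel_measurable (F t)" if "j \<le> m" for j
      using measurable_F_mono[OF S_F] measurable_F_mono[OF D_F] tt[OF that] by auto
    have IH: "(\<lambda>\<omega>. euler g x (\<lambda>u. S u \<omega> + D u \<omega>) t m k) \<in> borel_measurable (F t)" using Suc by simp
    show ?case
      using SD[of k] SD[of "Suc k"] IH measurable_compose[OF IH gm] Suc.prems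
      by (simp del: of_nat_Suc)
  qed
  \<comment> \<open>The shift to \<open>Suc m\<close> excludes the degenerate grid with no
    step.\<close>
  define Z where "Z = (\<lambda>\<omega>. lim (\<lambda>m. euler g x (\<lambda>u. S u \<omega> + D u \<omega>) t (Suc m) (Suc m)))"
  have "Z \<in> borel_measurable (F t)" unfolding Z_def
    by (rule borel_measurable_lim_metric, rule euler_m) simp_all
  moreover have "AE \<omega> in M. Z \<omega> = X t \<omega>" using AE_surplus_path
  proof eventually_elim
    case (elim \<omega>)
    interpret p: surplus_path g L x "\<lambda>t. N t \<omega>" "\<lambda>i. Y i \<omega>" "\<lambda>t. D t \<omega>" "\<lambda>t. X t \<omega>" by fact
    have "(\<lambda>m. euler g x (\<lambda>u. S u \<omega> + D u \<omega>) t m m) \<longlonglongrightarrow> X t \<omega>"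
      using p.euler_tendsto[OF t] by (simp add: p.S_def aggregate_claims_def)
    then show ?case unfolding Z_def by (intro limI LIMSEQ_Suc)
  qed
  ultimately show ?thesis by (rule measurable_F_AE[OF t])
qed

text \<open>\<open>zeta t\<close> is the surplus on \<open>{t \<le> \<tau>}\<close>; the value \<open>-1\<close> encodes ruin. Rational times make it measurable.\<close>

definition zeta :: "real \<Rightarrow> 'a \<Rightarrow> real" where
  "zeta t \<omega> = (if \<forall>q::rat. 0 \<le> q \<and> q \<le> 1 \<longrightarrow> 0 \<le> X (of_rat q * t) \<omega> then X t \<omega> else -1)"

lemma zeta_F:
  assumes t: "0 \<le> t"
  shows "zeta t \<in> borel_measurable (F t)"
proof -
  have X: "X (of_rat q * t) \<in> borel_measurable (F t)" if "0 \<le> q \<and> q \<le> 1" for q :: rat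
  proof -
    have "(0::real) \<le> of_rat q" "(of_rat q :: real) \<le> 1" using that by (auto simp: zero_le_of_rat_iff of_rat_le_1_iff)
    then show ?thesis using t by (intro measurable_F_mono[OF X_F]) (auto intro!: mult_left_le_one_le)
  qed
  have "Measurable.pred (F t) (\<lambda>\<omega>. \<forall>q::rat. 0 \<le> q \<and> q \<le> 1 \<longrightarrow> 0 \<le> X (of_rat q * t) \<omega>)"
  proof (rule pred_intros_countable)
    fix q :: rat
    show "Measurable.pred (F t) (\<lambda>\<omega>. 0 \<le> q \<and> q \<le> 1 \<longrightarrow> 0 \<le> X (of_rat q * t) \<omega>)"
      using X[of q] by (cases "0 \<le> q \<and> q \<le> 1") auto
  qed
  then show ?thesis unfolding zeta_def using X_F[OF t] by (intro measurable_If) auto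
qed

lemma zeta_M: "0 \<le> t \<Longrightarrow> zeta t \<in> borel_measurable M"
  using measurable_F_M[OF zeta_F] by simp

end

lemma borel_measurable_halfline_max:
  fixes f :: "real \<Rightarrow> real"
  assumes "continuous_on {0..} f"
  shows "(\<lambda>u. f (max 0 u)) \<in> borel_measurable borel"
proof (rule borel_measurable_continuous_onI)
  show "continuous_on UNIV (\<lambda>u. f (max 0 u))"
    using assms by (rule continuous_on_compose2) (auto intro!: continuous_intros)
qed

section \<open>Averages over one exponential claim\<close>

context dividend_hjb
begin

lemma W_cont: "continuous_on {0..} W"
  by (intro DERIV_continuous_on[of _ W W'] W_deriv) auto

lemma W'_cont: "continuous_on {0..} W'"
proof (rule lipschitz_on_continuous_on)
  show "K-lipschitz_on {0..} W'"
    using W'_lip K_nonneg by (auto simp: lipschitz_on_def dist_real_def)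
qed

lemma Weps_borel: "Weps \<epsilon> \<in> borel_measurable borel"
  unfolding Weps_def[abs_def] using borel_measurable_halfline_max[OF W_cont] by measurable

lemma Wdead_borel: "Wdead \<in> borel_measurable borel"
proof -
  have "Wdead = (\<lambda>z. if 0 \<le> z then W (max 0 z) else 0)" by (auto simp: Wdead_def fun_eq_iff)
  then show ?thesis using borel_measurable_halfline_max[OF W_cont] by simp
qed

lemma Wdead_bound: "0 \<le> B \<Longrightarrow> z \<le> B \<Longrightarrow> \<bar>Wdead z\<bar> \<le> W B"
  using W_mono[of z B] W_pos[of z] W_pos[of B] by (auto simp: Wdead_def)

lemma Weps_bound: "0 < \<epsilon> \<Longrightarrow> 0 \<le> B \<Longrightarrow> z \<le> B \<Longrightarrow> \<bar>Weps \<epsilon> z\<bar> \<le> W B"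
  using Weps_le[of \<epsilon> z B] Weps_nonneg[of \<epsilon> z] by simp

lemma exponential_density_le: "exponential_density \<alpha> y \<le> \<alpha>"
  using \<alpha> by (auto simp: exponential_density_def mult_le_cancel_left1)

lemma integrable_exponential_bounded:
  fixes f :: "real \<Rightarrow> real"
  assumes [measurable]: "f \<in> borel_measurable borel" and b: "\<And>y. 0 \<le> y \<Longrightarrow> \<bar>f y\<bar> \<le> c"
  shows "integrable lborel (\<lambda>y. exponential_density \<alpha> y * f y)"
proof -
  interpret e: prob_space "density lborel (exponential_density \<alpha>)" by (rule prob_space_exponential_density[OF \<alpha>])
  have "integrable lborel (\<lambda>y. exponential_density \<alpha> y * c)"
  proof -
    have "integrable (density lborel (exponential_density \<alpha>)) (\<lambda>_. c)" by simp
    then show ?thesis using \<alpha> by (subst (asm) integrable_density) (auto simp: exponential_density_nonneg)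
  qed
  then show ?thesis
  proof (rule Bochner_Integration.integrable_bound)
    show "AE y in lborel. norm (exponential_density \<alpha> y * f y) \<le> norm (exponential_density \<alpha> y * c)"
    proof (rule AE_I2)
      fix y :: real
      show "norm (exponential_density \<alpha> y * f y) \<le> norm (exponential_density \<alpha> y * c)"
        using b[of y] \<alpha> by (cases "y < 0") (auto simp: exponential_density_def abs_mult intro!: mult_left_mono)
    qed
  qed simp
qed

lemma integral_exponential_density: "(\<integral>y. exponential_density \<alpha> y \<partial>lborel) = 1"
proof -
  interpret e: prob_space "density lborel (exponential_density \<alpha>)" by (rule prob_space_exponential_density[OF \<alpha>])
  have "(\<integral>y. exponential_density \<alpha> y * 1 \<partial>lborel) = (\<integral>y. 1 \<partial>density lborel (exponential_density \<alpha>))"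
    using \<alpha> by (subst integral_density) (auto simp: exponential_density_nonneg)
  then show ?thesis using e.prob_space by simp
qed

text \<open>\<open>Wdead\<close> vanishes for claims exceeding u, which produces the upper limit of
  the integral.\<close>

lemma claim_mean_Wdead:
  assumes u: "0 \<le> u"
  shows "(\<integral>y. exponential_density \<alpha> y * Wdead (u - y) \<partial>lborel) = claim_mean \<alpha> W u"
proof -
  have "continuous_on {0..u} (\<lambda>y. W (u - y) * (\<alpha> * exp (- \<alpha> * y)))"
    by (intro continuous_intros continuous_on_compose2[OF W_cont]) auto
  then have "set_integrable lborel {0..u} (\<lambda>y. W (u - y) * (\<alpha> * exp (- \<alpha> * y)))"
    by (rule borel_integrable_atLeastAtMost')
  then have "(LINT y:{0..u}|lborel. W (u - y) * (\<alpha> * exp (- \<alpha> * y))) = claim_mean \<alpha> W u"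
    unfolding claim_mean_def by (rule set_borel_integral_eq_integral)
  moreover have "(LINT y:{0..u}|lborel. W (u - y) * (\<alpha> * exp (- \<alpha> * y))) = (\<integral>y. exponential_density \<alpha> y * Wdead (u - y) \<partial>lborel)"
    unfolding set_lebesgue_integral_def
    by (rule Bochner_Integration.integral_cong) (auto simp: exponential_density_def Wdead_def mult_ac split: split_indicator)
  ultimately show ?thesis by simp
qed

text \<open>The two continuations differ only for claims between u and u + \<epsilon>, by at most
  \<open>W 0\<close>, and the claim density is at most \<alpha>.\<close>

lemma Weps_claim_mean_le:
  assumes u: "0 \<le> u" and \<epsilon>: "0 < \<epsilon>"
  shows "(\<integral>y. exponential_density \<alpha> y * Weps \<epsilon> (u - y) \<partial>lborel) \<le> claim_mean \<alpha> W u + W 0 * \<alpha> * \<epsilon>"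
proof -
  note [measurable] = Weps_borel Wdead_borel
  have i1: "integrable lborel (\<lambda>y. exponential_density \<alpha> y * Weps \<epsilon> (u - y))"
    by (rule integrable_exponential_bounded[of _ "W u"]) (use Weps_bound[OF \<epsilon> u] in auto)
  have i2: "integrable lborel (\<lambda>y. exponential_density \<alpha> y * Wdead (u - y))"
    by (rule integrable_exponential_bounded[of _ "W u"]) (use Wdead_bound[OF u] in auto)
  have i3: "integrable lborel (\<lambda>y. W 0 * \<alpha> * indicator {u..u+\<epsilon>} y)"
    by (intro integrable_mult_right integrable_real_indicator) (use \<epsilon> in simp_all)
  have "(\<integral>y. exponential_density \<alpha> y * Weps \<epsilon> (u - y) \<partial>lborel)
     \<le> (\<integral>y. exponential_density \<alpha> y * Wdead (u - y) + W 0 * \<alpha> * indicator {u..u+\<epsilon>} y \<partial>lborel)"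
  proof (rule integral_mono[OF i1 Bochner_Integration.integrable_add[OF i2 i3]])
    fix y :: real
    have e0: "0 \<le> exponential_density \<alpha> y" using \<alpha> by (simp add: exponential_density_nonneg)
    show "exponential_density \<alpha> y * Weps \<epsilon> (u - y) \<le> exponential_density \<alpha> y * Wdead (u - y) + W 0 * \<alpha> * indicator {u..u+\<epsilon>} y"
    proof (cases "y \<le> u")
      case True
      then show ?thesis using \<epsilon> \<alpha> W0 by (simp add: Weps_nonneg_arg Wdead_def)
    next
      case False
      show ?thesis
      proof (cases "y \<le> u + \<epsilon>")
        case True
        have "Weps \<epsilon> (u - y) \<le> W 0" using Weps_le[of \<epsilon> "u - y" 0] False \<epsilon> by simp
        then have "exponential_density \<alpha> y * Weps \<epsilon> (u - y) \<le> \<alpha> * W 0"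
          using e0 exponential_density_le[of y] Weps_nonneg[OF \<epsilon>, of "u - y"] \<alpha> by (intro mult_mono) auto
        then show ?thesis using True False by (simp add: Wdead_def mult_ac)
      next
        case F2: False
        then have "(u - y) / \<epsilon> \<le> -1" using \<epsilon> by (simp add: field_simps)
        then have "Weps \<epsilon> (u - y) = 0" using False by (simp add: Weps_def)
        then show ?thesis using False F2 by (simp add: Wdead_def)
      qed
    qed
  qed
  also have "\<dots> = claim_mean \<alpha> W u + W 0 * \<alpha> * \<epsilon>"
    using \<epsilon> by (subst Bochner_Integration.integral_add[OF i2 i3]) (simp add: claim_mean_Wdead[OF u])
  finally show ?thesis .
qed

text \<open>\<open>q\<close> continued to the negative reals so as to be Borel on the whole
  line.\<close>

definition qp :: "real \<Rightarrow> real" where "qp u = g (max 0 u) * W' (max 0 u) - \<delta> * W (max 0 u)"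

lemma qp_borel: "qp \<in> borel_measurable borel"
  unfolding qp_def[abs_def]
  using borel_measurable_halfline_max[OF W_cont] borel_measurable_halfline_max[OF W'_cont]
    borel_measurable_halfline_max[OF lipschitz_on_continuous_on[OF g_lip]] by measurable

lemma qp_eq: "0 \<le> u \<Longrightarrow> qp u = q u" by (simp add: qp_def q_def max_def)

lemma qp_bound:
  assumes "0 \<le> u" "u \<le> B"
  shows "\<bar>qp u\<bar> \<le> (g 0 + L * B) * K1 + \<delta> * W B"
proof -
  have g: "0 < g u" "g u \<le> g 0 + L * B"
  proof -
    have "g u \<le> g 0 + L * u" using g_diff[of u 0] assms by (simp add: abs_le_iff)
    also have "\<dots> \<le> g 0 + L * B" using assms L_nonneg by (simp add: mult_left_mono)
    finally show "g u \<le> g 0 + L * B" .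
  qed (use g_pos assms in auto)
  have "0 \<le> g u * W' u" using g W'_ge1[of u] assms by simp
  moreover have "g u * W' u \<le> (g 0 + L * B) * K1"
    using g W'_le[of u] W'_ge1[of u] assms by (intro mult_mono) auto
  moreover have "0 \<le> \<delta> * W u" using \<delta> W_pos[of u] assms by simp
  moreover have "\<delta> * W u \<le> \<delta> * W B" using \<delta> assms W_mono[of u B] by simp
  ultimately show ?thesis unfolding qp_eq[OF assms(1)] q_def by linarith
qed

end

section \<open>Expected gains on the grid\<close>

locale hjb_model = dividend_hjb g lam \<alpha> \<delta> b L K K1 W W' + controlled_model M F N Y lam \<alpha> g L x D X
  for g lam \<alpha> \<delta> b L K K1 W W' and M :: "'a measure" and F N Y x D X
begin

lemma AE_hjb_path: "AE \<omega> in M. hjb_path g lam \<alpha> \<delta> b L K K1 W W' x (\<lambda>t. N t \<omega>) (\<lambda>i. Y i \<omega>) (\<lambda>t. D t \<omega>) (\<lambda>t. X t \<omega>)"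
  using AE_surplus_path by eventually_elim (intro hjb_path.intro dividend_hjb_axioms)

text \<open>The pathwise gain rewritten in terms of \<open>zeta\<close>, whose sign encodes
  survival; in this form it is measurable.\<close>

definition rgain :: "(real \<Rightarrow> real) \<Rightarrow> real \<Rightarrow> real \<Rightarrow> 'a \<Rightarrow> real" where
  "rgain \<Phi> s t \<omega> = (if 0 \<le> zeta s \<omega> then (t - s) * qp (zeta s \<omega>) +
     (if 0 < S t \<omega> - S s \<omega> then \<Phi> (zeta s \<omega> - (S t \<omega> - S s \<omega>)) - W (max 0 (zeta s \<omega>)) else 0) else 0)"

lemma rgain_eq:
  assumes "hjb_path g lam \<alpha> \<delta> b L K K1 W W' x (\<lambda>t. N t \<omega>) (\<lambda>i. Y i \<omega>) (\<lambda>t. D t \<omega>) (\<lambda>t. X t \<omega>)" "0 \<le> s"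
  shows "rgain \<Phi> s t \<omega> = hjb_path.gain g \<delta> W W' (\<lambda>t. N t \<omega>) (\<lambda>i. Y i \<omega>) (\<lambda>t. X t \<omega>) \<Phi> s t"
proof -
  interpret p: hjb_path g lam \<alpha> \<delta> b L K K1 W W' x "\<lambda>t. N t \<omega>" "\<lambda>i. Y i \<omega>" "\<lambda>t. D t \<omega>" "\<lambda>t. X t \<omega>" by fact
  have S: "S u \<omega> = p.S u" for u by (simp add: p.S_def aggregate_claims_def)
  show ?thesis
  proof (cases "p.alive s")
    case True
    then have z: "zeta s \<omega> = X s \<omega>" using p.alive_iff_rat[OF assms(2)] by (simp add: zeta_def)
    have X: "0 \<le> X s \<omega>" using p.aliveD[OF True assms(2)] .
    show ?thesis using True X by (simp add: rgain_def p.gain_def z S qp_eq max_def)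
  next
    case False
    then have "\<not> (\<forall>q::rat. 0 \<le> q \<and> q \<le> 1 \<longrightarrow> 0 \<le> X (of_rat q * s) \<omega>)" using p.alive_iff_rat[OF assms(2)] by blast
    then have z: "zeta s \<omega> = -1" unfolding zeta_def by (rule if_not_P)
    show ?thesis using False by (simp add: rgain_def p.gain_def z)
  qed
qed

text \<open>The effect on \<open>W\<close> of a claim y at surplus u. The cutoff at B makes it
  bounded for all arguments and is invisible when B bounds the surplus.\<close>

definition kern :: "(real \<Rightarrow> real) \<Rightarrow> real \<Rightarrow> real \<Rightarrow> real \<Rightarrow> real" where
  "kern \<Phi> B u y = (if 0 \<le> u \<and> u \<le> B \<and> 0 < y then \<Phi> (u - y) - W (max 0 u) else 0)"

text \<open>Expected gain per unit of time at surplus u, to first order. For \<open>Wdead\<close>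
  and u in [0, B] it is the left-hand side of the integro-differential equation for
  \<open>W\<close>.\<close>

definition drift :: "(real \<Rightarrow> real) \<Rightarrow> real \<Rightarrow> real \<Rightarrow> real" where
  "drift \<Phi> B u = (if 0 \<le> u \<and> u \<le> B then qp u else 0) + lam * (\<integral>y. exponential_density \<alpha> y * kern \<Phi> B u y \<partial>lborel)"

lemma drift_eq:
  assumes \<Phi>[measurable]: "\<Phi> \<in> borel_measurable borel" and c: "\<forall>z. z \<le> B \<longrightarrow> \<bar>\<Phi> z\<bar> \<le> c" and u: "0 \<le> u" "u \<le> B"
  shows "drift \<Phi> B u = g u * W' u - (lam + \<delta>) * W u + lam * (\<integral>y. exponential_density \<alpha> y * \<Phi> (u - y) \<partial>lborel)"
proof -
  have i1: "integrable lborel (\<lambda>y. exponential_density \<alpha> y * \<Phi> (u - y))"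
    by (rule integrable_exponential_bounded[of _ c]) (use c u in auto)
  have i2: "integrable lborel (\<lambda>y. exponential_density \<alpha> y * W u)"
    by (rule integrable_exponential_bounded[of _ "\<bar>W u\<bar>"]) auto
  have "(\<integral>y. exponential_density \<alpha> y * kern \<Phi> B u y \<partial>lborel)
     = (\<integral>y. exponential_density \<alpha> y * \<Phi> (u - y) - exponential_density \<alpha> y * W u \<partial>lborel)"
  proof (rule integral_cong_AE)
    show "AE y in lborel. exponential_density \<alpha> y * kern \<Phi> B u y = exponential_density \<alpha> y * \<Phi> (u - y) - exponential_density \<alpha> y * W u"
      using AE_lborel_singleton[of "0::real"]
      by eventually_elim (use u in \<open>auto simp: kern_def exponential_density_def algebra_simps max_def\<close>)
  qed (simp_all add: kern_def)
  also have "\<dots> = (\<integral>y. exponential_density \<alpha> y * \<Phi> (u - y) \<partial>lborel) - W u"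
    by (subst Bochner_Integration.integral_diff[OF i1 i2]) (simp add: integral_exponential_density)
  finally have K: "(\<integral>y. exponential_density \<alpha> y * kern \<Phi> B u y \<partial>lborel) = (\<integral>y. exponential_density \<alpha> y * \<Phi> (u - y) \<partial>lborel) - W u" .
  show ?thesis unfolding drift_def K using u by (simp add: qp_eq q_def algebra_simps)
qed

lemma drift_outside: "\<not> (0 \<le> u \<and> u \<le> B) \<Longrightarrow> drift \<Phi> B u = 0"
proof -
  assume u: "\<not> (0 \<le> u \<and> u \<le> B)"
  then have "kern \<Phi> B u = (\<lambda>_. 0)" by (auto simp: kern_def)
  then show ?thesis unfolding drift_def if_not_P[OF u] by simp
qed

text \<open>The drift part is exact; the claim part is a kernel evaluated at a variable measurable
  with respect to \<open>F s\<close> and an independent increment. The kernel is bounded by c + W B,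
  which explains the constant.\<close>

lemma rgain_expectation:
  assumes \<Phi>: "\<Phi> \<in> borel_measurable borel" and B: "0 \<le> B" and c: "\<forall>z. z \<le> B \<longrightarrow> \<bar>\<Phi> z\<bar> \<le> c"
    and st: "0 \<le> s" "s < t" and zB: "AE \<omega> in M. zeta s \<omega> \<le> B"
  shows "rgain \<Phi> s t \<in> borel_measurable M" "drift \<Phi> B \<in> borel_measurable borel"
    "integrable M (rgain \<Phi> s t)" "integrable M (\<lambda>\<omega>. drift \<Phi> B (zeta s \<omega>))"
    "\<bar>(\<integral>\<omega>. rgain \<Phi> s t \<omega> \<partial>M) - (t - s) * (\<integral>\<omega>. drift \<Phi> B (zeta s \<omega>) \<partial>M)\<bar> \<le> 2 * (c + W B) * (lam * (t - s))\<^sup>2"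
proof -
  note [measurable] = \<Phi> qp_borel zeta_M[OF st(1)] borel_measurable_halfline_max[OF W_cont]
  have [measurable]: "S t \<in> borel_measurable M" "S s \<in> borel_measurable M" using st by auto
  show rm[measurable]: "rgain \<Phi> s t \<in> borel_measurable M" unfolding rgain_def[abs_def] by measurable
  have kern2[measurable]: "(\<lambda>(u, y). kern \<Phi> B u y) \<in> borel_measurable (borel \<Otimes>\<^sub>M borel)"
    unfolding kern_def by measurable
  have kapm[measurable]: "(\<lambda>u. \<integral>y. exponential_density \<alpha> y * kern \<Phi> B u y \<partial>lborel) \<in> borel_measurable borel"
    by (intro lborel.borel_measurable_lebesgue_integral) (simp add: split_beta')
  show dm[measurable]: "drift \<Phi> B \<in> borel_measurable borel" unfolding drift_def[abs_def] by measurable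
  define C where "C = c + W B"
  have WB: "0 < W B" by (rule W_pos[OF B])
  have c0: "0 \<le> c" using c[rule_format, of B] by linarith
  have kb: "\<bar>kern \<Phi> B u y\<bar> \<le> C" for u y
  proof (cases "0 \<le> u \<and> u \<le> B \<and> 0 < y")
    case True
    have "\<bar>\<Phi> (u - y)\<bar> \<le> c" using True by (intro c[rule_format]) auto
    moreover have "W u \<le> W B" "0 < W u" using True W_mono[of u B] W_pos[of u] by auto
    ultimately show ?thesis using True by (simp add: kern_def C_def max_def)
  next
    case False
    then show ?thesis using c0 WB by (auto simp: kern_def C_def)
  qed
  define QB where "QB = (g 0 + L * B) * K1 + \<delta> * W B"
  have qb: "\<bar>if 0 \<le> u \<and> u \<le> B then qp u else 0\<bar> \<le> QB" for u
  proof -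
    have "0 \<le> QB" unfolding QB_def using g_pos[of 0] L_nonneg B K1_ge1 \<delta> WB by simp
    then show ?thesis using qp_bound[of u B] by (simp add: QB_def)
  qed
  have eC: "\<bar>\<integral>y. exponential_density \<alpha> y * kern \<Phi> B u y \<partial>lborel\<bar> \<le> C" for u
  proof -
    interpret e: prob_space "density lborel (exponential_density \<alpha>)" by (rule prob_space_exponential_density[OF \<alpha>])
    have km: "kern \<Phi> B u \<in> borel_measurable borel" unfolding kern_def[abs_def] by measurable
    have "(\<integral>y. exponential_density \<alpha> y * kern \<Phi> B u y \<partial>lborel) = (\<integral>y. kern \<Phi> B u y \<partial>density lborel (exponential_density \<alpha>))"
      using \<alpha> km by (subst integral_density) (auto simp: exponential_density_nonneg)
    then show ?thesis using e.integral_abs_le_const[of "kern \<Phi> B u" C] kb c0 WB by (simp add: C_def)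
  qed
  let ?qi = "\<lambda>\<omega>. if 0 \<le> zeta s \<omega> \<and> zeta s \<omega> \<le> B then qp (zeta s \<omega>) else 0"
  let ?ki = "\<lambda>\<omega>. if 0 < S t \<omega> - S s \<omega> then kern \<Phi> B (zeta s \<omega>) (S t \<omega> - S s \<omega>) else 0"
  let ?kap = "\<lambda>\<omega>. \<integral>y. exponential_density \<alpha> y * kern \<Phi> B (zeta s \<omega>) y \<partial>lborel"
  have kernm[measurable]: "(\<lambda>\<omega>. kern \<Phi> B (zeta s \<omega>) (S t \<omega> - S s \<omega>)) \<in> borel_measurable M"
    unfolding kern_def by measurable
  have iq: "integrable M ?qi" by (rule integrable_const_bound[of _ QB]) (use qb in auto)
  have ik: "integrable M ?ki"
    by (rule integrable_const_bound[of _ C]) (use kb c0 WB in \<open>auto simp: C_def\<close>)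
  have ikap: "integrable M ?kap"
    by (rule integrable_const_bound[of _ C]) (use eC in auto)
  have ae: "AE \<omega> in M. rgain \<Phi> s t \<omega> = (t - s) * ?qi \<omega> + ?ki \<omega>"
    using zB by eventually_elim (auto simp: rgain_def kern_def)
  show ir: "integrable M (rgain \<Phi> s t)"
  proof (subst integrable_cong_AE[OF _ _ ae])
    show "integrable M (\<lambda>\<omega>. (t - s) * ?qi \<omega> + ?ki \<omega>)"
      by (intro Bochner_Integration.integrable_add integrable_mult_right iq ik)
    then show "(\<lambda>\<omega>. (t - s) * ?qi \<omega> + ?ki \<omega>) \<in> borel_measurable M" by (rule borel_measurable_integrable)
  qed measurable
  have deq: "drift \<Phi> B (zeta s \<omega>) = ?qi \<omega> + lam * ?kap \<omega>" for \<omega> by (simp add: drift_def)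
  show "integrable M (\<lambda>\<omega>. drift \<Phi> B (zeta s \<omega>))"
    unfolding deq by (intro Bochner_Integration.integrable_add integrable_mult_right iq ikap)
  have e1: "(\<integral>\<omega>. rgain \<Phi> s t \<omega> \<partial>M) = (t - s) * (\<integral>\<omega>. ?qi \<omega> \<partial>M) + (\<integral>\<omega>. ?ki \<omega> \<partial>M)"
  proof -
    have im: "integrable M (\<lambda>\<omega>. (t - s) * ?qi \<omega>)" by (intro integrable_mult_right iq)
    have "(\<integral>\<omega>. rgain \<Phi> s t \<omega> \<partial>M) = (\<integral>\<omega>. (t - s) * ?qi \<omega> + ?ki \<omega> \<partial>M)"
      by (rule integral_cong_AE[OF rm _ ae]) (rule borel_measurable_add[OF borel_measurable_integrable[OF im] borel_measurable_integrable[OF ik]])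
    also have "\<dots> = (\<integral>\<omega>. (t - s) * ?qi \<omega> \<partial>M) + (\<integral>\<omega>. ?ki \<omega> \<partial>M)"
      by (rule Bochner_Integration.integral_add[OF im ik])
    finally show ?thesis by (simp only: integral_mult_right_zero)
  qed
  have e2: "(\<integral>\<omega>. drift \<Phi> B (zeta s \<omega>) \<partial>M) = (\<integral>\<omega>. ?qi \<omega> \<partial>M) + lam * (\<integral>\<omega>. ?kap \<omega> \<partial>M)"
  proof -
    have im: "integrable M (\<lambda>\<omega>. lam * ?kap \<omega>)" by (intro integrable_mult_right ikap)
    show ?thesis unfolding deq
      by (subst Bochner_Integration.integral_add[OF iq im]) (simp only: integral_mult_right_zero)
  qed
  have "\<bar>(\<integral>\<omega>. ?ki \<omega> \<partial>M) - lam * (t - s) * (\<integral>\<omega>. ?kap \<omega> \<partial>M)\<bar> \<le> 2 * C * (lam * (t - s))\<^sup>2"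
    by (rule claim_increment_expectation_F[OF st zeta_F[OF st(1)] kern2 kb])
  then show "\<bar>(\<integral>\<omega>. rgain \<Phi> s t \<omega> \<partial>M) - (t - s) * (\<integral>\<omega>. drift \<Phi> B (zeta s \<omega>) \<partial>M)\<bar> \<le> 2 * (c + W B) * (lam * (t - s))\<^sup>2"
    unfolding e1 e2 C_def by (simp add: algebra_simps)
qed


definition msum :: "(real \<Rightarrow> real) \<Rightarrow> real \<Rightarrow> nat \<Rightarrow> 'a \<Rightarrow> real" where
  "msum \<Phi> T m \<omega> = (\<Sum>k<m. exp (- \<delta> * (T * real k / real m)) * rgain \<Phi> (T * real k / real m) (T * real (Suc k) / real m) \<omega>)"

lemma msum_eq:
  fixes T :: real
  assumes "hjb_path g lam \<alpha> \<delta> b L K K1 W W' x (\<lambda>t. N t \<omega>) (\<lambda>i. Y i \<omega>) (\<lambda>t. D t \<omega>) (\<lambda>t. X t \<omega>)" "0 < T"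
  shows "msum \<Phi> T m \<omega> = (\<Sum>k<m. exp (- \<delta> * (T * real k / real m)) *
    hjb_path.gain g \<delta> W W' (\<lambda>t. N t \<omega>) (\<lambda>i. Y i \<omega>) (\<lambda>t. X t \<omega>) \<Phi> (T * real k / real m) (T * real (Suc k) / real m))"
  unfolding msum_def by (intro sum.cong refl arg_cong2[of _ _ _ _ "(*)"] rgain_eq assms(1)) (use assms(2) in simp)

lemma grid:
  fixes T :: real
  assumes "0 < T" "k < m"
  shows "0 \<le> T * real k / real m" "T * real k / real m < T * real (Suc k) / real m" "T * real (Suc k) / real m \<le> T"
    "T * real k / real m \<le> T" "T * real (Suc k) / real m - T * real k / real m = T / real m"
proof -
  have m: "0 < real m" using assms by simp
  show "0 \<le> T * real k / real m" using assms by simp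
  show d: "T * real (Suc k) / real m - T * real k / real m = T / real m" by (simp add: algebra_simps diff_divide_distrib[symmetric])
  have "0 < T / real m" using assms m by simp
  with d show lt: "T * real k / real m < T * real (Suc k) / real m" by linarith
  have "T * real (Suc k) \<le> T * real m" using assms by (intro mult_left_mono) auto
  then show le: "T * real (Suc k) / real m \<le> T" using m by (simp add: divide_le_eq)
  show "T * real k / real m \<le> T" using lt le by linarith
qed

context
  fixes \<Phi> :: "real \<Rightarrow> real" and B c T :: real
  assumes \<Phi>: "\<Phi> \<in> borel_measurable borel" and B: "0 \<le> B" and c: "\<forall>z. z \<le> B \<longrightarrow> \<bar>\<Phi> z\<bar> \<le> c" and T: "0 < T"
    and zB: "AE \<omega> in M. \<forall>s. 0 \<le> s \<longrightarrow> s \<le> T \<longrightarrow> zeta s \<omega> \<le> B"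
begin

lemma zB': "0 \<le> s \<Longrightarrow> s \<le> T \<Longrightarrow> AE \<omega> in M. zeta s \<omega> \<le> B"
  using zB by eventually_elim auto

lemma msum_measurable: "msum \<Phi> T m \<in> borel_measurable M"
  unfolding msum_def[abs_def]
  by (intro borel_measurable_sum borel_measurable_times borel_measurable_const)
    (use rgain_expectation(1)[OF \<Phi> B c _ _ zB'] grid[OF T] in auto)

text \<open>Discount factors are at most 1, and m errors of order (T / m)^2 add up to order 1 /
  m.\<close>

lemma msum_expectation:
  assumes m: "0 < m"
  shows "\<bar>(\<integral>\<omega>. msum \<Phi> T m \<omega> \<partial>M)
     - (\<Sum>k<m. exp (- \<delta> * (T * real k / real m)) * ((T / real m) * (\<integral>\<omega>. drift \<Phi> B (zeta (T * real k / real m) \<omega>) \<partial>M)))\<bar>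
     \<le> 2 * (c + W B) * (lam * T)\<^sup>2 * inverse (real m)"
proof -
  note rg = rgain_expectation[OF \<Phi> B c grid(1,2)[OF T] zB'[OF grid(1,4)[OF T]]]
  have "(\<integral>\<omega>. msum \<Phi> T m \<omega> \<partial>M) = (\<Sum>k<m. exp (- \<delta> * (T * real k / real m)) * (\<integral>\<omega>. rgain \<Phi> (T * real k / real m) (T * real (Suc k) / real m) \<omega> \<partial>M))"
    unfolding msum_def using rg(3)
    by (subst Bochner_Integration.integral_sum) (auto simp del: of_nat_Suc)
  then have eq: "(\<integral>\<omega>. msum \<Phi> T m \<omega> \<partial>M)
     - (\<Sum>k<m. exp (- \<delta> * (T * real k / real m)) * ((T / real m) * (\<integral>\<omega>. drift \<Phi> B (zeta (T * real k / real m) \<omega>) \<partial>M)))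
     = (\<Sum>k<m. exp (- \<delta> * (T * real k / real m)) * ((\<integral>\<omega>. rgain \<Phi> (T * real k / real m) (T * real (Suc k) / real m) \<omega> \<partial>M)
         - (T / real m) * (\<integral>\<omega>. drift \<Phi> B (zeta (T * real k / real m) \<omega>) \<partial>M)))"
    by (simp only: sum_subtractf[symmetric] right_diff_distrib)
  have "\<bar>\<Sum>k<m. exp (- \<delta> * (T * real k / real m)) * ((\<integral>\<omega>. rgain \<Phi> (T * real k / real m) (T * real (Suc k) / real m) \<omega> \<partial>M)
         - (T / real m) * (\<integral>\<omega>. drift \<Phi> B (zeta (T * real k / real m) \<omega>) \<partial>M))\<bar> \<le> (\<Sum>k<m. 2 * (c + W B) * (lam * (T / real m))\<^sup>2)"
  proof (rule order_trans[OF sum_abs], rule sum_mono)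
    fix k assume "k \<in> {..<m}"
    then have k: "k < m" by simp
    let ?d = "(\<integral>\<omega>. rgain \<Phi> (T * real k / real m) (T * real (Suc k) / real m) \<omega> \<partial>M) - (T / real m) * (\<integral>\<omega>. drift \<Phi> B (zeta (T * real k / real m) \<omega>) \<partial>M)"
    have "\<bar>exp (- \<delta> * (T * real k / real m)) * ?d\<bar> = exp (- \<delta> * (T * real k / real m)) * \<bar>?d\<bar>" by (simp only: abs_mult abs_exp_cancel)
    also have "\<dots> \<le> \<bar>?d\<bar>"
      using mult_nonneg_nonneg[OF less_imp_le[OF \<delta>] grid(1)[OF T k]] by (intro mult_left_le_one_le) auto
    also have "\<dots> \<le> 2 * (c + W B) * (lam * (T / real m))\<^sup>2"
      using rg(5)[OF k k k k] unfolding grid(5)[OF T k] .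
    finally show "\<bar>exp (- \<delta> * (T * real k / real m)) * ?d\<bar> \<le> 2 * (c + W B) * (lam * (T / real m))\<^sup>2" .
  qed
  also have "\<dots> = 2 * (c + W B) * (lam * T)\<^sup>2 * inverse (real m)"
  proof -
    define l where "l = lam * T"
    have "real m * (l / real m)\<^sup>2 = l\<^sup>2 * inverse (real m)"
      using m by (simp add: power2_eq_square inverse_eq_divide)
    moreover have "lam * (T / real m) = l / real m" by (simp add: l_def)
    moreover have "(\<Sum>k<m. 2 * (c + W B) * (lam * (T / m))\<^sup>2) = 2 * (c + W B) * (real m * (lam * (T / real m))\<^sup>2)"
      unfolding sum_constant card_lessThan by (rule mult.left_commute)
    ultimately have "(\<Sum>k<m. 2 * (c + W B) * (lam * (T / m))\<^sup>2) = 2 * (c + W B) * (l\<^sup>2 * inverse (real m))"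
      by metis
    then show ?thesis unfolding l_def by (simp only: mult.assoc)
  qed
  finally show ?thesis unfolding eq .
qed

lemma drift_integrable: "k < m \<Longrightarrow> integrable M (\<lambda>\<omega>. drift \<Phi> B (zeta (T * real k / real m) \<omega>))"
  by (rule rgain_expectation(4)[OF \<Phi> B c grid(1,2)[OF T] zB'[OF grid(1,4)[OF T]]])

lemma msum_expectation_le:
  assumes m: "0 < m" and r: "0 \<le> r" "\<And>u. drift \<Phi> B u \<le> r"
  shows "(\<integral>\<omega>. msum \<Phi> T m \<omega> \<partial>M) \<le> T * r + 2 * (c + W B) * (lam * T)\<^sup>2 * inverse (real m)"
proof -
  have "(\<Sum>k<m. exp (- \<delta> * (T * real k / real m)) * ((T / real m) * (\<integral>\<omega>. drift \<Phi> B (zeta (T * real k / real m) \<omega>) \<partial>M))) \<le> (\<Sum>k<m. (T / real m) * r)"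
  proof (rule sum_mono)
    fix k assume "k \<in> {..<m}"
    then have k: "k < m" by simp
    have "(\<integral>\<omega>. drift \<Phi> B (zeta (T * real k / real m) \<omega>) \<partial>M) \<le> (\<integral>\<omega>. r \<partial>M)"
      by (rule integral_mono[OF drift_integrable[OF k]]) (use r in auto)
    then have "(T / real m) * (\<integral>\<omega>. drift \<Phi> B (zeta (T * real k / real m) \<omega>) \<partial>M) \<le> (T / real m) * r"
      using T by (intro mult_left_mono) (auto simp: prob_space)
    then have "exp (- \<delta> * (T * real k / real m)) * ((T / real m) * (\<integral>\<omega>. drift \<Phi> B (zeta (T * real k / real m) \<omega>) \<partial>M)) \<le> exp (- \<delta> * (T * real k / real m)) * ((T / real m) * r)"
      by (rule mult_left_mono) simp
    also have "\<dots> \<le> (T / real m) * r"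
      using mult_nonneg_nonneg[OF less_imp_le[OF \<delta>] grid(1)[OF T k]] r T by (intro mult_left_le_one_le) auto
    finally show "exp (- \<delta> * (T * real k / real m)) * ((T / real m) * (\<integral>\<omega>. drift \<Phi> B (zeta (T * real k / real m) \<omega>) \<partial>M)) \<le> (T / real m) * r" .
  qed
  also have "\<dots> = T * r" using m by simp
  finally show ?thesis using msum_expectation[OF m] by linarith
qed

lemma msum_expectation_ge:
  assumes m: "0 < m" and r: "\<And>u. 0 \<le> drift \<Phi> B u"
  shows "- (2 * (c + W B) * (lam * T)\<^sup>2 * inverse (real m)) \<le> (\<integral>\<omega>. msum \<Phi> T m \<omega> \<partial>M)"
proof -
  have "0 \<le> (\<Sum>k<m. exp (- \<delta> * (T * real k / real m)) * ((T / real m) * (\<integral>\<omega>. drift \<Phi> B (zeta (T * real k / real m) \<omega>) \<partial>M)))"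
    using T r by (intro sum_nonneg mult_nonneg_nonneg Bochner_Integration.integral_nonneg) auto
  then show ?thesis using msum_expectation[OF m] by linarith
qed

text \<open>A majorant independent of m: each step contributes its length times the bound on
  \<open>qp\<close>, a step with claims another c + W B, and at most N T steps contain
  claims.\<close>

lemma msum_bound:
  shows "AE \<omega> in M. \<bar>msum \<Phi> T m \<omega>\<bar> \<le> T * ((g 0 + L * B) * K1 + \<delta> * W B) + (c + W B) * real (N T \<omega>)"
  using zB AE_hjb_path
proof eventually_elim
  case (elim \<omega>)
  interpret p: hjb_path g lam \<alpha> \<delta> b L K K1 W W' x "\<lambda>t. N t \<omega>" "\<lambda>i. Y i \<omega>" "\<lambda>t. D t \<omega>" "\<lambda>t. X t \<omega>" by fact
  define QB where "QB = (g 0 + L * B) * K1 + \<delta> * W B"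
  have WB: "0 < W B" by (rule W_pos[OF B])
  have c0: "0 \<le> c" using c[rule_format, of B] by linarith
  have QB: "0 \<le> QB" unfolding QB_def using g_pos[of 0] L_nonneg B K1_ge1 \<delta> WB by simp
  have rg: "\<bar>rgain \<Phi> s t \<omega>\<bar> \<le> (t - s) * QB + (c + W B) * (real (N t \<omega>) - real (N s \<omega>))"
    if st: "0 \<le> s" "s < t" "t \<le> T" for s t
  proof -
    have n: "real (N s \<omega>) \<le> real (N t \<omega>)" using p.n_le[of s t] st by simp
    have R: "0 \<le> (t - s) * QB" "0 \<le> (c + W B) * (real (N t \<omega>) - real (N s \<omega>))" using st QB n c0 WB by auto
    show ?thesis
    proof (cases "0 \<le> zeta s \<omega>")
      case True
      have zb: "zeta s \<omega> \<le> B" using elim(1) st by auto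
      have a: "\<bar>(t - s) * qp (zeta s \<omega>)\<bar> \<le> (t - s) * QB"
        unfolding abs_mult QB_def using qp_bound[OF True zb] st by (intro mult_mono) auto
      show ?thesis
      proof (cases "0 < S t \<omega> - S s \<omega>")
        case d: True
        have "S u \<omega> = p.S u" for u by (simp add: p.S_def aggregate_claims_def)
        then have "N s \<omega> < N t \<omega>" using p.S_less[of s t] st d by simp
        then have n1: "1 \<le> real (N t \<omega>) - real (N s \<omega>)" by simp
        have "\<bar>\<Phi> (zeta s \<omega> - (S t \<omega> - S s \<omega>))\<bar> \<le> c" using zb d by (intro c[rule_format]) auto
        moreover have "W (max 0 (zeta s \<omega>)) \<le> W B" "0 < W (max 0 (zeta s \<omega>))"
          using zb B by (auto intro!: W_mono W_pos)
        ultimately have "\<bar>\<Phi> (zeta s \<omega> - (S t \<omega> - S s \<omega>)) - W (max 0 (zeta s \<omega>))\<bar> \<le> c + W B" by linarith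
        also have "\<dots> \<le> (c + W B) * (real (N t \<omega>) - real (N s \<omega>))"
          using n1 c0 WB mult_left_mono[of 1 "real (N t \<omega>) - real (N s \<omega>)" "c + W B"] by simp
        finally show ?thesis using a True d unfolding rgain_def by simp
      next
        case False
        then show ?thesis using a True R unfolding rgain_def by simp
      qed
    next
      case False
      then show ?thesis using R by (simp add: rgain_def)
    qed
  qed
  show ?case
  proof (cases "m = 0")
    case True
    then show ?thesis using T QB c0 WB by (simp add: msum_def flip: QB_def)
  next
    case False
    let ?n = "\<lambda>k. real (N (T * real k / real m) \<omega>)"
    have "\<bar>msum \<Phi> T m \<omega>\<bar> \<le> (\<Sum>k<m. (T / real m) * QB + (c + W B) * (?n (Suc k) - ?n k))"
      unfolding msum_def
    proof (rule order_trans[OF sum_abs], rule sum_mono)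
      fix k assume "k \<in> {..<m}"
      then have k: "k < m" by simp
      have "\<bar>exp (- \<delta> * (T * real k / real m)) * rgain \<Phi> (T * real k / real m) (T * real (Suc k) / real m) \<omega>\<bar>
         = exp (- \<delta> * (T * real k / real m)) * \<bar>rgain \<Phi> (T * real k / real m) (T * real (Suc k) / real m) \<omega>\<bar>"
        by (simp only: abs_mult abs_exp_cancel)
      also have "\<dots> \<le> \<bar>rgain \<Phi> (T * real k / real m) (T * real (Suc k) / real m) \<omega>\<bar>"
        using mult_nonneg_nonneg[OF less_imp_le[OF \<delta>] grid(1)[OF T k]] by (intro mult_left_le_one_le) auto
      also have "\<dots> \<le> (T / real m) * QB + (c + W B) * (?n (Suc k) - ?n k)"
        using rg[OF grid(1,2,3)[OF T k]] unfolding grid(5)[OF T k] .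
      finally show "\<bar>exp (- \<delta> * (T * real k / real m)) * rgain \<Phi> (T * real k / real m) (T * real (Suc k) / real m) \<omega>\<bar> \<le> (T / real m) * QB + (c + W B) * (?n (Suc k) - ?n k)" .
    qed
    also have "\<dots> = T * QB + (c + W B) * (?n m - ?n 0)"
      using False sum_lessThan_telescope[of ?n m]
      by (simp add: sum.distrib sum_distrib_left[symmetric] del: of_nat_Suc)
    also have "\<dots> = T * QB + (c + W B) * real (N T \<omega>)"
      using False elim(2) p.n0 by simp
    finally show ?thesis by (simp add: QB_def)
  qed
qed

end

text \<open>The grid is refined for fixed \<epsilon>. The excess of \<open>Weps\<close> over
  \<open>Wdead\<close> raises the drift to at most lam W 0 \<alpha> \<epsilon>, which accumulates
  over time T.\<close>

lemma payoff_upper_T: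
  fixes T \<epsilon> :: real
  assumes T: "0 < T" and \<epsilon>: "0 < \<epsilon>"
  obtains H where "H \<in> borel_measurable M"
    "AE \<omega> in M. (\<integral>\<^sup>+u. ennreal (exp (- \<delta> * u)) * indicator {u. 0 \<le> u \<and> u \<le> T \<and> surplus_path.alive (\<lambda>t. X t \<omega>) u} u \<partial>interval_measure (\<lambda>t. D t \<omega>)) \<le> H \<omega>"
    "(\<integral>\<^sup>+\<omega>. H \<omega> \<partial>M) \<le> ennreal (W x + T * (lam * (W 0 * \<alpha> * \<epsilon>)))"
proof -
  define B where "B = (1 + x) * exp ((g 0 + L) * T)"
  have B: "0 \<le> B" using x_nonneg by (simp add: B_def)
  have zB: "AE \<omega> in M. \<forall>s. 0 \<le> s \<longrightarrow> s \<le> T \<longrightarrow> zeta s \<omega> \<le> B"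
    using AE_surplus_path
  proof eventually_elim
    case (elim \<omega>)
    interpret p: surplus_path g L x "\<lambda>t. N t \<omega>" "\<lambda>i. Y i \<omega>" "\<lambda>t. D t \<omega>" "\<lambda>t. X t \<omega>" by fact
    show ?case
    proof (intro allI impI)
      fix s assume s: "0 \<le> s" "s \<le> T"
      have "X s \<omega> \<le> (1 + x) * exp ((g 0 + L) * s)" by (rule p.X_le_exp[OF s(1)])
      also have "\<dots> \<le> B" unfolding B_def using x_nonneg s g_pos[of 0] L_nonneg
        by (intro mult_left_mono) (auto intro!: mult_left_mono)
      finally show "zeta s \<omega> \<le> B" using B by (simp add: zeta_def)
    qed
  qed
  have c: "\<forall>z. z \<le> B \<longrightarrow> \<bar>Weps \<epsilon> z\<bar> \<le> W B" using Weps_bound[OF \<epsilon> B] by blast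
  note ms = Weps_borel[of \<epsilon>] B c T zB
  define r where "r = lam * (W 0 * \<alpha> * \<epsilon>)"
  have r: "0 \<le> r" using lam W0 \<alpha> \<epsilon> by (simp add: r_def)
  have drift: "drift (Weps \<epsilon>) B u \<le> r" for u
  proof (cases "0 \<le> u \<and> u \<le> B")
    case True
    then have u: "0 \<le> u" "u \<le> B" by auto
    have "lam * (\<integral>y. exponential_density \<alpha> y * Weps \<epsilon> (u - y) \<partial>lborel) \<le> lam * (claim_mean \<alpha> W u + W 0 * \<alpha> * \<epsilon>)"
      using Weps_claim_mean_le[OF u(1) \<epsilon>] lam by (intro mult_left_mono) auto
    moreover have "lam * (claim_mean \<alpha> W u + W 0 * \<alpha> * \<epsilon>) = lam * claim_mean \<alpha> W u + r" by (simp add: r_def distrib_left)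
    ultimately show ?thesis using drift_eq[OF Weps_borel c u] hjb_le[OF u(1)] by linarith
  next
    case False
    then show ?thesis using r by (simp add: drift_outside)
  qed
  define C where "C = 2 * (W B + W B) * (lam * T)\<^sup>2"
  have lim0: "(\<lambda>m. C * inverse (real m)) \<longlonglongrightarrow> 0"
    using tendsto_mult[OF tendsto_const[of C] lim_inverse_n] by simp
  define QB where "QB = T * ((g 0 + L * B) * K1 + \<delta> * W B)"
  define w where "w = (\<lambda>\<omega>. W x + (QB + (W B + W B) * real (N T \<omega>)))"
  let ?phi = "\<lambda>\<omega>. \<integral>\<^sup>+u. ennreal (exp (- \<delta> * u)) * indicator {u. 0 \<le> u \<and> u \<le> T \<and> surplus_path.alive (\<lambda>t. X t \<omega>) u} u \<partial>interval_measure (\<lambda>t. D t \<omega>)"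
  let ?f = "\<lambda>m \<omega>. W x + msum (Weps \<epsilon>) T m \<omega>"
  have fm: "?f m \<in> borel_measurable M" for m
    using msum_measurable[OF ms] by (rule borel_measurable_add[OF borel_measurable_const])
  have wi: "integrable M w" unfolding w_def
    by (intro Bochner_Integration.integrable_add integrable_mult_right poisson_process_integrable[OF prob_space_axioms poisson lam_pos T])
      simp_all
  have dom: "AE \<omega> in M. \<bar>?f m \<omega>\<bar> \<le> w \<omega>" for m
    using msum_bound[OF ms, of m] by eventually_elim (use W_pos[OF x_nonneg] in \<open>simp add: w_def QB_def abs_le_iff\<close>)
  have le: "AE \<omega> in M. \<forall>\<^sub>F m in sequentially. 0 \<le> ?f m \<omega> + e \<and> ?phi \<omega> \<le> ennreal (?f m \<omega> + e)" if e: "0 < e" for e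
    using AE_hjb_path
  proof eventually_elim
    case (elim \<omega>)
    interpret p: hjb_path g lam \<alpha> \<delta> b L K K1 W W' x "\<lambda>t. N t \<omega>" "\<lambda>i. Y i \<omega>" "\<lambda>t. D t \<omega>" "\<lambda>t. X t \<omega>" by fact
    show ?case using p.discounted_dividends_le[OF T \<epsilon> e] unfolding msum_eq[OF elim T] .
  qed
  have c0: "0 \<le> W x + T * r" using W_pos[OF x_nonneg] T r by simp
  have E: "\<forall>\<^sub>F m in sequentially. (\<integral>\<omega>. ?f m \<omega> \<partial>M) \<le> (W x + T * r) + e" if e: "0 < e" for e
    using order_tendstoD(2)[OF lim0 e] eventually_gt_at_top[of 0]
  proof eventually_elim
    case (elim m)
    have im: "integrable M (msum (Weps \<epsilon>) T m)"
    proof (rule Bochner_Integration.integrable_bound[of M "\<lambda>\<omega>. QB + (W B + W B) * real (N T \<omega>)"])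
      show "integrable M (\<lambda>\<omega>. QB + (W B + W B) * real (N T \<omega>))"
        by (intro Bochner_Integration.integrable_add integrable_mult_right poisson_process_integrable[OF prob_space_axioms poisson lam_pos T]) simp
      show "AE \<omega> in M. norm (msum (Weps \<epsilon>) T m \<omega>) \<le> norm (QB + (W B + W B) * real (N T \<omega>))"
        using msum_bound[OF ms, of m] by eventually_elim (simp add: QB_def)
    qed (rule msum_measurable[OF ms])
    have "(\<integral>\<omega>. ?f m \<omega> \<partial>M) = W x + (\<integral>\<omega>. msum (Weps \<epsilon>) T m \<omega> \<partial>M)"
      by (subst Bochner_Integration.integral_add[OF _ im]) (simp_all add: prob_space)
    also have "\<dots> \<le> W x + (T * r + C * inverse (real m))"
      using msum_expectation_le[OF ms elim(2) r drift] by (simp add: C_def)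
    finally show ?case using elim(1) by simp
  qed
  obtain H where "H \<in> borel_measurable M" "AE \<omega> in M. ?phi \<omega> \<le> H \<omega>" "(\<integral>\<^sup>+\<omega>. H \<omega> \<partial>M) \<le> ennreal (W x + T * r)"
    by (rule nn_integral_dominated_upper[OF fm wi dom c0 le E]) (assumption | erule (2) that)+
  then show ?thesis using that by (simp add: r_def)
qed

end

section \<open>Verification\<close>

lemma before_ruin_alive:
  assumes "ereal t < ruin_time X \<omega>" and "surplus_path g L x n y D (\<lambda>t. X t \<omega>)"
  shows "surplus_path.alive (\<lambda>t. X t \<omega>) t"
proof -
  interpret p: surplus_path g L x n y D "\<lambda>t. X t \<omega>" by fact
  show ?thesis unfolding p.alive_def
  proof (intro allI impI, rule ccontr)
    fix r assume r: "0 \<le> r" "r \<le> t" "\<not> 0 \<le> X r \<omega>"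
    then have "ruin_time X \<omega> \<le> ereal r" unfolding ruin_time_def by (intro Inf_lower) auto
    also have "\<dots> \<le> ereal t" using r by simp
    finally show False using assms(1) by simp
  qed
qed

text \<open>Monotone convergence in the horizon. The horizons \<open>Suc j\<close> are positive, as
  the finite-horizon estimates demand.\<close>

lemma nn_integral_T_limit:
  assumes A: "{u. A u} \<in> sets borel"
  shows "(\<integral>\<^sup>+u. ennreal (exp (- \<delta> * u)) * indicator {u. 0 \<le> u \<and> A u} u \<partial>interval_measure D)
    = (SUP j. \<integral>\<^sup>+u. ennreal (exp (- \<delta> * u)) * indicator {u. 0 \<le> u \<and> u \<le> real (Suc j) \<and> A u} u \<partial>interval_measure D)"
proof -
  let ?h = "\<lambda>j u. ennreal (exp (- \<delta> * u)) * indicator {u. 0 \<le> u \<and> u \<le> real (Suc j) \<and> A u} u"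
  have eq: "{u. 0 \<le> u \<and> u \<le> v \<and> A u} = {0..v} \<inter> {u. A u}" for v :: real by auto
  have m: "?h j \<in> borel_measurable (interval_measure D)" for j unfolding eq using A by simp
  have inc: "incseq ?h"
    by (intro incseq_SucI le_funI mult_left_mono) (auto split: split_indicator)
  have "ennreal (exp (- \<delta> * u)) * indicator {u. 0 \<le> u \<and> A u} u = (SUP j. ?h j u)" for u
  proof (cases "0 \<le> u \<and> A u")
    case True
    obtain j where "u \<le> real j" using real_arch_simple by blast
    then have j: "?h j u = ennreal (exp (- \<delta> * u))" using True by simp
    show ?thesis
    proof (rule antisym)
      show "ennreal (exp (- \<delta> * u)) * indicator {u. 0 \<le> u \<and> A u} u \<le> (SUP j. ?h j u)"
        using True by (intro SUP_upper2[of j]) (simp_all only: j, simp_all)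
      show "(SUP j. ?h j u) \<le> ennreal (exp (- \<delta> * u)) * indicator {u. 0 \<le> u \<and> A u} u"
        by (rule SUP_least) (use True in \<open>auto split: split_indicator\<close>)
    qed
  next
    case False
    then have "?h j u = 0" for j by auto
    then show ?thesis using False by simp
  qed
  then have "(\<integral>\<^sup>+u. ennreal (exp (- \<delta> * u)) * indicator {u. 0 \<le> u \<and> A u} u \<partial>interval_measure D)
     = (\<integral>\<^sup>+u. (SUP j. ?h j u) \<partial>interval_measure D)" by simp
  also have "\<dots> = (SUP j. \<integral>\<^sup>+u. ?h j u \<partial>interval_measure D)"
    using inc m by (rule nn_integral_monotone_convergence_SUP)
  finally show ?thesis .
qed

context hjb_model
begin

text \<open>The payoff integrand need not be measurable. As \<open>\<integral>\<^sup>+\<close> is a lower integral, measurable dominating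
  functions suffice.\<close>

lemma payoff_le: "payoff M \<delta> D X \<le> ennreal (W x)"
proof -
  let ?phi = "\<lambda>j \<omega>. \<integral>\<^sup>+u. ennreal (exp (- \<delta> * u)) * indicator {u. 0 \<le> u \<and> u \<le> real (Suc j) \<and> surplus_path.alive (\<lambda>t. X t \<omega>) u} u \<partial>interval_measure (\<lambda>t. D t \<omega>)"
  define \<kappa> where "\<kappa> = lam * (W 0 * \<alpha>)"
  have \<kappa>: "0 < \<kappa>" using lam W0 \<alpha> by (simp add: \<kappa>_def)
  have "\<exists>H. H \<in> borel_measurable M \<and> (AE \<omega> in M. ?phi j \<omega> \<le> H \<omega>) \<and> (\<integral>\<^sup>+\<omega>. H \<omega> \<partial>M) \<le> ennreal (W x + inverse (real (Suc j)))" for j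
  proof -
    \<comment> \<open>With this choice the horizon j + 1 times the drift excess equals 1 / (j +
      1).\<close>
    define \<epsilon> where "\<epsilon> = inverse (real (Suc j)) / (real (Suc j) * \<kappa>)"
    have \<epsilon>: "0 < \<epsilon>" using \<kappa> by (simp add: \<epsilon>_def)
    have "real (Suc j) * (lam * (W 0 * \<alpha> * \<epsilon>)) = real (Suc j) * \<kappa> * \<epsilon>" by (simp add: \<kappa>_def)
    also have "\<dots> = inverse (real (Suc j))" using \<kappa> by (simp add: \<epsilon>_def del: of_nat_Suc)
    finally have e: "real (Suc j) * (lam * (W 0 * \<alpha> * \<epsilon>)) = inverse (real (Suc j))" .
    show ?thesis
      by (rule payoff_upper_T[of "real (Suc j)" \<epsilon>]) (use \<epsilon> in \<open>auto simp only: e intro: exI\<close>)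
  qed
  then have "\<forall>j. \<exists>H. H \<in> borel_measurable M \<and> (AE \<omega> in M. ?phi j \<omega> \<le> H \<omega>) \<and> (\<integral>\<^sup>+\<omega>. H \<omega> \<partial>M) \<le> ennreal (W x + inverse (real (Suc j)))"
    by (rule allI)
  from choice[OF this] obtain H where HH: "\<forall>j. H j \<in> borel_measurable M \<and> (AE \<omega> in M. ?phi j \<omega> \<le> H j \<omega>) \<and> (\<integral>\<^sup>+\<omega>. H j \<omega> \<partial>M) \<le> ennreal (W x + inverse (real (Suc j)))" ..
  have H: "\<And>j. H j \<in> borel_measurable M" "\<And>j. AE \<omega> in M. ?phi j \<omega> \<le> H j \<omega>"
    "\<And>j. (\<integral>\<^sup>+\<omega>. H j \<omega> \<partial>M) \<le> ennreal (W x + inverse (real (Suc j)))"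
    by (rule HH[rule_format, THEN conjunct1], rule HH[rule_format, THEN conjunct2, THEN conjunct1],
        rule HH[rule_format, THEN conjunct2, THEN conjunct2])
  have HA: "AE \<omega> in M. \<forall>j. ?phi j \<omega> \<le> H j \<omega>" using H(2) by (simp add: AE_all_countable)
  \<comment> \<open>Dividends up to a horizon increase with it, so each lies below all later
    \<open>H i\<close>; hence the liminf of these dominates the payoff integrand.\<close>
  have "payoff M \<delta> D X \<le> (\<integral>\<^sup>+\<omega>. liminf (\<lambda>j. H j \<omega>) \<partial>M)"
    unfolding payoff_def
  proof (rule nn_integral_mono_AE)
    show "AE \<omega> in M. (\<integral>\<^sup>+t. ennreal (exp (- \<delta> * t)) * indicator {t. 0 \<le> t \<and> ereal t < ruin_time X \<omega>} t \<partial>interval_measure (\<lambda>t. D t \<omega>))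
       \<le> liminf (\<lambda>j. H j \<omega>)"
      using HA AE_surplus_path
    proof eventually_elim
      case (elim \<omega>)
      interpret p: surplus_path g L x "\<lambda>t. N t \<omega>" "\<lambda>i. Y i \<omega>" "\<lambda>t. D t \<omega>" "\<lambda>t. X t \<omega>" by fact
      have "(\<integral>\<^sup>+t. ennreal (exp (- \<delta> * t)) * indicator {t. 0 \<le> t \<and> ereal t < ruin_time X \<omega>} t \<partial>interval_measure (\<lambda>t. D t \<omega>))
         \<le> (\<integral>\<^sup>+t. ennreal (exp (- \<delta> * t)) * indicator {t. 0 \<le> t \<and> p.alive t} t \<partial>interval_measure (\<lambda>t. D t \<omega>))"
        using before_ruin_alive[where X=X and \<omega>=\<omega>, OF _ p.surplus_path_axioms]
        by (intro nn_integral_mono mult_left_mono) (auto split: split_indicator)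
      also have "\<dots> = (SUP j. ?phi j \<omega>)" by (rule nn_integral_T_limit[OF p.alive_measurable])
      also have "\<dots> \<le> liminf (\<lambda>j. H j \<omega>)"
      proof (rule SUP_least, rule Liminf_bounded)
        fix j
        show "\<forall>\<^sub>F i in sequentially. ?phi j \<omega> \<le> H i \<omega>"
          using eventually_ge_at_top[of j]
        proof eventually_elim
          case (elim i)
          have "?phi j \<omega> \<le> ?phi i \<omega>"
            using elim by (intro nn_integral_mono mult_left_mono) (auto split: split_indicator)
          also have "\<dots> \<le> H i \<omega>" using \<open>\<forall>j. ?phi j \<omega> \<le> H j \<omega>\<close> by blast
          finally show ?case .
        qed
      qed
      finally show ?case .
    qed
  qed
  also have "\<dots> \<le> liminf (\<lambda>j. \<integral>\<^sup>+\<omega>. H j \<omega> \<partial>M)" by (rule nn_integral_liminf) (rule H(1))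
  also have "\<dots> \<le> liminf (\<lambda>j. ennreal (W x + inverse (real (Suc j))))"
    by (rule Liminf_mono) (use H(3) in auto)
  also have "\<dots> = ennreal (W x)"
  proof (rule lim_imp_Liminf)
    have "(\<lambda>j. W x + inverse (real (Suc j))) \<longlonglongrightarrow> W x + 0"
      by (intro tendsto_intros LIMSEQ_inverse_real_of_nat)
    then show "(\<lambda>j. ennreal (W x + inverse (real (Suc j)))) \<longlonglongrightarrow> ennreal (W x)"
      by (intro tendsto_ennrealI) simp
  qed simp
  finally show ?thesis .
qed

end

locale barrier_model = hjb_model +
  assumes AE_barrier: "AE \<omega> in M. barrier_path g lam \<alpha> \<delta> b L K K1 W W' x (\<lambda>t. N t \<omega>) (\<lambda>i. Y i \<omega>) (\<lambda>t. D t \<omega>) (\<lambda>t. X t \<omega>)"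
begin

lemma payoff_lower_T:
  fixes T :: real
  assumes T: "0 < T"
  shows "ennreal (W x - exp (- \<delta> * T) * W b) \<le> payoff M \<delta> D X"
proof -
  have zB: "AE \<omega> in M. \<forall>s. 0 \<le> s \<longrightarrow> s \<le> T \<longrightarrow> zeta s \<omega> \<le> b"
    using AE_barrier
  proof eventually_elim
    case (elim \<omega>)
    interpret p: barrier_path g lam \<alpha> \<delta> b L K K1 W W' x "\<lambda>t. N t \<omega>" "\<lambda>i. Y i \<omega>" "\<lambda>t. D t \<omega>" "\<lambda>t. X t \<omega>" by fact
    show ?case using p.X_le b by (auto simp: zeta_def)
  qed
  have c: "\<forall>z. z \<le> b \<longrightarrow> \<bar>Wdead z\<bar> \<le> W b" using Wdead_bound[OF b] by blast
  note ms = Wdead_borel b c T zB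
  \<comment> \<open>Truncation takes place at b itself, which bounds the surplus; on [0, b] the
    equation holds with equality and the drift is 0.\<close>
  have drift: "0 \<le> drift Wdead b u" for u
  proof (cases "0 \<le> u \<and> u \<le> b")
    case True
    then have u: "0 \<le> u" "u \<le> b" by auto
    show ?thesis using drift_eq[OF Wdead_borel c u] hjb_eq[OF u] claim_mean_Wdead[OF u(1)] by simp
  qed (simp add: drift_outside)
  define C where "C = 2 * (W b + W b) * (lam * T)\<^sup>2"
  have lim0: "(\<lambda>m. C * inverse (real m)) \<longlonglongrightarrow> 0"
    using tendsto_mult[OF tendsto_const[of C] lim_inverse_n] by simp
  define QB where "QB = T * ((g 0 + L * b) * K1 + \<delta> * W b)"
  define w0 where "w0 = W x - exp (- \<delta> * T) * W b"
  define w where "w = (\<lambda>\<omega>. \<bar>w0\<bar> + (QB + (W b + W b) * real (N T \<omega>)))"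
  let ?phi = "\<lambda>\<omega>. \<integral>\<^sup>+t. ennreal (exp (- \<delta> * t)) * indicator {t. 0 \<le> t \<and> ereal t < ruin_time X \<omega>} t \<partial>interval_measure (\<lambda>t. D t \<omega>)"
  let ?f = "\<lambda>m \<omega>. w0 + msum Wdead T m \<omega>"
  have fm: "?f m \<in> borel_measurable M" for m
    using msum_measurable[OF ms] by (rule borel_measurable_add[OF borel_measurable_const])
  have wi: "integrable M w" unfolding w_def
    by (intro Bochner_Integration.integrable_add integrable_mult_right poisson_process_integrable[OF prob_space_axioms poisson lam_pos T])
      simp_all
  have dom: "AE \<omega> in M. \<bar>?f m \<omega>\<bar> \<le> w \<omega>" for m
    using msum_bound[OF ms, of m] unfolding w_def QB_def[symmetric] by eventually_elim linarith
  have le: "AE \<omega> in M. \<forall>\<^sub>F m in sequentially. ennreal (?f m \<omega> - e) \<le> ?phi \<omega>" if e: "0 < e" for e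
    using AE_barrier AE_hjb_path
  proof eventually_elim
    case (elim \<omega>)
    interpret p: barrier_path g lam \<alpha> \<delta> b L K K1 W W' x "\<lambda>t. N t \<omega>" "\<lambda>i. Y i \<omega>" "\<lambda>t. D t \<omega>" "\<lambda>t. X t \<omega>" by fact
    \<comment> \<open>Survival up to t extends beyond t, so t precedes ruin strictly and payments at
      t count in the payoff.\<close>
    have ruin: "ereal t < ruin_time X \<omega>" if t: "0 \<le> t" "p.alive t" for t
    proof -
      obtain t' where t': "t < t'" "p.alive t'" using p.alive_extend[OF t] by blast
      have "ereal t' \<le> ruin_time X \<omega>" unfolding ruin_time_def
      proof (rule Inf_greatest)
        fix v assume "v \<in> {ereal t |t. 0 \<le> t \<and> X t \<omega> < 0}"
        then obtain r where r: "v = ereal r" "0 \<le> r" "X r \<omega> < 0" by auto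
        have "\<not> r \<le> t'" using t'(2) r unfolding p.alive_def by force
        then show "ereal t' \<le> v" using r by simp
      qed
      moreover have "ereal t < ereal t'" using t' by simp
      ultimately show ?thesis by (rule less_le_trans[rotated])
    qed
    have mono: "(\<integral>\<^sup>+u. ennreal (exp (- \<delta> * u)) * indicator {u. 0 \<le> u \<and> u \<le> T \<and> p.alive u} u \<partial>interval_measure (\<lambda>t. D t \<omega>)) \<le> ?phi \<omega>"
      using ruin by (intro nn_integral_mono mult_left_mono) (auto split: split_indicator)
    show ?case using p.discounted_dividends_ge[OF T e]
    proof eventually_elim
      case (elim m)
      have e: "w0 + msum Wdead T m \<omega> - e = W x + msum Wdead T m \<omega> - e - exp (- \<delta> * T) * W b" by (simp add: w0_def)
      have "ennreal (W x + msum Wdead T m \<omega> - e - exp (- \<delta> * T) * W b) \<le> (\<integral>\<^sup>+u. ennreal (exp (- \<delta> * u)) * indicator {u. 0 \<le> u \<and> u \<le> T \<and> p.alive u} u \<partial>interval_measure (\<lambda>t. D t \<omega>))"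
        using elim unfolding msum_eq[OF p.hjb_path_axioms T] .
      then show ?case unfolding e using mono by (rule order_trans)
    qed
  qed
  have E: "\<forall>\<^sub>F m in sequentially. w0 - e \<le> (\<integral>\<omega>. ?f m \<omega> \<partial>M)" if e: "0 < e" for e
    using order_tendstoD(2)[OF lim0 e] eventually_gt_at_top[of 0]
  proof eventually_elim
    case (elim m)
    have im: "integrable M (msum Wdead T m)"
    proof (rule Bochner_Integration.integrable_bound[of M "\<lambda>\<omega>. QB + (W b + W b) * real (N T \<omega>)"])
      show "integrable M (\<lambda>\<omega>. QB + (W b + W b) * real (N T \<omega>))"
        by (intro Bochner_Integration.integrable_add integrable_mult_right poisson_process_integrable[OF prob_space_axioms poisson lam_pos T]) simp
      show "AE \<omega> in M. norm (msum Wdead T m \<omega>) \<le> norm (QB + (W b + W b) * real (N T \<omega>))"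
        using msum_bound[OF ms, of m] by eventually_elim (simp add: QB_def)
    qed (rule msum_measurable[OF ms])
    have "(\<integral>\<omega>. ?f m \<omega> \<partial>M) = w0 + (\<integral>\<omega>. msum Wdead T m \<omega> \<partial>M)"
      by (subst Bochner_Integration.integral_add[OF _ im]) (simp_all add: prob_space)
    moreover have "- (C * inverse (real m)) \<le> (\<integral>\<omega>. msum Wdead T m \<omega> \<partial>M)"
      using msum_expectation_ge[OF ms elim(2) drift] by (simp add: C_def)
    ultimately show ?case using elim(1) by simp
  qed
  have "ennreal w0 \<le> (\<integral>\<^sup>+\<omega>. ?phi \<omega> \<partial>M)"
    by (rule nn_integral_dominated_lower[OF fm wi dom le E])
  then show ?thesis by (simp add: payoff_def w0_def)
qed

lemma payoff_eq: "payoff M \<delta> D X = ennreal (W x)"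
proof (rule antisym[OF payoff_le])
  have "(\<lambda>j. exp (- \<delta> * real (Suc j))) \<longlonglongrightarrow> 0"
  proof -
    have "(\<lambda>j. exp (- \<delta>) ^ Suc j) \<longlonglongrightarrow> 0" using \<delta> by (intro LIMSEQ_Suc LIMSEQ_power_zero) simp
    moreover have "exp (- \<delta>) ^ Suc j = exp (- \<delta> * real (Suc j))" for j
      using exp_of_nat_mult[of "Suc j" "- \<delta>"] by (simp only: mult.commute)
    ultimately show ?thesis by (simp only:)
  qed
  then have "(\<lambda>j. W x - exp (- \<delta> * real (Suc j)) * W b) \<longlonglongrightarrow> W x - 0 * W b"
    by (intro tendsto_intros)
  then have "(\<lambda>j. ennreal (W x - exp (- \<delta> * real (Suc j)) * W b)) \<longlonglongrightarrow> ennreal (W x)"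
    by (intro tendsto_ennrealI) simp
  then show "ennreal (W x) \<le> payoff M \<delta> D X"
    by (rule LIMSEQ_le_const2) (use payoff_lower_T in auto)
qed

end

lemma jump_altdef: "(f \<longlongrightarrow> l) (at_left t) \<Longrightarrow> jump f t = f t - l"
  unfolding jump_def left_lim_def by (subst tendsto_Lim) auto

lemma left_lim_eq: "(f \<longlongrightarrow> l) (at_left (t::real)) \<Longrightarrow> left_lim f t = l"
  unfolding left_lim_def by (rule tendsto_Lim) auto

lemma indicator_integrable_on:
  fixes X :: "real \<Rightarrow> real" and b c t :: real
  assumes t: "0 \<le> t" and X: "X \<in> borel_measurable (restrict_space borel {0..t})"
  shows "(\<lambda>u. c * indicator {b} (X u)) integrable_on {0..t}"
proof -
  let ?R = "restrict_space borel {0..t}"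
  have "(\<lambda>u. c * indicator {b} (X u)) \<in> borel_measurable ?R"
    by (rule measurable_compose[OF X]) (intro borel_measurable_times borel_measurable_const borel_measurable_indicator, simp)
  then have bm: "(\<lambda>u. indicator {0..t} u *\<^sub>R (c * indicator {b} (X u))) \<in> borel_measurable borel"
    by (subst (asm) borel_measurable_restrict_space_iff) auto
  have "set_integrable lborel {0..t} (\<lambda>u. c * indicator {b} (X u))"
    unfolding set_integrable_def
  proof (rule Bochner_Integration.integrable_bound[of lborel "\<lambda>u. \<bar>c\<bar> * indicator {0..t} u", rotated])
    show "integrable lborel (\<lambda>u. \<bar>c\<bar> * indicator {0..t} u)"
      by (intro integrable_mult_right integrable_real_indicator) (use t in simp_all)
    show "AE u in lborel. norm (indicator {0..t} u *\<^sub>R (c * indicator {b} (X u))) \<le> norm (\<bar>c\<bar> * indicator {0..t} u)"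
      by (rule AE_I2) (auto split: split_indicator)
  qed (use bm in simp)
  then show ?thesis by (rule set_borel_integral_eq_integral(1))
qed

section \<open>From the jump conditions to the reflected path\<close>

context surplus_path
begin

text \<open>An integer-valued function with a left limit is constant on some interval to the
  left.\<close>

lemma S_left_limit:
  assumes t: "0 < t"
  obtains l where "(S \<longlongrightarrow> l) (at_left t)" "l \<le> S t"
proof -
  obtain v where v: "((\<lambda>t. real (n t)) \<longlongrightarrow> v) (at_left t)" using n_cadlag t by (auto simp: cadlag_def)
  then have "\<forall>\<^sub>F s in at_left t. dist (real (n s)) v < 1/2" by (rule tendstoD) simp
  then obtain a where a: "a < t" "\<And>s. a < s \<Longrightarrow> s < t \<Longrightarrow> dist (real (n s)) v < 1/2"
    unfolding eventually_at_left_field by auto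
  define r where "r = (max 0 a + t) / 2"
  have r: "0 < r" "a < r" "r < t" using a t by (auto simp: r_def)
  have "n s = n r" if "a < s" "s < t" for s
  proof -
    have "\<bar>real (n s) - v\<bar> < 1/2" "\<bar>real (n r) - v\<bar> < 1/2" using a(2)[of s] a(2)[of r] that r by (simp_all add: dist_real_def)
    then have "\<bar>real (n s) - real (n r)\<bar> < 1" by linarith
    then show ?thesis by linarith
  qed
  then have S: "S s = S r" if "a < s" "s < t" for s using that by (simp add: S_def)
  have "(S \<longlongrightarrow> S r) (at_left t)"
    by (rule tendsto_eventually) (use a S in \<open>auto simp: eventually_at_left_field intro!: exI[of _ a]\<close>)
  moreover have "S r \<le> S t" using r by (intro S_le) auto
  ultimately show ?thesis by (rule that)
qed

text \<open>The premium integral is continuous and claims only decrease the surplus, so at a jump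
  the surplus drops by at least the payment.\<close>

lemma X_left_limit:
  assumes t: "0 < t" and D: "(D \<longlongrightarrow> dl) (at_left t)"
  obtains l where "(X \<longlongrightarrow> l) (at_left t)" "X t \<le> l - (D t - dl)"
proof -
  obtain sl where sl: "(S \<longlongrightarrow> sl) (at_left t)" "sl \<le> S t" by (rule S_left_limit[OF t])
  let ?I = "\<lambda>t. integral {0..t} (\<lambda>u. G (X u))"
  have "continuous_on {0..t} ?I" by (intro indefinite_integral_continuous_1 X_int) (use t in simp)
  then have "(?I \<longlongrightarrow> ?I t) (at t within {0..t})" using t by (auto simp: continuous_on)
  then have I: "(?I \<longlongrightarrow> ?I t) (at_left t)"
    by (subst at_within_Icc_at_left[symmetric, OF t])
  have "((\<lambda>s. x + ?I s - S s - D s) \<longlongrightarrow> x + ?I t - sl - dl) (at_left t)"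
    by (intro tendsto_intros I sl D)
  moreover have "\<forall>\<^sub>F s in at_left t. x + ?I s - S s - D s = X s"
    unfolding eventually_at_left_field using t X_eq by (intro exI[of _ 0]) (auto simp: S_def)
  ultimately have "(X \<longlongrightarrow> x + ?I t - sl - dl) (at_left t)" by (rule Lim_transform_eventually)
  moreover have "X t \<le> x + ?I t - sl - dl - (D t - dl)" using X_eq[of t] t sl(2) by (simp add: S_def)
  ultimately show ?thesis by (rule that)
qed

lemma indicator_X_integrable:
  fixes c b :: real
  assumes t: "0 \<le> t"
  shows "(\<lambda>u. c * indicator {b} (X u)) integrable_on {0..t}"
proof -
  let ?I = "\<lambda>t. integral {0..t} (\<lambda>u. G (X u))"
  let ?R = "restrict_space borel {0..t}"
  have "continuous_on {0..t} ?I" by (intro indefinite_integral_continuous_1 X_int t)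
  then have I: "?I \<in> borel_measurable ?R" by (rule borel_measurable_continuous_on_restrict)
  have S: "S \<in> borel_measurable ?R"
    by (rule borel_measurable_mono_on_fnc) (auto simp: mono_on_def intro: S_le)
  have D: "D \<in> borel_measurable ?R"
    by (rule borel_measurable_mono_on_fnc) (auto simp: mono_on_def intro: D_le)
  have "(\<lambda>s. x + ?I s - S s - D s) \<in> borel_measurable ?R" using I S D by measurable
  moreover have "X s = x + ?I s - S s - D s" if "s \<in> space ?R" for s
    using that X_eq[of s] by (simp add: space_restrict_space S_def)
  ultimately have "X \<in> borel_measurable ?R" by (subst measurable_cong) auto
  then show ?thesis by (rule indicator_integrable_on[OF t])
qed

text \<open>A left limit above b is brought down to at most b by the prescribed payment; any other
  left limit does not exceed b. So X \<le> b from time 0 on, left limits after time 0 are at most b,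
  only the initial jump of \<open>D\<close> remains, and the jump sum reduces to
  \<open>D 0\<close>.\<close>

lemma barrier_path_properties:
  assumes b: "0 \<le> b" and X_neg: "\<forall>t<0. X t = x"
    and bar: "\<forall>t\<ge>0. D t - (\<Sum>\<^sub>\<infinity>s\<in>{0..t}. jump D s) = integral {0..t} (\<lambda>s. g b * indicator {b} (X s)) \<and>
      jump D t = (if left_lim X t > b then left_lim X t - b else 0)"
  shows "\<And>t. 0 \<le> t \<Longrightarrow> X t \<le> b" and "D 0 = max 0 (x - b)"
    and "\<And>t. 0 \<le> t \<Longrightarrow> D t = D 0 + integral {0..t} (\<lambda>u. g b * indicator {b} (X u))"
proof -
  have D0: "(D \<longlongrightarrow> 0) (at_left 0)"
    by (rule tendsto_eventually) (use D_neg in \<open>auto simp: eventually_at_left_field intro!: exI[of _ "-1"]\<close>)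
  have X0: "(X \<longlongrightarrow> x) (at_left 0)"
    by (rule tendsto_eventually) (use X_neg in \<open>auto simp: eventually_at_left_field intro!: exI[of _ "-1"]\<close>)
  have j0: "jump D 0 = D 0" using jump_altdef[OF D0] by simp
  show D_0: "D 0 = max 0 (x - b)" using bar[rule_format, of 0] left_lim_eq[OF X0] j0 by (simp add: max_def)
  have Dl: "\<exists>dl. (D \<longlongrightarrow> dl) (at_left t)" if "0 < t" for t using D_cadlag that unfolding cadlag_def by blast
  show Xb: "X t \<le> b" if t: "0 \<le> t" for t
  proof (cases "t = 0")
    case True
    then show ?thesis using X_eq[of 0] n0 D_0 by (simp add: max_def)
  next
    case False
    then have t0: "0 < t" using t by simp
    obtain dl where dl: "(D \<longlongrightarrow> dl) (at_left t)" using Dl[OF t0] by blast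
    obtain l where l: "(X \<longlongrightarrow> l) (at_left t)" "X t \<le> l - (D t - dl)" by (rule X_left_limit[OF t0 dl])
    show ?thesis
      using bar[rule_format, OF t] left_lim_eq[OF l(1)] jump_altdef[OF dl] l(2) by (simp split: if_splits)
  qed
  have jump0: "jump D t = 0" if t: "0 < t" for t
  proof -
    obtain dl where dl: "(D \<longlongrightarrow> dl) (at_left t)" using Dl[OF t] by blast
    obtain l where l: "(X \<longlongrightarrow> l) (at_left t)" "X t \<le> l - (D t - dl)" by (rule X_left_limit[OF t dl])
    have "l \<le> b"
    proof (rule tendsto_upperbound[OF l(1)])
      show "\<forall>\<^sub>F s in at_left t. X s \<le> b"
        unfolding eventually_at_left_field using t Xb by (intro exI[of _ 0]) auto
    qed simp
    then show ?thesis using bar[rule_format, of t] t left_lim_eq[OF l(1)] by simp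
  qed
  show "D t = D 0 + integral {0..t} (\<lambda>u. g b * indicator {b} (X u))" if t: "0 \<le> t" for t
  proof -
    have "(\<Sum>\<^sub>\<infinity>s\<in>{0..t}. jump D s) = (\<Sum>\<^sub>\<infinity>s\<in>{0}. jump D s)"
      by (rule infsum_cong_neutral) (use t jump0 in \<open>auto simp: order_le_less\<close>)
    also have "\<dots> = D 0" using j0 by simp
    finally show ?thesis using bar[rule_format, OF t] by simp
  qed
qed

end

context hjb_model
begin

lemma barrier_modelI:
  assumes bar: "barrier_strategy M F g S b x D X"
  shows "barrier_model g lam \<alpha> \<delta> b L K K1 W W' M F N Y x D X"
proof unfold_locales
  from bar have 1: "AE \<omega> in M. \<forall>t\<ge>0.
        D t \<omega> - (\<Sum>\<^sub>\<infinity>s\<in>{0..t}. jump (\<lambda>s. D s \<omega>) s) =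
          integral {0..t} (\<lambda>s. g b * indicator {b} (X s \<omega>)) \<and>
        jump (\<lambda>s. D s \<omega>) t =
          (if left_lim (\<lambda>s. X s \<omega>) t > b then left_lim (\<lambda>s. X s \<omega>) t - b else 0)"
    by (simp add: barrier_strategy_def)
  have 2: "AE \<omega> in M. \<forall>t<0. X t \<omega> = x"
    using surplus unfolding controlled_surplus_def by eventually_elim blast
  show "AE \<omega> in M. barrier_path g lam \<alpha> \<delta> b L K K1 W W' x (\<lambda>t. N t \<omega>) (\<lambda>i. Y i \<omega>) (\<lambda>t. D t \<omega>) (\<lambda>t. X t \<omega>)"
    using 1 2 AE_hjb_path
  proof eventually_elim
    case (elim \<omega>)
    interpret p: hjb_path g lam \<alpha> \<delta> b L K K1 W W' x "\<lambda>t. N t \<omega>" "\<lambda>i. Y i \<omega>" "\<lambda>t. D t \<omega>" "\<lambda>t. X t \<omega>" by fact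
    note bf = p.barrier_path_properties[OF b elim(2,1)]
    show ?case by unfold_locales (fact bf | rule p.indicator_X_integrable; assumption)+
  qed
qed

text \<open>The prescribed jump is 0 or the left limit less b, so only nonnegativity of the left
  limit is at stake; up to and including ruin it is a limit of nonnegative values.\<close>

lemma barrier_admissible:
  assumes bar: "barrier_strategy M F g S b x D X"
  shows "admissible M F g S x D X"
proof -
  from bar have 1: "AE \<omega> in M. \<forall>t\<ge>0.
        D t \<omega> - (\<Sum>\<^sub>\<infinity>s\<in>{0..t}. jump (\<lambda>s. D s \<omega>) s) =
          integral {0..t} (\<lambda>s. g b * indicator {b} (X s \<omega>)) \<and>
        jump (\<lambda>s. D s \<omega>) t =
          (if left_lim (\<lambda>s. X s \<omega>) t > b then left_lim (\<lambda>s. X s \<omega>) t - b else 0)"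
    by (simp add: barrier_strategy_def)
  have 2: "AE \<omega> in M. \<forall>t<0. X t \<omega> = x"
    using surplus unfolding controlled_surplus_def by eventually_elim blast
  have "AE \<omega> in M. \<forall>t\<ge>0. ereal t \<le> ruin_time X \<omega> \<longrightarrow>
        jump (\<lambda>s. D s \<omega>) t \<le> left_lim (\<lambda>s. X s \<omega>) t"
    using 1 2 AE_surplus_path
  proof eventually_elim
    case (elim \<omega>)
    interpret p: surplus_path g L x "\<lambda>t. N t \<omega>" "\<lambda>i. Y i \<omega>" "\<lambda>t. D t \<omega>" "\<lambda>t. X t \<omega>" by fact
    show ?case
    proof (intro allI impI)
      fix t :: real assume t: "0 \<le> t" "ereal t \<le> ruin_time X \<omega>"
      have "0 \<le> left_lim (\<lambda>s. X s \<omega>) t"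
      proof (cases "t = 0")
        case True
        have "((\<lambda>s. X s \<omega>) \<longlongrightarrow> x) (at_left 0)"
          by (rule tendsto_eventually) (use elim(2) in \<open>auto simp: eventually_at_left_field intro!: exI[of _ "-1"]\<close>)
        then show ?thesis using True left_lim_eq x_nonneg by metis
      next
        case False
        then have t0: "0 < t" using t by simp
        obtain dl where dl: "((\<lambda>s. D s \<omega>) \<longlongrightarrow> dl) (at_left t)"
          using p.D_cadlag t0 unfolding cadlag_def by blast
        obtain l where l: "((\<lambda>s. X s \<omega>) \<longlongrightarrow> l) (at_left t)" by (rule p.X_left_limit[OF t0 dl])
        have "0 \<le> l"
        proof (rule tendsto_lowerbound[OF l])
          have "0 \<le> X s \<omega>" if s: "0 < s" "s < t" for s
          proof -
            have "ereal s < ruin_time X \<omega>" using s t(2) by (metis ereal_less(2) less_ereal.simps(1) less_le_trans)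
            then show ?thesis
              using p.aliveD[OF before_ruin_alive[where X=X and \<omega>=\<omega>, OF _ p.surplus_path_axioms]] s by simp
          qed
          then show "\<forall>\<^sub>F s in at_left t. 0 \<le> X s \<omega>"
            unfolding eventually_at_left_field using t0 by (intro exI[of _ 0]) auto
        qed simp
        then show ?thesis using left_lim_eq[OF l] by simp
      qed
      then show "jump (\<lambda>s. D s \<omega>) t \<le> left_lim (\<lambda>s. X s \<omega>) t"
        using elim(1)[rule_format, OF t(1)] b by simp
    qed
  qed
  then show ?thesis using dividends surplus by (simp add: admissible_def)
qed

end

section \<open>Construction of the barrier strategy\<close>

text \<open>In the coordinate \<open>H\<close> with \<open>H' = 1 / g\<close> the surplus moves with unit speed between claims.\<close>

locale barrier_flow =
  fixes g :: "real \<Rightarrow> real" and b m Mx :: real and H \<Phi> :: "real \<Rightarrow> real"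
  assumes b: "0 \<le> b" and m: "0 < m" "m \<le> Mx"
    and H\<Phi>: "\<And>u. H (\<Phi> u) = u" and \<Phi>H: "\<And>z. \<Phi> (H z) = z"
    and H_lower: "\<And>z z'. z \<le> z' \<Longrightarrow> z' - z \<le> Mx * (H z' - H z)"
    and H_upper: "\<And>z z'. z \<le> z' \<Longrightarrow> m * (H z' - H z) \<le> z' - z"
    and \<Phi>_deriv: "\<And>u. \<Phi> u \<le> b \<Longrightarrow> (\<Phi> has_real_derivative g (max 0 (\<Phi> u))) (at u)"

text \<open>Clamping the argument of g to [0, b] gives a rate between two positive constants, so an
  antiderivative of its reciprocal is a bi-Lipschitz bijection of the line. Changing the rate above
  b does no harm, as the flow will be stopped there.\<close>

lemma barrier_flow_exists:
  fixes g :: "real \<Rightarrow> real"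
  assumes pos: "\<And>z. 0 \<le> z \<Longrightarrow> g z > 0" and cont: "continuous_on {0..} g" and b: "0 \<le> b"
  obtains m Mx H \<Phi> where "barrier_flow g b m Mx H \<Phi>"
proof -
  define Gb where "Gb = (\<lambda>z. g (max 0 (min z b)))"
  have Gcont: "continuous_on UNIV Gb"
    unfolding Gb_def using cont by (rule continuous_on_compose2) (auto intro!: continuous_intros)
  have "compact {0..b}" "{0..b} \<noteq> {}" using b by auto
  moreover have "continuous_on {0..b} g" using cont by (rule continuous_on_subset) auto
  ultimately obtain z1 z2 where z1: "z1 \<in> {0..b}" "\<And>z. z \<in> {0..b} \<Longrightarrow> g z1 \<le> g z"
    and z2: "z2 \<in> {0..b}" "\<And>z. z \<in> {0..b} \<Longrightarrow> g z \<le> g z2"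
    using continuous_attains_inf[of "{0..b}" g] continuous_attains_sup[of "{0..b}" g] by metis
  define m Mx where "m = g z1" and "Mx = g z2"
  have m: "0 < m" "m \<le> Mx" using pos z1 z2 by (auto simp: m_def Mx_def)
  have Gb: "m \<le> Gb z" "Gb z \<le> Mx" for z
    using z1(2)[of "max 0 (min z b)"] z2(2)[of "max 0 (min z b)"] b by (auto simp: Gb_def m_def Mx_def)
  have Gb0: "Gb z > 0" for z using Gb(1)[of z] m by linarith
  have "\<exists>H. \<forall>z::real. -\<infinity> < ereal z \<longrightarrow> ereal z < \<infinity> \<longrightarrow> (H has_vector_derivative inverse (Gb z)) (at z)"
  proof (rule einterval_antiderivative)
    fix z :: real
    show "isCont (\<lambda>z. inverse (Gb z)) z"
      using Gcont Gb0[of z] by (intro continuous_intros) (auto simp: continuous_on_eq_continuous_at)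
  qed simp
  then obtain H where "\<And>z. (H has_vector_derivative inverse (Gb z)) (at z)" by auto
  then have H: "(H has_real_derivative inverse (Gb z)) (at z)" for z
    by (simp add: has_real_derivative_iff_has_vector_derivative)
  have Hmvt: "\<exists>w. H z' - H z = (z' - z) * inverse (Gb w)" if zz: "z < z'" for z z'
  proof -
    obtain w where "H z' - H z = (z' - z) * inverse (Gb w)" using MVT2[OF zz H] by blast
    then show ?thesis by blast
  qed
  have Hlo: "z' - z \<le> Mx * (H z' - H z)" if "z \<le> z'" for z z'
  proof (cases "z = z'")
    case False
    then have "z < z'" using that by simp
    then obtain w where w: "H z' - H z = (z' - z) * inverse (Gb w)" using Hmvt by blast
    have "1 \<le> Mx * inverse (Gb w)" using Gb(2)[of w] Gb0[of w] by (simp add: field_simps)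
    then have "(z' - z) * 1 \<le> (z' - z) * (Mx * inverse (Gb w))" using that by (intro mult_left_mono) auto
    then show ?thesis by (simp add: w mult_ac)
  qed simp
  have Hup: "m * (H z' - H z) \<le> z' - z" if "z \<le> z'" for z z'
  proof (cases "z = z'")
    case False
    then have "z < z'" using that by simp
    then obtain w where w: "H z' - H z = (z' - z) * inverse (Gb w)" using Hmvt by blast
    have "m * inverse (Gb w) \<le> 1" using Gb(1)[of w] Gb0[of w] by (simp add: field_simps)
    then have "(z' - z) * (m * inverse (Gb w)) \<le> (z' - z) * 1" using that by (intro mult_left_mono) auto
    then show ?thesis by (simp add: w mult_ac)
  qed simp
  have Hstrict: "H z < H z'" if "z < z'" for z z'
  proof -
    have "0 < Mx * (H z' - H z)" using Hlo[of z z'] that by simp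
    then show ?thesis using m by (simp add: zero_less_mult_iff)
  qed
  have Hinj: "H z = H z' \<Longrightarrow> z = z'" for z z' using Hstrict by (metis linorder_neqE_linordered_idom order_less_irrefl)
  have Hcont: "continuous_on UNIV H"
    by (rule DERIV_continuous_on[of _ _ "\<lambda>z. inverse (Gb z)"]) (rule H)
  have "\<exists>z. H z = u" for u
  proof -
    \<comment> \<open>\<open>H\<close> grows at rate at least 1 / Mx, so its values at -a and a
      enclose u.\<close>
    define a where "a = Mx * \<bar>u - H 0\<bar>"
    have a: "0 \<le> a" using m by (simp add: a_def)
    have "Mx * \<bar>u - H 0\<bar> \<le> Mx * (H a - H 0)" using Hlo[of 0 a] a by (simp add: a_def)
    then have 1: "u \<le> H a" using m by (simp add: mult_le_cancel_left)
    have "Mx * \<bar>u - H 0\<bar> \<le> Mx * (H 0 - H (- a))" using Hlo[of "- a" 0] a by (simp add: a_def)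
    then have 2: "H (- a) \<le> u" using m by (simp add: mult_le_cancel_left)
    have "\<exists>z. - a \<le> z \<and> z \<le> a \<and> H z = u"
      by (rule IVT'[of H "- a" u a, OF 2 1]) (use a in simp, rule continuous_on_subset[OF Hcont], simp)
    then show ?thesis by blast
  qed
  then obtain \<Phi> where H\<Phi>: "\<And>u. H (\<Phi> u) = u" by metis
  have \<Phi>H: "\<Phi> (H z) = z" for z using Hinj H\<Phi> by blast
  have \<Phi>lip: "\<bar>\<Phi> u - \<Phi> v\<bar> \<le> Mx * \<bar>u - v\<bar>" for u v
  proof (cases "\<Phi> u \<le> \<Phi> v")
    case True
    then show ?thesis using Hlo[OF True] m by (simp add: H\<Phi>) (smt (verit) mult_left_mono)
  next
    case False
    then have "\<Phi> v \<le> \<Phi> u" by simp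
    then show ?thesis using Hlo[of "\<Phi> v" "\<Phi> u"] m by (simp add: H\<Phi>) (smt (verit) mult_left_mono)
  qed
  have "continuous_on UNIV \<Phi>"
  proof (rule lipschitz_on_continuous_on)
    show "Mx-lipschitz_on UNIV \<Phi>" using \<Phi>lip m by (auto simp: lipschitz_on_def dist_real_def)
  qed
  then have \<Phi>cont: "isCont \<Phi> u" for u by (simp add: continuous_on_eq_continuous_at)
  have \<Phi>d: "(\<Phi> has_real_derivative Gb (\<Phi> u)) (at u)" for u
  proof -
    have "(\<Phi> has_real_derivative inverse (inverse (Gb (\<Phi> u)))) (at u)"
      by (rule DERIV_inverse_function[where f=H and a="u-1" and b="u+1"]) (use H H\<Phi> \<Phi>cont Gb0[of "\<Phi> u"] in auto)
    then show ?thesis by simp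
  qed
  have "barrier_flow g b m Mx H \<Phi>"
  proof
    fix u assume "\<Phi> u \<le> b"
    then show "(\<Phi> has_real_derivative g (max 0 (\<Phi> u))) (at u)" using \<Phi>d[of u] by (simp add: Gb_def min_def)
  qed (use b m H\<Phi> \<Phi>H Hlo Hup in auto)
  then show ?thesis by (rule that)
qed

context barrier_flow
begin

text \<open>The flow held at b. In the coordinate \<open>H\<close> it is addition of t capped at
  \<open>H b\<close>, which makes the semigroup and contraction properties immediate.\<close>

definition P :: "real \<Rightarrow> real \<Rightarrow> real" where "P t z = min b (\<Phi> (H z + t))"

text \<open>Premium rate minus dividend rate under the barrier strategy; it is discontinuous at
  b.\<close>

definition f :: "real \<Rightarrow> real" where "f z = g (max 0 z) - g b * indicator {b} z"

lemma H_mono: "z \<le> z' \<Longrightarrow> H z \<le> H z'"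
proof -
  assume "z \<le> z'"
  then have "0 \<le> Mx * (H z' - H z)" using H_lower[of z z'] by simp
  then show ?thesis using m by (simp add: zero_le_mult_iff)
qed

lemma H_le_iff: "H z \<le> H z' \<longleftrightarrow> z \<le> z'"
  using H_mono \<Phi>H by (metis linear order_antisym)

lemma \<Phi>_mono: "u \<le> v \<Longrightarrow> \<Phi> u \<le> \<Phi> v"
  using H_le_iff[of "\<Phi> u" "\<Phi> v"] by (simp add: H\<Phi>)

lemma H_P: "H (P t z) = min (H b) (H z + t)"
  unfolding P_def using H_le_iff[of b "\<Phi> (H z + t)"] by (auto simp: min_def H\<Phi>)

lemma P_0: "z \<le> b \<Longrightarrow> P 0 z = z" by (simp add: P_def \<Phi>H)

lemma P_le: "P t z \<le> b" by (simp add: P_def)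

lemma P_semigroup: "0 \<le> t \<Longrightarrow> P t (P s z) = P (s + t) z"
proof -
  assume t: "0 \<le> t"
  have "H (P t (P s z)) = H (P (s + t) z)" using t by (auto simp: H_P)
  then show ?thesis by (metis \<Phi>H)
qed

lemma P_ge: "0 \<le> t \<Longrightarrow> z \<le> b \<Longrightarrow> z \<le> P t z"
  using H_le_iff[of z "P t z"] H_mono[of z b] by (simp add: H_P)

lemma P_upper: "0 \<le> t \<Longrightarrow> z \<le> b \<Longrightarrow> P t z \<le> z + Mx * t"
proof -
  assume t: "0 \<le> t" and z: "z \<le> b"
  have "P t z - z \<le> Mx * (H (P t z) - H z)" using P_ge[OF t z] by (rule H_lower)
  also have "\<dots> \<le> Mx * t" using m by (intro mult_left_mono) (auto simp: H_P)
  finally show ?thesis by simp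
qed

lemma continuous_\<Phi>: "continuous_on UNIV \<Phi>"
proof (rule lipschitz_on_continuous_on)
  have "\<bar>\<Phi> u - \<Phi> v\<bar> \<le> Mx * \<bar>u - v\<bar>" for u v
  proof (cases "u \<le> v")
    case True
    then show ?thesis using H_lower[OF \<Phi>_mono[OF True]] \<Phi>_mono[OF True] by (simp add: H\<Phi>)
  next
    case False
    then have "v \<le> u" by simp
    then show ?thesis using H_lower[OF \<Phi>_mono[of v u]] \<Phi>_mono[of v u] by (simp add: H\<Phi>)
  qed
  then show "Mx-lipschitz_on UNIV \<Phi>" using m by (auto simp: lipschitz_on_def dist_real_def)
qed

lemma continuous_H: "continuous_on UNIV H"
proof (rule lipschitz_on_continuous_on)
  have le: "H v - H u \<le> 1 / m * (v - u)" if "u \<le> v" for u v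
    using H_upper[OF that] m by (simp add: field_simps)
  have "\<bar>H u - H v\<bar> \<le> 1 / m * \<bar>u - v\<bar>" for u v
    using le[of u v] le[of v u] H_mono[of u v] H_mono[of v u] by (cases "u \<le> v") auto
  then show "(1 / m)-lipschitz_on UNIV H" using m by (auto simp: lipschitz_on_def dist_real_def)
qed

lemma P_borel: "P t \<in> borel_measurable borel"
  unfolding P_def[abs_def]
  by (intro borel_measurable_continuous_onI continuous_intros continuous_on_compose2[OF continuous_\<Phi>] continuous_H) auto

text \<open>The flow is continuous, and differentiable except at the time \<open>ts\<close> of
  arrival at b, which the fundamental theorem tolerates.\<close>

lemma P_integral:
  assumes z: "z \<le> b" and t: "0 \<le> t"
  shows "((\<lambda>s. f (P s z)) has_integral (P t z - z)) {0..t}"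
proof -
  define ts where "ts = H b - H z"
  have "((\<lambda>s. f (P s z)) has_integral (P t z - P 0 z)) {0..t}"
  proof (rule fundamental_theorem_of_calculus_interior_strong[of "{ts}"])
    fix s assume s: "s \<in> {0<..<t} - {ts}"
    show "((\<lambda>s. P s z) has_vector_derivative f (P s z)) (at s)"
    proof (cases "s < ts")
      case True
      have lt: "\<Phi> (H z + v) < b" if "v < ts" for v
        using H_le_iff[of b "\<Phi> (H z + v)"] that by (simp add: H\<Phi> ts_def not_le[symmetric])
      have "((\<lambda>v. \<Phi> (H z + v)) has_real_derivative g (max 0 (\<Phi> (H z + s))) * 1) (at s)"
        by (rule DERIV_chain2[OF \<Phi>_deriv]) (use lt[OF True] in \<open>auto intro!: derivative_eq_intros\<close>)
      then have "((\<lambda>v. \<Phi> (H z + v)) has_real_derivative g (max 0 (\<Phi> (H z + s)))) (at s)" by simp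
      then have "((\<lambda>v. P v z) has_real_derivative g (max 0 (\<Phi> (H z + s)))) (at s)"
        by (rule has_field_derivative_transform_within_open[of _ _ _ "{..<ts}"])
          (use True less_imp_le[OF lt] in \<open>auto simp: P_def min_absorb2\<close>)
      moreover have "f (P s z) = g (max 0 (\<Phi> (H z + s)))" using lt[OF True] by (simp add: f_def P_def min_def)
      ultimately show ?thesis by (simp add: has_real_derivative_iff_has_vector_derivative)
    next
      case False
      then have "ts < s" using s by auto
      have Pb: "P v z = b" if "ts \<le> v" for v
      proof -
        have "H (P v z) = H b" using that by (simp add: H_P ts_def)
        then have "\<Phi> (H (P v z)) = \<Phi> (H b)" by (rule arg_cong)
        then show ?thesis by (simp only: \<Phi>H)
      qed
      have "((\<lambda>_. b) has_real_derivative 0) (at s)" by simp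
      then have "((\<lambda>v. P v z) has_real_derivative 0) (at s)"
        by (rule has_field_derivative_transform_within_open[of _ _ _ "{ts<..}"])
          (use \<open>ts < s\<close> Pb in auto)
      moreover have "f (P s z) = 0" using Pb[of s] \<open>ts < s\<close> b by (simp add: f_def max_def)
      ultimately show ?thesis by (simp add: has_real_derivative_iff_has_vector_derivative)
    qed
  next
    show "continuous_on {0..t} (\<lambda>s. P s z)" unfolding P_def
      by (intro continuous_intros continuous_on_compose2[OF continuous_\<Phi>]) auto
  qed (use t in auto)
  then show ?thesis using P_0[OF z] by simp
qed

lemma P_H_contract: "\<bar>H (P t z) - H (P t w)\<bar> \<le> \<bar>H z - H w\<bar>"
  by (auto simp: H_P min_def)

lemma H_dist_upper: "m * \<bar>H z - H w\<bar> \<le> \<bar>z - w\<bar>"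
  using H_upper[of z w] H_upper[of w z] H_mono[of z w] H_mono[of w z] by (cases "z \<le> w") auto

lemma H_dist_lower: "\<bar>z - w\<bar> \<le> Mx * \<bar>H z - H w\<bar>"
  using H_lower[of z w] H_lower[of w z] H_mono[of z w] H_mono[of w z] by (cases "z \<le> w") auto

end

text \<open>The jumps of \<open>n\<close> are not assumed to have size \<open>1\<close>: simultaneous claims have equal \<open>hit\<close> times and are
  subtracted one after the other.\<close>

definition hit :: "(real \<Rightarrow> nat) \<Rightarrow> nat \<Rightarrow> real" where "hit n k = Inf {t. 0 \<le> t \<and> k \<le> n t}"

text \<open>Right continuity of an integer-valued function turns the infimum into a minimum.\<close>

lemma hit_properties:
  assumes n_cadlag: "cadlag (\<lambda>t. real (n t))" and t: "0 \<le> t" "k \<le> n t"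
  shows "0 \<le> hit n k" "hit n k \<le> t" "k \<le> n (hit n k)" "\<And>s. 0 \<le> s \<Longrightarrow> s < hit n k \<Longrightarrow> n s < k"
proof -
  let ?A = "{t. 0 \<le> t \<and> k \<le> n t}"
  have ne: "?A \<noteq> {}" using t by auto
  have bdd: "bdd_below ?A" by (rule bdd_belowI[of _ 0]) auto
  show h0: "0 \<le> hit n k" unfolding hit_def by (rule cInf_greatest[OF ne]) auto
  show "hit n k \<le> t" unfolding hit_def by (rule cInf_lower[OF _ bdd]) (use t in auto)
  have low: "hit n k \<le> s" if "s \<in> ?A" for s unfolding hit_def by (rule cInf_lower[OF that bdd])
  show "n s < k" if "0 \<le> s" "s < hit n k" for s
    using low[of s] that by (cases "k \<le> n s") auto
  have "((\<lambda>t. real (n t)) \<longlongrightarrow> real (n (hit n k))) (at_right (hit n k))"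
    using n_cadlag h0 by (auto simp: cadlag_def continuous_within)
  then have "\<forall>\<^sub>F s in at_right (hit n k). dist (real (n s)) (real (n (hit n k))) < 1" by (rule tendstoD) simp
  then obtain c where c: "hit n k < c" "\<And>s. hit n k < s \<Longrightarrow> s < c \<Longrightarrow> dist (real (n s)) (real (n (hit n k))) < 1"
    unfolding eventually_at_right_field by auto
  obtain s where s: "s \<in> ?A" "s < c" using cInf_lessD[OF ne, of c] c(1) unfolding hit_def by auto
  show "k \<le> n (hit n k)"
  proof (cases "s = hit n k")
    case False
    then have "hit n k < s" using low[OF s(1)] by simp
    then have "n s = n (hit n k)" using c(2)[of s] s by (simp add: dist_real_def)
    then show ?thesis using s by simp
  qed (use s in auto)
qed

section \<open>The reflected path with claims\<close>

context barrier_flow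
begin

lemma P_integral_shift:
  assumes w: "w \<le> b" and t: "c \<le> t"
  shows "((\<lambda>s. f (P (s - c) w)) has_integral (P (t - c) w - w)) {c..t}"
proof -
  have "((\<lambda>s. f (P s w)) has_integral (P (t - c) w - w)) {0..t - c}" using w t by (intro P_integral) auto
  then show ?thesis
    using has_integral_shift_Icc_real[of "\<lambda>s. f (P (s - c) w)" c "P (t - c) w - w" 0 "t - c"] by (simp add: o_def)
qed

text \<open>The path on which only the first k claims are executed. The next one arrives at
  \<open>hit n (Suc k)\<close> and has size \<open>y k\<close>, as sizes are numbered from 0; from
  there the path restarts at the reduced value.\<close>

primrec pth :: "(real \<Rightarrow> nat) \<Rightarrow> (nat \<Rightarrow> real) \<Rightarrow> real \<Rightarrow> nat \<Rightarrow> real \<Rightarrow> real" where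
  "pth n y z 0 t = P t z"
| "pth n y z (Suc k) t = (if n t \<le> k then pth n y z k t
     else P (t - hit n (Suc k)) (pth n y z k (hit n (Suc k)) - y k))"

definition bpath :: "(real \<Rightarrow> nat) \<Rightarrow> (nat \<Rightarrow> real) \<Rightarrow> real \<Rightarrow> real \<Rightarrow> real" where
  "bpath n y z t = pth n y z (n t) t"

text \<open>Splitting scheme: the exact flow over a step, then subtraction of the claims of the
  step. The flow replaces an Euler step because it is a contraction in \<open>H\<close> although the
  rate jumps at b.\<close>

primrec scheme :: "real \<Rightarrow> (real \<Rightarrow> real) \<Rightarrow> real \<Rightarrow> nat \<Rightarrow> nat \<Rightarrow> real" where
  "scheme z \<xi> t N 0 = z"
| "scheme z \<xi> t N (Suc k) = P (t / real N) (scheme z \<xi> t N k) - (\<xi> (t * real (Suc k) / real N) - \<xi> (t * real k / real N))"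

context
  fixes n :: "real \<Rightarrow> nat" and y :: "nat \<Rightarrow> real" and z :: real
  assumes n0: "n 0 = 0" and n_mono: "mono_on {0..} n" and n_cadlag: "cadlag (\<lambda>t. real (n t))"
    and y_pos: "\<And>i. 0 < y i" and z: "z \<le> b"
begin

lemma n_le: "0 \<le> s \<Longrightarrow> s \<le> t \<Longrightarrow> n s \<le> n t" using n_mono by (auto simp: mono_on_def)

lemma pth_le: "pth n y z k t \<le> b"
  by (induction k) (simp_all add: P_le)

lemma pth_semigroup: "0 \<le> s \<Longrightarrow> s \<le> t \<Longrightarrow> n s = n t \<or> k \<le> n s \<Longrightarrow> pth n y z k t = P (t - s) (pth n y z k s)"
proof (induction k)
  case 0
  then show ?case by (simp add: P_semigroup)
next
  case (Suc k)
  show ?case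
  proof (cases "n t \<le> k")
    case True
    then have "n s \<le> k" using n_le[of s t] Suc.prems by simp
    then show ?thesis using True Suc by auto
  next
    case False
    then have s: "\<not> n s \<le> k" using Suc.prems by auto
    show ?thesis using Suc.prems False s by (simp add: P_semigroup)
  qed
qed

text \<open>Induction on the number of executed claims: the interval is split at the arrival of the
  next claim, where a single altered value of the integrand is immaterial.\<close>

lemma pth_integral:
  "0 \<le> t \<Longrightarrow> ((\<lambda>s. f (pth n y z k s)) has_integral (pth n y z k t - z + (\<Sum>i<min k (n t). y i))) {0..t}"
proof (induction k arbitrary: t)
  case 0
  then show ?case using P_integral[OF z] by simp
next
  case (Suc k)
  show ?case
  proof (cases "n t \<le> k")
    case True
    have "((\<lambda>s. f (pth n y z (Suc k) s)) has_integral (pth n y z k t - z + (\<Sum>i<min k (n t). y i))) {0..t}"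
    proof (rule has_integral_eq[OF _ Suc.IH[OF Suc.prems]])
      fix s assume "s \<in> {0..t}"
      then have "n s \<le> k" using n_le[of s t] True by simp
      then show "f (pth n y z k s) = f (pth n y z (Suc k) s)" by simp
    qed
    moreover have "min k (n t) = min (Suc k) (n t)" using True by auto
    moreover have "pth n y z (Suc k) t = pth n y z k t" using True by simp
    ultimately show ?thesis by (simp only:)
  next
    case False
    define c where "c = hit n (Suc k)"
    have "Suc k \<le> n t" using False by simp
    note h = hit_properties[OF n_cadlag Suc.prems this, folded c_def]
    define w where "w = pth n y z k c - y k"
    have w: "w \<le> b" using pth_le[of k c] y_pos[of k] by (simp add: w_def)
    have 1: "((\<lambda>s. f (pth n y z (Suc k) s)) has_integral (pth n y z k c - z + (\<Sum>i<min k (n c). y i))) {0..c}"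
    proof (rule has_integral_spike_finite[OF _ _ Suc.IH[OF h(1)]])
      show "f (pth n y z (Suc k) s) = f (pth n y z k s)" if "s \<in> {0..c} - {c}" for s
      proof -
        have "n s < Suc k" using that by (intro h(4)) auto
        then show ?thesis by simp
      qed
    qed simp
    have 2: "((\<lambda>s. f (pth n y z (Suc k) s)) has_integral (P (t - c) w - w)) {c..t}"
    proof (rule has_integral_eq[OF _ P_integral_shift[OF w h(2)]])
      fix s assume "s \<in> {c..t}"
      then have "Suc k \<le> n s" using n_le[of c s] h(1,3) by auto
      then show "f (P (s - c) w) = f (pth n y z (Suc k) s)" by (simp add: c_def w_def)
    qed
    have "pth n y z k c - z + (\<Sum>i<min k (n c). y i) + (P (t - c) w - w)
      = pth n y z (Suc k) t - z + (\<Sum>i<min (Suc k) (n t). y i)"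
      using False h(3) by (simp add: min_def w_def c_def)
    with has_integral_combine[OF h(1,2) 1 2] show ?thesis by simp
  qed
qed

lemma pth_stable: "n t \<le> k \<Longrightarrow> pth n y z k t = pth n y z (n t) t"
proof (induction k)
  case (Suc k)
  show ?case
  proof (cases "n t = Suc k")
    case False
    then have "n t \<le> k" using Suc.prems by simp
    then show ?thesis using Suc.IH by simp
  qed simp
qed simp

lemma bpath_le: "bpath n y z t \<le> b" unfolding bpath_def by (rule pth_le)

lemma bpath_0: "bpath n y z 0 = z" using z by (simp add: bpath_def n0 P_0)

lemma bpath_integral:
  assumes t: "0 \<le> t"
  shows "((\<lambda>s. f (bpath n y z s)) has_integral (bpath n y z t - z + (\<Sum>i<n t. y i))) {0..t}"
proof -
  have "((\<lambda>s. f (bpath n y z s)) has_integral (pth n y z (n t) t - z + (\<Sum>i<min (n t) (n t). y i))) {0..t}"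
  proof (rule has_integral_eq[OF _ pth_integral[OF t]])
    fix s assume "s \<in> {0..t}"
    then have "n s \<le> n t" using n_le by auto
    then show "f (pth n y z (n t) s) = f (bpath n y z s)" using pth_stable[of s "n t"] unfolding bpath_def by metis
  qed
  then show ?thesis by (simp add: bpath_def)
qed

lemma bpath_semigroup: "0 \<le> s \<Longrightarrow> s \<le> t \<Longrightarrow> n s = n t \<Longrightarrow> bpath n y z t = P (t - s) (bpath n y z s)"
  using pth_semigroup[of s t "n s"] by (simp add: bpath_def)

lemma claims_le: "0 \<le> s \<Longrightarrow> s \<le> t \<Longrightarrow> (\<Sum>i<n s. y i) \<le> (\<Sum>i<n t. y i)"
  using n_le[of s t] y_pos by (intro sum_mono2) (auto intro: less_imp_le)

text \<open>The bounds on g are recovered from difference quotients of \<Phi>, which is monotone and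
  Lipschitz with constant Mx.\<close>

lemma f_nonneg:
  assumes v: "v \<le> b"
  shows "0 \<le> f v" "f v \<le> Mx"
proof -
  have d: "(\<Phi> has_real_derivative g (max 0 v)) (at (H v))" using \<Phi>_deriv[of "H v"] v by (simp add: \<Phi>H)
  have up: "\<bar>\<Phi> u - \<Phi> w\<bar> \<le> Mx * \<bar>u - w\<bar>" for u w
    using H_dist_lower[of "\<Phi> u" "\<Phi> w"] by (simp add: H\<Phi>)
  have lim: "((\<lambda>u. (\<Phi> u - \<Phi> (H v)) / (u - H v)) \<longlongrightarrow> g (max 0 v)) (at (H v))"
    using d by (simp add: has_field_derivative_iff)
  have "g (max 0 v) \<le> Mx"
  proof (rule tendsto_upperbound[OF lim])
    show "\<forall>\<^sub>F u in at (H v). (\<Phi> u - \<Phi> (H v)) / (u - H v) \<le> Mx"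
    proof (rule eventually_at_topological[THEN iffD2], intro exI[of _ UNIV] conjI ballI impI)
      fix u assume "u \<noteq> H v"
      have "(\<Phi> u - \<Phi> (H v)) / (u - H v) \<le> \<bar>\<Phi> u - \<Phi> (H v)\<bar> / \<bar>u - H v\<bar>"
        by (metis abs_divide abs_ge_self)
      also have "\<dots> \<le> Mx" using up[of u "H v"] \<open>u \<noteq> H v\<close> by (simp add: divide_le_eq)
      finally show "(\<Phi> u - \<Phi> (H v)) / (u - H v) \<le> Mx" .
    qed auto
  qed simp
  moreover have "0 \<le> g (max 0 v)"
  proof (rule tendsto_lowerbound[OF lim])
    show "\<forall>\<^sub>F u in at (H v). 0 \<le> (\<Phi> u - \<Phi> (H v)) / (u - H v)"
    proof (rule eventually_at_topological[THEN iffD2], intro exI[of _ UNIV] conjI ballI impI)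
      fix u assume "u \<noteq> H v"
      show "0 \<le> (\<Phi> u - \<Phi> (H v)) / (u - H v)"
        using \<Phi>_mono[of u "H v"] \<Phi>_mono[of "H v" u] by (cases "u \<le> H v") (auto intro: divide_nonpos_nonpos divide_nonneg_nonneg)
    qed auto
  qed simp
  ultimately show "0 \<le> f v" "f v \<le> Mx" using v b m by (auto simp: f_def indicator_def max_def)
qed

lemma bpath_increment:
  assumes st: "0 \<le> s" "s \<le> t"
  shows "bpath n y z s - ((\<Sum>i<n t. y i) - (\<Sum>i<n s. y i)) \<le> bpath n y z t"
    and "bpath n y z t \<le> bpath n y z s - ((\<Sum>i<n t. y i) - (\<Sum>i<n s. y i)) + Mx * (t - s)"
proof -
  let ?F = "\<lambda>s. f (bpath n y z s)"
  have i: "?F integrable_on {0..t}" using bpath_integral[of t] st by (auto simp: integrable_on_def)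
  have "integral {0..s} ?F + integral {s..t} ?F = integral {0..t} ?F"
    using st i by (intro Henstock_Kurzweil_Integration.integral_combine) auto
  then have eq: "bpath n y z t = bpath n y z s - ((\<Sum>i<n t. y i) - (\<Sum>i<n s. y i)) + integral {s..t} ?F"
    using integral_unique[OF bpath_integral[of s]] integral_unique[OF bpath_integral[of t]] st by simp
  have ist: "?F integrable_on {s..t}" by (rule integrable_subinterval_real[OF i]) (use st in auto)
  have "0 \<le> integral {s..t} ?F" by (rule integral_nonneg[OF ist]) (use f_nonneg bpath_le in auto)
  moreover have "integral {s..t} ?F \<le> integral {s..t} (\<lambda>_. Mx)"
    by (rule integral_le[OF ist]) (use f_nonneg bpath_le in auto)
  ultimately show "bpath n y z s - ((\<Sum>i<n t. y i) - (\<Sum>i<n s. y i)) \<le> bpath n y z t"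
    "bpath n y z t \<le> bpath n y z s - ((\<Sum>i<n t. y i) - (\<Sum>i<n s. y i)) + Mx * (t - s)"
    using eq st by (simp_all add: mult.commute)
qed

text \<open>Measured in \<open>H\<close>, the error does not grow in a step without claims. A step
  with claims passes to the original coordinate and back, which adds h and multiplies by \<rho> = Mx
  / m. At most n t steps contain claims, so the error is at most h times n t times the power of
  \<rho> with exponent n t.\<close>

lemma scheme_tendsto:
  assumes t: "0 \<le> t"
  shows "(\<lambda>k. scheme z (\<lambda>u. \<Sum>i<n u. y i) t k k) \<longlonglongrightarrow> bpath n y z t"
proof -
  define \<xi> where "\<xi> u = (\<Sum>i<n u. y i)" for u
  define \<rho> where "\<rho> = Mx / m"
  have \<rho>: "1 \<le> \<rho>" using m by (simp add: \<rho>_def)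
  define C where "C = Mx * (t * (real (n t) * \<rho> ^ n t))"
  have bound: "\<bar>scheme z \<xi> t k k - bpath n y z t\<bar> \<le> C * inverse (real k)" if k: "0 < k" for k
  proof -
    define s where "s j = t * real j / real k" for j
    define h where "h = t / real k"
    have h: "0 \<le> h" using t by (simp add: h_def)
    have sS: "s (Suc j) = s j + h" for j using k by (simp add: s_def h_def field_simps)
    have s0: "s 0 = 0" "s k = t" using k by (auto simp: s_def)
    have sj0: "0 \<le> s j" for j using t by (simp add: s_def)
    have \<xi>_le: "\<xi> (s j) \<le> \<xi> (s (Suc j))" for j unfolding \<xi>_def by (rule claims_le) (use sj0 sS[of j] h in auto)
    have sch_S: "scheme z \<xi> t k (Suc j) = P h (scheme z \<xi> t k j) - (\<xi> (s (Suc j)) - \<xi> (s j))" for j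
      by (simp add: s_def h_def)
    have sch_le: "scheme z \<xi> t k j \<le> b" for j
    proof (cases j)
      case (Suc j')
      then show ?thesis using sch_S[of j'] P_le[of h "scheme z \<xi> t k j'"] \<xi>_le[of j'] by simp
    qed (use z in simp)
    define E where "E j = \<bar>H (scheme z \<xi> t k j) - H (bpath n y z (s j))\<bar>" for j
    have "E j \<le> h * (real (n (s j)) * \<rho> ^ n (s j))" for j
    proof (induction j)
      case 0
      then show ?case by (simp add: E_def s0 bpath_0 n0)
    next
      case (Suc j)
      have ss: "0 \<le> s j" "s j \<le> s (Suc j)" using sj0 sS[of j] h by auto
      show ?case
      proof (cases "n (s j) = n (s (Suc j))")
        case True
        then have "\<xi> (s (Suc j)) = \<xi> (s j)" by (simp add: \<xi>_def)
        moreover have "bpath n y z (s (Suc j)) = P h (bpath n y z (s j))"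
          using bpath_semigroup[OF ss True] sS[of j] by simp
        ultimately have "E (Suc j) \<le> E j" unfolding E_def sch_S using P_H_contract by simp
        then show ?thesis using Suc True by simp
      next
        case False
        then have nlt: "Suc (n (s j)) \<le> n (s (Suc j))" using n_le[OF ss] by simp
        have a: "scheme z \<xi> t k j \<le> P h (scheme z \<xi> t k j)" "P h (scheme z \<xi> t k j) \<le> scheme z \<xi> t k j + Mx * h"
          using P_ge[OF h sch_le] P_upper[OF h sch_le] by auto
        have hs: "s (Suc j) - s j = h" using sS[of j] by simp
        note bi = bpath_increment[OF ss, folded \<xi>_def, unfolded hs]
        have "\<bar>scheme z \<xi> t k (Suc j) - bpath n y z (s (Suc j))\<bar> \<le> \<bar>scheme z \<xi> t k j - bpath n y z (s j)\<bar> + Mx * h"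
          unfolding sch_S using a bi by linarith
        also have "\<dots> \<le> Mx * E j + Mx * h" unfolding E_def using H_dist_lower by simp
        finally have "m * E (Suc j) \<le> Mx * (E j + h)"
          using H_dist_upper[of "scheme z \<xi> t k (Suc j)" "bpath n y z (s (Suc j))"] by (simp add: E_def distrib_left)
        then have "E (Suc j) \<le> \<rho> * (E j + h)" using m by (simp add: \<rho>_def field_simps)
        also have "\<dots> \<le> \<rho> * (h * (real (n (s j)) * \<rho> ^ n (s j)) + h * \<rho> ^ n (s j))"
        proof -
          have "h * 1 \<le> h * \<rho> ^ n (s j)" using h one_le_power[OF \<rho>] by (intro mult_left_mono) auto
          then show ?thesis using Suc \<rho> by (intro mult_left_mono add_mono) auto
        qed
        also have "\<dots> = h * (real (Suc (n (s j))) * \<rho> ^ Suc (n (s j)))" by (simp add: algebra_simps)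
        also have "\<dots> \<le> h * (real (n (s (Suc j))) * \<rho> ^ n (s (Suc j)))"
          using h \<rho> nlt by (intro mult_left_mono mult_mono power_increasing) (auto simp del: of_nat_Suc)
        finally show ?thesis .
      qed
    qed
    from this[of k] have "E k \<le> h * (real (n t) * \<rho> ^ n t)" by (simp add: s0)
    then have "Mx * E k \<le> Mx * (h * (real (n t) * \<rho> ^ n t))" using m by (intro mult_left_mono) auto
    also have "\<dots> = C * inverse (real k)" by (simp add: C_def h_def divide_inverse)
    finally show ?thesis
      using H_dist_lower[of "scheme z \<xi> t k k" "bpath n y z t"] by (simp add: E_def s0)
  qed
  have "(\<lambda>k. scheme z \<xi> t k k - bpath n y z t) \<longlonglongrightarrow> 0"
  proof (rule Lim_null_comparison)
    show "\<forall>\<^sub>F k in sequentially. norm (scheme z \<xi> t k k - bpath n y z t) \<le> C * inverse (real k)"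
      using eventually_gt_at_top[of 0] by eventually_elim (use bound in simp)
    show "(\<lambda>k. C * inverse (real k)) \<longlonglongrightarrow> 0"
      using tendsto_mult[OF tendsto_const[of C] lim_inverse_n] by simp
  qed
  then show ?thesis unfolding \<xi>_def[abs_def] by (rule LIM_zero_cancel)
qed

end
end

text \<open>Adding the payments at b to the rate \<open>f\<close> restores the premium rate, which
  is the surplus equation. \<open>D\<close> is continuous after time 0, so the initial excess over b
  is its only jump.\<close>

lemma (in barrier_flow) bpath_controlled:
  fixes n :: "real \<Rightarrow> nat" and y :: "nat \<Rightarrow> real" and x L :: real
  assumes pos: "\<And>z. 0 \<le> z \<Longrightarrow> g z > 0" and lip: "L-lipschitz_on {0..} g" and x: "0 \<le> x"
    and n: "n 0 = 0" "mono_on {0..} n" "cadlag (\<lambda>t. real (n t))" "\<And>i. 0 < y i"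
  defines "X \<equiv> \<lambda>t. if t < 0 then x else bpath n y (min x b) t"
  defines "D \<equiv> \<lambda>t. if t < 0 then 0 else max 0 (x - b) + integral {0..t} (\<lambda>s. g b * indicator {b} (X s))"
  shows "surplus_path g L x n y D X"
    and "\<And>t. 0 \<le> t \<Longrightarrow> D t - (\<Sum>\<^sub>\<infinity>s\<in>{0..t}. jump D s) = integral {0..t} (\<lambda>s. g b * indicator {b} (X s)) \<and>
      jump D t = (if left_lim X t > b then left_lim X t - b else 0)"
proof -
  have zb: "min x b \<le> b" by simp
  note bp = bpath_le[OF n zb] bpath_0[OF n zb] bpath_integral[OF n zb]
  have X: "X t = bpath n y (min x b) t" if "0 \<le> t" for t using that by (simp add: X_def)
  let ?ind = "\<lambda>s. g b * indicator {b} (X s)"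
  have gb: "0 < g b" using pos b by simp
  have fint: "((\<lambda>s. f (X s)) has_integral (X t - min x b + (\<Sum>i<n t. y i))) {0..t}" if t: "0 \<le> t" for t
  proof -
    have "((\<lambda>s. f (X s)) has_integral (bpath n y (min x b) t - min x b + (\<Sum>i<n t. y i))) {0..t}"
      by (rule has_integral_eq[OF _ bp(3)[OF t]]) (simp add: X)
    then show ?thesis using X[OF t] by simp
  qed
  have indint: "?ind integrable_on {0..t}" if t: "0 \<le> t" for t
  proof (rule indicator_integrable_on[OF t])
    let ?I = "\<lambda>t. integral {0..t} (\<lambda>s. f (X s))"
    let ?R = "restrict_space borel {0..t}"
    have "continuous_on {0..t} ?I"
      using fint[OF t] by (intro indefinite_integral_continuous_1) (auto simp: integrable_on_def)
    then have I: "?I \<in> borel_measurable ?R" by (rule borel_measurable_continuous_on_restrict)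
    have S: "(\<lambda>s. \<Sum>i<n s. y i) \<in> borel_measurable ?R"
      by (rule borel_measurable_mono_on_fnc) (auto simp: mono_on_def intro: claims_le[OF n zb])
    have "(\<lambda>s. min x b + ?I s - (\<Sum>i<n s. y i)) \<in> borel_measurable ?R" using I S by measurable
    moreover have "X s = min x b + ?I s - (\<Sum>i<n s. y i)" if "s \<in> space ?R" for s
      using that integral_unique[OF fint[of s]] by (simp add: space_restrict_space)
    ultimately show "X \<in> borel_measurable ?R" by (subst measurable_cong) auto
  qed
  have Gsum: "((\<lambda>s. g (max 0 (X s))) has_integral (X t - min x b + (\<Sum>i<n t. y i) + integral {0..t} ?ind)) {0..t}" if t: "0 \<le> t" for t
    using has_integral_add[OF fint[OF t] integrable_integral[OF indint[OF t]]] by (simp add: f_def)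
  have D: "D t = max 0 (x - b) + integral {0..t} ?ind" if "0 \<le> t" for t using that by (simp add: D_def)
  have D_incr: "D s \<le> D t" if st: "s \<le> t" for s t
  proof -
    have nonneg: "0 \<le> integral {u..v} ?ind" for u v
    proof (cases "?ind integrable_on {u..v}")
      case True
      then show ?thesis by (rule integral_nonneg) (use gb in simp)
    next
      case False
      show ?thesis unfolding not_integrable_integral[OF False] by simp
    qed
    show ?thesis
    proof (cases "s < 0")
      case True
      then show ?thesis using nonneg[of 0 t] by (simp add: D_def)
    next
      case False
      then have "integral {0..s} ?ind + integral {s..t} ?ind = integral {0..t} ?ind"
        using st by (intro Henstock_Kurzweil_Integration.integral_combine indint) auto
      then show ?thesis using False st nonneg[of s t] by (simp add: D_def)
    qed
  qed
  have cont: "continuous_on {0..t} (\<lambda>t. max 0 (x - b) + integral {0..t} ?ind)" if "0 \<le> t" for t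
    by (intro continuous_intros indefinite_integral_continuous_1 indint that)
  have D_right: "continuous (at_right t) D" if t: "0 \<le> t" for t
  proof -
    have "((\<lambda>t. max 0 (x - b) + integral {0..t} ?ind) \<longlongrightarrow> max 0 (x - b) + integral {0..t} ?ind) (at t within {0..t+1})"
      using cont[of "t+1"] t by (auto simp: continuous_on)
    then have "((\<lambda>t. max 0 (x - b) + integral {0..t} ?ind) \<longlongrightarrow> max 0 (x - b) + integral {0..t} ?ind) (at t within {t..t+1})"
      by (rule tendsto_within_subset) (use t in auto)
    then have "((\<lambda>t. max 0 (x - b) + integral {0..t} ?ind) \<longlongrightarrow> D t) (at_right t)"
      using D[OF t] by (simp add: at_within_Icc_at_right)
    then have "(D \<longlongrightarrow> D t) (at_right t)"
      by (rule Lim_transform_eventually) (use t D in \<open>auto simp: eventually_at_right_field intro!: exI[of _ "t+1"]\<close>)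
    then show ?thesis by (simp add: continuous_within)
  qed
  have D_left: "(D \<longlongrightarrow> D t) (at_left t)" if t: "0 < t" for t
  proof -
    have "((\<lambda>t. max 0 (x - b) + integral {0..t} ?ind) \<longlongrightarrow> max 0 (x - b) + integral {0..t} ?ind) (at t within {0..t})"
      using cont[of t] t by (auto simp: continuous_on)
    then have "((\<lambda>t. max 0 (x - b) + integral {0..t} ?ind) \<longlongrightarrow> D t) (at_left t)"
      using D[of t] t by (simp add: at_within_Icc_at_left)
    then show ?thesis
      by (rule Lim_transform_eventually) (use t D in \<open>auto simp: eventually_at_left_field intro!: exI[of _ 0]\<close>)
  qed
  show sp: "surplus_path g L x n y D X"
  proof
    show "D t = 0" if "t < 0" for t using that by (simp add: D_def)
    show "mono D" using D_incr by (auto simp: mono_def)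
    show "cadlag D" unfolding cadlag_def using D_right D_left by blast
    fix t :: real assume t: "0 \<le> t"
    show "(\<lambda>s. g (max 0 (X s))) integrable_on {0..t}" using Gsum[OF t] by (auto simp: integrable_on_def)
    show "X t = x + integral {0..t} (\<lambda>s. g (max 0 (X s))) - (\<Sum>i<n t. y i) - D t"
      using integral_unique[OF Gsum[OF t]] D[OF t] by (simp add: min_def max_def split: if_splits)
  qed (use pos lip x n in auto)
  interpret p: surplus_path g L x n y D X by (rule sp)
  fix t :: real assume t: "0 \<le> t"
  have D0: "(D \<longlongrightarrow> 0) (at_left 0)"
    by (rule tendsto_eventually) (auto simp: D_def eventually_at_left_field intro!: exI[of _ "-1"])
  have X0: "(X \<longlongrightarrow> x) (at_left 0)"
    by (rule tendsto_eventually) (auto simp: X_def eventually_at_left_field intro!: exI[of _ "-1"])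
  have Dz: "D 0 = max 0 (x - b)" using D[of 0] by simp
  have j0: "jump D 0 = D 0" using jump_altdef[OF D0] by simp
  have j: "jump D s = 0" if "0 < s" for s using jump_altdef[OF D_left[OF that]] by simp
  have "(\<Sum>\<^sub>\<infinity>s\<in>{0..t}. jump D s) = (\<Sum>\<^sub>\<infinity>s\<in>{0}. jump D s)"
    by (rule infsum_cong_neutral) (use t j in \<open>auto simp: order_le_less\<close>)
  also have "\<dots> = D 0" using j0 by simp
  finally have sum: "D t - (\<Sum>\<^sub>\<infinity>s\<in>{0..t}. jump D s) = integral {0..t} ?ind" using D[OF t] Dz by simp
  have jmp: "jump D t = (if left_lim X t > b then left_lim X t - b else 0)"
  proof (cases "t = 0")
    case True
    then show ?thesis using j0 Dz left_lim_eq[OF X0] by (simp add: max_def)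
  next
    case False
    then have t0: "0 < t" using t by simp
    obtain l where l: "(X \<longlongrightarrow> l) (at_left t)" by (rule p.X_left_limit[OF t0 D_left[OF t0]])
    have "l \<le> b"
    proof (rule tendsto_upperbound[OF l])
      show "\<forall>\<^sub>F s in at_left t. X s \<le> b"
        unfolding eventually_at_left_field using t0 X bp(1) by (intro exI[of _ 0]) auto
    qed simp
    then show ?thesis using j[OF t0] left_lim_eq[OF l] by simp
  qed
  show "D t - (\<Sum>\<^sub>\<infinity>s\<in>{0..t}. jump D s) = integral {0..t} ?ind \<and>
      jump D t = (if left_lim X t > b then left_lim X t - b else 0)"
    using sum jmp ..
qed

text \<open>The surplus is adapted as an almost sure limit of splitting schemes in \<open>S\<close>.
  The dividends are a time integral of a discontinuous function of it; they are adapted because the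
  surplus equation expresses them through \<open>X\<close>, \<open>S\<close> and the premium
  integral, a limit of Riemann sums.\<close>

lemma (in risk_model) barrier_strategy_exists:
  fixes g :: "real \<Rightarrow> real"
  assumes pos: "\<And>z. 0 \<le> z \<Longrightarrow> g z > 0" and lip: "L-lipschitz_on {0..} g" and x: "0 \<le> x" and b: "0 \<le> b"
  shows "\<exists>D X. barrier_strategy M F g S b x D X"
proof -
  obtain m Mx H \<Phi> where "barrier_flow g b m Mx H \<Phi>"
    using barrier_flow_exists[OF pos lipschitz_on_continuous_on[OF lip] b] by blast
  then interpret B: barrier_flow g b m Mx H \<Phi> .
  define X where "X = (\<lambda>t \<omega>. if t < 0 then x else B.bpath (\<lambda>t. N t \<omega>) (\<lambda>i. Y i \<omega>) (min x b) t)"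
  define D where "D = (\<lambda>t \<omega>. if t < 0 then 0 else max 0 (x - b) + integral {0..t} (\<lambda>s. g b * indicator {b} (X s \<omega>)))"
  have path: "AE \<omega> in M. surplus_path g L x (\<lambda>t. N t \<omega>) (\<lambda>i. Y i \<omega>) (\<lambda>t. D t \<omega>) (\<lambda>t. X t \<omega>) \<and>
     (\<forall>t\<ge>0. D t \<omega> - (\<Sum>\<^sub>\<infinity>s\<in>{0..t}. jump (\<lambda>s. D s \<omega>) s) = integral {0..t} (\<lambda>s. g b * indicator {b} (X s \<omega>)) \<and>
        jump (\<lambda>s. D s \<omega>) t = (if left_lim (\<lambda>s. X s \<omega>) t > b then left_lim (\<lambda>s. X s \<omega>) t - b else 0))"
    using AE_claims
  proof eventually_elim
    case (elim \<omega>)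
    have n: "N 0 \<omega> = 0" "mono_on {0..} (\<lambda>t. N t \<omega>)" "cadlag (\<lambda>t. real (N t \<omega>))" "\<And>i. 0 < Y i \<omega>" using elim by auto
    show ?case
      using B.bpath_controlled[where n="\<lambda>t. N t \<omega>" and y="\<lambda>i. Y i \<omega>" and x=x and L=L, OF pos lip x n]
      unfolding X_def D_def by blast
  qed
  have X_F: "X t \<in> borel_measurable (F t)" if t: "0 \<le> t" for t
  proof -
    have sch_m: "(\<lambda>\<omega>. B.scheme (min x b) (\<lambda>u. S u \<omega>) t k j) \<in> borel_measurable (F t)" if k: "0 < k" and "j \<le> k" for k j
      using that(2)
    proof (induction j)
      case (Suc j)
      have tt: "0 \<le> t * real j / real k \<and> t * real j / real k \<le> t" if "j \<le> k" for j
        using that t k by (simp add: divide_le_eq mult_left_mono)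
      have SD: "S (t * real j / real k) \<in> borel_measurable (F t)" if "j \<le> k" for j
        using measurable_F_mono[OF S_F] tt[OF that] by auto
      have IH: "(\<lambda>\<omega>. B.scheme (min x b) (\<lambda>u. S u \<omega>) t k j) \<in> borel_measurable (F t)" using Suc by simp
      show ?case
        using SD[of j] SD[of "Suc j"] measurable_compose[OF IH B.P_borel] Suc.prems
        by (simp del: of_nat_Suc)
    qed simp
    define Z where "Z = (\<lambda>\<omega>. lim (\<lambda>k. B.scheme (min x b) (\<lambda>u. S u \<omega>) t (Suc k) (Suc k)))"
    have "Z \<in> borel_measurable (F t)" unfolding Z_def
      by (rule borel_measurable_lim_metric, rule sch_m) simp_all
    moreover have "AE \<omega> in M. Z \<omega> = X t \<omega>" using AE_claims
    proof eventually_elim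
      case (elim \<omega>)
      have n: "N 0 \<omega> = 0" "mono_on {0..} (\<lambda>t. N t \<omega>)" "cadlag (\<lambda>t. real (N t \<omega>))" "\<And>i. 0 < Y i \<omega>" using elim by auto
      have conv: "(\<lambda>k. B.scheme (min x b) (\<lambda>u. S u \<omega>) t k k) \<longlonglongrightarrow> B.bpath (\<lambda>t. N t \<omega>) (\<lambda>i. Y i \<omega>) (min x b) t"
        unfolding aggregate_claims_def by (rule B.scheme_tendsto[OF n _ t]) simp
      have Xt: "X t \<omega> = B.bpath (\<lambda>t. N t \<omega>) (\<lambda>i. Y i \<omega>) (min x b) t" using t by (simp add: X_def)
      show ?case unfolding Z_def Xt by (rule limI, rule LIMSEQ_Suc[OF conv])
    qed
    ultimately show ?thesis by (rule measurable_F_AE[OF t])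
  qed
  have g_cont: "continuous_on UNIV (\<lambda>z. g (max 0 z))"
    using lipschitz_on_continuous_on[OF lip]
    by (rule continuous_on_compose2) (auto intro!: continuous_intros)
  then have gm: "(\<lambda>z. g (max 0 z)) \<in> borel_measurable borel" by (rule borel_measurable_continuous_onI)
  have D_F: "D t \<in> borel_measurable (F t)" if t: "0 \<le> t" for t
  proof -
    let ?R = "\<lambda>k \<omega>. \<Sum>j<k. t / real k * g (max 0 (X (t * real j / real k) \<omega>))"
    have R_m: "?R k \<in> borel_measurable (F t)" for k
    proof (rule borel_measurable_sum)
      fix j assume "j \<in> {..<k}"
      then have "0 \<le> t * real j / real k" "t * real j / real k \<le> t"
        using t by (auto simp: divide_le_eq intro!: mult_left_mono)
      then have "X (t * real j / real k) \<in> borel_measurable (F t)" using measurable_F_mono[OF X_F] by simp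
      from measurable_compose[OF this gm]
      show "(\<lambda>\<omega>. t / real k * g (max 0 (X (t * real j / real k) \<omega>))) \<in> borel_measurable (F t)" by simp
    qed
    define Z where "Z = (\<lambda>\<omega>. x + lim (\<lambda>k. ?R k \<omega>) - S t \<omega> - X t \<omega>)"
    have "(\<lambda>\<omega>. lim (\<lambda>k. ?R k \<omega>)) \<in> borel_measurable (F t)"
      by (rule borel_measurable_lim_metric) (rule R_m)
    then have "Z \<in> borel_measurable (F t)" unfolding Z_def using S_F[OF t] X_F[OF t] by simp
    moreover have "AE \<omega> in M. Z \<omega> = D t \<omega>" using path
    proof eventually_elim
      case (elim \<omega>)
      then interpret p: surplus_path g L x "\<lambda>t. N t \<omega>" "\<lambda>i. Y i \<omega>" "\<lambda>t. D t \<omega>" "\<lambda>t. X t \<omega>" by blast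
      show ?case unfolding Z_def limI[OF p.premium_integral_riemann[OF t]]
        using p.X_eq[OF t] by (simp add: aggregate_claims_def)
    qed
    ultimately show ?thesis by (rule measurable_F_AE[OF t])
  qed
  have "dividend_process M F D"
    unfolding dividend_process_def adapted_def
  proof (intro conjI allI impI D_F)
    show "AE \<omega> in M. (\<forall>t<0. D t \<omega> = 0) \<and> mono (\<lambda>t. D t \<omega>) \<and> cadlag (\<lambda>t. D t \<omega>)"
      using path
    proof eventually_elim
      case (elim \<omega>)
      then interpret p: surplus_path g L x "\<lambda>t. N t \<omega>" "\<lambda>i. Y i \<omega>" "\<lambda>t. D t \<omega>" "\<lambda>t. X t \<omega>" by blast
      show ?case using p.D_neg p.D_mono p.D_cadlag by blast
    qed
  qed
  moreover have "controlled_surplus M g S x D X"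
    unfolding controlled_surplus_def using path
  proof eventually_elim
    case (elim \<omega>)
    then interpret p: surplus_path g L x "\<lambda>t. N t \<omega>" "\<lambda>i. Y i \<omega>" "\<lambda>t. D t \<omega>" "\<lambda>t. X t \<omega>" by blast
    show ?case unfolding aggregate_claims_def
      by (intro conjI allI impI) (simp add: X_def, erule p.X_int, erule p.X_eq)
  qed
  moreover have "AE \<omega> in M. \<forall>t\<ge>0. D t \<omega> - (\<Sum>\<^sub>\<infinity>s\<in>{0..t}. jump (\<lambda>s. D s \<omega>) s) = integral {0..t} (\<lambda>s. g b * indicator {b} (X s \<omega>)) \<and>
        jump (\<lambda>s. D s \<omega>) t = (if left_lim (\<lambda>s. X s \<omega>) t > b then left_lim (\<lambda>s. X s \<omega>) t - b else 0)"
    using path by eventually_elim (rule conjunct2)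
  ultimately have "barrier_strategy M F g S b x D X"
    unfolding barrier_strategy_def by blast
  then show ?thesis by blast
qed

text \<open>An upper bound for all admissible controls is attained by every barrier strategy; that
  one exists makes the supremum reach \<open>W x\<close>.\<close>

lemma (in risk_model) hjb_optimal:
  assumes hjb: "dividend_hjb g lam \<alpha> \<delta> b L K K1 W W'" and x: "0 \<le> x"
  shows "\<exists>D X. barrier_strategy M F g S b x D X"
    and "\<And>D X. barrier_strategy M F g S b x D X \<Longrightarrow> optimal M F g S \<delta> x D X"
    and "value_function M F g S \<delta> x = ennreal (W x)"
proof -
  interpret h: dividend_hjb g lam \<alpha> \<delta> b L K K1 W W' by fact
  have model: "hjb_model g lam \<alpha> \<delta> b L K K1 W W' M F N Y x D X"
    if "dividend_process M F D" "controlled_surplus M g S x D X" for D X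
    using that h.g_pos h.g_lip x
    by (intro hjb_model.intro controlled_model.intro controlled_model_axioms.intro risk_model_axioms h.dividend_hjb_axioms) auto
  show ex: "\<exists>D X. barrier_strategy M F g S b x D X"
    by (rule barrier_strategy_exists[OF h.g_pos h.g_lip x h.b])
  have upper: "value_function M F g S \<delta> x \<le> ennreal (W x)"
    unfolding value_function_def
  proof (rule SUP_least, clarify)
    fix D X assume "admissible M F g S x D X"
    then interpret m: hjb_model g lam \<alpha> \<delta> b L K K1 W W' M F N Y x D X
      by (intro model) (auto simp: admissible_def)
    show "payoff M \<delta> D X \<le> ennreal (W x)" by (rule m.payoff_le)
  qed
  have bar: "admissible M F g S x D X \<and> payoff M \<delta> D X = ennreal (W x)"
    if strat: "barrier_strategy M F g S b x D X" for D X
  proof -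
    interpret m: hjb_model g lam \<alpha> \<delta> b L K K1 W W' M F N Y x D X
      using strat by (intro model) (auto simp: barrier_strategy_def)
    interpret b: barrier_model g lam \<alpha> \<delta> b L K K1 W W' M F N Y x D X by (rule m.barrier_modelI[OF strat])
    show ?thesis using m.barrier_admissible[OF strat] b.payoff_eq by simp
  qed
  from ex obtain D X where DX: "barrier_strategy M F g S b x D X" by blast
  have "payoff M \<delta> D X \<le> value_function M F g S \<delta> x"
    unfolding value_function_def by (rule SUP_upper2[of "(D, X)"]) (use bar[OF DX] in auto)
  with bar[OF DX] upper show val: "value_function M F g S \<delta> x = ennreal (W x)" by simp
  show "optimal M F g S \<delta> x D X" if "barrier_strategy M F g S b x D X" for D X
    using bar[OF that] val by (simp add: optimal_def)
qed

theorem theorem3p7: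
  fixes M :: "'a measure" and F :: "real \<Rightarrow> 'a measure"
    and N :: "real \<Rightarrow> 'a \<Rightarrow> nat" and Y :: "nat \<Rightarrow> 'a \<Rightarrow> real" and S :: "real \<Rightarrow> 'a \<Rightarrow> real"
    and lam \<alpha> \<delta> :: real
    and g g' g'' \<psi> \<psi>' :: "real \<Rightarrow> real"
    and V :: "real \<Rightarrow> ennreal"
  defines "S \<equiv> aggregate_claims N Y"
    and "V \<equiv> value_function M F g S \<delta>"
  assumes "prob_space M" and "filtration_usual M F"
    and "lam > 0" and "\<alpha> > 0" and "\<delta> > 0"
    and "poisson_process M lam N"
    and "iid_exponential M \<alpha> Y"
    and "indep_claims M N Y"
    and "increments_relative_to M F S"
    and "C1_halfline g g'" and "C1_halfline g' g''"
    and "\<forall>x\<ge>0. g x > 0"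
    and "\<exists>L. L-lipschitz_on {0..} g"
    and "\<exists>K. \<forall>x\<ge>0. \<bar>g x\<bar> \<le> K * (1 + x)"
    and "\<forall>x\<ge>0. V x < \<infinity>"
    and "(SUP x\<in>{0..}. ereal (g'' x + \<alpha> * g' x - \<alpha> * \<delta>)) < 0"
    and "ide_solution g lam \<alpha> \<delta> \<psi> \<psi>'"
    and "\<forall>x\<ge>0. \<psi> x > 0" and "strict_mono_on {0..} \<psi>"
  shows
    "(\<alpha> * lam * g 0 + (g' 0 - lam - \<delta>) * (lam + \<delta>) > 0 \<longrightarrow>
       (\<exists>b>0. (\<forall>x\<ge>0. \<psi>' b \<le> \<psi>' x) \<and>
          barrier_optimal M F g S \<delta> b \<and>
          (\<forall>x\<ge>0. V x = ennreal (if x \<le> b then \<psi> x / \<psi>' b else x - b + \<psi> b / \<psi>' b)))) \<and>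
     (\<alpha> * lam * g 0 + (g' 0 - lam - \<delta>) * (lam + \<delta>) \<le> 0 \<longrightarrow>
       barrier_optimal M F g S \<delta> 0 \<and>
       (\<forall>x\<ge>0. V x = ennreal (x + g 0 / (lam + \<delta>))))"
proof -
  have S: "S = aggregate_claims N Y" and V: "V = value_function M F g S \<delta>" by (simp_all add: S_def V_def)
  obtain L where L: "L-lipschitz_on {0..} g" using assms by blast
  have risk: "risk_model M F N Y lam \<alpha>"
    using assms(3-11) unfolding S by (intro risk_model.intro risk_model_axioms.intro) auto
  \<comment> \<open>The supremum is an extended real; a real number is inserted between it and
    0.\<close>
  obtain \<eta> where \<eta>: "0 < \<eta>" "\<And>x. 0 \<le> x \<Longrightarrow> g'' x + \<alpha> * g' x - \<alpha> * \<delta> \<le> - \<eta>"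
  proof -
    let ?s = "SUP x\<in>{0..}. ereal (g'' x + \<alpha> * g' x - \<alpha> * \<delta>)"
    have neg: "?s < ereal 0" using assms(18) by (simp add: zero_ereal_def)
    from ereal_dense2[OF neg] obtain r where r: "?s < ereal r" "ereal r < ereal 0" by blast
    have "g'' x + \<alpha> * g' x - \<alpha> * \<delta> \<le> r" if "0 \<le> x" for x
    proof -
      have "ereal (g'' x + \<alpha> * g' x - \<alpha> * \<delta>) \<le> ?s" by (rule SUP_upper) (use that in simp)
      from le_less_trans[OF this r(1)] show ?thesis by simp
    qed
    then show ?thesis using r(2) by (intro that[of "- r"]) auto
  qed
  have g_pos: "\<And>x. 0 \<le> x \<Longrightarrow> 0 < g x" and \<psi>_pos: "\<And>x. 0 \<le> x \<Longrightarrow> 0 < \<psi> x" using assms(14,20) by auto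
  obtain b K K1 W W' where hjb: "dividend_hjb g lam \<alpha> \<delta> b L K K1 W W'"
    and b1: "\<alpha> * lam * g 0 + (g' 0 - lam - \<delta>) * (lam + \<delta>) > 0 \<Longrightarrow> b > 0"
    and b2: "\<alpha> * lam * g 0 + (g' 0 - lam - \<delta>) * (lam + \<delta>) \<le> 0 \<Longrightarrow> b = 0"
    and bmin: "\<And>x. 0 \<le> x \<Longrightarrow> \<psi>' b \<le> \<psi>' x"
    and W: "\<And>x. 0 \<le> x \<Longrightarrow> W x = (if x \<le> b then \<psi> x / \<psi>' b else x - b + \<psi> b / \<psi>' b)"
    and W0: "b = 0 \<Longrightarrow> W 0 = g 0 / (lam + \<delta>)"
    by (rule ide_solution_hjb[OF assms(5,6,7) assms(12,13) g_pos L \<eta> assms(19) \<psi>_pos assms(21)]) (assumption+, rule that)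
  interpret r: risk_model M F N Y lam \<alpha> by (rule risk)
  note opt = r.hjb_optimal[OF hjb, folded S]
  have "barrier_optimal M F g S \<delta> b" unfolding barrier_optimal_def using opt(1,2) by blast
  moreover have "V x = ennreal (W x)" if "0 \<le> x" for x unfolding V using opt(3)[OF that] .
  moreover have "W x = x + g 0 / (lam + \<delta>)" if "0 \<le> x" "b = 0" for x
    using W[of x] W[of 0] W0 that by (auto split: if_splits)
  ultimately show ?thesis using b1 b2 bmin W by auto
qed

end
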